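(* Let $w=w_{7}$ be the Atkin-Lehner involution of $X_0(56)$ attached to $7$. There exist $x,y,t\in\mathbb{Q}(X_0(56))$ such that $\mathbb{Q}(X_0(56))=\mathbb{Q}(x,y,t)$, the subfield of functions invariant under $w^*$ is $\mathbb{Q}(x,y)$, $w^*(t)=-t$, and $$y^2=x^3+x+2,\qquad t^2=(7+x^2)(2-x+x^2)(2+x+x^2).$$ In particular these two equations are equations for $X_0(56)$ over $\mathbb{Q}$ (up to birational equivalence over $\mathbb{Q}$).
   Context: $X_0(N)$ denotes the smooth projective curve over $\mathbb{Q}$ attached to $\Gamma_0(N)$, where $\mathbb{Q}(X_0(N))$ is the subfield of $\mathbb{C}(X_0(N))$ of functions with rational $q$-expansion at the cusp $\infty$, $q=e^{2\pi i z}$. For a positive divisor $d$ of $N$ coprime to $N/d$, the Atkin-Lehner involution $w_d$ of $X_0(N)$ is induced by any matrix $\frac{1}{\sqrt d}\begin{pmatrix} A d & B\\ N C & D d\end{pmatrix}$ of determinant $1$ with $A,B,C,D\in\mathbb{Z}$; it is defined over $\mathbb{Q}$. *)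

theory Defs
  imports
    "HOL-Complex_Analysis.Complex_Analysis"
    "HOL-Algebra.Generated_Fields"
    "HOL-Algebra.Algebraic_Closure_Type"
begin

section \<open>Modular functions for the group of level N\<close>

definition upper_half_plane :: "complex set" where
  "upper_half_plane = {z. Im z > 0}"

definition moebius :: "int \<Rightarrow> int \<Rightarrow> int \<Rightarrow> int \<Rightarrow> complex \<Rightarrow> complex" where
  "moebius a b c d z = (of_int a * z + of_int b) / (of_int c * z + of_int d)"

text \<open>
  \<open>f\<close> has the expansion \<open>F\<close> in powers of \<open>exp (2 * pi * \<i> * z / h)\<close> as \<open>Im z\<close> tends to infinity,
  with at most finitely many negative exponents and a positive radius of convergence; in other
  words, \<open>f\<close> is periodic near infinity and meromorphic there in this local parameter.
\<close>
definition has_q_expansion :: "nat \<Rightarrow> (complex \<Rightarrow> complex) \<Rightarrow> complex fls \<Rightarrow> bool" where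
  "has_q_expansion h f F \<longleftrightarrow>
     fls_conv_radius F > 0 \<and>
     (\<forall>\<^sub>F z in filtercomap Im at_top. f z = eval_fls F (exp (2 * of_real pi * \<i> * z / of_nat h)))"

definition Gamma0_invariant :: "nat \<Rightarrow> (complex \<Rightarrow> complex) \<Rightarrow> bool" where
  "Gamma0_invariant N f \<longleftrightarrow>
     (\<forall>a b c d. a * d - b * c = 1 \<longrightarrow> int N dvd c \<longrightarrow>
        (\<forall>z\<in>upper_half_plane. f (moebius a b c d z) = f z))"

text \<open>
  The meromorphic functions on the compact Riemann surface of level \<open>N > 0\<close>, viewed as functions
  on the upper half plane. To make equality of functions the right notion of equality, only
  canonical representatives are admitted: removable singularities are removed, the value at a pole
  is 0, and so is the value outside the upper half plane. Every cusp is the image of infinity under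
  some element of the full modular group, and its width divides \<open>N\<close>; hence meromorphy at the
  cusps can be tested with the local parameter \<open>exp (2 * pi * \<i> * z / N)\<close>.
\<close>
definition modular_function :: "nat \<Rightarrow> (complex \<Rightarrow> complex) \<Rightarrow> bool" where
  "modular_function N f \<longleftrightarrow>
     f nicely_meromorphic_on upper_half_plane \<and>
     (\<forall>z. z \<notin> upper_half_plane \<longrightarrow> f z = 0) \<and>
     Gamma0_invariant N f \<and>
     (\<forall>a b c d. a * d - b * c = 1 \<longrightarrow> (\<exists>F. has_q_expansion N (\<lambda>z. f (moebius a b c d z)) F))"

definition canonical_rep :: "(complex \<Rightarrow> complex) \<Rightarrow> complex \<Rightarrow> complex" where
  "canonical_rep f z = (if z \<in> upper_half_plane then remove_sings f z else 0)"

text \<open>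
  The function field over the rational numbers: the modular functions whose expansion at the cusp
  infinity (which has width 1) has rational coefficients.
\<close>
definition X0_function_field :: "nat \<Rightarrow> (complex \<Rightarrow> complex) ring" where
  "X0_function_field N =
     \<lparr> carrier = {f. modular_function N f \<and> (\<exists>F. has_q_expansion 1 f F \<and> (\<forall>n. fls_nth F n \<in> \<rat>))},
       monoid.mult = (\<lambda>f g. canonical_rep (\<lambda>z. f z * g z)),
       one = canonical_rep (\<lambda>_. 1),
       ring.zero = (\<lambda>_. 0),
       add = (\<lambda>f g. canonical_rep (\<lambda>z. f z + g z)) \<rparr>"


section \<open>Atkin-Lehner involutions\<close>

text \<open>
  The integers \<open>A, B, C, D\<close> such that the matrix with rows \<open>(A * d, B)\<close> and \<open>(N * C, D * d)\<close>,
  divided by the square root of \<open>d\<close>, has determinant 1. The scalar factor does not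
  affect the action on the upper half plane.
\<close>
definition atkin_lehner_entries :: "nat \<Rightarrow> nat \<Rightarrow> int \<Rightarrow> int \<Rightarrow> int \<Rightarrow> int \<Rightarrow> bool" where
  "atkin_lehner_entries N d A B C D \<longleftrightarrow>
     (A * int d) * (D * int d) - B * (int N * C) = int d"

text \<open>
  The action on functions. The matrix is chosen arbitrarily; see
  \<open>atkin_lehner_entries_exist\<close> and \<open>atkin_lehner_pullback_eq\<close> below.
\<close>
definition atkin_lehner_pullback :: "nat \<Rightarrow> nat \<Rightarrow> (complex \<Rightarrow> complex) \<Rightarrow> complex \<Rightarrow> complex" where
  "atkin_lehner_pullback N d f z =
     (if z \<in> upper_half_plane then
        (case (SOME (A, B, C, D). atkin_lehner_entries N d A B C D) of (A, B, C, D) \<Rightarrow>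
           f (moebius (A * int d) B (int N * C) (D * int d) z))
      else 0)"

lemma atkin_lehner_entries_exist:
  assumes "d > 0" "d dvd N" "coprime d (N div d)"
  shows "\<exists>A B C D. atkin_lehner_entries N d A B C D"
proof -
  obtain m where m: "N = d * m" using assms(2) by blast
  have "coprime (int d) (int m)" using assms m by simp
  then obtain u v where uv: "u * int d + v * int m = 1"
    by (metis coprime_iff_gcd_eq_1 bezout_int)
  have "(u * int d) * (1 * int d) - (-v) * (int N * 1) = int d * (u * int d + v * int m)"
    by (simp add: m algebra_simps)
  hence "atkin_lehner_entries N d u (-v) 1 1"
    using uv by (simp add: atkin_lehner_entries_def)
  thus ?thesis by blast
qed

lemma moebius_denominator_nonzero:
  assumes "a * d - b * c \<noteq> 0" "z \<in> upper_half_plane"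
  shows "of_int c * z + of_int d \<noteq> (0::complex)"
proof
  assume *: "of_int c * z + of_int d = (0::complex)"
  hence "Im (of_int c * z + of_int d) = 0" by simp
  hence "c = 0" using assms(2) by (auto simp: upper_half_plane_def)
  with * have "d = 0" by simp
  with \<open>c = 0\<close> assms(1) show False by simp
qed

lemma Im_moebius:
  "Im (moebius a b c d z) =
     of_int (a * d - b * c) * Im z / (cmod (of_int c * z + of_int d))\<^sup>2"
proof -
  have "Im (moebius a b c d z) =
          Im ((of_int a * z + of_int b) * cnj (of_int c * z + of_int d)) /
            (cmod (of_int c * z + of_int d))\<^sup>2"
    unfolding moebius_def by (subst complex_div_cnj) (simp flip: of_real_power)
  also have "Im ((of_int a * z + of_int b) * cnj (of_int c * z + of_int d)) =
               of_int (a * d - b * c) * Im z"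
    by (simp add: algebra_simps)
  finally show ?thesis .
qed

lemma moebius_in_upper_half_plane:
  assumes "a * d - b * c > 0" "z \<in> upper_half_plane"
  shows "moebius a b c d z \<in> upper_half_plane"
proof -
  have "of_int c * z + of_int d \<noteq> (0::complex)"
    using assms by (intro moebius_denominator_nonzero[of a d b c]) auto
  moreover have "of_int (a * d - b * c) > (0::real)"
    using assms(1) by linarith
  ultimately show ?thesis
    using assms(2) unfolding upper_half_plane_def mem_Collect_eq Im_moebius
    by (intro divide_pos_pos mult_pos_pos) auto
qed

text \<open>
  On functions invariant under the congruence subgroup, the action does not depend on the chosen
  matrix.
\<close>
lemma atkin_lehner_pullback_eq:
  assumes f: "Gamma0_invariant N f" and d: "d > 0" "d dvd N"
    and entries: "atkin_lehner_entries N d A B C D" and z: "z \<in> upper_half_plane"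
  shows "atkin_lehner_pullback N d f z = f (moebius (A * int d) B (int N * C) (D * int d) z)"
proof -
  define p where "p = (SOME (A, B, C, D). atkin_lehner_entries N d A B C D)"
  obtain A' B' C' D' where p: "p = (A', B', C', D')" by (cases p)
  have "case p of (A, B, C, D) \<Rightarrow> atkin_lehner_entries N d A B C D"
    unfolding p_def by (rule someI_ex) (use entries in auto)
  hence entries': "atkin_lehner_entries N d A' B' C' D'" by (simp add: p)
  obtain m where N: "N = d * m" using d by blast
  have e: "int d * (A * D) - B * (int m * C) = 1"
  proof -
    have "int d * (int d * (A * D) - B * (int m * C)) = int d * 1"
      using entries by (simp add: atkin_lehner_entries_def N algebra_simps)
    thus ?thesis using d by (simp only: mult_cancel_left) simp
  qed
  have e': "int d * (A' * D') - B' * (int m * C') = 1"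
  proof -
    have "int d * (int d * (A' * D') - B' * (int m * C')) = int d * 1"
      using entries' by (simp add: atkin_lehner_entries_def N algebra_simps)
    thus ?thesis using d by (simp only: mult_cancel_left) simp
  qed
  define z0 where "z0 = moebius (A * int d) B (int N * C) (D * int d) z"
  have det: "(A * int d) * (D * int d) - B * (int N * C) = int d"
    using entries by (simp add: atkin_lehner_entries_def)
  have z0: "z0 \<in> upper_half_plane"
    unfolding z0_def using det d z by (intro moebius_in_upper_half_plane) auto
  define a b c e where "a = int d * A' * D - int m * B' * C" "b = A * B' - A' * B"
    "c = int N * (C' * D - C * D')" "e = int d * A * D' - int m * B * C'"
  note defs = this
  have "a * e - b * c = (int d * (A * D) - B * (int m * C)) * (int d * (A' * D') - B' * (int m * C'))"
    unfolding defs N of_nat_mult by (simp add: algebra_simps)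
  hence det1: "a * e - b * c = 1"
    using e e' by simp
  have nz: "of_int (int N * C) * z + of_int (D * int d) \<noteq> (0::complex)"
    using det d z by (intro moebius_denominator_nonzero[of "A * int d" _ B]) auto
  have nz': "of_int (int N * C') * z + of_int (D' * int d) \<noteq> (0::complex)"
    using entries' d z
    by (intro moebius_denominator_nonzero[of "A' * int d" _ B']) (auto simp: atkin_lehner_entries_def)
  have nz1: "of_int c * z0 + of_int e \<noteq> (0::complex)"
    using det1 z0 by (intro moebius_denominator_nonzero[of a _ b]) auto
  have eC: "of_nat d * (of_int A * of_int D) - of_int B * (of_nat m * of_int C) = (1::complex)"
    using arg_cong[OF e, of "of_int :: int \<Rightarrow> complex"] by simp
  have z0_eq: "z0 * (of_int (int N * C) * z + of_int (D * int d)) = of_int (A * int d) * z + of_int B"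
    unfolding z0_def moebius_def using nz by simp
  have "moebius a b c e z0 = moebius (A' * int d) B' (int N * C') (D' * int d) z"
  proof -
    let ?q = "of_int (int N * C) * z + of_int (D * int d) :: complex"
    have num: "(of_int a * z0 + of_int b) * ?q = of_int (A' * int d) * z + of_int B'"
    proof -
      have "(of_int a * z0 + of_int b) * ?q = of_int a * (z0 * ?q) + of_int b * ?q"
        by (simp add: algebra_simps)
      also have "\<dots> = (of_nat d * (of_int A * of_int D) - of_int B * (of_nat m * of_int C)) *
                        (of_int (A' * int d) * z + of_int B')"
        unfolding z0_eq unfolding defs N by (simp add: algebra_simps)
      finally show ?thesis by (simp add: eC)
    qed
    have den: "(of_int c * z0 + of_int e) * ?q = of_int (int N * C') * z + of_int (D' * int d)"
    proof -
      have "(of_int c * z0 + of_int e) * ?q = of_int c * (z0 * ?q) + of_int e * ?q"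
        by (simp add: algebra_simps)
      also have "\<dots> = (of_nat d * (of_int A * of_int D) - of_int B * (of_nat m * of_int C)) *
                        (of_int (int N * C') * z + of_int (D' * int d))"
        unfolding z0_eq unfolding defs N by (simp add: algebra_simps)
      finally show ?thesis by (simp add: eC)
    qed
    have "moebius a b c e z0 = ((of_int a * z0 + of_int b) * ?q) / ((of_int c * z0 + of_int e) * ?q)"
      unfolding moebius_def using nz by simp
    thus ?thesis unfolding num den by (simp add: moebius_def)
  qed
  moreover have "f (moebius a b c e z0) = f z0"
    using f det1 z0 by (auto simp: Gamma0_invariant_def defs(3))
  ultimately show ?thesis
    using z by (simp add: atkin_lehner_pullback_def p p_def[symmetric] z0_def)
qed


section \<open>Function fields of curves given by equations\<close>

definition fraction_rel :: "('a, 'b) ring_scheme \<Rightarrow> (('a \<times> 'a) \<times> ('a \<times> 'a)) set" where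
  "fraction_rel R =
     {((a, b), (c, d)). a \<in> carrier R \<and> c \<in> carrier R \<and>
        b \<in> carrier R - {\<zero>\<^bsub>R\<^esub>} \<and> d \<in> carrier R - {\<zero>\<^bsub>R\<^esub>} \<and> a \<otimes>\<^bsub>R\<^esub> d = c \<otimes>\<^bsub>R\<^esub> b}"

text \<open>
  The field of fractions of an integral domain, with the class of \<open>(a, b)\<close> as the fraction \<open>a / b\<close>.
\<close>
definition fraction_field :: "('a, 'b) ring_scheme \<Rightarrow> ('a \<times> 'a) set ring" where
  "fraction_field R =
     \<lparr> carrier = (carrier R \<times> (carrier R - {\<zero>\<^bsub>R\<^esub>})) // fraction_rel R,
       monoid.mult = (\<lambda>P Q. \<Union>(a, b)\<in>P. \<Union>(c, d)\<in>Q.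
         fraction_rel R `` {(a \<otimes>\<^bsub>R\<^esub> c, b \<otimes>\<^bsub>R\<^esub> d)}),
       one = fraction_rel R `` {(\<one>\<^bsub>R\<^esub>, \<one>\<^bsub>R\<^esub>)},
       ring.zero = fraction_rel R `` {(\<zero>\<^bsub>R\<^esub>, \<one>\<^bsub>R\<^esub>)},
       add = (\<lambda>P Q. \<Union>(a, b)\<in>P. \<Union>(c, d)\<in>Q.
         fraction_rel R `` {(a \<otimes>\<^bsub>R\<^esub> d \<oplus>\<^bsub>R\<^esub> c \<otimes>\<^bsub>R\<^esub> b, b \<otimes>\<^bsub>R\<^esub> d)}) \<rparr>"

text \<open>
  Polynomials in three variables over the rational numbers are represented as iterated univariate
  polynomials.
\<close>
definition var_X :: "rat poly poly poly" where "var_X = [:[:[:0, 1:]:]:]"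
definition var_Y :: "rat poly poly poly" where "var_Y = [:[:0, 1:]:]"
definition var_T :: "rat poly poly poly" where "var_T = [:0, 1:]"

definition coordinate_ring :: "rat poly poly poly set \<Rightarrow> rat poly poly poly set ring" where
  "coordinate_ring E = ring_of_type_algebra Quot (Idl\<^bsub>ring_of_type_algebra\<^esub> E)"

text \<open>
  The polynomials in \<open>E\<close> are equations, up to birational equivalence over the rational numbers, for
  the curve with function field \<open>K\<close>: they define an integral affine scheme over the rational
  numbers whose function field is isomorphic to \<open>K\<close>. For fields of characteristic 0, every ring
  isomorphism is linear over the rational numbers.
\<close>
definition equations_up_to_birational :: "rat poly poly poly set \<Rightarrow> ('a, 'b) ring_scheme \<Rightarrow> bool" where
  "equations_up_to_birational E K \<longleftrightarrow>
     domain (coordinate_ring E) \<and> fraction_field (coordinate_ring E) \<simeq> K"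

end

theory Submission
  imports Defs
begin

text \<open>
 With the weight 1 Eisenstein series \<open>E\<close> of level 7 put \<open>h(z) = (E(z/2) - 2 E(z) + E(2 z)) / (E(z) - E(2 z))\<close>. Then
 \<open>x = h(4 z)\<close>, \<open>y = h(2 z) (h(4 z) + 1)\<close>, and \<open>t\<close> is the derivative of \<open>h\<close> at \<open>4 z\<close>, suitably divided. The
 relations between Eisenstein series hold because forms with many vanishing coefficients are zero. The
 involution exchanges the two cusps where \<open>x\<close> is unbounded, and \<open>x\<close> has a simple pole in the parameter of \<open>2 z\<close>, so
 functions invariant under \<open>z + 1/2\<close> and the involution are rational in \<open>x\<close>; in general \<open>1, y, t, y t\<close> is a basis.
\<close>

section \<open>The quasi-elliptic cotangent series\<close>

text \<open>The function h(2 z) is a coordinate on the genus 0 quotient of X_0(28) by its involution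
  attached to 7, and the sextic is the genus 2 curve X_0(28) over it. Both degeneracy maps from
  X_0(56) to X_0(28) enter: pulled back along z -> 2 z, the coordinate and the square root give x
  and t, while the coordinate itself, h(2 z), satisfies a quadratic equation over x and leads to y.
  What makes this explicit is the Hecke relation of E at 2 together with a quadratic relation:
  E(z/2), E(z), E(2 z) lie on a conic, and h parametrises it. The modularity of E comes from a
  quasi-elliptic function with simple poles on a lattice. Its sums over 7-division points give E in
  two ways, which the inversion of the lattice exchanges. Two obstacles shape the second half. Poles
  and cusps are treated by growth estimates on the half plane, with the maximum principle in place
  of the compact surface. And the decomposition over x is first obtained with complex coefficients;
  it is brought down to the rational numbers by linear functionals on the coefficients of
  expansions.\<close>

definition nome :: "complex \<Rightarrow> complex" where
 "nome z = exp (2 * of_real pi * \<i> * z)"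

lemma nome_add: "nome (u + v) = nome u * nome v"
 by (simp add: nome_def exp_add algebra_simps)

lemma nome_minus: "nome (-u) = inverse (nome u)"
 by (simp add: nome_def exp_minus)

lemma nome_nonzero [simp]: "nome u \<noteq> 0"
 by (simp add: nome_def)

lemma nome_0 [simp]: "nome 0 = 1"
 by (simp add: nome_def)

lemma nome_of_int [simp]: "nome (of_int n) = 1"
 unfolding nome_def exp_eq_1 by auto

lemma nome_1 [simp]: "nome 1 = 1"
 using nome_of_int[of 1] by simp

lemma nome_of_nat_mult: "nome (of_nat n * u) = nome u ^ n"
 by (simp add: nome_def exp_of_nat_mult[symmetric] algebra_simps)

lemma norm_nome: "norm (nome z) = exp (- 2 * pi * Im z)"
 by (simp add: nome_def)

lemma norm_nome_less_1: "Im z > 0 \<Longrightarrow> norm (nome z) < 1"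
 by (simp add: norm_nome)

lemma nome_holomorphic [holomorphic_intros]: "f holomorphic_on A \<Longrightarrow> (\<lambda>z. nome (f z)) holomorphic_on A"
 unfolding nome_def by (intro holomorphic_intros)

lemma nome_analytic [analytic_intros]: "f analytic_on A \<Longrightarrow> (\<lambda>z. nome (f z)) analytic_on A"
 unfolding nome_def by (intro analytic_intros)

lemma nome_eq_1_iff: "nome z = 1 \<longleftrightarrow> (\<exists>n::int. z = of_int n)"
proof
 assume "nome z = 1"
 then obtain n :: int where "Re (2 * of_real pi * \<i> * z) = 0" "Im (2 * of_real pi * \<i> * z) = of_int (2 * n) * pi"
  unfolding nome_def exp_eq_1 by blast
 hence "z = of_int n" by (auto simp: complex_eq_iff)
 thus "\<exists>n::int. z = of_int n" by blast
qed auto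

lemma holomorphic_suminf_M_test:
 fixes f :: "nat \<Rightarrow> complex \<Rightarrow> complex"
 assumes "open A" and hol: "\<And>n. f n holomorphic_on A"
  and le: "\<And>n w. w \<in> A \<Longrightarrow> norm (f n w) \<le> M n" and "summable M"
 shows "(\<lambda>w. \<Sum>n. f n w) holomorphic_on A"
proof (rule holomorphic_uniform_sequence[OF \<open>open A\<close>])
 show "(\<lambda>w. \<Sum>k<n. f k w) holomorphic_on A" for n
  by (intro holomorphic_intros hol)
 fix x assume "x \<in> A"
 then obtain d where "d > 0" "cball x d \<subseteq> A" using \<open>open A\<close> open_contains_cball by blast
 moreover have "uniform_limit (cball x d) (\<lambda>n w. \<Sum>k<n. f k w) (\<lambda>w. \<Sum>n. f n w) sequentially"
  by (rule Weierstrass_m_test[OF _ \<open>summable M\<close>]) (use le calculation in blast)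
 ultimately show "\<exists>d>0. cball x d \<subseteq> A \<and>
   uniform_limit (cball x d) (\<lambda>n w. \<Sum>k<n. f k w) (\<lambda>w. \<Sum>n. f n w) sequentially"
  by blast
qed

definition cot_tail :: "complex \<Rightarrow> complex \<Rightarrow> complex" where
 "cot_tail q w = (\<Sum>m. q ^ Suc m / (w - q ^ Suc m))"

lemma cot_tail_bound:
 fixes q w :: complex
 assumes "norm w \<ge> r" "r > 0" "norm q ^ n \<le> r / 2"
 shows "norm (q ^ n / (w - q ^ n)) \<le> 2 / r * norm q ^ n"
proof -
 have "norm (w - q ^ n) \<ge> norm w - norm (q ^ n)" by (rule norm_triangle_ineq2)
 hence *: "norm (w - q ^ n) \<ge> r / 2" using assms by (simp add: norm_power)
 have "norm (q ^ n / (w - q ^ n)) = norm q ^ n / norm (w - q ^ n)"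
  by (simp add: norm_divide norm_power)
 also have "\<dots> \<le> norm q ^ n / (r / 2)"
  using * assms by (intro divide_left_mono mult_pos_pos) auto
 finally show ?thesis by (simp add: field_simps)
qed

lemma eventually_power_le:
 fixes q :: complex
 assumes "norm q < 1" "r > 0"
 obtains M where "\<And>n. n \<ge> M \<Longrightarrow> norm q ^ n \<le> r"
proof -
 have "(\<lambda>n. norm q ^ n) \<longlonglongrightarrow> 0" using assms by (intro LIMSEQ_power_zero) auto
 hence "\<forall>\<^sub>F n in sequentially. norm q ^ n < r" using assms(2) by (rule order_tendstoD)
 then obtain M where "\<And>n. n \<ge> M \<Longrightarrow> norm q ^ n < r" unfolding eventually_sequentially by blast
 thus ?thesis using that[of M] by (meson less_imp_le)
qed

lemma summable_cot_tail:
 fixes q w :: complex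
 assumes "norm q < 1" "w \<noteq> 0"
 shows "summable (\<lambda>m. q ^ Suc m / (w - q ^ Suc m))"
proof -
 obtain M where M: "\<And>n. n \<ge> M \<Longrightarrow> norm q ^ n \<le> norm w / 2"
  using eventually_power_le[of q "norm w / 2"] assms by auto
 have "summable (\<lambda>m. 2 / norm w * norm q ^ m)"
  using assms by (intro summable_mult summable_geometric) auto
 hence "summable (\<lambda>m. q ^ m / (w - q ^ m))"
  by (rule summable_comparison_test'[of _ M]) (use M assms cot_tail_bound[of "norm w" w q] in auto)
 thus ?thesis by (subst summable_Suc_iff)
qed

text \<open>The poles q^m accumulate only at 0. On the ball of radius \<open>norm w / 2\<close> the
  terms from index \<open>M\<close> on are dominated by a geometric series, and the finitely many
  terms before them are analytic one by one.\<close>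

lemma cot_tail_analytic:
 fixes q w :: complex
 assumes q: "norm q < 1" and w: "w \<noteq> 0" "\<And>m. w \<noteq> q ^ Suc m"
 shows "cot_tail q analytic_on {w}"
proof -
 define r where "r = norm w / 2"
 have r: "r > 0" using w by (simp add: r_def)
 obtain M where M: "\<And>n. n \<ge> M \<Longrightarrow> norm q ^ n \<le> r / 2"
  using eventually_power_le[of q "r / 2"] r q by auto
 have big: "norm v \<ge> r" if "v \<in> ball w r" for v
 proof -
  have "norm w - norm v \<le> dist w v" unfolding dist_norm by (rule norm_triangle_ineq2)
  thus ?thesis using that by (simp add: r_def)
 qed
 let ?f = "\<lambda>m v. q ^ Suc (m + M) / (v - q ^ Suc (m + M))"
 have "(\<lambda>v. \<Sum>m. ?f m v) holomorphic_on ball w r"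
 proof (rule holomorphic_suminf_M_test)
  show "norm (?f m v) \<le> 2 / r * norm q ^ Suc (m + M)" if "v \<in> ball w r" for m v
   by (rule cot_tail_bound[OF big[OF that] r], rule M) simp
  show "?f m holomorphic_on ball w r" for m
  proof (intro holomorphic_intros)
   fix v assume v: "v \<in> ball w r"
   have "norm (q ^ Suc (m + M)) \<le> r / 2" unfolding norm_power by (rule M) simp
   thus "v - q ^ Suc (m + M) \<noteq> 0" using big[OF v] r by auto
  qed
  have "summable (\<lambda>m. (2 / r * norm q ^ Suc M) * norm q ^ m)"
   using q by (intro summable_mult summable_geometric) auto
  thus "summable (\<lambda>m. 2 / r * norm q ^ Suc (m + M))"
   by (simp add: power_add mult_ac)
 qed auto
 hence "(\<lambda>v. \<Sum>m. ?f m v) analytic_on {w}"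
  using r by (intro holomorphic_on_imp_analytic_at[of _ "ball w r"]) auto
 moreover have "(\<lambda>v. \<Sum>m<M. q ^ Suc m / (v - q ^ Suc m)) analytic_on {w}"
 proof -
  have nz: "w - q ^ Suc m \<noteq> 0" for m using w(2)[of m] by (simp del: power_Suc)
  show ?thesis by (intro analytic_intros) (use nz in auto)
 qed
 ultimately have "(\<lambda>v. (\<Sum>m. ?f m v) + (\<Sum>m<M. q ^ Suc m / (v - q ^ Suc m))) analytic_on {w}"
  by (rule analytic_on_add)
 moreover have "\<forall>\<^sub>F v in nhds w. (\<Sum>m. ?f m v) + (\<Sum>m<M. q ^ Suc m / (v - q ^ Suc m)) = cot_tail q v"
 proof -
  have "\<forall>\<^sub>F v in nhds w. v \<noteq> 0" using w by (intro t1_space_nhds) auto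
  thus ?thesis
   by eventually_elim (unfold cot_tail_def, subst suminf_split_initial_segment[OF summable_cot_tail[OF q], where k = M], auto)
 qed
 ultimately show ?thesis by (simp cong: analytic_at_cong)
qed

text \<open>With w = \<open>nome u\<close> this is cot(pi u), written as a rational function of the
  exponential.\<close>

definition cot_exp :: "complex \<Rightarrow> complex" where
 "cot_exp w = \<i> * (w + 1) / (w - 1)"

definition cot_series :: "complex \<Rightarrow> complex \<Rightarrow> complex" where
 "cot_series q w = cot_exp w + 2 * \<i> * (cot_tail q w - cot_tail q (1 / w))"

lemma cot_exp_inverse: "w \<noteq> 0 \<Longrightarrow> w \<noteq> 1 \<Longrightarrow> cot_exp (1 / w) = - cot_exp w"
 by (simp add: cot_exp_def divide_simps) (simp add: algebra_simps)

lemma cot_series_inverse: "w \<noteq> 0 \<Longrightarrow> w \<noteq> 1 \<Longrightarrow> cot_series q (1 / w) = - cot_series q w"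
 by (simp add: cot_series_def cot_exp_inverse algebra_simps)

lemma cot_tail_shift:
 assumes q: "norm q < 1" "q \<noteq> 0" and w: "w \<noteq> 0"
 shows "cot_tail q (q * w) = 1 / (w - 1) + cot_tail q w"
proof -
 have eq: "q ^ Suc m / (q * w - q ^ Suc m) = q ^ m / (w - q ^ m)" for m
 proof -
  have "q * w - q ^ Suc m = q * (w - q ^ m)" by (simp add: algebra_simps)
  thus ?thesis using q by simp
 qed
 have s: "summable (\<lambda>m. q ^ m / (w - q ^ m))"
  using summable_cot_tail[OF q(1) w] by (subst (asm) summable_Suc_iff)
 have "cot_tail q (q * w) = (\<Sum>m. q ^ m / (w - q ^ m))"
  unfolding cot_tail_def eq ..
 also have "\<dots> = 1 / (w - 1) + cot_tail q w"
  using suminf_split_head[OF s] by (simp add: cot_tail_def)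
 finally show ?thesis .
qed

text \<open>Going from w to q w, the first tail gains 1 / (w - 1) and the second loses q w / (1 - q
  w). Together with the change of \<open>cot_exp\<close> everything cancels except the -1 in v / (1
  - v) = -1 - 1 / (v - 1), which the factor 2 i turns into the quasi-period.\<close>

lemma cot_series_shift:
 assumes q: "norm q < 1" "q \<noteq> 0" and w: "w \<noteq> 0" "w \<noteq> 1" "q * w \<noteq> 1"
 shows "cot_series q (q * w) = cot_series q w - 2 * \<i>"
proof -
 have "cot_tail q (q * (1 / (q * w))) = 1 / (1 / (q * w) - 1) + cot_tail q (1 / (q * w))"
  by (rule cot_tail_shift) (use q w in auto)
 hence 1: "cot_tail q (1 / (q * w)) = cot_tail q (1 / w) - 1 / (1 / (q * w) - 1)"
  using q by simp
 have 2: "1 / (1 / (q * w) - 1) = q * w / (1 - q * w)" using q w by (simp add: field_simps)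
 have 3: "cot_exp v = \<i> + 2 * \<i> / (v - 1)" if "v \<noteq> 1" for v
 proof -
  have "\<i> * (v + 1) = \<i> * (v - 1) + 2 * \<i>" by (simp add: algebra_simps)
  thus ?thesis using that by (simp add: cot_exp_def add_divide_distrib)
 qed
 have 4: "v / (1 - v) = - 1 - 1 / (v - 1)" if "v \<noteq> 1" for v :: complex
 proof -
  have "1 / (v - 1) = - (1 / (1 - v))" by (metis minus_diff_eq minus_divide_right)
  thus ?thesis using that by (simp add: field_simps)
 qed
 show ?thesis
  unfolding cot_series_def 1 2 4[OF w(3)] cot_tail_shift[OF q w(1)] 3[OF w(2)] 3[OF w(3)]
  by (simp add: algebra_simps)
qed

text \<open>This is (zeta(u) - eta1 u) / pi for the Weierstrass zeta function of the lattice spanned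
  by v and 1, where eta1 is the quasi-period along 1. It is odd, has period 1, quasi-period -2 i
  along v and residue 1 / pi. Its value at lattice points is an artefact of division by
  zero.\<close>

definition zeta_cot :: "complex \<Rightarrow> complex \<Rightarrow> complex" where
 "zeta_cot u v = cot_series (nome v) (nome u)"

section \<open>Period lattices and quasi-periodicity\<close>

definition period_lattice :: "complex \<Rightarrow> complex set" where
 "period_lattice v = {of_int m * v + of_int n | m n. True}"

lemma latticeI: "u = of_int m * v + of_int n \<Longrightarrow> u \<in> period_lattice v"
 unfolding period_lattice_def by blast

lemma lattice_0 [simp]: "0 \<in> period_lattice v"
 by (rule latticeI[of _ 0 _ 0]) simp

lemma lattice_uminus: "u \<in> period_lattice v \<Longrightarrow> -u \<in> period_lattice v"
proof -
 assume "u \<in> period_lattice v"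
 then obtain m n where "u = of_int m * v + of_int n" unfolding period_lattice_def by blast
 thus ?thesis by (intro latticeI[of _ "-m" _ "-n"]) simp
qed

lemma lattice_add: "u \<in> period_lattice w \<Longrightarrow> v \<in> period_lattice w \<Longrightarrow> u + v \<in> period_lattice w"
proof -
 assume "u \<in> period_lattice w" "v \<in> period_lattice w"
 then obtain m n m' n' where "u = of_int m * w + of_int n" "v = of_int m' * w + of_int n'"
  unfolding period_lattice_def by blast
 thus ?thesis by (intro latticeI[of _ "m + m'" _ "n + n'"]) (simp add: algebra_simps)
qed

lemma lattice_diff: "u \<in> period_lattice w \<Longrightarrow> v \<in> period_lattice w \<Longrightarrow> u - v \<in> period_lattice w"
 using lattice_add[of u w "-v"] lattice_uminus by simp

lemma lattice_add_iff: "v \<in> period_lattice w \<Longrightarrow> u + v \<in> period_lattice w \<longleftrightarrow> u \<in> period_lattice w"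
 using lattice_add[of u w v] lattice_diff[of "u + v" w v] by auto

lemma lattice_uminus_iff: "-u \<in> period_lattice v \<longleftrightarrow> u \<in> period_lattice v"
 using lattice_uminus[of u v] lattice_uminus[of "-u" v] by auto

lemma lattice_small:
 assumes "Im v > 0" "u \<in> period_lattice v" "norm u < min 1 (Im v)"
 shows "u = 0"
proof -
 obtain m n where u: "u = of_int m * v + of_int n" using assms unfolding period_lattice_def by blast
 have "\<bar>Im u\<bar> < Im v" using abs_Im_le_cmod[of u] assms by simp
 hence "\<bar>of_int m\<bar> * Im v < 1 * Im v" using assms by (simp add: u abs_mult)
 hence "\<bar>of_int m :: real\<bar> < 1" using assms by (simp only: mult_less_cancel_right_pos)
 hence "m = 0" by linarith
 with u assms have "norm (of_int n :: complex) < 1" by simp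
 hence "n = 0" by simp
 with \<open>m = 0\<close> u show ?thesis by simp
qed

lemma closed_lattice: "Im v > 0 \<Longrightarrow> closed (period_lattice v)"
 by (rule discrete_imp_closed[of "min 1 (Im v)"])
   (auto simp: dist_norm dest: lattice_diff lattice_small)

lemma nome_eq_power_imp_lattice:
 assumes "nome u = nome v ^ m"
 shows "u \<in> period_lattice v"
proof -
 have "nome (u - of_nat m * v) = 1"
  using assms by (simp add: nome_add[of u "- (of_nat m * v)", simplified] nome_minus nome_of_nat_mult)
 then obtain n :: int where "u - of_nat m * v = of_int n" unfolding nome_eq_1_iff by blast
 thus ?thesis by (intro latticeI[of _ "int m" _ n]) (simp add: algebra_simps)
qed

lemma nome_neq_1: "u \<notin> period_lattice v \<Longrightarrow> nome u \<noteq> 1"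
 using nome_eq_power_imp_lattice[of u v 0] by auto

lemma zeta_cot_minus: "u \<notin> period_lattice v \<Longrightarrow> zeta_cot (-u) v = - zeta_cot u v"
 using cot_series_inverse[of "nome u" "nome v"] nome_neq_1[of u v]
 by (simp add: zeta_cot_def nome_minus inverse_eq_divide)

lemma zeta_cot_add_of_int: "zeta_cot (u + of_int n) v = zeta_cot u v"
 by (simp add: zeta_cot_def nome_add)

lemma zeta_cot_add_period:
 assumes "Im v > 0" "u \<notin> period_lattice v"
 shows "zeta_cot (u + v) v = zeta_cot u v - 2 * \<i>"
proof -
 have "u + v \<notin> period_lattice v"
  using assms(2) lattice_add_iff[of v v u] latticeI[of v 1 v 0] by simp
 hence "nome v * nome u \<noteq> 1" using nome_neq_1[of "u + v" v] by (simp add: nome_add mult.commute)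
 thus ?thesis
  using cot_series_shift[of "nome v" "nome u"] assms nome_neq_1[OF assms(2)] norm_nome_less_1
  by (simp add: zeta_cot_def nome_add mult.commute)
qed

lemma zeta_cot_add_periods:
 assumes "Im v > 0" "u \<notin> period_lattice v"
 shows "zeta_cot (u + (of_int m * v + of_int n)) v = zeta_cot u v - 2 * \<i> * of_int m"
proof -
 have not: "u + of_int k * v \<notin> period_lattice v" for k
  using assms(2) lattice_add_iff[of "of_int k * v" v u] latticeI[of "of_int k * v" k v 0] by simp
 have "zeta_cot (u + of_int m * v) v = zeta_cot u v - 2 * \<i> * of_int m"
 proof (induction m rule: int_induct[where k = 0])
  case (step1 i)
  have "zeta_cot (u + of_int (i + 1) * v) v = zeta_cot ((u + of_int i * v) + v) v"
   by (simp add: algebra_simps)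
  also have "\<dots> = zeta_cot (u + of_int i * v) v - 2 * \<i>"
   by (rule zeta_cot_add_period[OF assms(1) not])
  also have "\<dots> = zeta_cot u v - 2 * \<i> * of_int i - 2 * \<i>" by (simp only: step1)
  finally have E: "zeta_cot (u + of_int (i + 1) * v) v = zeta_cot u v - 2 * \<i> * of_int i - 2 * \<i>" .
  show ?case unfolding E by (simp add: algebra_simps)
 next
  case (step2 i)
  have "zeta_cot (u + of_int i * v) v = zeta_cot ((u + of_int (i - 1) * v) + v) v"
   by (simp add: algebra_simps)
  also have "\<dots> = zeta_cot (u + of_int (i - 1) * v) v - 2 * \<i>"
   by (rule zeta_cot_add_period[OF assms(1) not])
  finally have E: "zeta_cot (u + of_int (i - 1) * v) v = zeta_cot (u + of_int i * v) v + 2 * \<i>"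
   by simp
  show ?case unfolding E step2(2) by (simp add: algebra_simps)
 qed simp
 thus ?thesis using zeta_cot_add_of_int[of "u + of_int m * v" n v] by (simp add: add.assoc)
qed

text \<open>Subtracting the cotangent leaves poles only at nonzero multiples of v, modulo integers.
  Hence u = 0 is allowed here, and the residue of \<open>zeta_cot\<close> at 0 is that of the
  cotangent.\<close>

lemma zeta_cot_regular_part:
 assumes "Im v > 0" "u \<notin> period_lattice v \<or> u = 0"
 shows "(\<lambda>u. zeta_cot u v - cot_exp (nome u)) analytic_on {u}"
proof -
 have q: "norm (nome v) < 1" using assms norm_nome_less_1 by blast
 have ne: "nome u \<noteq> nome v ^ Suc m" if "u \<notin> period_lattice v \<or> u = 0" for u m
 proof (cases "u = 0")
  case True
  have "norm (nome v ^ Suc m) < 1" unfolding norm_power using q by (intro power_less_one_iff[THEN iffD2]) auto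
  thus ?thesis using True by (metis less_irrefl nome_0 norm_one)
 qed (use that nome_eq_power_imp_lattice in blast)
 have "cot_tail (nome v) analytic_on {nome u}"
  by (rule cot_tail_analytic[OF q]) (use ne assms in auto)
 moreover have "cot_tail (nome v) analytic_on {nome (-u)}"
  by (rule cot_tail_analytic[OF q]) (use ne[of "-u"] assms in \<open>auto simp: lattice_uminus_iff\<close>)
 ultimately have "(cot_tail (nome v) \<circ> nome) analytic_on {u}"
   "(cot_tail (nome v) \<circ> (\<lambda>u. nome (-u))) analytic_on {u}"
  by (intro analytic_on_compose; simp; intro analytic_intros)+
 hence "(\<lambda>u. 2 * \<i> * ((cot_tail (nome v) \<circ> nome) u - (cot_tail (nome v) \<circ> (\<lambda>u. nome (-u))) u)) analytic_on {u}"
  by (intro analytic_intros)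
 thus ?thesis
  by (simp add: zeta_cot_def cot_series_def o_def nome_minus inverse_eq_divide)
qed

lemma zeta_cot_analytic:
 assumes "Im v > 0" "u \<notin> period_lattice v"
 shows "(\<lambda>u. zeta_cot u v) analytic_on {u}"
proof -
 have "(\<lambda>u. cot_exp (nome u)) analytic_on {u}"
  unfolding cot_exp_def using nome_neq_1[OF assms(2)] by (intro analytic_intros) auto
 from analytic_on_add[OF zeta_cot_regular_part[OF assms(1)] this] show ?thesis
  using assms(2) by simp
qed

lemma cot_exp_nome_residue: "((\<lambda>u. u * cot_exp (nome u)) \<longlongrightarrow> 1 / of_real pi) (at 0)"
proof -
 have "(nome has_field_derivative 2 * of_real pi * \<i>) (at 0)"
  unfolding nome_def by (auto intro!: derivative_eq_intros)
 hence "((\<lambda>u. (nome u - 1) / u) \<longlongrightarrow> 2 * of_real pi * \<i>) (at 0)"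
  by (simp add: has_field_derivative_iff)
 moreover have "(nome \<longlongrightarrow> 1) (at 0)"
  unfolding nome_def by (auto intro!: tendsto_eq_intros)
 ultimately have "((\<lambda>u. \<i> * (nome u + 1) / ((nome u - 1) / u)) \<longlongrightarrow> \<i> * (1 + 1) / (2 * of_real pi * \<i>)) (at 0)"
  by (intro tendsto_intros) auto
 thus ?thesis by (simp add: cot_exp_def mult_ac)
qed

lemma zeta_cot_residue:
 assumes "Im v > 0"
 shows "((\<lambda>u. u * zeta_cot u v) \<longlongrightarrow> 1 / of_real pi) (at 0)"
proof -
 have "isCont (\<lambda>u. zeta_cot u v - cot_exp (nome u)) 0"
  by (intro analytic_at_imp_isCont zeta_cot_regular_part assms) simp
 hence "((\<lambda>u. zeta_cot u v - cot_exp (nome u)) \<longlongrightarrow> zeta_cot 0 v - cot_exp (nome 0)) (at 0)"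
  by (simp add: isCont_def)
 from tendsto_add[OF tendsto_mult[OF tendsto_ident_at this] cot_exp_nome_residue]
 show ?thesis by (simp add: algebra_simps)
qed

lemma bounded_on_period_parallelogram:
 fixes G :: "complex \<Rightarrow> complex"
 assumes "Im v > 0" "continuous_on UNIV G"
  and per: "\<And>u m n. G (u + (of_int m * v + of_int n)) = G u"
 shows "bounded (range G)"
proof -
 define p where "p = (\<lambda>(s, t). complex_of_real s * v + of_real t)"
 have "continuous_on ({0..1} \<times> {0..1}) p"
  unfolding p_def split_def by (intro continuous_intros)
 hence "compact (p ` ({0..1} \<times> {0..1}))"
  by (rule compact_continuous_image) (intro compact_Times compact_Icc)
 hence "compact (G ` p ` ({0..1} \<times> {0..1}))"
  by (intro compact_continuous_image[OF continuous_on_subset[OF assms(2) subset_UNIV]])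
 moreover have "range G \<subseteq> G ` p ` ({0..1} \<times> {0..1})"
 proof safe
  fix u :: complex
  define s t where "s = Im u / Im v" and "t = Re u - Im u / Im v * Re v"
  have u: "u = of_real s * v + of_real t"
   using assms(1) by (simp add: complex_eq_iff s_def t_def)
  have "G u = G (u + (of_int (-\<lfloor>s\<rfloor>) * v + of_int (-\<lfloor>t\<rfloor>)))" by (rule per[symmetric])
  also have "u + (of_int (-\<lfloor>s\<rfloor>) * v + of_int (-\<lfloor>t\<rfloor>)) = p (frac s, frac t)"
   unfolding u p_def frac_def by (simp add: algebra_simps)
  finally show "G u \<in> G ` p ` ({0..1} \<times> {0..1})"
   by (auto intro!: imageI simp: frac_ge_0 frac_lt_1 less_imp_le)
 qed
 ultimately show ?thesis using bounded_subset compact_imp_bounded by blast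
qed

text \<open>Multiplied by c v + d, the lattice of the transformed point is spanned by a v + b and c
  v + d, which is a basis of the original lattice because the determinant is 1.\<close>

lemma lattice_moebius_iff:
 fixes a b c d :: int
 assumes det: "a * d - b * c = 1" and J: "of_int c * v + of_int d \<noteq> (0 :: complex)"
 shows "u / (of_int c * v + of_int d) \<in> period_lattice (moebius a b c d v) \<longleftrightarrow> u \<in> period_lattice v"
proof -
 define J where "J = of_int c * v + of_int d"
 have detC: "of_int a * of_int d - of_int b * of_int c = (1 :: complex)"
  using arg_cong[OF det, of "of_int :: int \<Rightarrow> complex"] by simp
 have J0: "J \<noteq> 0" using assms by (simp add: J_def)
 have mJ: "moebius a b c d v * J = of_int a * v + of_int b"
  using J0 by (simp add: moebius_def J_def)
 have "u / J \<in> period_lattice (moebius a b c d v)" if "u \<in> period_lattice v"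
 proof -
  from that obtain m n where u: "u = of_int m * v + of_int n" unfolding period_lattice_def by blast
  have "(of_int (m * d - n * c) * moebius a b c d v + of_int (n * a - m * b)) * J =
    of_int (m * d - n * c) * (moebius a b c d v * J) + of_int (n * a - m * b) * J"
   by (simp add: algebra_simps)
  also have "\<dots> = (of_int a * of_int d - of_int b * of_int c) * u"
   unfolding mJ unfolding u J_def by (simp add: algebra_simps)
  also have "\<dots> = u" by (simp only: detC mult_1)
  finally show ?thesis
   by (intro latticeI[of _ "m * d - n * c" _ "n * a - m * b"]) (simp only: nonzero_divide_eq_eq[OF J0])
 qed
 moreover have "u \<in> period_lattice v" if "u / J \<in> period_lattice (moebius a b c d v)"
 proof -
  from that obtain m n where "u / J = of_int m * moebius a b c d v + of_int n" unfolding period_lattice_def by blast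
  hence "u = of_int m * (moebius a b c d v * J) + of_int n * J" using J0 by (simp add: field_simps)
  hence "u = of_int (m * a + n * c) * v + of_int (m * b + n * d)"
   unfolding mJ by (simp add: J_def algebra_simps)
  thus ?thesis by (rule latticeI)
 qed
 ultimately show ?thesis unfolding J_def by blast
qed

text \<open>
 Both terms on the left have simple poles with equal residues at the same points, and their
 quasi-periods differ by those of the linear function on the right; Liouville's theorem applies.
\<close>
theorem zeta_cot_modular:
 fixes a b c d :: int
 assumes det: "a * d - b * c = 1" and k: "Im k > 0" and u: "u \<notin> period_lattice k"
 defines "J \<equiv> of_int c * k + of_int d" and "k' \<equiv> moebius a b c d k"
 shows "zeta_cot (u / J) k' / J = zeta_cot u k + 2 * \<i> * of_int c * u / J"
proof -
 define g where "g = (\<lambda>u. zeta_cot (u / J) k' / J - zeta_cot u k - 2 * \<i> * of_int c * u / J)"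
 have kH: "k \<in> upper_half_plane" using k by (simp add: upper_half_plane_def)
 have J0: "J \<noteq> 0" unfolding J_def using moebius_denominator_nonzero[of a d b c k] det kH by simp
 have "k' \<in> upper_half_plane" unfolding k'_def using det kH by (intro moebius_in_upper_half_plane) auto
 hence k': "Im k' > 0" by (simp add: upper_half_plane_def)
 have detC: "of_int a * of_int d - of_int b * of_int c = (1 :: complex)"
  using arg_cong[OF det, of "of_int :: int \<Rightarrow> complex"] by simp
 have mJ: "k' * J = of_int a * k + of_int b"
  using J0 by (simp add: moebius_def J_def k'_def)
 have lat: "u / J \<in> period_lattice k' \<longleftrightarrow> u \<in> period_lattice k" for u
  unfolding J_def k'_def using lattice_moebius_iff[OF det] J0 by (simp add: J_def)
 have g_per: "g (u + (of_int m * k + of_int n)) = g u" if "u \<notin> period_lattice k" for u m n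
 proof -
  \<comment> \<open>The coordinates of the period in the new lattice come from the inverse matrix.
    The linear term of \<open>g\<close> is made to absorb the difference of the two quasi-periods,
    -2 i m' / J and -2 i m.\<close>
  define m' n' where "m' = m * d - n * c" and "n' = n * a - m * b"
  have "(of_int m' * k' + of_int n') * J = of_int m' * (k' * J) + of_int n' * J"
   by (simp add: algebra_simps)
  also have "\<dots> = (of_int a * of_int d - of_int b * of_int c) * (of_int m * k + of_int n)"
   unfolding mJ unfolding m'_def n'_def J_def by (simp add: algebra_simps)
  also have "\<dots> = of_int m * k + of_int n" by (simp only: detC mult_1)
  finally have "(of_int m * k + of_int n) / J = of_int m' * k' + of_int n'"
   by (simp only: nonzero_divide_eq_eq[OF J0])
  hence 1: "(u + (of_int m * k + of_int n)) / J = u / J + (of_int m' * k' + of_int n')"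
   by (simp add: add_divide_distrib)
  have m'_eq: "of_int m' = of_int m * J - of_int c * (of_int m * k + of_int n)"
   unfolding m'_def J_def by (simp add: algebra_simps)
  have alg: "(z1 - 2 * \<i> * (mm * J - cc * w)) / J - (z2 - 2 * \<i> * mm) - 2 * \<i> * cc * (u + w) / J =
    z1 / J - z2 - 2 * \<i> * cc * u / J" for z1 z2 mm cc w
   using J0 by (simp add: field_simps)
  have "g (u + (of_int m * k + of_int n)) = (zeta_cot (u / J) k' - 2 * \<i> * of_int m') / J
    - (zeta_cot u k - 2 * \<i> * of_int m) - 2 * \<i> * of_int c * (u + (of_int m * k + of_int n)) / J"
   unfolding g_def 1 using that lat k k' by (simp only: zeta_cot_add_periods not_False_eq_True)
  thus ?thesis unfolding g_def m'_eq alg .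
 qed
 have g_ana: "g analytic_on {u}" if "u \<notin> period_lattice k" for u
 proof -
  have "(\<lambda>u. zeta_cot u k') analytic_on {u / J}" using zeta_cot_analytic[OF k'] that lat by blast
  moreover have "(\<lambda>u. u / J) analytic_on {u}" using J0 by (intro analytic_intros) auto
  ultimately have "((\<lambda>u. zeta_cot u k') \<circ> (\<lambda>u. u / J)) analytic_on {u}"
   by (intro analytic_on_compose) auto
  thus ?thesis unfolding g_def o_def using J0 zeta_cot_analytic[OF k that]
   by (intro analytic_intros) auto
 qed
 have g_odd: "g (-u) = - g u" if "u \<notin> period_lattice k" for u
  unfolding g_def using zeta_cot_minus[OF that] zeta_cot_minus[of "u / J" k'] that lat by simp
 have g_lim: "((\<lambda>u. (u - 0) * g u) \<longlongrightarrow> 0) (at 0)"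
 proof -
  have "filterlim (\<lambda>u. u / J) (at 0) (at 0)"
   using J0 by (auto simp: filterlim_at eventually_at_filter intro!: tendsto_eq_intros)
  hence "((\<lambda>u. (u / J) * zeta_cot (u / J) k') \<longlongrightarrow> 1 / of_real pi) (at 0)"
   using filterlim_compose[OF zeta_cot_residue[OF k'], of "\<lambda>u. u / J"] by simp
  hence "((\<lambda>u. (u / J) * zeta_cot (u / J) k' - u * zeta_cot u k - u * (2 * \<i> * of_int c * u / J))
    \<longlongrightarrow> 1 / of_real pi - 1 / of_real pi - 0 * (2 * \<i> * of_int c * 0 / J)) (at 0)"
   by (intro tendsto_intros zeta_cot_residue[OF k]) (use J0 in auto)
  thus ?thesis by (simp add: g_def algebra_simps)
 qed
 define r where "r = min 1 (Im k)"
 have r: "r > 0" using k by (simp add: r_def)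
 have punct: "u \<notin> period_lattice k" if "u \<in> ball 0 r - {0}" for u
  using lattice_small[OF k, of u] that by (auto simp: r_def)
 have "g holomorphic_on ball 0 r - {0}"
  using g_ana punct analytic_imp_holomorphic analytic_on_analytic_at by blast
 then obtain h where h: "h holomorphic_on ball 0 r" "\<And>u. u \<in> ball 0 r - {0} \<Longrightarrow> h u = g u"
  using holomorphic_on_extend_lim[of g "ball 0 r" 0] g_lim r by auto
 \<comment> \<open>The residues cancel at 0, so \<open>g\<close> extends there; by periodicity the
   same value repairs every lattice point.\<close>
 define G where "G = (\<lambda>u. if u \<in> period_lattice k then h 0 else g u)"
 have G_per: "G (u + (of_int m * k + of_int n)) = G u" for u m n
  unfolding G_def using lattice_add_iff[of "of_int m * k + of_int n" k u] latticeI g_per by auto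
 have G0: "G analytic_on {0}"
 proof -
  have "h analytic_on {0}" using h r by (intro holomorphic_on_imp_analytic_at[of _ "ball 0 r"]) auto
  moreover have "\<forall>\<^sub>F u in nhds 0. u \<in> ball 0 r" using r by (intro eventually_nhds_in_open) auto
  hence "\<forall>\<^sub>F u in nhds 0. h u = G u"
  proof eventually_elim
   case (elim u)
   thus ?case using h(2)[of u] punct[of u] by (cases "u = 0") (auto simp: G_def)
  qed
  ultimately show ?thesis by (simp cong: analytic_at_cong)
 qed
 have G_ana: "G analytic_on {u}" for u
 proof (cases "u \<in> period_lattice k")
  case True
  then obtain m n where mn: "u = of_int m * k + of_int n" unfolding period_lattice_def by blast
  have "(G \<circ> (\<lambda>v. v - u)) analytic_on {u}"
   by (intro analytic_on_compose analytic_intros) (simp add: G0)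
  moreover have "(G \<circ> (\<lambda>v. v - u)) = G"
   using G_per[of "_ - u" m n] by (auto simp: mn)
  ultimately show ?thesis by simp
 next
  case False
  hence "\<forall>\<^sub>F v in nhds u. v \<in> - period_lattice k"
   using closed_lattice[OF k] by (intro eventually_nhds_in_open) auto
  hence "\<forall>\<^sub>F v in nhds u. g v = G v" by eventually_elim (simp add: G_def)
  thus ?thesis using g_ana[OF False] by (simp cong: analytic_at_cong)
 qed
 have hol: "G holomorphic_on UNIV"
  using G_ana analytic_imp_holomorphic analytic_on_analytic_at by blast
 have "bounded (range G)"
  using holomorphic_on_imp_continuous_on[OF hol] G_per by (intro bounded_on_period_parallelogram[OF k]) auto
 with Liouville_theorem[OF hol] obtain C where C: "\<And>u. G u = C"
  by (auto simp: constant_on_def)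
 have gC: "g v = C" if "v \<notin> period_lattice k" for v using C[of v] that by (simp add: G_def)
 \<comment> \<open>Liouville only yields a constant; since \<open>g\<close> is odd, the constant is
   0.\<close>
 have "C = - C" using g_odd[OF u] gC[OF u] gC[of "-u"] u by (simp add: lattice_uminus_iff)
 hence "g u = 0" using gC[OF u] by simp
 thus ?thesis by (simp add: g_def algebra_simps)
qed

section \<open>The weight one Eisenstein series of level 7\<close>

text \<open>The Legendre symbol modulo 7, the character of the field generated by sqrt(-7). It is
  odd, and its value at 2 is 1, which later makes doubling and halving the argument
  harmless.\<close>

definition chi7 :: "int \<Rightarrow> int" where
 "chi7 n = (if n mod 7 \<in> {1, 2, 4} then 1 else if n mod 7 = 0 then 0 else - 1)"

text \<open>The constant term is L(0, chi7) = 1 in the normalisation where the other coefficients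
  are twice the divisor sums. The resulting series is also the theta series of the form m^2 + m n +
  2 n^2.\<close>

definition eis7_coeff :: "nat \<Rightarrow> int" where
 "eis7_coeff n = (if n = 0 then 1 else 2 * (\<Sum>d | d dvd n. chi7 (int d)))"

definition eis7_fps :: "nat \<Rightarrow> complex fps" where
 "eis7_fps k = Abs_fps (\<lambda>n. if k dvd n then of_int (eis7_coeff (n div k)) else 0)"

definition eis7 :: "complex \<Rightarrow> complex" where
 "eis7 z = eval_fps (eis7_fps 1) (nome z)"

lemma abs_chi7_le: "\<bar>chi7 n\<bar> \<le> 1"
 by (auto simp: chi7_def)

lemma chi7_mod: "chi7 (n mod 7) = chi7 n"
 by (simp add: chi7_def)

lemma chi7_cong: "m mod 7 = n mod 7 \<Longrightarrow> chi7 m = chi7 n"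
 by (simp add: chi7_def)

lemma mod_7_cases:
 fixes n :: int
 obtains "n mod 7 = 0" | "n mod 7 = 1" | "n mod 7 = 2" | "n mod 7 = 3" | "n mod 7 = 4" | "n mod 7 = 5" | "n mod 7 = 6"
proof -
 have "n mod 7 = 0 \<or> n mod 7 = 1 \<or> n mod 7 = 2 \<or> n mod 7 = 3 \<or> n mod 7 = 4 \<or> n mod 7 = 5 \<or> n mod 7 = 6"
  by presburger
 thus ?thesis using that by metis
qed

lemma chi7_mult: "chi7 (m * n) = chi7 m * chi7 n"
proof -
 have "chi7 (m * n) = chi7 ((m mod 7) * (n mod 7))" by (intro chi7_cong) (simp add: mod_mult_eq)
 also have "\<dots> = chi7 (m mod 7) * chi7 (n mod 7)"
  by (cases m rule: mod_7_cases; cases n rule: mod_7_cases; simp add: chi7_def)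
 finally show ?thesis by (simp only: chi7_mod)
qed

lemma chi7_2 [simp]: "chi7 2 = 1" and chi7_1 [simp]: "chi7 1 = 1"
 by (simp_all add: chi7_def)

text \<open>One absolutely convergent double sum of c(d) q^(d k), grouped in three ways: by the
  product d k, by d, and by k. The first grouping gives the Eisenstein coefficients, the second
  meets the cotangent series at multiples of the variable, the third the cotangent series at seventh
  parts of 1.\<close>

lemma lambert_series:
 fixes c :: "nat \<Rightarrow> complex" and q :: complex
 assumes q: "norm q < 1" and c: "\<And>d. norm (c d) \<le> 1"
 obtains L where
  "(\<lambda>n. (\<Sum>d | d dvd Suc n. c d) * q ^ Suc n) sums L"
  "(\<lambda>d. c (Suc d) * (q ^ Suc d / (1 - q ^ Suc d))) sums L"
  "(\<lambda>k. \<Sum>d. c (Suc d) * (q ^ Suc k) ^ Suc d) sums L"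
proof -
 define g where "g = (\<lambda>(d, k). c (Suc d) * q ^ (Suc d * Suc k))"
 have qn: "norm (q ^ Suc d) < 1" for d
  unfolding norm_power using q by (intro power_less_one_iff[THEN iffD2]) auto
 have geo: "(\<lambda>k. x ^ Suc k) sums (x / (1 - x))" if "norm x < 1" for x :: complex
  using sums_mult[OF geometric_sums[OF that], of x] by (simp add: mult.commute)
 have geo_real: "(\<lambda>k. x ^ Suc k) sums (x / (1 - x))" if "0 \<le> x" "x < 1" for x :: real
  using sums_mult[OF geometric_sums[of x], of x] that by simp
 have ng: "norm (g (d, k)) \<le> (norm q ^ Suc d) ^ Suc k" for d k
  using mult_right_mono[OF c[of "Suc d"], of "norm q ^ (Suc d * Suc k)"]
  by (simp add: g_def norm_mult norm_power power_mult del: mult_Suc mult_Suc_right power_Suc)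
 have qr: "norm q ^ Suc d < 1" for d using qn[of d] by (simp only: norm_power)
 have abs: "(\<lambda>p. norm (g p)) summable_on UNIV \<times> UNIV"
  unfolding Infinite_Sum.abs_summable_on_Sigma_iff
 proof safe
  fix d
  have "summable (\<lambda>k. norm (g (d, k)))"
   by (rule summable_comparison_test'[OF sums_summable[OF geo_real[OF _ qr[of d]]], of 0]) (use ng in auto)
  thus "(\<lambda>k. norm (g (d, k))) summable_on UNIV"
   by (intro norm_summable_imp_summable_on) simp
 next
  have le: "(\<Sum>\<^sub>\<infinity>k. norm (g (d, k))) \<le> norm q ^ Suc d / (1 - norm q)" for d
  proof -
   have s: "((\<lambda>k. (norm q ^ Suc d) ^ Suc k) has_sum norm q ^ Suc d / (1 - norm q ^ Suc d)) UNIV"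
    by (rule norm_summable_imp_has_sum) (use geo_real[OF _ qr[of d]] in \<open>auto simp: sums_iff abs_mult power_abs\<close>)
   have "(\<Sum>\<^sub>\<infinity>k. norm (g (d, k))) \<le> norm q ^ Suc d / (1 - norm q ^ Suc d)"
   proof (cases "(\<lambda>k. norm (g (d, k))) summable_on UNIV")
    case True
    thus ?thesis using has_sum_mono[OF has_sum_infsum[OF True] s] ng by auto
   next
    case False
    thus ?thesis using qr[of d] by (simp add: infsum_not_exists del: power_Suc)
   qed
   also have "\<dots> \<le> norm q ^ Suc d / (1 - norm q)"
   proof (intro divide_left_mono)
    have "norm q ^ Suc d \<le> norm q ^ 1" using q by (intro power_decreasing) auto
    thus "1 - norm q \<le> 1 - norm q ^ Suc d" by simp
   qed (use q qr[of d] in auto)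
   finally show ?thesis .
  qed
  have "summable (\<lambda>d. norm (\<Sum>\<^sub>\<infinity>k. norm (g (d, k))))"
  proof (rule summable_comparison_test'[of _ 0])
   show "summable (\<lambda>d. norm q ^ Suc d / (1 - norm q))"
    using sums_summable[OF geo_real[of "norm q"]] q by (intro summable_divide) auto
   show "norm (norm (\<Sum>\<^sub>\<infinity>k. norm (g (d, k)))) \<le> norm q ^ Suc d / (1 - norm q)" for d
    using le[of d] by (simp add: infsum_nonneg del: power_Suc)
  qed
  thus "(\<lambda>d. norm (\<Sum>\<^sub>\<infinity>k. norm (g (d, k)))) summable_on UNIV"
   by (intro norm_summable_imp_summable_on) simp
 qed
 hence sm: "g summable_on UNIV \<times> UNIV" by (rule Infinite_Sum.abs_summable_summable)
 define L where "L = infsum g (UNIV \<times> UNIV)"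
 have L: "(g has_sum L) (UNIV \<times> UNIV)" unfolding L_def using sm by (rule has_sum_infsum)
 have sum1: "(\<lambda>k. norm x ^ Suc k) sums (norm x / (1 - norm x))" if "norm x < 1" for x :: complex
  using geo_real[of "norm x"] that by simp
 have A: "((\<lambda>d. c (Suc d) * (q ^ Suc d / (1 - q ^ Suc d))) has_sum L) UNIV"
 proof (rule has_sum_SigmaD[OF L])
  fix d
  have "((\<lambda>k. (q ^ Suc d) ^ Suc k) has_sum q ^ Suc d / (1 - q ^ Suc d)) UNIV"
   by (rule norm_summable_imp_has_sum[OF _ geo[OF qn]]) (use sums_summable[OF sum1[OF qn[of d]]] in \<open>simp add: norm_mult norm_power\<close>)
  from has_sum_cmult_right[OF this, of "c (Suc d)"]
  show "((\<lambda>k. g (d, k)) has_sum c (Suc d) * (q ^ Suc d / (1 - q ^ Suc d))) UNIV"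
   by (simp only: g_def split power_mult)
 qed
 have L': "((\<lambda>(k, d). g (d, k)) has_sum L) (UNIV \<times> UNIV)"
 proof -
  have "bij_betw prod.swap (UNIV \<times> UNIV :: (nat \<times> nat) set) (UNIV \<times> UNIV)"
   by (auto simp: bij_betw_def)
  from has_sum_reindex_bij_betw[OF this, of g] L show ?thesis
   by (simp add: case_prod_unfold prod.swap_def)
 qed
 have B: "((\<lambda>k. \<Sum>d. c (Suc d) * (q ^ Suc k) ^ Suc d) has_sum L) UNIV"
 proof (rule has_sum_SigmaD[OF L'])
  fix k
  have "summable (\<lambda>d. norm (c (Suc d) * (q ^ Suc k) ^ Suc d))"
  proof (rule summable_comparison_test'[of _ 0])
   show "summable (\<lambda>d. norm (q ^ Suc k) ^ Suc d)" by (rule sums_summable[OF sum1[OF qn]])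
   show "norm (norm (c (Suc d) * (q ^ Suc k) ^ Suc d)) \<le> norm (q ^ Suc k) ^ Suc d" for d
    using mult_right_mono[OF c[of "Suc d"], of "norm (q ^ Suc k) ^ Suc d"]
    by (simp add: norm_mult norm_power)
  qed
  from norm_summable_imp_has_sum[OF this summable_sums[OF summable_norm_cancel[OF this]]]
  have "((\<lambda>d. c (Suc d) * (q ^ Suc k) ^ Suc d) has_sum (\<Sum>d. c (Suc d) * (q ^ Suc k) ^ Suc d)) UNIV" .
  moreover have "q ^ (Suc d * Suc k) = (q ^ Suc k) ^ Suc d" for d
   by (metis mult.commute power_mult)
  ultimately show "((\<lambda>d. case (k, d) of (k, d) \<Rightarrow> g (d, k)) has_sum (\<Sum>d. c (Suc d) * (q ^ Suc k) ^ Suc d)) UNIV"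
   by (simp only: g_def split)
 qed
 have L'': "((\<lambda>(n, d). c d * q ^ Suc n) has_sum L) (SIGMA n:UNIV. {d. d dvd Suc n})"
 proof -
  \<comment> \<open>All indices start at 0: the pair (d, k) stands for the divisor d + 1 of (d + 1)
    (k + 1), and this product is \<open>Suc n\<close>.\<close>
  have "bij_betw (\<lambda>(d, k). (Suc d * Suc k - 1, Suc d)) (UNIV \<times> UNIV) (SIGMA n:UNIV. {d. d dvd Suc n})"
  proof (rule bij_betwI)
   show "(\<lambda>(n, d). (d - 1, Suc n div d - 1)) \<in> (SIGMA n:UNIV. {d. d dvd Suc n}) \<rightarrow> UNIV \<times> UNIV" by auto
   show "(\<lambda>(d, k). (Suc d * Suc k - 1, Suc d)) ((\<lambda>(n, d). (d - 1, Suc n div d - 1)) p) = p"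
    if p: "p \<in> (SIGMA n:UNIV. {d. d dvd Suc n})" for p
   proof -
    obtain n d where nd: "p = (n, d)" "d dvd Suc n" using p by auto
    then obtain k where k: "Suc n = d * k" by blast
    hence pos: "d > 0" "k > 0" by (auto intro!: Nat.gr0I)
    hence "Suc (d - 1) = d" "Suc (k - 1) = k" "Suc n div d = k" "d * k - 1 = n" using k by auto
    thus ?thesis by (simp add: nd(1) del: mult_Suc mult_Suc_right One_nat_def)
   qed
   show "(\<lambda>(d, k). (Suc d * Suc k - 1, Suc d)) \<in> UNIV \<times> UNIV \<rightarrow> (SIGMA n:UNIV. {d. d dvd Suc n})"
   proof safe
    fix d k :: nat
    have "Suc (Suc d * Suc k - 1) = Suc d * Suc k" by simp
    thus "Suc d dvd Suc (Suc d * Suc k - 1)" by (metis dvd_triv_left)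
   qed auto
   show "(\<lambda>(n, d). (d - 1, Suc n div d - 1)) ((\<lambda>(d, k). (Suc d * Suc k - 1, Suc d)) p) = p" for p :: "nat \<times> nat"
   proof -
    obtain d k where dk: "p = (d, k)" by (cases p)
    have "Suc (Suc d * Suc k - 1) div Suc d = Suc k"
     by (subst Suc_diff_1) (simp_all del: mult_Suc mult_Suc_right)
    thus ?thesis by (simp add: dk del: mult_Suc mult_Suc_right)
   qed
  qed
  from has_sum_reindex_bij_betw[OF this, of "\<lambda>(n, d). c d * q ^ Suc n" L]
  have "((\<lambda>p. (\<lambda>(n, d). c d * q ^ Suc n) ((\<lambda>(d, k). (Suc d * Suc k - 1, Suc d)) p)) has_sum L) (UNIV \<times> UNIV)
    \<longleftrightarrow> ((\<lambda>(n, d). c d * q ^ Suc n) has_sum L) (SIGMA n:UNIV. {d. d dvd Suc n})" .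
  moreover have "(\<lambda>(n, d). c d * q ^ Suc n) ((\<lambda>(d, k). (Suc d * Suc k - 1, Suc d)) p) = g p" for p :: "nat \<times> nat"
  proof -
   obtain d k where dk: "p = (d, k)" by (cases p)
   have "Suc (Suc d * Suc k - 1) = Suc d * Suc k" by simp
   thus ?thesis by (simp only: dk split g_def)
  qed
  ultimately show ?thesis using L by simp
 qed
 have C: "((\<lambda>n. (\<Sum>d | d dvd Suc n. c d) * q ^ Suc n) has_sum L) UNIV"
 proof (rule has_sum_SigmaD[OF L''])
  fix n
  show "((\<lambda>d. case (n, d) of (n, d) \<Rightarrow> c d * q ^ Suc n) has_sum (\<Sum>d | d dvd Suc n. c d) * q ^ Suc n) {d. d dvd Suc n}"
   by (rule has_sum_finiteI) (auto simp: sum_distrib_right)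
 qed
 show ?thesis using that[of L] A B C by (blast intro: has_sum_imp_sums)
qed

lemma eis7_coeff_sums:
 assumes "norm q < 1"
 obtains L where "(\<lambda>n. of_int (eis7_coeff n) * q ^ n) sums (1 + 2 * L :: complex)"
  "(\<lambda>d. of_int (chi7 (int (Suc d))) * (q ^ Suc d / (1 - q ^ Suc d))) sums L"
  "(\<lambda>k. \<Sum>d. of_int (chi7 (int (Suc d))) * (q ^ Suc k) ^ Suc d) sums L"
proof -
 have le: "norm (of_int (chi7 (int d)) :: complex) \<le> 1" for d
  using abs_chi7_le[of "int d"] by (simp flip: of_int_abs)
 obtain L where L:
  "(\<lambda>n. (\<Sum>d | d dvd Suc n. of_int (chi7 (int d))) * q ^ Suc n) sums L"
  "(\<lambda>d. of_int (chi7 (int (Suc d))) * (q ^ Suc d / (1 - q ^ Suc d))) sums L"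
  "(\<lambda>k. \<Sum>d. of_int (chi7 (int (Suc d))) * (q ^ Suc k) ^ Suc d) sums L"
  by (rule lambert_series[OF assms le])
 have "(\<lambda>n. of_int (eis7_coeff (Suc n)) * q ^ Suc n) sums (2 * L)"
  using sums_mult[OF L(1), of 2] by (simp add: eis7_coeff_def mult.assoc)
 hence "(\<lambda>n. of_int (eis7_coeff n) * q ^ n) sums (2 * L + of_int (eis7_coeff 0) * q ^ 0)"
  by (rule sums_Suc)
 thus ?thesis using that[of L] L by (simp add: eis7_coeff_def add.commute)
qed

lemma eis7_fps_sums:
 assumes "norm q < 1" "k > 0"
 shows "(\<lambda>n. fps_nth (eis7_fps k) n * q ^ n) sums (\<Sum>n. of_int (eis7_coeff n) * (q ^ k) ^ n)"
proof -
 have "norm (q ^ k) < 1" unfolding norm_power using assms by (intro power_less_one_iff[THEN iffD2]) auto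
 from eis7_coeff_sums[OF this] have "summable (\<lambda>n. of_int (eis7_coeff n) * (q ^ k) ^ n)"
  by (metis sums_summable)
 hence *: "(\<lambda>n. of_int (eis7_coeff n) * (q ^ k) ^ n) sums (\<Sum>n. of_int (eis7_coeff n) * (q ^ k) ^ n)"
  by (rule summable_sums)
 have "(\<lambda>n. fps_nth (eis7_fps k) (k * n) * q ^ (k * n)) sums (\<Sum>n. of_int (eis7_coeff n) * (q ^ k) ^ n)"
  using * assms by (simp add: eis7_fps_def power_mult)
 moreover have "strict_mono (\<lambda>n. k * n)" using assms by (auto simp: strict_mono_def)
 moreover have "fps_nth (eis7_fps k) n * q ^ n = 0" if "n \<notin> range (\<lambda>n. k * n)" for n
  using that by (auto simp: eis7_fps_def elim!: dvdE)
 ultimately show ?thesis by (subst (asm) sums_mono_reindex)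
qed

lemma eis7_fps_conv_radius:
 assumes "k > 0"
 shows "fps_conv_radius (eis7_fps k) \<ge> 1"
 unfolding fps_conv_radius_def
proof (rule conv_radius_geI_ex')
 fix r :: real assume "0 < r" "ereal r < 1"
 hence "norm (complex_of_real r) < 1" by simp
 from sums_summable[OF eis7_fps_sums[OF this assms]]
 show "summable (\<lambda>n. fps_nth (eis7_fps k) n * complex_of_real r ^ n)" .
qed

lemma eis7_eq_suminf:
 assumes "Im z > 0"
 shows "eis7 z = (\<Sum>n. of_int (eis7_coeff n) * nome z ^ n)"
 using sums_unique[OF eis7_fps_sums[OF norm_nome_less_1[OF assms], of 1]]
 by (simp add: eis7_def eval_fps_def)

lemma eis7_multiple:
 assumes "Im z > 0" "k > 0"
 shows "eis7 (of_nat k * z) = eval_fps (eis7_fps k) (nome z)"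
proof -
 have "Im (of_nat k * z) > 0" using assms by simp
 hence "eis7 (of_nat k * z) = (\<Sum>n. of_int (eis7_coeff n) * (nome z ^ k) ^ n)"
  by (simp only: eis7_eq_suminf nome_of_nat_mult)
 also have "\<dots> = eval_fps (eis7_fps k) (nome z)"
  using sums_unique[OF eis7_fps_sums[OF norm_nome_less_1[OF assms(1)] assms(2)]] by (simp add: eval_fps_def)
 finally show ?thesis .
qed

lemma eis7_holomorphic: "eis7 holomorphic_on upper_half_plane"
proof -
 have "nome ` upper_half_plane \<subseteq> eball 0 (fps_conv_radius (eis7_fps 1))"
 proof safe
  fix z assume "z \<in> upper_half_plane"
  hence "norm (nome z) < 1" by (simp add: upper_half_plane_def norm_nome_less_1)
  hence "ereal (norm (nome z)) < 1" by (simp add: one_ereal_def)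
  also have "\<dots> \<le> fps_conv_radius (eis7_fps 1)" using eis7_fps_conv_radius[of 1] by simp
  finally show "nome z \<in> eball 0 (fps_conv_radius (eis7_fps 1))" by simp
 qed
 moreover have "nome holomorphic_on upper_half_plane"
  unfolding nome_def by (intro holomorphic_intros)
 ultimately have "(eval_fps (eis7_fps 1) \<circ> nome) holomorphic_on upper_half_plane"
  by (intro holomorphic_on_compose_gen[OF _ holomorphic_on_eval_fps[OF order_refl]])
 thus ?thesis by (simp add: o_def eis7_def[abs_def])
qed

lemma eis7_add_of_int: "eis7 (z + of_int n) = eis7 z"
 by (simp add: eis7_def nome_add)

text \<open>The Hecke relation at 2. The divisors of 2 n are those of n together with the doubles of
  those d for which 2 d does not divide n, and doubling does not change the character.\<close>

lemma eis7_coeff_double: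
 assumes "n > 0"
 shows "eis7_coeff (2 * n) = 2 * eis7_coeff n - (if even n then eis7_coeff (n div 2) else 0)"
proof -
 define E where "E = {d. d dvd n \<and> \<not> 2 * d dvd n}"
 have fin: "finite {d. d dvd n}" "finite {d. d dvd 2 * n}" using assms by auto
 have split: "{d. d dvd 2 * n} = {d. d dvd n} \<union> (\<lambda>d. 2 * d) ` E"
 proof (intro equalityI subsetI; clarsimp)
  fix d assume d: "d dvd 2 * n" "d \<notin> (\<lambda>d. 2 * d) ` E"
  show "d dvd n"
  proof (cases "even d")
   case True
   then obtain e where e: "d = 2 * e" by blast
   hence "e dvd n" using d by simp
   thus ?thesis using d e by (auto simp: E_def)
  next
   case False
   hence "coprime d 2" by simp
   thus ?thesis using d coprime_dvd_mult_right_iff by blast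
  qed
 next
  fix d assume "d dvd n \<or> d \<in> (\<lambda>d. 2 * d) ` E"
  thus "d dvd 2 * n" by (auto simp: E_def)
 qed
 have finE: "finite E" using fin by (simp add: E_def)
 have "(\<Sum>d | d dvd 2 * n. chi7 (int d)) = (\<Sum>d | d dvd n. chi7 (int d)) + (\<Sum>d\<in>(\<lambda>d. 2 * d) ` E. chi7 (int d))"
  unfolding split using fin finE by (intro sum.union_disjoint) (auto simp: E_def)
 also have "(\<Sum>d\<in>(\<lambda>d. 2 * d) ` E. chi7 (int d)) = (\<Sum>d\<in>E. chi7 (int d))"
  by (subst sum.reindex) (auto simp: chi7_mult inj_on_def)
 also have "(\<Sum>d\<in>E. chi7 (int d)) = (\<Sum>d | d dvd n. chi7 (int d)) - (\<Sum>d | 2 * d dvd n. chi7 (int d))"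
 proof -
  have "E = {d. d dvd n} - {d. 2 * d dvd n}" by (auto simp: E_def)
  moreover have "{d. 2 * d dvd n} \<subseteq> {d. d dvd n}" by (auto intro: dvd_trans)
  ultimately show ?thesis using fin by (simp add: sum_diff)
 qed
 also have "(\<Sum>d | 2 * d dvd n. chi7 (int d)) = (if even n then \<Sum>d | d dvd n div 2. chi7 (int d) else 0)"
 proof (cases "even n")
  case True
  then obtain m where "n = 2 * m" by blast
  thus ?thesis by simp
 next
  case False
  hence "{d. 2 * d dvd n} = {}" by auto
  thus ?thesis using False by simp
 qed
 finally show ?thesis using assms by (auto simp: eis7_coeff_def elim!: evenE)
qed

text \<open>E(z) + E(z + 1/2) is twice the part of E with even exponents, and by the Hecke relation
  at 2 that part is 2 E(2 z) - E(4 z).\<close>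

lemma eis7_half_shift:
 assumes "Im z > 0"
 shows "eis7 (z + 1 / 2) = 4 * eis7 (2 * z) - 2 * eis7 (4 * z) - eis7 z"
proof -
 have n: "norm (nome z) < 1" using assms by (rule norm_nome_less_1)
 have m: "nome (z + 1 / 2) = - nome z"
  by (simp add: nome_add) (simp add: nome_def)
 have s: "(\<lambda>n. fps_nth (eis7_fps k) n * nome z ^ n) sums eis7 (of_nat k * z)" if "k > 0" for k
  using eis7_fps_sums[OF n that] eis7_multiple[OF assms that] by (simp add: eval_fps_def sums_iff)
 have "(\<lambda>n. fps_nth (eis7_fps 1) n * nome (z + 1 / 2) ^ n) sums eis7 (of_nat 1 * (z + 1 / 2))"
  using eis7_fps_sums[of "nome (z + 1 / 2)" 1] eis7_multiple[of "z + 1 / 2" 1] assms n m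
  by (simp add: eval_fps_def sums_iff)
 hence "(\<lambda>n. (- 1) ^ n * fps_nth (eis7_fps 1) n * nome z ^ n) sums eis7 (z + 1 / 2)"
  unfolding m by (subst (asm) power_minus) (simp add: mult_ac)
 moreover have "(\<lambda>n. 4 * (fps_nth (eis7_fps 2) n * nome z ^ n) - 2 * (fps_nth (eis7_fps 4) n * nome z ^ n)
   - fps_nth (eis7_fps 1) n * nome z ^ n) sums (4 * eis7 (of_nat 2 * z) - 2 * eis7 (of_nat 4 * z) - eis7 (of_nat 1 * z))"
  by (intro sums_diff sums_mult s) auto
 moreover have "4 * (fps_nth (eis7_fps 2) n * x) - 2 * (fps_nth (eis7_fps 4) n * x)
   - fps_nth (eis7_fps 1) n * x = (- 1) ^ n * fps_nth (eis7_fps 1) n * x" for n x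
 proof (cases "even n")
  case True
  then obtain k where k: "n = 2 * k" by blast
  have div4: "4 dvd n \<longleftrightarrow> even k" "n div 4 = k div 2" unfolding k by presburger+
  \<comment> \<open>The constant term is not a divisor sum and is treated apart; it obeys the same
    rule because 1 = 2 - 1.\<close>
  have "of_int (eis7_coeff n) = (2 * of_int (eis7_coeff k) - (if even k then of_int (eis7_coeff (k div 2)) else 0) :: complex)"
  proof (cases "k = 0")
   case False
   thus ?thesis using eis7_coeff_double[of k] by (simp add: k)
  qed (simp add: k eis7_coeff_def)
  hence "fps_nth (eis7_fps 1) n = 2 * fps_nth (eis7_fps 2) n - fps_nth (eis7_fps 4) n"
   by (simp add: eis7_fps_def div4) (simp add: k)
  thus ?thesis by (simp only: power_even_eq True) (simp add: True algebra_simps)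
 next
  case False
  hence "\<not> 4 dvd n" by presburger
  thus ?thesis using False by (simp add: eis7_fps_def)
 qed
 ultimately show ?thesis by (simp add: sums_iff)
qed

section \<open>Two formulas for the Eisenstein series in terms of cotangent series\<close>

lemma sum_7_terms: "sum f {m..<m + 7} = f m + f (m + 1) + f (m + 2) + f (m + 3) + f (m + 4) + f (m + 5) + f (m + (6::nat))"
 for f :: "nat \<Rightarrow> complex"
 by (simp add: eval_nat_numeral sum.atLeastLessThan_Suc)

text \<open>The cotangent series at j w, with period 7 w, collects the Lambert terms q^n / (1 - q^n)
  with n congruent to j and, with the opposite sign, to -j modulo 7. For j = 1, 2, 4 these are all
  classes with the signs of \<open>chi7\<close>. Each of the three leading cotangents contributes
  -i, which makes 3 after multiplication by i; the -2 restores the constant term 1.\<close>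

lemma eis7_eq_zeta_cot:
 assumes w: "Im w > 0"
 shows "eis7 w = \<i> * (zeta_cot w (7 * w) + zeta_cot (2 * w) (7 * w) + zeta_cot (4 * w) (7 * w)) - 2"
proof -
 define q where "q = nome w"
 define l where "l = (\<lambda>n. q ^ n / (1 - q ^ n))"
 have q: "norm q < 1" "q \<noteq> 0" using norm_nome_less_1[OF w] by (auto simp: q_def)
 have q7: "norm (q ^ 7) < 1" unfolding norm_power using q by (intro power_less_one_iff[THEN iffD2]) auto
 have qn1: "q ^ n \<noteq> 1" if "n > 0" for n
 proof
  assume "q ^ n = 1"
  hence "norm q ^ n = 1" by (metis norm_one norm_power)
  thus False using power_less_one_iff[of "norm q" n] q that by simp
 qed
 have t1: "(q ^ 7) ^ Suc m / (q ^ j - (q ^ 7) ^ Suc m) = l (7 * m + 7 - j)" if "j < 7" for m j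
 proof -
  have "(q ^ 7) ^ Suc m = q ^ j * q ^ (7 * m + 7 - j)"
   using that by (simp add: power_add[symmetric] power_mult[symmetric] add.commute del: power_Suc)
  moreover have "v * y / (v - v * y) = y / (1 - y)" if "v \<noteq> 0" for v y :: complex
   by (metis mult.right_neutral mult_divide_mult_cancel_left right_diff_distrib that)
  ultimately show ?thesis using q unfolding l_def by (simp del: power_Suc)
 qed
 have t2: "(q ^ 7) ^ Suc m / (1 / q ^ j - (q ^ 7) ^ Suc m) = l (7 * m + 7 + j)" for m j
 proof -
  have "q ^ (7 * m + 7 + j) = q ^ j * (q ^ 7) ^ Suc m"
   by (simp add: power_add[symmetric] power_mult[symmetric] del: power_Suc) (simp add: algebra_simps)
  moreover have "x / (1 / v - x) = v * x / (1 - v * x)" if "v \<noteq> 0" for x v :: complex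
   using that by (simp add: divide_simps mult.commute)
  ultimately show ?thesis using q unfolding l_def by (simp del: power_Suc)
 qed
 define N P where "N = (\<lambda>j. \<Sum>m. l (7 * m + 7 - j))" and "P = (\<lambda>j. \<Sum>m. l (7 * m + 7 + j))"
 have N: "(\<lambda>m. l (7 * m + 7 - j)) sums N j" if "j < 7" for j
  using summable_sums[OF summable_cot_tail[OF q7, of "q ^ j"]] q t1[OF that] by (simp add: N_def del: power_Suc)
 have P: "(\<lambda>m. l (7 * m + 7 + j)) sums P j" for j
  using summable_sums[OF summable_cot_tail[OF q7, of "1 / q ^ j"]] q t2 by (simp add: P_def del: power_Suc)
 have z: "zeta_cot (of_nat j * w) (7 * w) = - \<i> - 2 * \<i> * l j + 2 * \<i> * (N j - P j)" if "0 < j" "j < 7" for j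
 proof -
  have n7: "nome (7 * w) = q ^ 7" using nome_of_nat_mult[of 7 w] by (simp add: q_def)
  have nj: "nome (of_nat j * w) = q ^ j" by (simp add: nome_of_nat_mult q_def)
  have "cot_tail (q ^ 7) (q ^ j) = N j" "cot_tail (q ^ 7) (1 / q ^ j) = P j"
   unfolding cot_tail_def t1[OF that(2)] t2 N_def P_def by simp_all
  moreover have "cot_exp (q ^ j) = - \<i> - 2 * \<i> * l j"
  proof -
   have "1 - q ^ j \<noteq> 0" "q ^ j - 1 \<noteq> 0" using qn1[OF that(1)] by auto
   thus ?thesis unfolding cot_exp_def l_def by (simp add: divide_simps) (simp add: algebra_simps)
  qed
  ultimately show ?thesis unfolding zeta_cot_def cot_series_def n7 nj by simp
 qed
 obtain L where L: "(\<lambda>n. of_int (eis7_coeff n) * q ^ n) sums (1 + 2 * L)"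
  "(\<lambda>d. of_int (chi7 (int (Suc d))) * (q ^ Suc d / (1 - q ^ Suc d))) sums L"
  by (rule eis7_coeff_sums[OF q(1)])
 have P': "(\<lambda>m. l (7 * m + j)) sums (P j + l j)" for j
  using sums_Suc[of "\<lambda>m. l (7 * m + j)" "P j"] P[of j] by (simp add: add.assoc add.commute add.left_commute)
 have "(\<lambda>n. \<Sum>d\<in>{n * 7..<n * 7 + 7}. of_int (chi7 (int (Suc d))) * l (Suc d)) sums L"
  using sums_group[OF L(2), of 7] by (simp add: l_def)
 moreover have "(\<Sum>d\<in>{n * 7..<n * 7 + 7}. of_int (chi7 (int (Suc d))) * l (Suc d)) =
   l (7 * n + 1) + l (7 * n + 2) + l (7 * n + 4) - l (7 * n + 7 - 1) - l (7 * n + 7 - 2) - l (7 * n + 7 - 4)" for n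
 proof -
  have c: "chi7 (int (Suc (n * 7 + i))) = chi7 (int (Suc i))" for i
   by (intro chi7_cong) (simp, presburger)
  have c0: "chi7 (int (Suc (n * 7))) = 1" using c[of 0] by simp
  have c': "chi7 3 = -1" "chi7 4 = 1" "chi7 5 = -1" "chi7 6 = -1" "chi7 7 = 0" by (simp_all add: chi7_def)
  have i: "Suc (n * 7 + 6) = 7 * n + 7" "Suc (n * 7 + 5) = 7 * n + 7 - 1" "Suc (n * 7 + 4) = 7 * n + 7 - 2"
   "Suc (n * 7 + 3) = 7 * n + 4" "Suc (n * 7 + 2) = 7 * n + 7 - 4" "Suc (n * 7 + 1) = 7 * n + 2" "Suc (n * 7) = 7 * n + 1"
   by simp_all
  show ?thesis unfolding sum_7_terms c c0 unfolding i by (simp add: c')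
 qed
 ultimately have "(\<lambda>n. l (7 * n + 1) + l (7 * n + 2) + l (7 * n + 4) - l (7 * n + 7 - 1) - l (7 * n + 7 - 2) - l (7 * n + 7 - 4)) sums L"
  by simp
 moreover have "(\<lambda>n. l (7 * n + 1) + l (7 * n + 2) + l (7 * n + 4) - l (7 * n + 7 - 1) - l (7 * n + 7 - 2) - l (7 * n + 7 - 4)) sums
   ((P 1 + l 1) + (P 2 + l 2) + (P 4 + l 4) - N 1 - N 2 - N 4)"
  by (intro sums_add sums_diff P' N) auto
 ultimately have L_eq: "L = (P 1 + l 1) + (P 2 + l 2) + (P 4 + l 4) - N 1 - N 2 - N 4"
  by (rule sums_unique2)
 have "eis7 w = 1 + 2 * L" using eis7_eq_suminf[OF w] L(1) by (simp add: q_def sums_iff)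
 also have "\<dots> = \<i> * (zeta_cot (of_nat 1 * w) (7 * w) + zeta_cot (of_nat 2 * w) (7 * w) + zeta_cot (of_nat 4 * w) (7 * w)) - 2"
  unfolding L_eq by (subst (1 2 3) z; simp add: algebra_simps)
 finally show ?thesis by simp
qed

text \<open>The two half sums have sum -1 and product 2, so the square of their difference is -7.
  The sign of the root is read off from the imaginary part, where sin(8 pi / 7) = - sin(pi / 7) is
  outweighed by sin(2 pi / 7).\<close>

lemma root_of_unity_7:
 defines "v \<equiv> nome (1 / 7)"
 shows "v ^ 7 = 1" "1 + v + v ^ 2 + v ^ 3 + v ^ 4 + v ^ 5 + v ^ 6 = 0"
  "v + v ^ 2 + v ^ 4 - (v ^ 3 + v ^ 5 + v ^ 6) = \<i> * of_real (sqrt 7)"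
proof -
 show z7: "v ^ 7 = 1" unfolding v_def nome_of_nat_mult[symmetric] by simp
 have "v \<noteq> 1"
 proof
  assume "v = 1"
  then obtain n :: int where "1 / 7 = (of_int n :: complex)" unfolding v_def nome_eq_1_iff by blast
  hence "of_int (7 * n) = (of_int 1 :: complex)" by (simp add: field_simps)
  hence "7 * n = 1" by (simp only: of_int_eq_iff)
  thus False by presburger
 qed
 moreover have "(v - 1) * (1 + v + v ^ 2 + v ^ 3 + v ^ 4 + v ^ 5 + v ^ 6) = v ^ 7 - 1"
  by (simp add: algebra_simps power_numeral_reduce)
 ultimately show s0: "1 + v + v ^ 2 + v ^ 3 + v ^ 4 + v ^ 5 + v ^ 6 = 0" using z7 by simp
 define s s' where "s = v + v ^ 2 + v ^ 4" and "s' = v ^ 3 + v ^ 5 + v ^ 6"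
 have ss: "s + s' = -1" using s0 unfolding s_def s'_def by (simp add: algebra_simps eq_neg_iff_add_eq_0)
 have "s * s' = (v ^ 4 + v ^ 6 + v ^ 5) + 3 * v ^ 7 + v ^ 7 * (v + v ^ 2 + v ^ 3)"
  unfolding s_def s'_def by (simp add: algebra_simps power_numeral_reduce)
 also have "\<dots> = 3 + (s + s')" unfolding z7 s_def s'_def by simp
 finally have "s * s' = 2" using ss by simp
 hence "(s - s') ^ 2 = (\<i> * of_real (sqrt 7)) ^ 2"
 proof -
  have "(s - s') ^ 2 = (s + s') ^ 2 - 4 * (s * s')" by (simp add: power2_eq_square algebra_simps)
  also have "\<dots> = - 7" by (simp add: ss \<open>s * s' = 2\<close>)
  also have "\<dots> = (\<i> * of_real (sqrt 7)) ^ 2" by (simp add: power_mult_distrib flip: of_real_power)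
  finally show ?thesis .
 qed
 hence cases: "s - s' = \<i> * of_real (sqrt 7) \<or> s - s' = - (\<i> * of_real (sqrt 7))"
  by (simp only: power2_eq_iff)
 have Imz: "Im (v ^ n) = sin (2 * pi * n / 7)" for n
  unfolding v_def nome_of_nat_mult[symmetric] by (simp add: nome_def Im_exp)
 have "Im s' = - Im s"
 proof -
  have "Im (s + s') = 0" by (simp add: ss)
  thus ?thesis by simp
 qed
 moreover have "Im s > 0"
 proof -
  have "Im s = sin (2 * pi / 7) + sin (4 * pi / 7) + sin (8 * pi / 7)"
   using Imz[of 1] Imz[of 2] Imz[of 4] by (simp add: s_def)
  moreover have "sin (8 * pi / 7) = - sin (pi / 7)"
   using sin_periodic_pi[of "pi / 7"] by (simp add: field_simps)
  moreover have "sin (pi / 7) < sin (2 * pi / 7)"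
   by (rule sin_monotone_2pi) (use pi_gt_zero in linarith)+
  moreover have "sin (4 * pi / 7) > 0" by (rule sin_gt_zero) auto
  ultimately show ?thesis by linarith
 qed
 ultimately have "Im (s - s') > 0" by simp
 moreover have "Im (- (\<i> * of_real (sqrt 7))) \<le> 0" by simp
 ultimately have "s - s' = \<i> * of_real (sqrt 7)" using cases by (metis not_less)
 thus "v + v ^ 2 + v ^ 4 - (v ^ 3 + v ^ 5 + v ^ 6) = \<i> * of_real (sqrt 7)" by (simp add: s_def s'_def)
qed

text \<open>Raising the root of unity to the power n multiplies the exponents modulo 7: squares
  preserve the classes {1, 2, 4} and {3, 5, 6}, nonsquares exchange them, and for multiples of 7 all
  terms are equal.\<close>

lemma gauss_sum_7:
 fixes n :: nat
 defines "w \<equiv> nome (1 / 7) ^ n"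
 shows "w + w ^ 2 + w ^ 4 - (w ^ 6 + w ^ 5 + w ^ 3) = \<i> * of_real (sqrt 7) * of_int (chi7 (int n))"
proof -
 define v where "v = nome (1 / 7)"
 have red: "v ^ m = v ^ (m mod 7)" for m
 proof -
  have "v ^ m = v ^ (7 * (m div 7) + m mod 7)" by simp
  also have "\<dots> = v ^ (m mod 7)" unfolding power_add power_mult root_of_unity_7(1)[folded v_def] by simp
  finally show ?thesis .
 qed
 define r where "r = n mod 7"
 have r: "r \<in> {0, 1, 2, 3, 4, 5, 6}" unfolding r_def by auto
 have w: "w = v ^ r" unfolding w_def v_def[symmetric] r_def by (rule red)
 have c: "chi7 (int n) = chi7 (int r)" by (intro chi7_cong) (simp add: r_def zmod_int)
 have p: "w ^ k = v ^ (r * k mod 7)" for k unfolding w power_mult[symmetric] by (rule red)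
 have g: "v + v ^ 2 + v ^ 4 - (v ^ 3 + v ^ 5 + v ^ 6) = \<i> * of_real (sqrt 7)"
  unfolding v_def by (rule root_of_unity_7(3))
 have w1: "w = v ^ (r mod 7)" using p[of 1] by simp
 have "v ^ (r mod 7) + v ^ (r * 2 mod 7) + v ^ (r * 4 mod 7) - (v ^ (r * 6 mod 7) + v ^ (r * 5 mod 7) + v ^ (r * 3 mod 7))
   = \<i> * of_real (sqrt 7) * of_int (chi7 (int r))"
  using r g by (auto simp: chi7_def algebra_simps power2_eq_square)
 thus ?thesis unfolding p c using w1 by simp
qed

lemma not_in_lattice_sevenths:
 assumes "Im v > 0" "\<not> 7 dvd (k :: int)"
 shows "of_int k / 7 \<notin> period_lattice v"
proof
 assume "of_int k / 7 \<in> period_lattice v"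
 then obtain m n :: int where mn: "of_int k / 7 = of_int m * v + of_int n" unfolding period_lattice_def by blast
 have "Im (of_int k / 7) = Im (of_int m * v + of_int n)" using mn by simp
 hence "m = 0" using assms(1) by simp
 with mn have "of_int k = (of_int (7 * n) :: complex)" by (simp add: field_simps)
 hence "k = 7 * n" by (simp only: of_int_eq_iff)
 thus False using assms(2) by simp
qed

text \<open>Expanding the tails as geometric series produces powers of a seventh root of unity,
  which combine to Gauss sums; these bring in the character and the factor sqrt 7. The constant term
  is the identity cot(pi/7) + cot(2 pi/7) + cot(4 pi/7) = sqrt 7.\<close>

lemma zeta_cot_sevenths:
 assumes h: "Im h > 0"
 shows "zeta_cot (1 / 7) h + zeta_cot (2 / 7) h + zeta_cot (4 / 7) h = of_real (sqrt 7) * eis7 h"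
proof -
 define q p where "q = nome h" and "p = nome (1 / 7)"
 have q: "norm q < 1" "q \<noteq> 0" using norm_nome_less_1[OF h] by (auto simp: q_def)
 note root = root_of_unity_7[folded p_def]
 have p0: "p \<noteq> 0" and norm1: "norm p = 1" by (auto simp: p_def norm_nome)
 obtain L where L: "(\<lambda>n. of_int (eis7_coeff n) * q ^ n) sums (1 + 2 * L)"
  "(\<lambda>k. \<Sum>d. of_int (chi7 (int (Suc d))) * (q ^ Suc k) ^ Suc d) sums L"
  by (rule eis7_coeff_sums[OF q(1)])
 have inv: "1 / p ^ j = p ^ (7 - j)" if "j \<le> 7" for j
  using p0 root(1) that by (simp add: field_simps power_add[symmetric])
 define T where "T = (\<lambda>j m. q ^ Suc m / (p ^ j - q ^ Suc m))"
 have T: "(\<lambda>m. T j m) sums cot_tail q (p ^ j)" for j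
  unfolding T_def cot_tail_def by (intro summable_sums summable_cot_tail q) (use p0 in auto)
 have geo: "(\<lambda>n. (x * p ^ (7 - j)) ^ Suc n) sums (x / (p ^ j - x))" if "norm x < 1" "j \<le> 7" for x j
 proof -
  have lt: "norm (x * p ^ (7 - j)) < 1" using that norm1 by (simp add: norm_mult norm_power)
  from sums_mult[OF geometric_sums[OF this], of "x * p ^ (7 - j)"]
  have "(\<lambda>n. (x * p ^ (7 - j)) ^ Suc n) sums ((x * p ^ (7 - j)) / (1 - x * p ^ (7 - j)))" by simp
  moreover have "(x * p ^ (7 - j)) / (1 - x * p ^ (7 - j)) = x / (p ^ j - x)"
   unfolding inv[OF that(2), symmetric] using p0 by (simp add: divide_simps)
  ultimately show ?thesis by simp
 qed
 \<comment> \<open>The expansion of x / (p^j - x) involves inverse powers of p, that is, exponents 7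
   - j. So the exponents 1, 2, 4 and 6, 5, 3 trade places, which is the source of the minus
   sign.\<close>
 have trm: "T 1 m + T 2 m + T 4 m - (T 6 m + T 5 m + T 3 m) =
   - (\<i> * of_real (sqrt 7)) * (\<Sum>d. of_int (chi7 (int (Suc d))) * (q ^ Suc m) ^ Suc d)" for m
 proof -
  define x where "x = q ^ Suc m"
  have x: "norm x < 1" unfolding x_def norm_power using q by (intro power_less_one_iff[THEN iffD2]) auto
  note g = geo[OF x]
  have "(\<lambda>n. (x * p ^ (7 - 1)) ^ Suc n + (x * p ^ (7 - 2)) ^ Suc n + (x * p ^ (7 - 4)) ^ Suc n
    - ((x * p ^ (7 - 6)) ^ Suc n + (x * p ^ (7 - 5)) ^ Suc n + (x * p ^ (7 - 3)) ^ Suc n)) sums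
    (T 1 m + T 2 m + T 4 m - (T 6 m + T 5 m + T 3 m))"
   unfolding T_def x_def[symmetric] by (intro sums_add sums_diff g) auto
  moreover have "(x * p ^ (7 - 1)) ^ Suc n + (x * p ^ (7 - 2)) ^ Suc n + (x * p ^ (7 - 4)) ^ Suc n
    - ((x * p ^ (7 - 6)) ^ Suc n + (x * p ^ (7 - 5)) ^ Suc n + (x * p ^ (7 - 3)) ^ Suc n)
    = - (\<i> * of_real (sqrt 7)) * (of_int (chi7 (int (Suc n))) * x ^ Suc n)" for n
  proof -
   have sw: "(x * p ^ k) ^ Suc n = x ^ Suc n * (p ^ Suc n) ^ k" for k
    by (simp only: power_mult_distrib power_mult[symmetric] mult.commute)
   define v where "v = p ^ Suc n"
   have "x ^ Suc n * v ^ (7 - 1) + x ^ Suc n * v ^ (7 - 2) + x ^ Suc n * v ^ (7 - 4)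
    - (x ^ Suc n * v ^ (7 - 6) + x ^ Suc n * v ^ (7 - 5) + x ^ Suc n * v ^ (7 - 3))
    = - (x ^ Suc n * (v + v ^ 2 + v ^ 4 - (v ^ 6 + v ^ 5 + v ^ 3)))"
    by (simp add: algebra_simps del: power_Suc)
   also have "v + v ^ 2 + v ^ 4 - (v ^ 6 + v ^ 5 + v ^ 3) = \<i> * of_real (sqrt 7) * of_int (chi7 (int (Suc n)))"
    unfolding v_def p_def by (rule gauss_sum_7)
   finally show ?thesis unfolding sw v_def[symmetric] by (simp add: mult_ac del: power_Suc of_nat_Suc)
  qed
  ultimately have S: "(\<lambda>n. - (\<i> * of_real (sqrt 7)) * (of_int (chi7 (int (Suc n))) * x ^ Suc n)) sums
    (T 1 m + T 2 m + T 4 m - (T 6 m + T 5 m + T 3 m))" by simp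
  have ne: "- (\<i> * of_real (sqrt 7)) \<noteq> 0" by simp
  from S have "summable (\<lambda>n. of_int (chi7 (int (Suc n))) * x ^ Suc n)"
   using summable_cmult_iff[of "- (\<i> * of_real (sqrt 7))" "\<lambda>n. of_int (chi7 (int (Suc n))) * x ^ Suc n"] ne
   by (simp add: sums_iff)
  from sums_unique2[OF S sums_mult[OF summable_sums[OF this]]] show ?thesis by (simp add: x_def)
 qed
 have "(\<lambda>m. T 1 m + T 2 m + T 4 m - (T 6 m + T 5 m + T 3 m)) sums
   (cot_tail q (p ^ 1) + cot_tail q (p ^ 2) + cot_tail q (p ^ 4) - (cot_tail q (p ^ 6) + cot_tail q (p ^ 5) + cot_tail q (p ^ 3)))"
  by (intro sums_add sums_diff T)
 moreover have "(\<lambda>m. T 1 m + T 2 m + T 4 m - (T 6 m + T 5 m + T 3 m)) sums (- (\<i> * of_real (sqrt 7)) * L)"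
  unfolding trm by (intro sums_mult L)
 ultimately have tails: "cot_tail q (p ^ 1) + cot_tail q (p ^ 2) + cot_tail q (p ^ 4)
   - (cot_tail q (p ^ 6) + cot_tail q (p ^ 5) + cot_tail q (p ^ 3)) = - (\<i> * of_real (sqrt 7)) * L"
  by (rule sums_unique2)
 have ne1: "p ^ j \<noteq> 1" if "0 < j" "j < 7" for j
 proof
  assume "p ^ j = 1"
  hence "nome (of_int (int j) / 7) = 1" using nome_of_nat_mult[of j "1 / 7"] by (simp add: p_def)
  then obtain n :: int where "of_int (int j) / 7 = (of_int n :: complex)" unfolding nome_eq_1_iff by blast
  hence "of_int (int j) = (of_int (7 * n) :: complex)" by (simp add: field_simps)
  hence "int j = 7 * n" by (simp only: of_int_eq_iff)
  thus False using that by presburger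
 qed
 \<comment> \<open>For a nontrivial seventh root of unity, 7 / (w - 1) = w + 2 w^2 + ... + 6 w^6.
   This makes the cotangents linear in the powers of p, so that their sum can be reduced to the
   Gauss sum.\<close>
 have ce: "cot_exp w = \<i> * (1 + 2 / 7 * (w + 2 * w ^ 2 + 3 * w ^ 3 + 4 * w ^ 4 + 5 * w ^ 5 + 6 * w ^ 6))"
  if "w \<noteq> 1" "w ^ 7 = 1" "1 + w + w ^ 2 + w ^ 3 + w ^ 4 + w ^ 5 + w ^ 6 = 0" for w
 proof -
  have "(w - 1) * (w + 2 * w ^ 2 + 3 * w ^ 3 + 4 * w ^ 4 + 5 * w ^ 5 + 6 * w ^ 6) =
   7 * w ^ 7 - w ^ 7 + 1 - (1 + w + w ^ 2 + w ^ 3 + w ^ 4 + w ^ 5 + w ^ 6)"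
   by (simp add: algebra_simps power_numeral_reduce)
  also have "\<dots> = 7" using that by simp
  finally have "w + 2 * w ^ 2 + 3 * w ^ 3 + 4 * w ^ 4 + 5 * w ^ 5 + 6 * w ^ 6 = 7 / (w - 1)"
   using that by (simp add: eq_divide_eq mult.commute)
  moreover have "cot_exp w = \<i> * (1 + 2 / 7 * (7 / (w - 1)))"
   using that(1) by (simp add: cot_exp_def divide_simps)
  ultimately show ?thesis by (simp only:)
 qed
 have red: "p ^ m = p ^ (m mod 7)" for m
 proof -
  have "p ^ m = p ^ (7 * (m div 7) + m mod 7)" by simp
  also have "\<dots> = p ^ (m mod 7)" unfolding power_add power_mult root(1) by simp
  finally show ?thesis .
 qed
 have c1: "cot_exp (p ^ 1) = \<i> * (1 + 2 / 7 * (p + 2 * p ^ 2 + 3 * p ^ 3 + 4 * p ^ 4 + 5 * p ^ 5 + 6 * p ^ 6))"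
  using ce[of p] root ne1[of 1] by simp
 have c2: "cot_exp (p ^ 2) = \<i> * (1 + 2 / 7 * (p ^ 2 + 2 * p ^ 4 + 3 * p ^ 6 + 4 * p + 5 * p ^ 3 + 6 * p ^ 5))"
 proof -
  have "1 + p ^ 2 + (p ^ 2) ^ 2 + (p ^ 2) ^ 3 + (p ^ 2) ^ 4 + (p ^ 2) ^ 5 + (p ^ 2) ^ 6 = 0"
   using root(2) unfolding power_mult[symmetric] by (simp add: red[of 8] red[of 10] red[of 12] algebra_simps power2_eq_square)
  moreover have "(p ^ 2) ^ 7 = 1" unfolding power_mult[symmetric] by (simp add: red[of 14])
  ultimately show ?thesis using ce[of "p ^ 2"] ne1[of 2] unfolding power_mult[symmetric]
   by (simp add: red[of 8] red[of 10] red[of 12])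
 qed
 have c4: "cot_exp (p ^ 4) = \<i> * (1 + 2 / 7 * (p ^ 4 + 2 * p + 3 * p ^ 5 + 4 * p ^ 2 + 5 * p ^ 6 + 6 * p ^ 3))"
 proof -
  have "1 + p ^ 4 + (p ^ 4) ^ 2 + (p ^ 4) ^ 3 + (p ^ 4) ^ 4 + (p ^ 4) ^ 5 + (p ^ 4) ^ 6 = 0"
   using root(2) unfolding power_mult[symmetric]
   by (simp add: red[of 8] red[of 12] red[of 16] red[of 20] red[of 24] algebra_simps power2_eq_square)
  moreover have "(p ^ 4) ^ 7 = 1" unfolding power_mult[symmetric] by (simp add: red[of 28])
  ultimately show ?thesis using ce[of "p ^ 4"] ne1[of 4] unfolding power_mult[symmetric]
   by (simp add: red[of 8] red[of 12] red[of 16] red[of 20] red[of 24])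
 qed
 have const_part: "cot_exp (p ^ 1) + cot_exp (p ^ 2) + cot_exp (p ^ 4) = of_real (sqrt 7)"
 proof -
  have "cot_exp (p ^ 1) + cot_exp (p ^ 2) + cot_exp (p ^ 4) =
   \<i> * (3 * (1 + p + p ^ 2 + p ^ 3 + p ^ 4 + p ^ 5 + p ^ 6) - (p + p ^ 2 + p ^ 4 - (p ^ 3 + p ^ 5 + p ^ 6)))"
  proof -
   have "\<i> * (1 + 2 / 7 * (a + 2 * b + 3 * c + 4 * d + 5 * e + 6 * f)) + \<i> * (1 + 2 / 7 * (b + 2 * d + 3 * f + 4 * a + 5 * c + 6 * e))
     + \<i> * (1 + 2 / 7 * (d + 2 * a + 3 * e + 4 * b + 5 * f + 6 * c))
     = \<i> * (3 * (1 + a + b + c + d + e + f) - (a + b + d - (c + e + f)))" for a b c d e f :: complex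
   proof -
    have "\<i> * (1 + 2 / 7 * r) + \<i> * (1 + 2 / 7 * s) + \<i> * (1 + 2 / 7 * t) = \<i> * (3 + 2 / 7 * (r + s + t))" for r s t
     by (simp add: algebra_simps)
    moreover have "(a + 2 * b + 3 * c + 4 * d + 5 * e + 6 * f) + (b + 2 * d + 3 * f + 4 * a + 5 * c + 6 * e)
      + (d + 2 * a + 3 * e + 4 * b + 5 * f + 6 * c) = 7 * (a + b + d + 2 * (c + e + f))"
     by simp
    ultimately show ?thesis by (simp add: algebra_simps)
   qed
   thus ?thesis unfolding c1 c2 c4 .
  qed
  thus ?thesis unfolding root(2) root(3) by simp
 qed
 have z: "zeta_cot (of_nat j / 7) h = cot_exp (p ^ j) + 2 * \<i> * (cot_tail q (p ^ j) - cot_tail q (p ^ (7 - j)))"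
  if "j \<le> 7" for j
  using nome_of_nat_mult[of j "1 / 7"] inv[OF that]
  by (simp add: zeta_cot_def cot_series_def p_def[symmetric] q_def[symmetric])
 have "zeta_cot (of_nat 1 / 7) h + zeta_cot (of_nat 2 / 7) h + zeta_cot (of_nat 4 / 7) h =
   (cot_exp (p ^ 1) + cot_exp (p ^ 2) + cot_exp (p ^ 4)) + 2 * \<i> * (cot_tail q (p ^ 1) + cot_tail q (p ^ 2) + cot_tail q (p ^ 4)
   - (cot_tail q (p ^ 6) + cot_tail q (p ^ 5) + cot_tail q (p ^ 3)))"
 proof -
  have le: "1 \<le> (7::nat)" "2 \<le> (7::nat)" "4 \<le> (7::nat)" by simp_all
  show ?thesis unfolding z[OF le(1)] z[OF le(2)] z[OF le(3)] by (simp add: algebra_simps)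
 qed
 also have "\<dots> = of_real (sqrt 7) * (1 + 2 * L)"
  unfolding const_part tails by (simp add: algebra_simps)
 also have "1 + 2 * L = eis7 h" using eis7_eq_suminf[OF h] L(1) by (simp add: q_def sums_iff)
 finally show ?thesis by simp
qed

text \<open>Scaling by J = c v + d sends the division point j/7 to d j/7 plus the period (c/7) j v.
  The quasi-period of that period cancels the correction term of \<open>zeta_cot_modular\<close>.
  What remains is that multiplication by d permutes 1, 2, 4 up to sign, and as the cotangent series
  is odd this yields the factor \<open>chi7 d\<close>.\<close>

theorem eis7_Gamma0:
 assumes det: "a * d - b * c = 1" and c: "7 dvd c" and v: "Im v > 0"
 shows "eis7 (moebius a b c d v) = of_int (chi7 d) * (of_int c * v + of_int d) * eis7 v"
proof -
 obtain c' where c': "c = 7 * c'" using c by blast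
 define J v' where "J = of_int c * v + of_int d" and "v' = moebius a b c d v"
 have vH: "v \<in> upper_half_plane" using v by (simp add: upper_half_plane_def)
 have J0: "J \<noteq> 0" unfolding J_def using moebius_denominator_nonzero[of a d b c v] det vH by simp
 have "v' \<in> upper_half_plane" unfolding v'_def using det vH by (intro moebius_in_upper_half_plane) auto
 hence v': "Im v' > 0" by (simp add: upper_half_plane_def)
 define Z where "Z = (\<lambda>k :: int. zeta_cot (of_int k / 7) v)"
 have Zadd: "Z (k + 7 * n) = Z k" for k n
  using zeta_cot_add_of_int[of "of_int k / 7" n v] by (simp add: Z_def add_divide_distrib)
 have Zmod: "Z k = Z (k mod 7)" for k using Zadd[of "k mod 7" "k div 7"] by simp
 have Zneg: "Z (- k) = - Z k" if "\<not> 7 dvd k" for k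
  using zeta_cot_minus[OF not_in_lattice_sevenths[OF v that]] by (simp add: Z_def)
 have d7: "\<not> 7 dvd d"
 proof
  assume "7 dvd d"
  hence "7 dvd a * d - b * c" using c by simp
  thus False using det by simp
 qed
 have key: "zeta_cot (of_int j / 7) v' = J * Z (d * j)" if "\<not> 7 dvd j" for j
 proof -
  have "\<not> 7 dvd d * j" using d7 that prime_dvd_mult_iff[of "7 :: int"] by simp
  hence not: "of_int (d * j) / 7 \<notin> period_lattice v" by (rule not_in_lattice_sevenths[OF v])
  define u where "u = J * of_int j / 7"
  have u: "u = of_int (d * j) / 7 + (of_int (c' * j) * v + of_int 0)"
   unfolding u_def J_def c' by (simp add: field_simps)
  have notu: "u \<notin> period_lattice v" unfolding u using not by (subst lattice_add_iff[OF latticeI[OF refl]])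
  have uJ: "u / J = of_int j / 7" using J0 by (simp add: u_def)
  have "zeta_cot (u / J) v' / J = zeta_cot u v + 2 * \<i> * of_int c * u / J"
   unfolding J_def v'_def by (rule zeta_cot_modular[OF det v notu])
  also have "zeta_cot u v = Z (d * j) - 2 * \<i> * of_int (c' * j)"
   unfolding u Z_def by (rule zeta_cot_add_periods[OF v not])
  also have "2 * \<i> * of_int c * u / J = 2 * \<i> * of_int (c' * j)"
   using J0 by (simp add: u_def c')
  finally show ?thesis using J0 by (simp add: uJ field_simps)
 qed
 have "of_real (sqrt 7) * eis7 v' = J * (Z (d * 1) + Z (d * 2) + Z (d * 4))"
  using zeta_cot_sevenths[OF v'] key[of 1] key[of 2] key[of 4] by (simp add: algebra_simps)
 also have "Z (d * 1) + Z (d * 2) + Z (d * 4) = of_int (chi7 d) * (Z 1 + Z 2 + Z 4)"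
 proof -
  have neg: "Z 3 = - Z 4" "Z 5 = - Z 2" "Z 6 = - Z 1"
   using Zneg[of 4] Zadd[of "-4" 1] Zneg[of 2] Zadd[of "-2" 1] Zneg[of 1] Zadd[of "-1" 1] by simp_all
  have m: "d * k mod 7 = (d mod 7) * k mod 7" for k by (simp add: mod_mult_left_eq)
  have "d mod 7 \<noteq> 0" using d7 by auto
  thus ?thesis unfolding Zmod[of "d * _"] m
   by (cases d rule: mod_7_cases) (simp_all add: chi7_def neg)
 qed
 also have "Z 1 + Z 2 + Z 4 = of_real (sqrt 7) * eis7 v"
  using zeta_cot_sevenths[OF v] by (simp add: Z_def)
 finally have "of_real (sqrt 7) * eis7 v' = of_real (sqrt 7) * (of_int (chi7 d) * J * eis7 v)"
  by (simp add: mult_ac)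
 thus ?thesis by (simp add: J_def v'_def)
qed

text \<open>The inversion of the lattice with period 7 v exchanges the points j/7 with the points j
  v, hence the formula \<open>zeta_cot_sevenths\<close> with the formula
  \<open>eis7_eq_zeta_cot\<close>.\<close>

theorem eis7_Fricke:
 assumes v: "Im v > 0"
 shows "eis7 (- 1 / (7 * v)) = - (\<i> * of_real (sqrt 7)) * v * eis7 v"
proof -
 define T where "T = 7 * v"
 have T: "Im T > 0" and T0: "T \<noteq> 0" and v0: "v \<noteq> 0" using v by (auto simp: T_def)
 have T': "moebius 0 (-1) 1 0 T = - 1 / T" by (simp add: moebius_def)
 have "- 1 / T \<in> upper_half_plane"
  unfolding T'[symmetric] using T by (intro moebius_in_upper_half_plane) (auto simp: upper_half_plane_def)
 hence ImT': "Im (- 1 / T) > 0" by (simp add: upper_half_plane_def)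
 have key: "zeta_cot (of_int j / 7) (- 1 / T) = T * (zeta_cot (of_int j * v) T + 2 * \<i> * of_int j / 7)" if "\<not> 7 dvd j" for j
 proof -
  have J: "of_int 1 * T + of_int 0 = T" by simp
  have uT: "of_int j * v / T = of_int j / 7" using v0 by (simp add: T_def)
  have "of_int j / 7 \<notin> period_lattice (- 1 / T)" by (rule not_in_lattice_sevenths[OF ImT' that])
  hence "of_int j * v \<notin> period_lattice T"
   using lattice_moebius_iff[of 0 0 "-1" 1 T "of_int j * v"] T0 uT unfolding T' by simp
  from zeta_cot_modular[of 0 0 "-1" 1, OF _ T this]
  have "zeta_cot (of_int j / 7) (- 1 / T) / T = zeta_cot (of_int j * v) T + 2 * \<i> * of_int j / 7"
   unfolding J T' uT using v0 by (simp add: T_def)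
  thus ?thesis by (simp only: nonzero_divide_eq_eq[OF T0] mult.commute)
 qed
 \<comment> \<open>The corrections 2 i j / 7 for j = 1, 2, 4 add up to 2 i, which is exactly the
   constant -2 of \<open>eis7_eq_zeta_cot\<close>.\<close>
 have alg: "T * (x + 2 * \<i> * 1 / 7) + T * (y + 2 * \<i> * 2 / 7) + T * (z + 2 * \<i> * 4 / 7) = T * (x + y + z + 2 * \<i>)" for x y z
 proof -
  have "2 * \<i> * 1 / 7 + 2 * \<i> * 2 / 7 + 2 * \<i> * 4 / 7 = 2 * \<i>" by (simp add: complex_eq_iff)
  moreover have "T * (x + r) + T * (y + s) + T * (z + t) = T * (x + y + z + (r + s + t))" for r s t
   by (simp add: algebra_simps)
  ultimately show ?thesis by (simp only:)
 qed
 have "of_real (sqrt 7) * eis7 (- 1 / T) = T * (zeta_cot v T + zeta_cot (2 * v) T + zeta_cot (4 * v) T + 2 * \<i>)"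
  unfolding zeta_cot_sevenths[OF ImT', symmetric] alg[symmetric]
  using key[of 1] key[of 2] key[of 4] by simp
 also have "zeta_cot v T + zeta_cot (2 * v) T + zeta_cot (4 * v) T + 2 * \<i> = - \<i> * eis7 v"
  unfolding eis7_eq_zeta_cot[OF v] T_def by (simp add: algebra_simps)
 finally have E: "of_real (sqrt 7) * eis7 (- 1 / T) = T * (- \<i> * eis7 v)" .
 have "T = of_real (sqrt 7) * (of_real (sqrt 7) * v)"
  unfolding T_def mult.assoc[symmetric] of_real_mult[symmetric] by simp
 with E have "of_real (sqrt 7) * eis7 (- 1 / T) = of_real (sqrt 7) * (of_real (sqrt 7) * v * (- \<i> * eis7 v))"
  by (metis mult.assoc)
 moreover have "complex_of_real (sqrt 7) \<noteq> 0" by simp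
 ultimately have "eis7 (- 1 / T) = of_real (sqrt 7) * v * (- \<i> * eis7 v)"
  using mult_left_cancel by blast
 thus ?thesis by (simp add: T_def mult_ac)
qed

section \<open>Reduction theory\<close>

lemma finite_bounded_linear_forms:
 assumes "Im z > 0"
 shows "finite {(c :: int, d :: int). norm (of_int c * z + of_int d) \<le> 1}"
proof -
 define M where "M = \<lceil>1 / Im z\<rceil>"
 define N where "N = \<lceil>1 + of_int M * norm z\<rceil>"
 have "(c, d) \<in> {- M..M} \<times> {- N..N}" if le: "norm (of_int c * z + of_int d) \<le> 1" for c d :: int
 proof -
  have "\<bar>Im (of_int c * z + of_int d)\<bar> \<le> 1" using abs_Im_le_cmod le order_trans by blast
  hence "\<bar>of_int c\<bar> * Im z \<le> 1" using assms by (simp add: abs_mult)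
  hence "\<bar>of_int c\<bar> \<le> 1 / Im z" using assms by (simp add: field_simps)
  hence c: "\<bar>c\<bar> \<le> M" unfolding M_def by linarith
  have "norm (of_int d :: complex) \<le> norm (of_int c * z + of_int d) + norm (of_int c * z)"
   using norm_triangle_ineq4[of "of_int c * z + of_int d" "of_int c * z"] by simp
  also have "\<dots> \<le> 1 + of_int M * norm z"
   using le c by (intro add_mono) (auto simp: norm_mult intro!: mult_right_mono)
  finally have "\<bar>d\<bar> \<le> N" unfolding N_def by simp linarith
  with c show ?thesis by auto
 qed
 thus ?thesis by (intro finite_subset[OF _ finite_cartesian_product[of "{- M..M}" "{- N..N}"]]) auto
qed

lemma abs_diff_floor_half_le: "\<bar>x - of_int \<lfloor>x + 1 / 2\<rfloor>\<bar> \<le> (1 / 2 :: real)"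
 by linarith

lemma Im_minus_inverse: "Im (- 1 / z) = Im z / (norm z)\<^sup>2"
 by (simp add: Im_divide cmod_power2)

text \<open>Among the coprime pairs with norm of c z + d at most 1 a minimal one exists, since they
  are finitely many and (0, 1) is one of them. After a translation the upper row (a, b) cannot beat
  the minimum, so the image has norm at least 1, and with real part at most 1/2 its height is at
  least sqrt 3 / 2.\<close>

lemma SL2Z_reduction:
 assumes z: "Im z > 0"
 obtains a b c d :: int where "a * d - b * c = 1"
  "Im (moebius a b c d z) \<ge> sqrt 3 / 2" "\<bar>Re (moebius a b c d z)\<bar> \<le> 1 / 2"
proof -
 define S where "S = {(c :: int, d :: int). coprime c d \<and> norm (of_int c * z + of_int d) \<le> 1}"
 have "finite S" unfolding S_def
  by (rule finite_subset[OF _ finite_bounded_linear_forms[OF z]]) auto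
 moreover have "(0, 1) \<in> S" by (simp add: S_def)
 ultimately obtain p where p: "p \<in> S" "\<And>p'. p' \<in> S \<Longrightarrow>
   norm (of_int (fst p) * z + of_int (snd p)) \<le> norm (of_int (fst p') * z + of_int (snd p'))"
  using ex_min_if_finite[of "(\<lambda>p. norm (of_int (fst p) * z + of_int (snd p))) ` S"]
  by (metis (no_types, lifting) empty_iff finite_imageI image_iff image_is_empty not_le)
 obtain c d where cd: "p = (c, d)" by (cases p)
 have cop: "coprime c d" and le1: "norm (of_int c * z + of_int d) \<le> 1" using p(1) by (auto simp: S_def cd)
 from cop obtain u v where "u * c + v * d = 1" by (metis coprime_iff_gcd_eq_1 bezout_int)
 hence det0: "v * d - (- u) * c = 1" by simp
 define n where "n = \<lfloor>Re (moebius v (- u) c d z) + 1 / 2\<rfloor>"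
 define a b where "a = v - n * c" and "b = - u - n * d"
 have det: "a * d - b * c = 1" using det0 by (simp add: a_def b_def algebra_simps)
 have zH: "z \<in> upper_half_plane" using z by (simp add: upper_half_plane_def)
 have J0: "of_int c * z + of_int d \<noteq> (0 :: complex)"
  using moebius_denominator_nonzero[of a d b c z] det zH by simp
 have shift: "moebius a b c d z = moebius v (- u) c d z - of_int n"
  using J0 by (simp add: moebius_def a_def b_def field_simps)
 define w where "w = moebius a b c d z"
 have Re: "\<bar>Re w\<bar> \<le> 1 / 2" unfolding w_def shift n_def using abs_diff_floor_half_le by simp
 have "norm w \<ge> 1"
 proof (rule ccontr)
  assume "\<not> norm w \<ge> 1"
  hence "norm (of_int a * z + of_int b) < norm (of_int c * z + of_int d)"
   using J0 by (simp add: w_def moebius_def norm_divide divide_simps split: if_splits)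
  moreover have "coprime a b"
  proof (rule coprimeI)
   fix e assume "e dvd a" "e dvd b"
   hence "e dvd a * d - b * c" by simp
   thus "is_unit e" using det by simp
  qed
  ultimately have "(a, b) \<in> S" using le1 by (auto simp: S_def)
  from p(2)[OF this] \<open>norm (of_int a * z + of_int b) < _\<close> show False by (simp add: cd)
 qed
 hence "1 \<le> (norm w)\<^sup>2" by simp
 hence "1 \<le> (Re w)\<^sup>2 + (Im w)\<^sup>2" by (simp add: cmod_power2)
 moreover have "(Re w)\<^sup>2 \<le> (1 / 2)\<^sup>2" using Re by (metis abs_le_square_iff abs_of_pos half_gt_zero_iff zero_less_one)
 ultimately have "(sqrt 3 / 2)\<^sup>2 \<le> (Im w)\<^sup>2" by (simp add: power_divide)
 moreover have "Im w > 0"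
  using moebius_in_upper_half_plane[of a d b c z] det zH by (simp add: w_def upper_half_plane_def)
 ultimately have "sqrt 3 / 2 \<le> Im w" by (meson less_imp_le power2_le_imp_le)
 thus ?thesis using that[OF det] Re by (simp add: w_def)
qed

lemma moebius_compose:
 assumes "of_int c * z + of_int d \<noteq> (0 :: complex)"
 shows "moebius a' b' c' d' (moebius a b c d z) =
  moebius (a' * a + b' * c) (a' * b + b' * d) (c' * a + d' * c) (c' * b + d' * d) z"
proof -
 define J where "J = of_int c * z + of_int d"
 have J: "J \<noteq> 0" using assms by (simp add: J_def)
 have m: "moebius a b c d z = (of_int a * z + of_int b) / J" by (simp add: moebius_def J_def)
 have "moebius a' b' c' d' (moebius a b c d z) =
  ((of_int a' * moebius a b c d z + of_int b') * J) / ((of_int c' * moebius a b c d z + of_int d') * J)"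
  using J by (simp add: moebius_def)
 also have "(of_int a' * moebius a b c d z + of_int b') * J = of_int (a' * a + b' * c) * z + of_int (a' * b + b' * d)"
  unfolding m using J by (simp add: distrib_right J_def) (simp add: algebra_simps)
 also have "(of_int c' * moebius a b c d z + of_int d') * J = of_int (c' * a + d' * c) * z + of_int (c' * b + d' * d)"
  unfolding m using J by (simp add: distrib_right J_def) (simp add: algebra_simps)
 finally show ?thesis by (simp add: moebius_def)
qed

text \<open>If the matrix reducing z is not in Gamma0(7), some -1 / (w + j) lies in the
  Gamma0(7)-orbit of z, where w is the reduced point. The Fricke involution turns it into (w + j) /
  7. This costs a factor 7 in height, whence sqrt 3 / 14.\<close>

lemma Fricke_reduction:
 fixes h :: "complex \<Rightarrow> 'a"
 assumes z: "Im z > 0"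
  and Gamma: "\<And>a b c d z. a * d - b * c = 1 \<Longrightarrow> 7 dvd c \<Longrightarrow> Im z > 0 \<Longrightarrow> h (moebius a b c d z) = h z"
  and Fricke: "\<And>z. Im z > 0 \<Longrightarrow> h (- 1 / (7 * z)) = h z"
 obtains z' where "Im z' \<ge> sqrt 3 / 14" "\<bar>Re z'\<bar> \<le> 1 / 2" "h z' = h z"
proof -
 obtain a b c d :: int where det: "a * d - b * c = 1"
  and w: "Im (moebius a b c d z) \<ge> sqrt 3 / 2" by (rule SL2Z_reduction[OF z])
 define w where "w = moebius a b c d z"
 have zH: "z \<in> upper_half_plane" using z by (simp add: upper_half_plane_def)
 have J0: "of_int c * z + of_int d \<noteq> (0 :: complex)"
  using moebius_denominator_nonzero[of a d b c z] det zH by simp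
 have "\<exists>z1. Im z1 \<ge> sqrt 3 / 14 \<and> h z1 = h z"
 proof (cases "7 dvd c")
  case True
  have "sqrt 3 / 14 \<le> sqrt 3 / 2" by simp
  with w have "sqrt 3 / 14 \<le> Im w" unfolding w_def by (rule order_trans[rotated])
  thus ?thesis using Gamma[OF det True z] by (auto simp: w_def)
 next
  case False
  have "coprime c 7" using False prime_imp_coprime[of "7 :: int" c] by (simp add: coprime_commute)
  then obtain u v where uv: "u * c + v * 7 = 1" by (metis coprime_iff_gcd_eq_1 bezout_int)
  \<comment> \<open>A solution of a + j c = 0 modulo 7; it puts the matrix with lower row (a + j c,
    b + j d) into Gamma0(7).\<close>
  define j where "j = - a * u"
  have "a + j * c = a * (1 - u * c)" by (simp add: j_def algebra_simps)
  also have "\<dots> = 7 * (a * v)" using uv by (simp add: algebra_simps flip: uv)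
  finally have j: "7 dvd a + j * c" by simp
  have wH: "w \<in> upper_half_plane" unfolding w_def using det zH by (intro moebius_in_upper_half_plane) auto
  have "(- c) * (b + j * d) - (- d) * (a + j * c) = 1" using det by (simp add: algebra_simps)
  from Gamma[OF this j z] have 1: "h (moebius (- c) (- d) (a + j * c) (b + j * d) z) = h z" .
  have "moebius (- c) (- d) (a + j * c) (b + j * d) z = moebius 0 (-1) 1 j w"
   unfolding w_def moebius_compose[OF J0] by (simp add: algebra_simps)
  also have "\<dots> = - 1 / (w + of_int j)" by (simp add: moebius_def)
  finally have 2: "h (- 1 / (w + of_int j)) = h z" using 1 by simp
  define v where "v = w + of_int j"
  have v: "Im v > 0" using wH by (simp add: v_def upper_half_plane_def)
  hence v0: "v \<noteq> 0" by auto
  have "Im (- 1 / v) > 0" unfolding Im_minus_inverse using v v0 by simp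
  from Fricke[OF this] have "h (v / 7) = h (- 1 / v)" using v0 by simp
  moreover have "Im (v / 7) \<ge> sqrt 3 / 14" using w by (simp add: v_def w_def)
  ultimately show ?thesis using 2 by (intro exI[of _ "v / 7"]) (simp add: v_def)
 qed
 then obtain z1 where z1: "Im z1 \<ge> sqrt 3 / 14" "h z1 = h z" by blast
 define n where "n = - \<lfloor>Re z1 + 1 / 2\<rfloor>"
 have "Im z1 > 0" using z1(1) by (rule less_le_trans[rotated]) simp
 hence "h (moebius 1 n 0 1 z1) = h z1" by (intro Gamma) auto
 hence "h (z1 + of_int n) = h z" using z1 by (simp add: moebius_def)
 moreover have "\<bar>Re (z1 + of_int n)\<bar> \<le> 1 / 2" unfolding n_def using abs_diff_floor_half_le[of "Re z1"] by simp
 ultimately show ?thesis using that[of "z1 + of_int n"] z1 by simp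
qed

section \<open>Series in the nome and vanishing of modular forms\<close>

text \<open>Stronger than \<open>has_q_expansion\<close>: there is no pole and the series converges
  on the whole unit disc, so that the maximum modulus principle may be used on every smaller
  disc.\<close>

definition q_series :: "(complex \<Rightarrow> complex) \<Rightarrow> complex fps \<Rightarrow> bool" where
 "q_series f F \<longleftrightarrow> fps_conv_radius F \<ge> 1 \<and> (\<forall>z. Im z > 0 \<longrightarrow> f z = eval_fps F (nome z))"

lemma q_series_radius:
 assumes "q_series f F" "Im z > 0"
 shows "ereal (norm (nome z)) < fps_conv_radius F"
proof -
 have "ereal (norm (nome z)) < 1" using norm_nome_less_1[OF assms(2)] by (simp add: one_ereal_def)
 also have "\<dots> \<le> fps_conv_radius F" using assms(1) by (simp add: q_series_def)
 finally show ?thesis .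
qed

lemma q_series_eq: "q_series f F \<Longrightarrow> Im z > 0 \<Longrightarrow> f z = eval_fps F (nome z)"
 by (simp add: q_series_def)

lemma q_series_const: "q_series (\<lambda>_. c) (fps_const c)"
 by (simp add: q_series_def)

lemma q_series_add:
 assumes "q_series f F" "q_series g G"
 shows "q_series (\<lambda>z. f z + g z) (F + G)"
 using assms q_series_radius[OF assms(1)] q_series_radius[OF assms(2)]
  order_trans[OF _ fps_conv_radius_add[of F G]]
 by (auto simp: q_series_def eval_fps_add)

lemma q_series_diff:
 assumes "q_series f F" "q_series g G"
 shows "q_series (\<lambda>z. f z - g z) (F - G)"
 using assms q_series_radius[OF assms(1)] q_series_radius[OF assms(2)]
  order_trans[OF _ fps_conv_radius_diff[of F G]]
 by (auto simp: q_series_def eval_fps_diff)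

lemma q_series_mult:
 assumes "q_series f F" "q_series g G"
 shows "q_series (\<lambda>z. f z * g z) (F * G)"
 using assms q_series_radius[OF assms(1)] q_series_radius[OF assms(2)]
  order_trans[OF _ fps_conv_radius_mult[of F G]]
 by (auto simp: q_series_def eval_fps_mult)

lemma q_series_power: "q_series f F \<Longrightarrow> q_series (\<lambda>z. f z ^ n) (F ^ n)"
proof (induction n)
 case 0
 thus ?case using q_series_const[of 1] by simp
next
 case (Suc n)
 thus ?case using q_series_mult[of f F "\<lambda>z. f z ^ n" "F ^ n"] by simp
qed

lemma q_series_numeral: "q_series (\<lambda>_. numeral k) (numeral k)"
 using q_series_const[of "numeral k"] by (simp add: numeral_fps_const)

lemma q_series_nome: "q_series nome fps_X"
 by (simp add: q_series_def)

lemma q_series_has_derivative: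
 assumes "q_series f F" "Im z > 0"
 shows "(f has_field_derivative 2 * of_real pi * \<i> * eval_fps (fps_X * fps_deriv F) (nome z)) (at z)"
proof -
 have "(nome has_field_derivative 2 * of_real pi * \<i> * nome z) (at z)"
  unfolding nome_def by (auto intro!: derivative_eq_intros)
 from DERIV_chain2[OF has_field_derivative_eval_fps[OF q_series_radius[OF assms], of UNIV] this]
 have "((\<lambda>z. eval_fps F (nome z)) has_field_derivative eval_fps (fps_deriv F) (nome z) * (2 * of_real pi * \<i> * nome z)) (at z)"
  by (simp add: has_field_derivative_subset)
 moreover have "eval_fps (fps_X * fps_deriv F) (nome z) = nome z * eval_fps (fps_deriv F) (nome z)"
  using less_le_trans[OF q_series_radius[OF assms] fps_conv_radius_deriv] by (subst eval_fps_mult) auto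
 ultimately have *: "((\<lambda>z. eval_fps F (nome z)) has_field_derivative 2 * of_real pi * \<i> * eval_fps (fps_X * fps_deriv F) (nome z)) (at z)"
  by (simp add: mult_ac)
 have "open {z. Im z > 0}" by (rule open_halfspace_Im_gt)
 from has_field_derivative_transform_within_open[OF * this] show ?thesis
  using assms by (simp add: q_series_def)
qed

lemma q_series_deriv:
 assumes "q_series f F"
 shows "q_series (\<lambda>z. deriv f z / (2 * of_real pi * \<i>)) (fps_X * fps_deriv F)"
 unfolding q_series_def
proof safe
 have "1 \<le> fps_conv_radius F" using assms by (simp add: q_series_def)
 also have "\<dots> \<le> fps_conv_radius (fps_deriv F)" by (rule fps_conv_radius_deriv)
 also have "\<dots> \<le> fps_conv_radius (fps_X * fps_deriv F)"
  using fps_conv_radius_mult[of fps_X "fps_deriv F"] by simp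
 finally show "1 \<le> fps_conv_radius (fps_X * fps_deriv F)" .
next
 fix z assume "Im z > 0"
 from DERIV_imp_deriv[OF q_series_has_derivative[OF assms this]]
 show "deriv f z / (2 * of_real pi * \<i>) = eval_fps (fps_X * fps_deriv F) (nome z)" by simp
qed

lemma q_series_continuous_on:
 assumes "q_series f F" "A \<subseteq> {z. Im z > 0}"
 shows "continuous_on A f"
proof -
 have "isCont f z" if "z \<in> A" for z
  using q_series_has_derivative[OF assms(1), of z] assms(2) that by (blast intro: DERIV_isCont)
 thus ?thesis by (simp add: continuous_at_imp_continuous_on)
qed

lemma Im_Fricke: "Im (- 1 / (7 * z)) = Im z / (7 * (norm z)\<^sup>2)"
proof -
 have "- 1 / (7 * z) = (- 1 / z) / of_real 7" by simp
 hence "Im (- 1 / (7 * z)) = Im (- 1 / z) / 7" by (simp only: Im_divide_of_real)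
 thus ?thesis by (simp only: Im_minus_inverse) simp
qed

lemma Im_gt_0_imp_nonzero: "Im z > 0 \<Longrightarrow> z \<noteq> 0"
 by auto

lemma Im_Fricke_pos: "Im z > 0 \<Longrightarrow> Im (- 1 / (7 * z)) > 0"
 unfolding Im_Fricke using Im_gt_0_imp_nonzero[of z] by simp

lemma fps_split_shift:
 fixes F :: "complex fps"
 assumes "\<And>n. n < m \<Longrightarrow> fps_nth F n = 0"
 shows "F = fps_X ^ m * fps_shift m F"
 by (rule fps_ext) (use assms in \<open>auto simp: fps_X_power_mult_nth\<close>)

text \<open>
 A Sturm-type bound. If \<open>F\<close> does not vanish, then \<open>\<bar>F z\<bar> * Im z ^ l\<close> attains its
 maximum; comparing this with the maximum modulus principle for \<open>F / q^m\<close> on smaller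
 discs bounds \<open>m\<close>.
\<close>
theorem Fricke_form_eq_0:
 assumes F: "q_series f F" and van: "\<And>n. n < m \<Longrightarrow> fps_nth F n = 0"
  and Gamma: "\<And>a b c d z. a * d - b * c = 1 \<Longrightarrow> 7 dvd c \<Longrightarrow> Im z > 0 \<Longrightarrow>
    norm (f (moebius a b c d z)) = norm (of_int c * z + of_int d) ^ (2 * l) * norm (f z)"
  and Fricke: "\<And>z. Im z > 0 \<Longrightarrow> norm (f (- 1 / (7 * z))) = 7 ^ l * norm z ^ (2 * l) * norm (f z)"
  and bound: "real l < 2 * pi * real m * (sqrt 3 / 14)" and z: "Im z > 0"
 shows "f z = 0"
proof (rule ccontr)
 assume fz: "f z \<noteq> 0"
 define w where "w = (\<lambda>z. norm (f z) * Im z ^ l)"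
 define y0 where "y0 = sqrt 3 / 14"
 have y0: "y0 > 0" by (simp add: y0_def)
 have inv1: "w (moebius a b c d z) = w z" if "a * d - b * c = 1" "7 dvd c" "Im z > 0" for a b c d :: int and z
 proof -
  have "of_int c * z + of_int d \<noteq> (0 :: complex)"
   using moebius_denominator_nonzero[of a d b c z] that by (simp add: upper_half_plane_def)
  thus ?thesis using that Gamma[OF that] by (simp add: w_def Im_moebius power_mult power_divide)
 qed
 have inv2: "w (- 1 / (7 * z)) = w z" if "Im z > 0" for z
  using Fricke[OF that] Im_gt_0_imp_nonzero[OF that]
  unfolding w_def Im_Fricke by (simp add: power_mult power_divide power_mult_distrib)
 define G where "G = fps_shift m F"
 have radG: "fps_conv_radius G \<ge> 1" using F by (simp add: G_def q_series_def)
 have FG: "F = fps_X ^ m * G" unfolding G_def by (rule fps_split_shift[OF van])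
 have inball: "q \<in> eball 0 (fps_conv_radius G)" if "norm q < 1" for q :: complex
 proof -
  have "ereal (norm q) < 1" using that by (simp add: one_ereal_def)
  hence "ereal (norm q) < fps_conv_radius G" using radG by (rule less_le_trans)
  thus ?thesis by simp
 qed
 have fG: "f z = nome z ^ m * eval_fps G (nome z)" if "Im z > 0" for z
 proof -
  have "nome z \<in> eball 0 (fps_conv_radius G)" by (rule inball[OF norm_nome_less_1[OF that]])
  thus ?thesis using q_series_eq[OF F that] unfolding FG by (subst (asm) eval_fps_mult) auto
 qed
 have exp_less: "exp (- 2 * pi * y) < 1" if "y > 0" for y using that by simp
 have disc: "cball 0 (exp (- 2 * pi * y)) \<subseteq> eball (0::complex) (fps_conv_radius G)" if "y > 0" for y
  using inball le_less_trans[OF _ exp_less[OF that]] by (auto simp del: in_eball_iff)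
 obtain B where B: "\<And>q. q \<in> cball 0 (exp (- 2 * pi * y0)) \<Longrightarrow> norm (eval_fps G q) \<le> B"
 proof -
  have "compact (eval_fps G ` cball 0 (exp (- 2 * pi * y0)))"
   using continuous_on_subset[OF continuous_on_eval_fps disc[OF y0]] by (intro compact_continuous_image) auto
  thus ?thesis using that compact_imp_bounded by (fastforce simp: bounded_iff)
 qed
 have m: "m > 0" using bound by (cases m) auto
 have phi_le: "w z \<le> B * (exp (- 2 * pi * real m * Im z) * Im z ^ l)" if "Im z \<ge> y0" for z
 proof -
  have "Im z > 0" using that y0 by simp
  moreover have "norm (nome z) \<le> exp (- 2 * pi * y0)" using that by (simp add: norm_nome)
  hence "norm (eval_fps G (nome z)) \<le> B" by (intro B) simp
  moreover have "norm (nome z) ^ m = exp (- 2 * pi * real m * Im z)"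
   by (simp add: norm_nome exp_of_nat_mult[symmetric] mult_ac)
  ultimately have "norm (f z) \<le> exp (- 2 * pi * real m * Im z) * B"
   using fG by (simp add: norm_mult norm_power mult_left_mono)
  thus ?thesis unfolding w_def using \<open>Im z > 0\<close> mult_right_mono[of "norm (f z)" _ "Im z ^ l"] by (simp add: mult_ac)
 qed
 obtain z' where z': "Im z' \<ge> y0" "\<bar>Re z'\<bar> \<le> 1 / 2" "w z' = w z"
  using Fricke_reduction[of z w, OF z inv1 inv2] unfolding y0_def by blast
 have pos: "w z > 0" using fz z by (simp add: w_def)
 \<comment> \<open>The exponential decay beats the power of the height, so high points cannot
   compete with \<open>z\<close>. The supremum over the reduced region is therefore a maximum over
   the compact set \<open>K\<close>.\<close>
 have "((\<lambda>y. B * (exp (- 2 * pi * real m * y) * y ^ l)) \<longlongrightarrow> 0) at_top"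
  using m by real_asymp
 hence "\<forall>\<^sub>F y in at_top. B * (exp (- 2 * pi * real m * y) * y ^ l) < w z"
  using pos by (rule order_tendstoD)
 then obtain Y where Y: "\<And>y. y \<ge> Y \<Longrightarrow> B * (exp (- 2 * pi * real m * y) * y ^ l) < w z"
  unfolding eventually_at_top_linorder by blast
 define K where "K = cbox (Complex (- 1 / 2) y0) (Complex (1 / 2) (max Y (Im z')))"
 have z'K: "z' \<in> K" using z' by (auto simp: K_def in_cbox_complex_iff abs_le_iff)
 have "continuous_on K w" unfolding w_def
  using y0 by (intro continuous_intros q_series_continuous_on[OF F]) (auto simp: K_def in_cbox_complex_iff)
 then obtain z1 where z1: "z1 \<in> K" "\<And>v. v \<in> K \<Longrightarrow> w v \<le> w z1"
  using continuous_attains_sup[of K w] z'K by (auto simp: K_def)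
 have max: "w v \<le> w z1" if vpos: "Im v > 0" for v
 proof -
  obtain v' where v': "Im v' \<ge> y0" "\<bar>Re v'\<bar> \<le> 1 / 2" "w v' = w v"
   using Fricke_reduction[of v w, OF vpos inv1 inv2] unfolding y0_def by blast
  show ?thesis
  proof (cases "v' \<in> K")
   case True
   thus ?thesis using z1(2) v' by metis
  next
   case False
   hence "Im v' \<ge> Y" using v' by (auto simp: K_def in_cbox_complex_iff abs_le_iff)
   from Y[OF this] phi_le[OF v'(1)] have "w v < w z" using v' by simp
   also have "\<dots> \<le> w z1" using z1(2)[OF z'K] z' by simp
   finally show ?thesis by simp
  qed
 qed
 define y1 where "y1 = Im z1"
 have y1: "y1 \<ge> y0" using z1(1) by (simp add: K_def in_cbox_complex_iff y1_def)
 have y1pos: "y1 > 0" using y1 y0 by simp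
 have fz1: "norm (f z1) > 0" using max[OF z] pos by (auto simp: w_def)
 \<comment> \<open>Maximum modulus on the disc of radius exp(-2 pi y), which contains
   \<open>nome z1\<close>, gives a point \<open>z2\<close> of height y with |f z1| exp(2 pi m y1) <=
   |f z2| exp(2 pi m y). Combined with maximality at \<open>z1\<close> and ln s <= s - 1, this
   leaves 2 pi m y <= l for every y below y1, although l < 2 pi m y1.\<close>
 have main: "2 * pi * real m * y \<le> real l" if y: "0 < y" "y < y1" for y
 proof -
  define r where "r = exp (- 2 * pi * y)"
  have r: "r > 0" "r < 1" using exp_less[OF y(1)] by (auto simp: r_def)
  have "compact (sphere (0::complex) r)" "sphere (0::complex) r \<noteq> {}" using r by auto
  moreover have cont: "continuous_on (cball 0 r) (eval_fps G)"
   using continuous_on_subset[OF continuous_on_eval_fps disc[OF y(1)]] by (simp add: r_def)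
  ultimately obtain q2 where q2: "q2 \<in> sphere 0 r" "\<And>q. q \<in> sphere 0 r \<Longrightarrow> norm (eval_fps G q) \<le> norm (eval_fps G q2)"
   using continuous_attains_sup[of "sphere 0 r" "\<lambda>q. norm (eval_fps G q)"]
   by (metis continuous_on_norm continuous_on_subset sphere_cball)
  have q20: "q2 \<noteq> 0" using q2 r by auto
  define z2 where "z2 = Ln q2 / (2 * of_real pi * \<i>)"
  have nz2: "nome z2 = q2" using q20 by (simp add: nome_def z2_def)
  hence "exp (- 2 * pi * Im z2) = exp (- 2 * pi * y)" using q2 norm_nome[of z2] by (simp add: r_def)
  hence Imz2: "Im z2 = y" by simp
  have "norm (eval_fps G (nome z1)) \<le> norm (eval_fps G q2)"
  proof (rule maximum_modulus_frontier[of "eval_fps G" "cball 0 r"])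
   show "eval_fps G holomorphic_on interior (cball 0 r)"
    using holomorphic_on_eval_fps[OF disc[OF y(1)]] holomorphic_on_subset[OF _ interior_subset] by (auto simp: r_def)
   show "nome z1 \<in> cball 0 r" using y by (simp add: norm_nome r_def y1_def)
  qed (use cont q2 in auto)
  moreover have "norm (f z1) = exp (- 2 * pi * real m * y1) * norm (eval_fps G (nome z1))"
   using fG[of z1] y1pos by (simp add: norm_mult norm_power norm_nome exp_of_nat_mult[symmetric] mult_ac y1_def)
  moreover have "norm (f z2) = exp (- 2 * pi * real m * y) * norm (eval_fps G q2)"
   using fG[of z2] y by (simp add: nz2[symmetric] norm_mult norm_power norm_nome exp_of_nat_mult[symmetric] mult_ac Imz2)
  moreover have "(exp (- 2 * pi * real m * x) * g) * exp (2 * pi * real m * x) = g" for x g :: real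
  proof -
   have "exp (- 2 * pi * real m * x) * exp (2 * pi * real m * x) = 1"
    by (simp only: mult_exp_exp) simp
   thus ?thesis by (metis mult.commute mult.left_commute mult.right_neutral)
  qed
  ultimately have 1: "norm (f z1) * exp (2 * pi * real m * y1) \<le> norm (f z2) * exp (2 * pi * real m * y)"
   by (simp only:)
  have 2: "norm (f z2) * y ^ l \<le> norm (f z1) * y1 ^ l"
   using max[of z2] Imz2 y by (simp add: w_def y1_def)
  have "(norm (f z1) * exp (2 * pi * real m * y1)) * y ^ l \<le> (norm (f z2) * exp (2 * pi * real m * y)) * y ^ l"
   by (intro mult_right_mono 1) (use y in auto)
  also have "\<dots> = (norm (f z2) * y ^ l) * exp (2 * pi * real m * y)" by simp
  also have "\<dots> \<le> (norm (f z1) * y1 ^ l) * exp (2 * pi * real m * y)" by (intro mult_right_mono 2) auto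
  finally have "norm (f z1) * (exp (2 * pi * real m * y1) * y ^ l) \<le> norm (f z1) * (y1 ^ l * exp (2 * pi * real m * y))"
   by (simp add: mult_ac)
  hence "exp (2 * pi * real m * y1) * y ^ l \<le> y1 ^ l * exp (2 * pi * real m * y)"
   using fz1 by (simp only: mult_le_cancel_left_pos)
  hence "ln (exp (2 * pi * real m * y1) * y ^ l) \<le> ln (y1 ^ l * exp (2 * pi * real m * y))"
   using y y1pos by (subst ln_le_cancel_iff) auto
  hence "2 * pi * real m * y1 + real l * ln y \<le> real l * ln y1 + 2 * pi * real m * y"
   using y y1pos by (simp add: ln_mult ln_realpow)
  hence "2 * pi * real m * (y1 - y) \<le> real l * ln (y1 / y)"
   using y y1pos by (simp add: ln_div algebra_simps)
  also have "\<dots> \<le> real l * ((y1 - y) / y)"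
   using ln_le_minus_one[of "y1 / y"] y y1pos by (intro mult_left_mono) (auto simp: diff_divide_distrib)
  finally have "(2 * pi * real m * y) * (y1 - y) \<le> real l * (y1 - y)"
   using y by (simp add: field_simps)
  thus ?thesis using y by (simp only: mult_le_cancel_right_pos[of "y1 - y"] diff_gt_0_iff_gt)
 qed
 have "real l < 2 * pi * real m * y1"
  by (rule less_le_trans[OF bound[folded y0_def]]) (rule mult_left_mono[OF y1], simp)
 hence "real l / (2 * pi * real m) < y1" using m by (simp add: field_simps)
 moreover have "0 \<le> real l / (2 * pi * real m)" by simp
 ultimately obtain y where y: "real l / (2 * pi * real m) < y" "y < y1" using dense by blast
 have "y > 0" using y(1) \<open>0 \<le> real l / (2 * pi * real m)\<close> by linarith
 from main[OF this y(2)] y(1) m show False by (simp add: field_simps)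
qed

section \<open>Identities between the weight one forms\<close>

text \<open>The weight 1 translates of E(2 z) under Gamma0(7), one for each of the three cosets of
  Gamma0(14), labelled by the points of the projective line over the field with two elements. The
  factor 2 in \<open>eis_inf\<close> gives all three the same automorphy factor.\<close>

definition eis_inf :: "complex \<Rightarrow> complex" where "eis_inf z = 2 * eis7 (2 * z)"
definition eis_0 :: "complex \<Rightarrow> complex" where "eis_0 z = eis7 (z / 2)"
definition eis_1 :: "complex \<Rightarrow> complex" where "eis_1 z = eis7 ((z + 1) / 2)"

section \<open>Gamma0(7) and the Fricke involution permute the three forms\<close>

lemma eis7_moebius_eq:
 assumes "a * d - b * c = 1" "7 dvd c" "Im v > 0"
  and w: "w * (of_int c * v + of_int d) = of_int a * v + of_int b"
 shows "eis7 w = of_int (chi7 d) * (of_int c * v + of_int d) * eis7 v"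
proof -
 have "of_int c * v + of_int d \<noteq> (0 :: complex)"
  using moebius_denominator_nonzero[of a d b c v] assms by (simp add: upper_half_plane_def)
 hence "w = moebius a b c d v" using w by (simp add: moebius_def eq_divide_eq)
 thus ?thesis using eis7_Gamma0[OF assms(1-3)] by simp
qed

lemma chi7_half: "chi7 (2 * d) = chi7 d"
 by (simp add: chi7_mult)

lemma dvd_7_half: "7 dvd 2 * c \<Longrightarrow> 7 dvd (c :: int)"
 by presburger

lemma eis7_quotient:
 assumes "A * D - B * C = 1" "7 dvd C" "Im v > 0" "k \<noteq> 0" "of_int A * v + of_int B = k * p" "of_int C * v + of_int D = k * q"
 shows "eis7 (p / q) = of_int (chi7 D) * (k * q) * eis7 v"
 using eis7_Gamma0[OF assms(1-3)] assms(4) by (simp add: moebius_def assms(5,6))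

text \<open>The factor 2 in front of the matrix can be moved into c or d when that entry is even,
  and the new matrix acts on 2 z or z / 2 as an element of Gamma0(7). If both are odd, the
  substitution of z + 1 makes the last entry even.\<close>

lemma eis_inf_moebius:
 fixes a b c d :: int
 assumes det: "a * d - b * c = 1" and c: "7 dvd c" and z: "Im z > 0"
 shows "eis_inf (moebius a b c d z) = of_int (chi7 d) * (of_int c * z + of_int d) *
  (if even c then eis_inf z else if even d then eis_0 z else eis_1 z)"
proof -
 have 1: ?thesis if e: "even c"
 proof -
  obtain c0 where c0: "c = 2 * c0" using e by blast
  have "eis7 (2 * (of_int a * z + of_int b) / (of_int c * z + of_int d)) = of_int (chi7 d) * (1 * (of_int c * z + of_int d)) * eis7 (2 * z)"
   by (rule eis7_quotient[of a d "2 * b" c0]) (use det c z dvd_7_half[of c0] in \<open>simp_all add: c0\<close>)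
  thus ?thesis using e by (simp add: eis_inf_def moebius_def)
 qed
 have 2: "eis_inf (moebius a b c d z) = of_int (chi7 d) * (of_int c * z + of_int d) * eis_0 z"
  if det: "a * d - b * c = 1" and c: "7 dvd c" and z: "Im z > 0" and d: "even d" for a b c d :: int and z
 proof -
  obtain d0 where d0: "d = 2 * d0" using d by blast
  have "eis7 (2 * (of_int a * z + of_int b) / (of_int c * z + of_int d)) = of_int (chi7 d0) * (1 / 2 * (of_int c * z + of_int d)) * eis7 (z / 2)"
   by (rule eis7_quotient[of "2 * a" d0 b c]) (use det c z in \<open>auto simp: d0 add_divide_distrib\<close>)
  thus ?thesis by (simp add: eis_inf_def eis_0_def moebius_def d0 chi7_half)
 qed
 have 3: ?thesis if "odd c" "odd d"
 proof -
  have "chi7 (d - c) = chi7 d" by (intro chi7_cong) (use c in presburger)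
  moreover have "moebius a (b - a) c (d - c) (z + 1) = moebius a b c d z" by (simp add: moebius_def algebra_simps)
  ultimately show ?thesis
   using 2[of a "d - c" "b - a" c "z + 1"] det c z that by (simp add: eis_0_def eis_1_def algebra_simps)
 qed
 show ?thesis using 1 2[OF det c z] 3 by auto
qed

lemma eis_0_moebius:
 fixes a b c d :: int
 assumes det: "a * d - b * c = 1" and c: "7 dvd c" and z: "Im z > 0"
 shows "eis_0 (moebius a b c d z) = of_int (chi7 d) * (of_int c * z + of_int d) *
  (if even b then eis_0 z else if even a then eis_inf z else eis_1 z)"
proof -
 have 1: "eis_0 (moebius a b c d z) = of_int (chi7 d) * (of_int c * z + of_int d) * eis_0 z"
  if det: "a * d - b * c = 1" and c: "7 dvd c" and z: "Im z > 0" and b: "even b" for a b c d :: int and z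
 proof -
  obtain b0 where b0: "b = 2 * b0" using b by blast
  have "eis7 ((of_int a * z + of_int b) / (2 * (of_int c * z + of_int d))) = of_int (chi7 d) * (1 / 2 * (2 * (of_int c * z + of_int d))) * eis7 (z / 2)"
   by (rule eis7_quotient[of a d b0 "2 * c"]) (use det c z in \<open>auto simp: b0 add_divide_distrib\<close>)
  thus ?thesis by (simp add: eis_0_def moebius_def mult.commute)
 qed
 have 2: ?thesis if e: "odd b" "even a"
 proof -
  obtain a0 where a0: "a = 2 * a0" using e(2) by blast
  have "eis7 ((of_int a * z + of_int b) / (2 * (of_int c * z + of_int d))) = of_int (chi7 (2 * d)) * (1 * (2 * (of_int c * z + of_int d))) * eis7 (2 * z)"
   by (rule eis7_quotient[of a0 "2 * d" b c]) (use det c z in \<open>auto simp: a0 distrib_left\<close>)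
  thus ?thesis using e by (simp add: eis_0_def eis_inf_def moebius_def chi7_half mult.commute[of _ 2])
 qed
 have 3: ?thesis if "odd b" "odd a"
 proof -
  have "chi7 (d - c) = chi7 d" by (intro chi7_cong) (use c in presburger)
  moreover have "moebius a (b - a) c (d - c) (z + 1) = moebius a b c d z" by (simp add: moebius_def algebra_simps)
  ultimately show ?thesis
   using 1[of a "d - c" "b - a" c "z + 1"] det c z that by (simp add: eis_0_def eis_1_def algebra_simps)
 qed
 show ?thesis using 1[OF det c z] 2 3 by auto
qed

lemma eis_1_eq: "eis_1 z = eis_0 (z + 1)"
 by (simp add: eis_1_def eis_0_def)

lemma eis_1_moebius:
 fixes a b c d :: int
 assumes det: "a * d - b * c = 1" and c: "7 dvd c" and z: "Im z > 0"
 shows "eis_1 (moebius a b c d z) = of_int (chi7 d) * (of_int c * z + of_int d) *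
  (if even (b + d) then eis_0 z else if even (a + c) then eis_inf z else eis_1 z)"
proof -
 have J0: "of_int c * z + of_int d \<noteq> (0 :: complex)"
  using moebius_denominator_nonzero[of a d b c z] det z by (simp add: upper_half_plane_def)
 have "moebius a b c d z + 1 = moebius (a + c) (b + d) c d z"
  using J0 by (simp add: moebius_def divide_simps) (simp add: algebra_simps)
 moreover have "(a + c) * d - (b + d) * c = 1" using det by (simp add: algebra_simps)
 ultimately show ?thesis using eis_0_moebius[OF _ c z, of "a + c" d "b + d"] by (simp add: eis_1_eq)
qed

lemma eis_permuted:
 fixes a b c d :: int
 assumes det: "a * d - b * c = 1" and c: "7 dvd c" and z: "Im z > 0"
 defines "J \<equiv> of_int (chi7 d) * (of_int c * z + of_int d)"
 shows "(eis_inf (moebius a b c d z), eis_0 (moebius a b c d z), eis_1 (moebius a b c d z)) \<in>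
  {(J * eis_inf z, J * eis_0 z, J * eis_1 z), (J * eis_inf z, J * eis_1 z, J * eis_0 z),
   (J * eis_0 z, J * eis_inf z, J * eis_1 z), (J * eis_0 z, J * eis_1 z, J * eis_inf z),
   (J * eis_1 z, J * eis_0 z, J * eis_inf z), (J * eis_1 z, J * eis_inf z, J * eis_0 z)}"
proof -
 have par: "odd (a * d - b * c)" using det by simp
 show ?thesis unfolding J_def eis_inf_moebius[OF det c z] eis_0_moebius[OF det c z] eis_1_moebius[OF det c z]
  using par by (cases "even a"; cases "even b"; cases "even c"; cases "even d"; simp)
qed

lemma eis7_Fricke_eq:
 assumes "Im v > 0" "w * (7 * v) = - 1"
 shows "eis7 w = - (\<i> * of_real (sqrt 7)) * v * eis7 v"
proof -
 have "v \<noteq> 0" using assms(1) by auto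
 hence "w = - 1 / (7 * v)" using assms(2) by (simp add: eq_divide_eq del: minus_divide_left divide_minus_left)
 thus ?thesis using eis7_Fricke[OF assms(1)] by simp
qed

lemma eis_Fricke:
 assumes z: "Im z > 0"
 defines "J \<equiv> - (\<i> * of_real (sqrt 7)) * z"
 shows "eis_inf (- 1 / (7 * z)) = J * eis_0 z" "eis_0 (- 1 / (7 * z)) = J * eis_inf z"
  "eis_1 (- 1 / (7 * z)) = J * eis_1 z"
proof -
 have z2: "Im (2 * z) > 0" "Im (z / 2) > 0" "Im ((z + 1) / 2) > 0" using z by auto
 have z0: "z \<noteq> 0" using z by auto
 have "eis7 (2 * (- 1 / (7 * z))) = - (\<i> * of_real (sqrt 7)) * (z / 2) * eis7 (z / 2)"
  using z0 by (intro eis7_Fricke_eq z2) simp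
 thus "eis_inf (- 1 / (7 * z)) = J * eis_0 z" by (simp add: eis_inf_def eis_0_def J_def)
 have "eis7 ((- 1 / (7 * z)) / 2) = - (\<i> * of_real (sqrt 7)) * (2 * z) * eis7 (2 * z)"
  using z0 by (intro eis7_Fricke_eq z2) simp
 thus "eis_0 (- 1 / (7 * z)) = J * eis_inf z" by (simp add: eis_inf_def eis_0_def J_def)
 define m where "m = (z + 1) / 2"
 have m: "Im m > 0" "z = 2 * m - 1" using z2 by (auto simp: m_def field_simps)
 have den: "4 - 7 * m \<noteq> 0"
 proof
  assume "4 - 7 * m = 0"
  hence "Im (4 - 7 * m) = 0" by simp
  thus False using m by simp
 qed
 \<comment> \<open>The Fricke involution does not carry (z + 1) / 2 to the required point directly.
   This element of Gamma0(7) first moves m = (z + 1) / 2 to z / (4 - 7 m), whose Fricke image is (-1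
   / (7 z) + 1) / 2.\<close>
 define v where "v = moebius 2 (-1) (-7) 4 m"
 have v: "v * (4 - 7 * m) = 2 * m - 1" using den by (simp add: v_def moebius_def)
 have v1: "eis7 v = of_int (chi7 4) * (of_int (-7) * m + of_int 4) * eis7 m"
  unfolding v_def by (rule eis7_Gamma0) (use m in auto)
 have "v \<in> upper_half_plane"
  unfolding v_def using m(1) by (intro moebius_in_upper_half_plane) (auto simp: upper_half_plane_def)
 hence Imv: "Im v > 0" by (simp add: upper_half_plane_def)
 have "2 * m - 1 \<noteq> 0" using z0 m(2) by simp
 hence v0: "v = (2 * m - 1) / (4 - 7 * m)" using den v by (simp add: eq_divide_eq)
 have "(- 1 / (7 * z) + 1) / 2 * (7 * v) = - 1"
 proof -
  have "(- 1 / (7 * z) + 1) / 2 * (7 * v) = (- 1 / (7 * z) + 1) * (7 * z) * (v / (2 * z))"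
   using z0 by (simp add: field_simps)
  also have "(- 1 / (7 * z) + 1) * (7 * z) = 7 * z - 1" using z0 by (simp add: field_simps)
  also have "v / (2 * z) = 1 / (2 * (4 - 7 * m))" unfolding v0 m(2)[symmetric] using z0 by simp
  also have "7 * z - 1 = - (2 * (4 - 7 * m))" by (simp add: m(2))
  finally have E: "(- 1 / (7 * z) + 1) / 2 * (7 * v) = - (2 * (4 - 7 * m)) * (1 / (2 * (4 - 7 * m)))" .
  have gen: "D \<noteq> 0 \<Longrightarrow> - D * (1 / D) = - 1" for D :: complex by simp
  show ?thesis unfolding E by (rule gen) (use den in simp)
 qed
 from eis7_Fricke_eq[OF Imv this]
 have "eis7 ((- 1 / (7 * z) + 1) / 2) = - (\<i> * of_real (sqrt 7)) * v * ((4 - 7 * m) * eis7 m)"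
  unfolding v1 by (simp add: chi7_def algebra_simps)
 also have "\<dots> = - (\<i> * of_real (sqrt 7)) * (v * (4 - 7 * m)) * eis7 m" by simp
 finally show "eis_1 (- 1 / (7 * z)) = J * eis_1 z"
  unfolding v by (simp add: eis_1_def J_def m_def[symmetric] m(2)[symmetric])
qed

lemma eis_sum:
 assumes "Im z > 0"
 shows "eis_inf z + eis_0 z + eis_1 z = 4 * eis7 z"
 using eis7_half_shift[of "z / 2"] assms by (simp add: eis_inf_def eis_0_def eis_1_def add_divide_distrib)

subsection \<open>Series computations\<close>

text \<open>Integer lists make the truncated products executable. Eight coefficients are what the
  weight 12 identity below demands.\<close>

definition coeffs_upto_8 :: "complex fps \<Rightarrow> int list \<Rightarrow> bool" where
 "coeffs_upto_8 F xs \<longleftrightarrow> length xs = 8 \<and> (\<forall>n<8. fps_nth F n = of_int (xs ! n))"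

definition mult_8 :: "int list \<Rightarrow> int list \<Rightarrow> int list" where
 "mult_8 xs ys = map (\<lambda>n. \<Sum>i\<leftarrow>[0..<Suc n]. xs ! i * ys ! (n - i)) [0..<8]"

definition add_8 :: "int list \<Rightarrow> int list \<Rightarrow> int list" where
 "add_8 xs ys = map (\<lambda>n. xs ! n + ys ! n) [0..<8]"

definition diff_8 :: "int list \<Rightarrow> int list \<Rightarrow> int list" where
 "diff_8 xs ys = map (\<lambda>n. xs ! n - ys ! n) [0..<8]"

definition scale_8 :: "int \<Rightarrow> int list \<Rightarrow> int list" where
 "scale_8 c xs = map (\<lambda>n. c * xs ! n) [0..<8]"

definition deriv_8 :: "int list \<Rightarrow> int list" where
 "deriv_8 xs = map (\<lambda>n. int n * xs ! n) [0..<8]"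

lemma sum_list_upt_Suc: "(\<Sum>i\<leftarrow>[0..<Suc n]. f i) = (\<Sum>i=0..n. f i)" for f :: "nat \<Rightarrow> int"
 by (simp add: interv_sum_list_conv_sum_set_nat atLeastLessThanSuc_atLeastAtMost del: upt_Suc sum.op_ivl_Suc)

lemma coeffs_upto_8_mult:
 assumes "coeffs_upto_8 F xs" "coeffs_upto_8 G ys"
 shows "coeffs_upto_8 (F * G) (mult_8 xs ys)"
 using assms
 by (auto simp: coeffs_upto_8_def mult_8_def fps_mult_nth sum_list_upt_Suc simp del: upt_Suc intro!: sum.cong)

lemma coeffs_upto_8_add: "coeffs_upto_8 F xs \<Longrightarrow> coeffs_upto_8 G ys \<Longrightarrow> coeffs_upto_8 (F + G) (add_8 xs ys)"
 by (auto simp: coeffs_upto_8_def add_8_def)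

lemma coeffs_upto_8_diff: "coeffs_upto_8 F xs \<Longrightarrow> coeffs_upto_8 G ys \<Longrightarrow> coeffs_upto_8 (F - G) (diff_8 xs ys)"
 by (auto simp: coeffs_upto_8_def diff_8_def)

lemma coeffs_upto_8_scale: "coeffs_upto_8 F xs \<Longrightarrow> coeffs_upto_8 (fps_const (of_int c) * F) (scale_8 c xs)"
 by (auto simp: coeffs_upto_8_def scale_8_def)

lemma coeffs_upto_8_deriv: "coeffs_upto_8 F xs \<Longrightarrow> coeffs_upto_8 (fps_X * fps_deriv F) (deriv_8 xs)"
 unfolding coeffs_upto_8_def
proof safe
 fix n :: nat assume xs: "\<forall>n<8. fps_nth F n = of_int (xs ! n)" "n < 8"
 thus "fps_nth (fps_X * fps_deriv F) n = of_int (deriv_8 xs ! n)"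
  by (cases n) (auto simp: deriv_8_def)
qed (simp add: deriv_8_def)

lemma eis7_coeff_list:
 assumes "n > 0"
 shows "eis7_coeff n = 2 * (\<Sum>d\<leftarrow>[1..<Suc n]. if d dvd n then chi7 (int d) else 0)"
proof -
 have "{d. d dvd n} = {d\<in>{1..<Suc n}. d dvd n}" using assms by (auto dest: dvd_imp_le intro!: Nat.gr0I)
 hence "(\<Sum>d | d dvd n. chi7 (int d)) = (\<Sum>d\<in>{1..<Suc n}. if d dvd n then chi7 (int d) else 0)"
  by (simp only: sum.inter_filter[OF finite_atLeastLessThan])
 thus ?thesis using assms
  by (simp add: eis7_coeff_def interv_sum_list_conv_sum_set_nat del: upt_Suc sum.op_ivl_Suc)
qed

lemma eis7_coeff_values:
 "eis7_coeff 0 = 1" "eis7_coeff 1 = 2" "eis7_coeff 2 = 4" "eis7_coeff 3 = 0" "eis7_coeff 4 = 6"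
 "eis7_coeff 5 = 0" "eis7_coeff 6 = 0" "eis7_coeff 7 = 2"
 by (simp add: eis7_coeff_def, (subst eis7_coeff_list, simp, code_simp)+)

lemma less_8_cases:
 assumes "n < (8 :: nat)"
 obtains "n = 0" | "n = 1" | "n = 2" | "n = 3" | "n = 4" | "n = 5" | "n = 6" | "n = 7"
proof -
 have "n = 0 \<or> n = 1 \<or> n = 2 \<or> n = 3 \<or> n = 4 \<or> n = 5 \<or> n = 6 \<or> n = 7" using assms by presburger
 thus ?thesis using that by metis
qed

lemma coeffs_upto_8_eis7: "coeffs_upto_8 (eis7_fps 1) [1, 2, 4, 0, 6, 0, 0, 2]"
 unfolding coeffs_upto_8_def
proof safe
 fix n :: nat assume "n < 8"
 thus "fps_nth (eis7_fps 1) n = of_int ([1, 2, 4, 0, 6, 0, 0, 2] ! n)"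
  by (cases n rule: less_8_cases) (simp_all add: eis7_fps_def eis7_coeff_values eis7_coeff_values(2)[unfolded One_nat_def])
qed simp

lemma coeffs_upto_8_eis7_2: "coeffs_upto_8 (eis7_fps 2) [1, 0, 2, 0, 4, 0, 0, 0]"
 unfolding coeffs_upto_8_def
proof safe
 fix n :: nat assume "n < 8"
 thus "fps_nth (eis7_fps 2) n = of_int ([1, 0, 2, 0, 4, 0, 0, 0] ! n)"
  by (cases n rule: less_8_cases) (simp_all add: eis7_fps_def eis7_coeff_values eis7_coeff_values(2)[unfolded One_nat_def])
qed simp

lemma q_series_eis7: "q_series eis7 (eis7_fps 1)"
 using eis7_fps_conv_radius[of 1] by (simp add: q_series_def eis7_def)

lemma q_series_eis7_2: "q_series (\<lambda>z. eis7 (2 * z)) (eis7_fps 2)"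
 using eis7_fps_conv_radius[of 2] eis7_multiple[of _ 2] by (simp add: q_series_def)

definition eis7_odd_fps :: "complex fps" where
 "eis7_odd_fps = Abs_fps (\<lambda>k. of_int (eis7_coeff (2 * k + 1)))"

text \<open>\<open>eis_0\<close> and \<open>eis_1\<close> are series in the square root of q that
  differ by its sign. Their difference has only odd exponents, hence is twice that root times a
  series in q, and its square is again a series in q.\<close>

lemma eis_diff_squared: "q_series (\<lambda>z. (eis_0 z - eis_1 z) ^ 2) (4 * (fps_X * eis7_odd_fps ^ 2))"
proof -
 have odd_sums: "(\<lambda>k. 2 * (of_int (eis7_coeff (2 * k + 1)) * r ^ (2 * k + 1))) sums
   ((\<Sum>n. of_int (eis7_coeff n) * r ^ n) - (\<Sum>n. of_int (eis7_coeff n) * (- r) ^ n))"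
  if "norm r < 1" for r :: complex
 proof -
  have s: "(\<lambda>n. of_int (eis7_coeff n) * s ^ n) sums (\<Sum>n. of_int (eis7_coeff n) * s ^ n)" if "norm s < 1" for s :: complex
   by (rule summable_sums, rule eis7_coeff_sums[OF that]) (rule sums_summable)
  define g where "g = (\<lambda>n. of_int (eis7_coeff n) * r ^ n - of_int (eis7_coeff n) * (- r) ^ n)"
  have "g sums ((\<Sum>n. of_int (eis7_coeff n) * r ^ n) - (\<Sum>n. of_int (eis7_coeff n) * (- r) ^ n))"
   unfolding g_def by (intro sums_diff s) (use that in auto)
  moreover have "strict_mono (\<lambda>k :: nat. 2 * k + 1)" by (auto simp: strict_mono_def)
  moreover have "g n = 0" if "n \<notin> range (\<lambda>k. 2 * k + 1)" for n
  proof -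
   have "even n" using that by (metis oddE rangeI)
   thus ?thesis by (simp add: g_def)
  qed
  ultimately have "(\<lambda>k. g (2 * k + 1)) sums ((\<Sum>n. of_int (eis7_coeff n) * r ^ n) - (\<Sum>n. of_int (eis7_coeff n) * (- r) ^ n))"
   by (subst sums_mono_reindex)
  moreover have "g (2 * k + 1) = 2 * (of_int (eis7_coeff (2 * k + 1)) * r ^ (2 * k + 1))" for k
   by (simp add: g_def)
  ultimately show ?thesis by simp
 qed
 have odd_pow: "2 * (c * s ^ (2 * k + 1)) = (2 * s) * (c * (s ^ 2) ^ k)" for c s :: complex and k
  by (simp add: power_mult[symmetric])
 have rad: "fps_conv_radius eis7_odd_fps \<ge> 1"
  unfolding fps_conv_radius_def
 proof (rule conv_radius_geI_ex')
  fix r :: real assume r: "0 < r" "ereal r < 1"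
  define s where "s = complex_of_real (sqrt r)"
  have s: "norm s < 1" "s \<noteq> 0" "s ^ 2 = of_real r" using r by (auto simp: s_def simp flip: of_real_power)
  from sums_summable[OF odd_sums[OF s(1)]]
  have "summable (\<lambda>k. (2 * s) * (of_int (eis7_coeff (2 * k + 1)) * (s ^ 2) ^ k))"
   by (simp only: odd_pow)
  hence "summable (\<lambda>k. of_int (eis7_coeff (2 * k + 1)) * (s ^ 2) ^ k)"
   using s(2) by (subst (asm) summable_cmult_iff) auto
  thus "summable (\<lambda>n. fps_nth eis7_odd_fps n * complex_of_real r ^ n)"
   by (simp add: eis7_odd_fps_def s(3))
 qed
 define g where "g = (\<lambda>z. eval_fps eis7_odd_fps (nome z))"
 have g: "q_series g eis7_odd_fps" using rad by (simp add: q_series_def g_def)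
 have "q_series (\<lambda>z. 4 * (nome z * g z ^ 2)) (4 * (fps_X * eis7_odd_fps ^ 2))"
  by (intro q_series_mult q_series_numeral q_series_nome q_series_power g)
 moreover have "(eis_0 z - eis_1 z) ^ 2 = 4 * (nome z * g z ^ 2)" if z: "Im z > 0" for z
 proof -
  define r where "r = nome (z / 2)"
  have r: "norm r < 1" using z by (simp add: r_def norm_nome_less_1)
  have r2: "r ^ 2 = nome z" using nome_of_nat_mult[of 2 "z / 2"] by (simp add: r_def)
  have "nome ((z + 1) / 2) = - r"
   by (simp add: r_def add_divide_distrib nome_add) (simp add: nome_def)
  hence "eis_0 z - eis_1 z = (\<Sum>n. of_int (eis7_coeff n) * r ^ n) - (\<Sum>n. of_int (eis7_coeff n) * (- r) ^ n)"
   using eis7_eq_suminf[of "z / 2"] eis7_eq_suminf[of "(z + 1) / 2"] z by (simp add: eis_0_def eis_1_def r_def)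
  with odd_sums[OF r] have 1: "(\<lambda>k. 2 * (of_int (eis7_coeff (2 * k + 1)) * r ^ (2 * k + 1))) sums (eis_0 z - eis_1 z)"
   by simp
  have "(\<lambda>k. of_int (eis7_coeff (2 * k + 1)) * nome z ^ k) sums g z"
   using sums_eval_fps[OF q_series_radius[OF g z]] by (simp add: eis7_odd_fps_def g_def)
  from sums_mult[OF this, of "2 * r"]
  have "(\<lambda>k. 2 * (of_int (eis7_coeff (2 * k + 1)) * r ^ (2 * k + 1))) sums (2 * r * g z)"
   by (simp only: r2[symmetric] odd_pow mult.assoc)
  from sums_unique2[OF 1 this] have "eis_0 z - eis_1 z = 2 * r * g z" .
  thus ?thesis by (simp add: r2[symmetric] power_mult_distrib)
 qed
 ultimately show ?thesis by (simp add: q_series_def)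
qed

lemma chi7_square: "\<not> 7 dvd d \<Longrightarrow> chi7 d ^ 2 = 1"
 by (auto simp: chi7_def)

lemma Gamma0_7_not_dvd:
 assumes "a * d - b * c = (1 :: int)" "7 dvd c"
 shows "\<not> 7 dvd d"
proof
 assume "7 dvd d"
 hence "7 dvd a * d - b * c" using assms(2) by simp
 thus False using assms by simp
qed

lemma norm_chi7: "a * d - b * c = (1 :: int) \<Longrightarrow> 7 dvd c \<Longrightarrow> norm (of_int (chi7 d) :: complex) = 1"
 using chi7_square[OF Gamma0_7_not_dvd] by (metis norm_of_int abs_square_eq_1 of_int_1 of_int_abs power2_abs)

lemma norm_Fricke_factor: "norm (- (\<i> * complex_of_real (sqrt 7)) * z) ^ (2 * l) = 7 ^ l * norm z ^ (2 * l)"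
 by (simp add: norm_mult power_mult power_mult_distrib)

text \<open>Both sides are symmetric in the three permuted forms, so the difference is a weight 2
  form for Gamma0(7) compatible with the Fricke involution. Two vanishing coefficients suffice since
  1 < 4 pi sqrt 3 / 14.\<close>

theorem eis_sum_squares:
 assumes z: "Im z > 0"
 shows "eis_inf z ^ 2 + eis_0 z ^ 2 + eis_1 z ^ 2 = 6 * eis7 z ^ 2"
proof -
 define f where "f = (\<lambda>z. eis_inf z ^ 2 + eis_0 z ^ 2 + eis_1 z ^ 2 - 6 * eis7 z ^ 2)"

 have F: "q_series f (6 * eis7_fps 2 ^ 2 + (2 * (fps_X * eis7_odd_fps ^ 2) + 2 * eis7_fps 1 ^ 2)
   - 8 * (eis7_fps 1 * eis7_fps 2))"
 proof -
  \<comment> \<open>The unusual constant is just 1/2. With the sum of \<open>eis_0\<close> and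
    \<open>eis_1\<close> known from \<open>eis_sum\<close>, the sum of their squares is expressed
    through the square of their difference, which has an expansion in integral powers.\<close>
  have "q_series (\<lambda>z. (6 * eis7 (2 * z) ^ 2 + (fps_nth (fps_const (1 / 2)) 0 * ((eis_0 z - eis_1 z) ^ 2) + 2 * eis7 z ^ 2)) - 8 * (eis7 z * eis7 (2 * z)))
    ((6 * eis7_fps 2 ^ 2 + (fps_const (fps_nth (fps_const (1 / 2)) 0) * (4 * (fps_X * eis7_odd_fps ^ 2)) + 2 * eis7_fps 1 ^ 2)) - 8 * (eis7_fps 1 * eis7_fps 2))"
   by (intro q_series_diff q_series_add q_series_mult q_series_numeral q_series_const q_series_power q_series_eis7 q_series_eis7_2 eis_diff_squared)
  moreover have "fps_const (1 / 2 :: complex) * (4 * G) = 2 * G" for G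
   by (simp add: numeral_fps_const mult.assoc[symmetric])
  moreover have "f z = 6 * eis7 (2 * z) ^ 2 + (1 / 2 * ((eis_0 z - eis_1 z) ^ 2) + 2 * eis7 z ^ 2) - 8 * (eis7 z * eis7 (2 * z))"
   if "Im z > 0" for z
  proof -
   have e1: "eis_1 z = 4 * eis7 z - eis_inf z - eis_0 z" using eis_sum[OF that] by (simp add: algebra_simps)
   show ?thesis unfolding f_def e1 by (simp add: eis_inf_def power2_eq_square field_simps)
  qed
  ultimately show ?thesis by (simp add: q_series_def)
 qed
 have "f z = 0"
 proof (rule Fricke_form_eq_0[OF F, where m = 2 and l = 1])
  show "fps_nth (6 * eis7_fps 2 ^ 2 + (2 * (fps_X * eis7_odd_fps ^ 2) + 2 * eis7_fps 1 ^ 2)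
   - 8 * (eis7_fps 1 * eis7_fps 2)) n = 0" if "n < 2" for n
  proof -
   have e: "fps_nth (eis7_fps 1) 0 = 1" "fps_nth (eis7_fps 1) (Suc 0) = 2" "fps_nth (eis7_fps 2) 0 = 1" "fps_nth (eis7_fps 2) (Suc 0) = 0"
    "fps_nth eis7_odd_fps 0 = 2"
    using eis7_coeff_values(1,2) by (simp_all add: eis7_fps_def eis7_odd_fps_def)
   from that have "n = 0 \<or> n = Suc 0" by auto
   thus ?thesis by (auto simp: fps_mult_nth power2_eq_square numeral_fps_const e e[unfolded One_nat_def])
  qed
  show "norm (f (moebius a b c d z)) = norm (of_int c * z + of_int d) ^ (2 * 1) * norm (f z)"
   if g: "a * d - b * c = 1" "7 dvd c" "Im z > 0" for a b c d :: int and z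
  proof -
   define J where "J = of_int (chi7 d) * (of_int c * z + of_int d)"
   have "eis7 (moebius a b c d z) = J * eis7 z" unfolding J_def by (rule eis7_Gamma0[OF g])
   hence "f (moebius a b c d z) = J ^ 2 * f z"
    using eis_permuted[OF g, folded J_def] by (auto simp: f_def power_mult_distrib algebra_simps)
   thus ?thesis using norm_chi7[OF g(1,2)] by (simp add: norm_mult norm_power J_def)
  qed
  show "norm (f (- 1 / (7 * z))) = 7 ^ 1 * norm z ^ (2 * 1) * norm (f z)" if "Im z > 0" for z
  proof -
   define J where "J = - (\<i> * of_real (sqrt 7)) * z"
   have "f (- 1 / (7 * z)) = J ^ 2 * f z"
    unfolding f_def eis_Fricke[OF that, folded J_def] eis7_Fricke[OF that, folded J_def]
    by (simp add: power_mult_distrib algebra_simps)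
   thus ?thesis using norm_Fricke_factor[of z 1, folded J_def] by (simp add: norm_mult norm_power)
  qed
  have "sqrt 3 \<ge> 17 / 10" by (rule real_le_rsqrt) (simp add: power2_eq_square)
  moreover have "pi > 3" using pi_approx by simp
  ultimately have "3 * (17 / 10) \<le> pi * sqrt 3" by (intro mult_mono) auto
  thus "real 1 < 2 * pi * real 2 * (sqrt 3 / 14)" by simp
 qed (rule z)
 thus ?thesis by (simp add: f_def)
qed

section \<open>The differential equation\<close>

text \<open>Four times the cusp form eta(z)^3 eta(7 z)^3 of weight 3. This shape, in E(z) and E(2 z)
  only, is the one to be expanded; the symmetric product in \<open>eis_prod_eq\<close>, equal to it
  by the linear and the quadratic relation, shows how it transforms.\<close>

definition eis_prod :: "complex \<Rightarrow> complex" where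
 "eis_prod z = (2 * eis7 z - eis_inf z) * (eis7 z - eis_inf z) ^ 2"

lemma eis_prod_eq:
 assumes "Im z > 0"
 shows "eis_prod z = (2 * eis7 z - eis_inf z) * (2 * eis7 z - eis_0 z) * (2 * eis7 z - eis_1 z)"
proof -
 define v f0 f1 fi where "v = eis7 z" and "f0 = eis_0 z" and "f1 = eis_1 z" and "fi = eis_inf z"
 have s: "f1 = 4 * v - fi - f0" using eis_sum[OF assms] by (simp add: v_def f0_def f1_def fi_def algebra_simps)
 have q: "fi ^ 2 + f0 ^ 2 + f1 ^ 2 = 6 * v ^ 2"
  using eis_sum_squares[OF assms] by (simp add: v_def f0_def f1_def fi_def)
 have "2 * ((2 * v - f0) * (2 * v - f1)) = 2 * (v - fi) ^ 2 - (fi ^ 2 + f0 ^ 2 + f1 ^ 2 - 6 * v ^ 2)"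
  unfolding s by (simp add: power2_eq_square algebra_simps)
 hence "(2 * v - f0) * (2 * v - f1) = (v - fi) ^ 2" unfolding q by simp
 thus ?thesis by (simp add: eis_prod_def v_def f0_def f1_def fi_def mult.assoc)
qed

lemma eis_prod_moebius:
 assumes "a * d - b * c = 1" "7 dvd c" "Im z > 0"
 shows "eis_prod (moebius a b c d z) = (of_int (chi7 d) * (of_int c * z + of_int d)) ^ 3 * eis_prod z"
proof -
 define J where "J = of_int (chi7 d) * (of_int c * z + of_int d)"
 have "moebius a b c d z \<in> upper_half_plane"
  using assms by (intro moebius_in_upper_half_plane) (auto simp: upper_half_plane_def)
 hence im: "Im (moebius a b c d z) > 0" by (simp add: upper_half_plane_def)
 have e: "eis7 (moebius a b c d z) = J * eis7 z" unfolding J_def by (rule eis7_Gamma0[OF assms])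
 show ?thesis unfolding J_def[symmetric] eis_prod_eq[OF im] eis_prod_eq[OF assms(3)] e
  using eis_permuted[OF assms, folded J_def]
  by (elim insertE emptyE) (simp_all add: power3_eq_cube algebra_simps)
qed

lemma eis_prod_Fricke:
 assumes "Im z > 0"
 shows "eis_prod (- 1 / (7 * z)) = (- (\<i> * of_real (sqrt 7)) * z) ^ 3 * eis_prod z"
proof -
 define J where "J = - (\<i> * of_real (sqrt 7)) * z"
 show ?thesis unfolding J_def[symmetric] eis_prod_eq[OF Im_Fricke_pos[OF assms]] eis_prod_eq[OF assms]
   eis_Fricke[OF assms, folded J_def] eis7_Fricke[OF assms, folded J_def]
  by (simp add: power3_eq_cube algebra_simps)
qed

definition eis_prod_fps :: "complex fps" where
 "eis_prod_fps = (2 * eis7_fps 1 - 2 * eis7_fps 2) * ((eis7_fps 1 - 2 * eis7_fps 2) * (eis7_fps 1 - 2 * eis7_fps 2))"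

lemma q_series_eis_prod: "q_series eis_prod eis_prod_fps"
proof -
 have "q_series (\<lambda>z. (2 * eis7 z - 2 * eis7 (2 * z)) * ((eis7 z - 2 * eis7 (2 * z)) * (eis7 z - 2 * eis7 (2 * z)))) eis_prod_fps"
  unfolding eis_prod_fps_def
  by (intro q_series_mult q_series_diff q_series_numeral q_series_eis7 q_series_eis7_2)
 thus ?thesis by (simp add: eis_prod_def[abs_def] eis_inf_def power2_eq_square)
qed

lemma has_field_derivative_moebius:
 fixes a b c d :: int
 assumes "of_int c * z + of_int d \<noteq> (0 :: complex)"
 shows "(moebius a b c d has_field_derivative of_int (a * d - b * c) / (of_int c * z + of_int d) ^ 2) (at z)"
 unfolding moebius_def[abs_def] using assms by (auto intro!: derivative_eq_intros simp: power2_eq_square algebra_simps)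

lemma open_upper: "open {z. Im z > 0}"
 by (rule open_halfspace_Im_gt)

text \<open>The Rankin-Cohen bracket of forms of weights 1 and 3 is a form of weight 6.\<close>
lemma bracket_transform:
 assumes z: "Im z > 0" and g: "(g has_field_derivative g') (at z)" and gz: "Im (g z) > 0"
  and u: "(u has_field_derivative u') (at z)" "(u has_field_derivative u1) (at (g z))"
  and v: "(v has_field_derivative v') (at z)" "(v has_field_derivative v1) (at (g z))"
  and j: "(j has_field_derivative j') (at z)"
  and ug: "\<And>w. Im w > 0 \<Longrightarrow> u (g w) = e * j w * u w"
  and vg: "\<And>w. Im w > 0 \<Longrightarrow> v (g w) = (e * j w) ^ 3 * v w"
 shows "(u (g z) * v1 - 3 * v (g z) * u1) * g' = e ^ 4 * j z ^ 4 * (u z * v' - 3 * v z * u')"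
proof -
 have "((\<lambda>w. e * j w * u w) has_field_derivative e * (j' * u z + j z * u')) (at z)"
  by (rule derivative_eq_intros u j refl | simp add: algebra_simps)+
 from has_field_derivative_transform_within_open[OF this open_upper, of "\<lambda>w. u (g w)"] z ug
 have "((\<lambda>w. u (g w)) has_field_derivative e * (j' * u z + j z * u')) (at z)" by simp
 from DERIV_unique[OF this DERIV_chain2[OF u(2) g]]
 have 1: "u1 * g' = e * (j' * u z + j z * u')" by simp
 have "((\<lambda>w. (e * j w) ^ 3 * v w) has_field_derivative e ^ 3 * (3 * j z ^ 2 * j' * v z + j z ^ 3 * v')) (at z)"
  by (rule derivative_eq_intros v j refl | simp add: algebra_simps power2_eq_square power3_eq_cube)+
 from has_field_derivative_transform_within_open[OF this open_upper, of "\<lambda>w. v (g w)"] z vg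
 have "((\<lambda>w. v (g w)) has_field_derivative e ^ 3 * (3 * j z ^ 2 * j' * v z + j z ^ 3 * v')) (at z)" by simp
 from DERIV_unique[OF this DERIV_chain2[OF v(2) g]]
 have 2: "v1 * g' = e ^ 3 * (3 * j z ^ 2 * j' * v z + j z ^ 3 * v')" by simp
 have "(u (g z) * v1 - 3 * v (g z) * u1) * g' = u (g z) * (v1 * g') - 3 * v (g z) * (u1 * g')"
  by (simp add: algebra_simps)
 also have "\<dots> = e ^ 4 * j z ^ 4 * (u z * v' - 3 * v z * u')"
  unfolding 1 2 ug[OF z] vg[OF z] by (simp add: algebra_simps power_numeral_reduce)
 finally show ?thesis .
qed

definition eis_bracket :: "complex \<Rightarrow> complex" where
 "eis_bracket z = eis7 z * (deriv eis_prod z / (2 * of_real pi * \<i>)) - 3 * (eis_prod z * (deriv eis7 z / (2 * of_real pi * \<i>)))"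

lemma eis7_has_derivative: "Im z > 0 \<Longrightarrow> (eis7 has_field_derivative deriv eis7 z) (at z)"
 using q_series_has_derivative[OF q_series_eis7] by (metis DERIV_imp_deriv)

lemma eis_prod_has_derivative: "Im z > 0 \<Longrightarrow> (eis_prod has_field_derivative deriv eis_prod z) (at z)"
 using q_series_has_derivative[OF q_series_eis_prod] by (metis DERIV_imp_deriv)

lemma eis_bracket_eq:
 "eis_bracket z = (eis7 z * deriv eis_prod z - 3 * eis_prod z * deriv eis7 z) / (2 * of_real pi * \<i>)"
 by (simp add: eis_bracket_def diff_divide_distrib)

lemma eis_bracket_moebius:
 fixes a b c d :: int
 assumes det: "a * d - b * c = 1" and c: "7 dvd c" and z: "Im z > 0"
 shows "eis_bracket (moebius a b c d z) = (of_int c * z + of_int d) ^ 6 * eis_bracket z"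
proof -
 define J where "J = (\<lambda>z :: complex. of_int c * z + of_int d)"
 have J0: "J z \<noteq> 0"
  using moebius_denominator_nonzero[of a d b c z] det z by (simp add: upper_half_plane_def J_def)
 have "moebius a b c d z \<in> upper_half_plane"
  using assms by (intro moebius_in_upper_half_plane) (auto simp: upper_half_plane_def)
 hence im: "Im (moebius a b c d z) > 0" by (simp add: upper_half_plane_def)
 have e: "(of_int (chi7 d) :: complex) ^ 4 = 1"
 proof -
  have "(of_int (chi7 d) :: complex) ^ 4 = of_int ((chi7 d ^ 2) ^ 2)" by (simp add: power_mult[symmetric])
  thus ?thesis using chi7_square[OF Gamma0_7_not_dvd[OF det c]] by simp
 qed
 have "(eis7 (moebius a b c d z) * deriv eis_prod (moebius a b c d z) - 3 * eis_prod (moebius a b c d z) * deriv eis7 (moebius a b c d z)) * (1 / J z ^ 2)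
   = of_int (chi7 d) ^ 4 * J z ^ 4 * (eis7 z * deriv eis_prod z - 3 * eis_prod z * deriv eis7 z)"
 proof (rule bracket_transform[where z = z and g = "moebius a b c d" and u = eis7 and v = eis_prod and j = J and j' = "of_int c",
    OF z _ im eis7_has_derivative[OF z] eis7_has_derivative[OF im]
    eis_prod_has_derivative[OF z] eis_prod_has_derivative[OF im]])
  show "(moebius a b c d has_field_derivative 1 / J z ^ 2) (at z)"
   using has_field_derivative_moebius[of c z d a b] J0 det by (simp add: J_def)
  show "(J has_field_derivative of_int c) (at z)"
   unfolding J_def by (auto intro!: derivative_eq_intros)
 qed (use eis7_Gamma0[OF det c] eis_prod_moebius[OF det c] in \<open>auto simp: J_def\<close>)
 hence "eis7 (moebius a b c d z) * deriv eis_prod (moebius a b c d z) - 3 * eis_prod (moebius a b c d z) * deriv eis7 (moebius a b c d z)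
   = J z ^ 6 * (eis7 z * deriv eis_prod z - 3 * eis_prod z * deriv eis7 z)"
  using J0 by (simp add: e divide_eq_eq power_add[symmetric])
 thus ?thesis by (simp add: eis_bracket_eq J_def)
qed

lemma eis_bracket_Fricke:
 assumes z: "Im z > 0"
 shows "eis_bracket (- 1 / (7 * z)) = 343 * z ^ 6 * eis_bracket z"
proof -
 define e where "e = - (\<i> * complex_of_real (sqrt 7))"
 have z0: "z \<noteq> 0" using z by auto
 have e2: "e ^ 2 = - 7" by (simp add: e_def power_mult_distrib flip: of_real_power)
 have "e ^ 4 = (e ^ 2) ^ 2" by (simp add: power_mult[symmetric])
 hence e4: "e ^ 4 = 49" unfolding e2 by simp
 have "(eis7 (- 1 / (7 * z)) * deriv eis_prod (- 1 / (7 * z)) - 3 * eis_prod (- 1 / (7 * z)) * deriv eis7 (- 1 / (7 * z))) * (1 / (7 * z ^ 2))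
   = e ^ 4 * z ^ 4 * (eis7 z * deriv eis_prod z - 3 * eis_prod z * deriv eis7 z)"
 proof (rule bracket_transform[where z = z and g = "\<lambda>z. - 1 / (7 * z)" and u = eis7 and v = eis_prod and j = "\<lambda>z. z" and j' = 1,
    OF z _ Im_Fricke_pos[OF z] eis7_has_derivative[OF z] eis7_has_derivative[OF Im_Fricke_pos[OF z]]
    eis_prod_has_derivative[OF z] eis_prod_has_derivative[OF Im_Fricke_pos[OF z]]])
  show "((\<lambda>z. - 1 / (7 * z)) has_field_derivative 1 / (7 * z\<^sup>2)) (at z)"
   using z0 by (auto intro!: derivative_eq_intros simp: power2_eq_square)
 qed (use eis7_Fricke eis_prod_Fricke in \<open>auto simp: e_def\<close>)
 hence "eis7 (- 1 / (7 * z)) * deriv eis_prod (- 1 / (7 * z)) - 3 * eis_prod (- 1 / (7 * z)) * deriv eis7 (- 1 / (7 * z))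
   = (e ^ 4 * z ^ 4 * (eis7 z * deriv eis_prod z - 3 * eis_prod z * deriv eis7 z)) * (7 * z ^ 2)"
  using z0 by (simp only: times_divide_eq_right mult_1_right) (simp add: divide_eq_eq)
 also have "\<dots> = 343 * z ^ 6 * (eis7 z * deriv eis_prod z - 3 * eis_prod z * deriv eis7 z)"
  unfolding e4 by (simp add: power_numeral_reduce)
 finally show ?thesis by (simp add: eis_bracket_eq)
qed

lemma coeffs_upto_8_numeral: "coeffs_upto_8 F xs \<Longrightarrow> coeffs_upto_8 (numeral k * F) (scale_8 (numeral k) xs)"
 using coeffs_upto_8_scale[of F xs "numeral k"] by (simp add: numeral_fps_const)

text \<open>The quotient of \<open>eis_prod\<close> by E^3 is a coordinate on the quotient of X_0(7)
  by the Fricke involution, and the bracket is the numerator of its derivative. Divided by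
  \<open>eis_prod\<close> times E^3 the bracket changes sign under the involution, so its square is
  rational in the coordinate; the two cubic factors belong to the two fixed points of the
  involution.\<close>

theorem eis_differential_equation:
 assumes z: "Im z > 0"
 shows "16 * eis_bracket z ^ 2 = eis_prod z ^ 2 * ((4 * eis7 z ^ 3 - 27 * eis_prod z) * (4 * eis7 z ^ 3 + eis_prod z))"
proof -
 define f where "f = (\<lambda>z. 16 * (eis_bracket z * eis_bracket z) - (eis_prod z * eis_prod z) *
   ((4 * (eis7 z * (eis7 z * eis7 z)) - 27 * eis_prod z) * (4 * (eis7 z * (eis7 z * eis7 z)) + eis_prod z)))"
 define A P B where "A = eis7_fps 1" and "P = eis_prod_fps"
  and "B = A * (fps_X * fps_deriv P) - 3 * (P * (fps_X * fps_deriv A))"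
 define F where "F = 16 * (B * B) - (P * P) * ((4 * (A * (A * A)) - 27 * P) * (4 * (A * (A * A)) + P))"
 have B: "q_series eis_bracket B"
  unfolding eis_bracket_def[abs_def] B_def A_def P_def
  by (intro q_series_diff q_series_mult q_series_numeral q_series_deriv q_series_eis7 q_series_eis_prod)
 have F: "q_series f F"
  unfolding f_def F_def A_def P_def
  by (intro q_series_diff q_series_add q_series_mult q_series_numeral B q_series_eis7 q_series_eis_prod)
 define a b where "a = [1, 2, 4, 0, 6, 0, 0, 2 :: int]" and "b = [1, 0, 2, 0, 4, 0, 0, 0 :: int]"
 define p where "p = mult_8 (diff_8 (scale_8 2 a) (scale_8 2 b)) (mult_8 (diff_8 a (scale_8 2 b)) (diff_8 a (scale_8 2 b)))"
 define c where "c = diff_8 (mult_8 a (deriv_8 p)) (scale_8 3 (mult_8 p (deriv_8 a)))"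
 define r where "r = diff_8 (scale_8 16 (mult_8 c c)) (mult_8 (mult_8 p p)
  (mult_8 (diff_8 (scale_8 4 (mult_8 a (mult_8 a a))) (scale_8 27 p)) (add_8 (scale_8 4 (mult_8 a (mult_8 a a))) p)))"
 have cA: "coeffs_upto_8 A a" unfolding A_def a_def by (rule coeffs_upto_8_eis7)
 have cP: "coeffs_upto_8 P p" unfolding P_def p_def eis_prod_fps_def a_def b_def
  by (intro coeffs_upto_8_mult coeffs_upto_8_diff coeffs_upto_8_numeral coeffs_upto_8_eis7 coeffs_upto_8_eis7_2)
 have cB: "coeffs_upto_8 B c" unfolding B_def c_def
  by (intro coeffs_upto_8_mult coeffs_upto_8_diff coeffs_upto_8_numeral coeffs_upto_8_deriv cA cP)
 have cF: "coeffs_upto_8 F r" unfolding F_def r_def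
  by (intro coeffs_upto_8_mult coeffs_upto_8_diff coeffs_upto_8_add coeffs_upto_8_numeral cA cP cB)
 have pv: "p = [0, 4, - 12, 0, 20, 0, 0, - 28]" unfolding p_def a_def b_def by code_simp
 \<comment> \<open>The evaluation that proves the identity: all coefficients up to the seventh power
   of q vanish.\<close>
 have r0: "r = [0, 0, 0, 0, 0, 0, 0, 0]" unfolding r_def c_def pv a_def by code_simp
 have scale: "16 * (y * r * (y * r)) - x ^ 3 * p * (x ^ 3 * p) * ((4 * (x * a * (x * a * (x * a))) - 27 * (x ^ 3 * p)) * (4 * (x * a * (x * a * (x * a))) + x ^ 3 * p))
   = x ^ 12 * (16 * (r * r) - p * p * ((4 * (a * (a * a)) - 27 * p) * (4 * (a * (a * a)) + p)))"
  if "x ^ 12 = y * y" for x y r p a :: complex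
 proof -
  have 1: "x * a * (x * a * (x * a)) = x ^ 3 * (a * (a * a))" by (simp add: power3_eq_cube)
  have 2: "x ^ 12 = x ^ 3 * x ^ 3 * (x ^ 3 * x ^ 3)" by (simp add: power_add[symmetric])
  have "y * r * (y * r) = (y * y) * (r * r)" by (simp only: mult_ac)
  hence 3: "y * r * (y * r) = x ^ 3 * x ^ 3 * (x ^ 3 * x ^ 3) * (r * r)" by (simp only: 2 that[symmetric])
  have "16 * (u * u * (u * u) * s) - u * p * (u * p) * ((4 * (u * b) - 27 * (u * p)) * (4 * (u * b) + u * p))
    = u * u * (u * u) * (16 * s - p * p * ((4 * b - 27 * p) * (4 * b + p)))" for u s b :: complex
  proof -
   have "4 * (u * b) - 27 * (u * p) = u * (4 * b - 27 * p)" "4 * (u * b) + u * p = u * (4 * b + p)"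
    by (simp_all add: algebra_simps)
   thus ?thesis by (simp only: right_diff_distrib mult_ac)
  qed
  thus ?thesis unfolding 1 2 3 .
 qed
 have "f z = 0"
 proof (rule Fricke_form_eq_0[OF F, where m = 8 and l = 6])
  show "fps_nth F n = 0" if "n < 8" for n
   using that cF unfolding coeffs_upto_8_def r0 by (cases n rule: less_8_cases) auto
  show "norm (f (moebius a b c d z)) = norm (of_int c * z + of_int d) ^ (2 * 6) * norm (f z)"
   if g: "a * d - b * c = 1" "7 dvd c" "Im z > 0" for a b c d :: int and z
  proof -
   define e J where "e = (of_int (chi7 d) :: complex)" and "J = of_int c * z + of_int d"
   have "e ^ 2 = 1"
    using chi7_square[OF Gamma0_7_not_dvd[OF g(1,2)]] unfolding e_def by (metis of_int_1 of_int_power)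
   moreover have "(e * J) ^ 12 = (e ^ 2) ^ 6 * J ^ 12" by (simp add: power_mult[symmetric] power_mult_distrib)
   ultimately have eJ: "(e * J) ^ 12 = J ^ 6 * J ^ 6" by (simp add: power_add[symmetric])
   have "f (moebius a b c d z) = (e * J) ^ 12 * f z"
    unfolding f_def eis_bracket_moebius[OF g, folded J_def] eis_prod_moebius[OF g, folded J_def e_def] eis7_Gamma0[OF g, folded J_def e_def]
    by (rule scale[OF eJ])
   thus ?thesis unfolding eJ by (simp add: norm_mult norm_power J_def power_add[symmetric])
  qed
  show "norm (f (- 1 / (7 * z))) = 7 ^ 6 * norm z ^ (2 * 6) * norm (f z)" if z: "Im z > 0" for z
  proof -
   define J where "J = - (\<i> * of_real (sqrt 7)) * z"
   have J2: "J ^ 2 = - 7 * z ^ 2" by (simp add: J_def power_mult_distrib flip: of_real_power)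
   have "J ^ 12 = (J ^ 2) ^ 6" by (simp add: power_mult[symmetric])
   also have "\<dots> = (343 * z ^ 6) * (343 * z ^ 6)" unfolding J2 by (simp add: power_mult_distrib power_mult[symmetric] power_add[symmetric])
   finally have J12: "J ^ 12 = (343 * z ^ 6) * (343 * z ^ 6)" .
   have "f (- 1 / (7 * z)) = J ^ 12 * f z"
    unfolding f_def eis_bracket_Fricke[OF z] eis_prod_Fricke[OF z, folded J_def] eis7_Fricke[OF z, folded J_def]
    by (rule scale[OF J12])
   thus ?thesis unfolding J12 by (simp add: norm_mult norm_power power_add[symmetric])
  qed
  \<comment> \<open>The requirement is 6 < 16 pi sqrt 3 / 14, about 6.2. It is narrow: with seven
    coefficients it would fail.\<close>
  have "sqrt 3 \<ge> 173 / 100" by (rule real_le_rsqrt) (simp add: power2_eq_square)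
  moreover have "pi \<ge> 314 / 100" using pi_approx by (simp add: abs_if split: if_splits)
  ultimately have "314 / 100 * (173 / 100) \<le> pi * sqrt 3" by (intro mult_mono) auto
  thus "real 6 < 2 * pi * real 8 * (sqrt 3 / 14)" by simp
 qed (rule z)
 thus ?thesis by (simp only: f_def right_minus_eq power2_eq_square power3_eq_cube mult.assoc)
qed

section \<open>The Hauptmodul\<close>

definition haupt_den :: "complex \<Rightarrow> complex" where "haupt_den z = (eis7 z - eis7 (2 * z)) / 2"
definition haupt_num :: "complex \<Rightarrow> complex" where "haupt_num z = (eis7 (z / 2) - 2 * eis7 z + eis7 (2 * z)) / 2"
definition haupt :: "complex \<Rightarrow> complex" where "haupt = remove_sings (\<lambda>z. haupt_num z / haupt_den z)"

text \<open>The quadratic relation, with \<open>eis_1\<close> eliminated, is a conic in E(z/2),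
  E(z), E(2 z). In these coordinates it passes through the point where \<open>haupt_num\<close> and
  \<open>haupt_den\<close> vanish, and projection from that point parametrises it by their quotient
  h.\<close>

lemma haupt_conic:
 assumes "Im z > 0"
 shows "haupt_num z ^ 2 = haupt_den z * (eis7 z - 3 * haupt_den z)"
proof -
 have e1: "eis_1 z = 4 * eis7 z - eis_inf z - eis_0 z" using eis_sum[OF assms] by (simp add: algebra_simps)
 have "8 * (haupt_num z ^ 2 - haupt_den z * (eis7 z - 3 * haupt_den z)) = eis_inf z ^ 2 + eis_0 z ^ 2 + eis_1 z ^ 2 - 6 * eis7 z ^ 2"
  unfolding e1 haupt_num_def haupt_den_def eis_0_def eis_inf_def by (simp add: power2_eq_square field_simps)
 thus ?thesis unfolding eis_sum_squares[OF assms] by simp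
qed

lemma eis_prod_haupt:
 assumes "Im z > 0"
 shows "eis_prod z = 4 * haupt_den z * (eis7 z - 4 * haupt_den z) ^ 2"
 by (simp add: eis_prod_def eis_inf_def haupt_den_def power2_eq_square field_simps)

lemma connected_upper: "connected {z. Im z > 0}"
 by (intro convex_connected convex_halfspace_Im_gt)

lemma q_series_unique:
 assumes F: "q_series f F" and G: "q_series f G"
 shows "F = G"
proof -
 have pos: "fps_conv_radius F > 0" "fps_conv_radius G > 0"
  using F G by (auto simp: q_series_def intro: less_le_trans[of 0 1])
 have "eval_fps F has_laurent_expansion fps_to_fls F" "eval_fps G has_laurent_expansion fps_to_fls G"
  using pos by (auto intro!: has_laurent_expansion_fps eval_fps_has_fps_expansion)
 moreover have "\<forall>\<^sub>F q in at 0. eval_fps F q = eval_fps G q"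
 proof -
  have "\<forall>\<^sub>F q in at (0 :: complex). q \<in> ball 0 1 - {0}" by (intro eventually_at_in_open) auto
  thus ?thesis
  proof eventually_elim
   case (elim q)
   define z where "z = Ln q / (2 * of_real pi * \<i>)"
   have q: "nome z = q" using elim by (simp add: nome_def z_def)
   hence "exp (- 2 * pi * Im z) < 1" using elim norm_nome[of z] by simp
   hence "Im z > 0" by (simp add: zero_less_mult_iff)
   thus ?case using F G q by (auto simp: q_series_def)
  qed
 qed
 ultimately have "fps_to_fls F = fps_to_fls G"
  using has_laurent_expansion_cong has_laurent_expansion_unique by metis
 thus ?thesis by simp
qed

lemma eis7_minus_double_not_0: "\<exists>z. Im z > 0 \<and> haupt_den z \<noteq> 0"
proof (rule ccontr)
 assume "\<not> ?thesis"
 hence den: "haupt_den z = 0" if "Im z > 0" for z using that by blast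
 have "q_series (\<lambda>z. eis7 z - eis7 (2 * z)) 0"
  unfolding q_series_def
 proof safe
  fix z assume "Im z > 0"
  from den[OF this] show "eis7 z - eis7 (2 * z) = eval_fps 0 (nome z)" by (simp add: haupt_den_def)
 qed simp
 from q_series_unique[OF this q_series_diff[OF q_series_eis7 q_series_eis7_2]]
 have "eis7_fps 1 - eis7_fps 2 = 0" by simp
 hence "fps_nth (eis7_fps 1 - eis7_fps 2) 1 = 0" by simp
 thus False by (simp add: eis7_fps_def eis7_coeff_values[unfolded One_nat_def])
qed

lemma eis7_comp_holomorphic:
 assumes "f holomorphic_on A" "\<And>z. z \<in> A \<Longrightarrow> Im (f z) > 0"
 shows "(\<lambda>z. eis7 (f z)) holomorphic_on A"
 using holomorphic_on_compose_gen[OF assms(1) eis7_holomorphic] assms(2)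
 by (auto simp: o_def upper_half_plane_def)

lemma haupt_den_holomorphic: "haupt_den holomorphic_on {z. Im z > 0}"
 unfolding haupt_den_def[abs_def] by (intro holomorphic_intros eis7_comp_holomorphic) auto

lemma haupt_num_holomorphic: "haupt_num holomorphic_on {z. Im z > 0}"
 unfolding haupt_num_def[abs_def] by (intro holomorphic_intros eis7_comp_holomorphic) auto

lemma eventually_haupt_den_nonzero:
 assumes "Im z > 0"
 shows "\<forall>\<^sub>F w in at z. haupt_den w \<noteq> 0 \<and> Im w > 0"
 using eis7_minus_double_not_0 non_zero_neighbour_alt[OF haupt_den_holomorphic open_upper connected_upper, of z] assms
 by auto

lemma analytic_at_upper: "f holomorphic_on {z. Im z > 0} \<Longrightarrow> Im z > 0 \<Longrightarrow> f analytic_on {z}"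
 using holomorphic_on_imp_analytic_at[OF _ open_upper] by simp

definition haupt_sextic :: "complex \<Rightarrow> complex" where
 "haupt_sextic h = (7 + h ^ 2) * (2 - h + h ^ 2) * (2 + h + h ^ 2)"

lemma haupt_quotient_has_derivative:
 assumes "Im z > 0" "haupt_den z \<noteq> 0"
 shows "((\<lambda>z. haupt_num z / haupt_den z) has_field_derivative deriv (\<lambda>z. haupt_num z / haupt_den z) z) (at z)"
proof -
 have "(\<lambda>z. haupt_num z / haupt_den z) analytic_on {z}"
  using assms analytic_at_upper haupt_num_holomorphic haupt_den_holomorphic by (intro analytic_intros) auto
 thus ?thesis using analytic_on_imp_differentiable_at DERIV_deriv_iff_field_differentiable by blast
qed

text \<open>With b = \<open>haupt_den z\<close>, the conic gives E = b (h^2 + 3), hence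
  \<open>eis_prod\<close> = 4 b^3 (h^2 - 1)^2. In the differential equation 4 E^3 - 27
  \<open>eis_prod\<close> becomes 4 b^3 h^2 (h^2 - 9)^2, a square up to b^3, and cancels against the
  bracket. Only the other factor survives, and it is the sextic. The excluded values of h are those
  where the cancelled factors vanish.\<close>

lemma haupt_quotient_ode:
 fixes z :: complex
 defines "h \<equiv> (\<lambda>z. haupt_num z / haupt_den z)"
 assumes z: "Im z > 0" and B: "haupt_den z \<noteq> 0"
  and ne: "h z \<noteq> 0" "h z ^ 2 \<noteq> 1" "h z ^ 2 \<noteq> 9"
 shows "4 * deriv h z ^ 2 = (2 * of_real pi * \<i>) ^ 2 * haupt_den z ^ 4 * (h z ^ 2 - 1) ^ 2 * haupt_sextic (h z)"
proof -
 define c :: complex where "c = 2 * of_real pi * \<i>"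
 have c0: "c \<noteq> 0" by (simp add: c_def)
 define S where "S = {z. Im z > 0} \<inter> {z. haupt_den z \<noteq> 0}"
 have "open S"
 proof -
  have "continuous_on {z. Im z > 0} haupt_den" by (intro holomorphic_on_imp_continuous_on haupt_den_holomorphic)
  hence "open ({z. Im z > 0} \<inter> haupt_den -` (- {0}))"
   by (rule continuous_open_preimage[OF _ open_upper open_Compl[OF closed_singleton]])
  moreover have "S = {z. Im z > 0} \<inter> haupt_den -` (- {0})" by (auto simp: S_def)
  ultimately show ?thesis by simp
 qed
 have zS: "z \<in> S" using z B by (simp add: S_def)
 have conic: "eis7 w = haupt_den w * (h w ^ 2 + 3)" if "w \<in> S" for w
 proof -
  have "haupt_den w \<noteq> 0" "Im w > 0" using that by (auto simp: S_def)
  thus ?thesis using haupt_conic[of w] unfolding h_def by (simp add: power_divide field_simps power2_eq_square)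
 qed
 have prod: "eis_prod w = 4 * haupt_den w ^ 3 * (h w ^ 2 - 1) ^ 2" if "w \<in> S" for w
  using that conic[OF that] eis_prod_haupt[of w] by (simp add: S_def power2_eq_square power3_eq_cube algebra_simps)
 define B' h' where "B' = deriv haupt_den z" and "h' = deriv h z"
 have dB: "(haupt_den has_field_derivative B') (at z)"
  using analytic_at_upper[OF haupt_den_holomorphic z] unfolding B'_def
  using analytic_on_imp_differentiable_at DERIV_deriv_iff_field_differentiable by blast
 have dh: "(h has_field_derivative h') (at z)"
  using haupt_quotient_has_derivative[OF z B] by (simp add: h_def h'_def)
 have "((\<lambda>w. haupt_den w * (h w ^ 2 + 3)) has_field_derivative B' * (h z ^ 2 + 3) + haupt_den z * (2 * h z * h')) (at z)"
  by (rule derivative_eq_intros dB dh refl | simp)+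
 from has_field_derivative_transform_within_open[OF this \<open>open S\<close> zS, of eis7] conic
 have "(eis7 has_field_derivative B' * (h z ^ 2 + 3) + haupt_den z * (2 * h z * h')) (at z)" by simp
 hence d1: "deriv eis7 z = B' * (h z ^ 2 + 3) + haupt_den z * (2 * h z * h')" by (rule DERIV_imp_deriv)
 have "((\<lambda>w. 4 * haupt_den w ^ 3 * (h w ^ 2 - 1) ^ 2) has_field_derivative
   12 * haupt_den z ^ 2 * B' * (h z ^ 2 - 1) ^ 2 + 4 * haupt_den z ^ 3 * (2 * (h z ^ 2 - 1) * (2 * h z * h'))) (at z)"
  by (rule derivative_eq_intros dB dh refl | simp)+
 from has_field_derivative_transform_within_open[OF this \<open>open S\<close> zS, of eis_prod] prod
 have "(eis_prod has_field_derivative 12 * haupt_den z ^ 2 * B' * (h z ^ 2 - 1) ^ 2 + 4 * haupt_den z ^ 3 * (2 * (h z ^ 2 - 1) * (2 * h z * h'))) (at z)"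
  by simp
 hence d2: "deriv eis_prod z = 12 * haupt_den z ^ 2 * B' * (h z ^ 2 - 1) ^ 2 + 4 * haupt_den z ^ 3 * (2 * (h z ^ 2 - 1) * (2 * h z * h'))"
  by (rule DERIV_imp_deriv)
 define b H where "b = haupt_den z" and "H = h z"
 have "c * eis_bracket z = eis7 z * deriv eis_prod z - 3 * eis_prod z * deriv eis7 z"
  using c0 by (simp add: eis_bracket_eq c_def)
 also have "\<dots> = 8 * b ^ 4 * H * (H ^ 2 - 1) * (9 - H ^ 2) * h'"
  unfolding d1 d2 conic[OF zS] prod[OF zS] b_def[symmetric] H_def[symmetric]
  by (simp add: power_numeral_reduce algebra_simps)
 finally have br: "c * eis_bracket z = 8 * b ^ 4 * H * (H ^ 2 - 1) * (9 - H ^ 2) * h'" .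
 have f1: "4 * eis7 z ^ 3 - 27 * eis_prod z = 4 * b ^ 3 * (H ^ 2 * (H ^ 2 - 9) ^ 2)"
  unfolding conic[OF zS] prod[OF zS] b_def[symmetric] H_def[symmetric]
  by (simp add: power_numeral_reduce algebra_simps)
 have f2: "4 * eis7 z ^ 3 + eis_prod z = 4 * b ^ 3 * haupt_sextic H"
  unfolding conic[OF zS] prod[OF zS] b_def[symmetric] H_def[symmetric] haupt_sextic_def
  by (simp add: power_numeral_reduce algebra_simps)
 define K where "K = 256 * b ^ 8 * H ^ 2 * (H ^ 2 - 1) ^ 2 * (H ^ 2 - 9) ^ 2"
 have "K \<noteq> 0" using B ne by (simp add: K_def b_def H_def)
 have "16 * (c * eis_bracket z) ^ 2 = c ^ 2 * (16 * eis_bracket z ^ 2)" by (simp add: power_mult_distrib)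
 also have "\<dots> = c ^ 2 * ((4 * b ^ 3 * (H ^ 2 - 1) ^ 2) ^ 2 * ((4 * b ^ 3 * (H ^ 2 * (H ^ 2 - 9) ^ 2)) * (4 * b ^ 3 * haupt_sextic H)))"
  unfolding eis_differential_equation[OF z] f1 f2 unfolding prod[OF zS] b_def H_def ..
 also have "\<dots> = K * (c ^ 2 * b ^ 4 * (H ^ 2 - 1) ^ 2 * haupt_sextic H)"
 proof -
  have A: "k * ((4 * b ^ 3 * u) ^ 2 * ((4 * b ^ 3 * (v * r)) * (4 * b ^ 3 * s))) = 256 * b ^ 8 * v * u * r * (k * b ^ 4 * u * s)"
   for k u v r s by (simp add: power_numeral_reduce mult_ac)
  show ?thesis unfolding K_def by (rule A)
 qed
 finally have e1: "16 * (c * eis_bracket z) ^ 2 = K * (c ^ 2 * b ^ 4 * (H ^ 2 - 1) ^ 2 * haupt_sextic H)" .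
 have "(9 - H ^ 2) ^ 2 = (H ^ 2 - 9) ^ 2" by (rule power2_commute)
 hence "16 * (c * eis_bracket z) ^ 2 = K * (4 * h' ^ 2)"
  unfolding br K_def by (simp add: power_mult_distrib power_mult[symmetric])
 with e1 \<open>K \<noteq> 0\<close> have "4 * h' ^ 2 = c ^ 2 * b ^ 4 * (H ^ 2 - 1) ^ 2 * haupt_sextic H" by simp
 thus ?thesis by (simp add: c_def b_def H_def h'_def)
qed

lemma haupt_quotient_meromorphic: "(\<lambda>z. haupt_num z / haupt_den z) meromorphic_on {z. Im z > 0}"
 using haupt_num_holomorphic haupt_den_holomorphic
 by (intro meromorphic_intros analytic_on_imp_meromorphic_on) (simp_all add: analytic_on_open open_upper)

text \<open>
 At a pole of \<open>h\<close> the logarithmic derivative has a pole too, whereas the differential equation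
 shows that its square stays bounded.
\<close>
lemma haupt_quotient_no_pole:
 assumes z: "Im z > 0"
 shows "\<not> is_pole (\<lambda>z. haupt_num z / haupt_den z) z"
proof
 define h where "h = (\<lambda>z. haupt_num z / haupt_den z)"
 define c :: complex where "c = 2 * of_real pi * \<i>"
 assume "is_pole (\<lambda>z. haupt_num z / haupt_den z) z"
 hence pole: "is_pole h z" by (simp add: h_def)
 have "h meromorphic_on {z}"
  using z unfolding h_def by (intro meromorphic_on_subset[OF haupt_quotient_meromorphic]) auto
 then obtain F where F: "(\<lambda>w. h (z + w)) has_laurent_expansion F" by (auto simp: meromorphic_on_def)
 have "F \<noteq> 0"
 proof
  assume "F = 0"
  hence "fls_subdegree F = 0" by simp
  thus False using is_pole_fls_subdegree_iff[OF F] pole by simp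
 qed
 hence "is_pole (\<lambda>w. deriv h w / h w) z" using is_pole_deriv_divide_iff[OF F] pole by simp
 hence inf1: "filterlim (\<lambda>w. (deriv h w / h w) ^ 2) at_infinity (at z)"
  unfolding is_pole_def by (intro Limits.filterlim_power_at_infinity) auto
 have inf2: "filterlim h at_infinity (at z)" using pole by (simp add: is_pole_def)
 define u where "u = (\<lambda>w. inverse (h w))"
 have u: "(u \<longlongrightarrow> 0) (at z)" unfolding u_def by (rule filterlim_compose[OF tendsto_inverse_0 inf2])
 \<comment> \<open>The right-hand side of the differential equation divided by 4 h^2, rewritten in u
   = 1/h after replacing \<open>haupt_den\<close> by E / (h^2 + 3). Numerator and denominator have
   equal degree in h, so it stays finite as u tends to 0.\<close>
 define R where "R = (\<lambda>w. c ^ 2 / 4 * eis7 w ^ 4 * ((1 - u w ^ 2) ^ 2 * ((7 * u w ^ 2 + 1) * (2 * u w ^ 2 - u w + 1) * (2 * u w ^ 2 + u w + 1)) / (1 + 3 * u w ^ 2) ^ 4))"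
 have "isCont eis7 z" using analytic_at_upper[of eis7 z] eis7_holomorphic z
  by (intro analytic_at_imp_isCont) (simp add: upper_half_plane_def)
 hence "(eis7 \<longlongrightarrow> eis7 z) (at z)" by (simp add: isCont_def)
 hence "(R \<longlongrightarrow> c ^ 2 / 4 * eis7 z ^ 4 * ((1 - 0 ^ 2) ^ 2 * ((7 * 0 ^ 2 + 1) * (2 * 0 ^ 2 - 0 + 1) * (2 * 0 ^ 2 + 0 + 1)) / (1 + 3 * 0 ^ 2) ^ 4)) (at z)"
  unfolding R_def by (intro tendsto_intros u) auto
 moreover have "\<forall>\<^sub>F w in at z. (deriv h w / h w) ^ 2 = R w"
 proof -
  have "\<forall>\<^sub>F w in at z. norm (h w) \<ge> 4" using inf2 unfolding filterlim_at_infinity[OF order_refl] by auto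
  with eventually_haupt_den_nonzero[OF z] show ?thesis
  proof eventually_elim
   case (elim w)
   define H where "H = h w"
   have nH: "norm H \<ge> 4" using elim by (simp add: H_def)
   have "4 * 4 \<le> norm H * norm H" by (intro mult_mono nH) auto
   hence n2: "norm (H ^ 2) \<ge> 16" by (simp add: norm_mult power2_eq_square)
   have ne: "H \<noteq> 0" "H ^ 2 \<noteq> 1" "H ^ 2 \<noteq> 9" "H ^ 2 + 3 \<noteq> 0" using nH n2 by (auto simp: eq_neg_iff_add_eq_0[symmetric])
   have ode: "4 * deriv h w ^ 2 = c ^ 2 * haupt_den w ^ 4 * (H ^ 2 - 1) ^ 2 * haupt_sextic H"
    using haupt_quotient_ode[of w] elim ne unfolding c_def H_def h_def by simp
   have v: "haupt_den w = eis7 w / (H ^ 2 + 3)"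
   proof -
    have "eis7 w = haupt_den w * (H ^ 2 + 3)"
     using haupt_conic[of w] elim unfolding H_def h_def by (simp add: power_divide field_simps power2_eq_square)
    thus ?thesis using ne by simp
   qed
   have uw: "u w = 1 / H" by (simp add: u_def H_def inverse_eq_divide)
   have 1: "1 + 3 * u w ^ 2 = (H ^ 2 + 3) / H ^ 2" "1 - u w ^ 2 = (H ^ 2 - 1) / H ^ 2" "7 * u w ^ 2 + 1 = (7 + H ^ 2) / H ^ 2"
     "2 * u w ^ 2 - u w + 1 = (2 - H + H ^ 2) / H ^ 2" "2 * u w ^ 2 + u w + 1 = (2 + H + H ^ 2) / H ^ 2"
    unfolding uw using ne by (simp_all add: field_simps power2_eq_square)
   have "R w = c ^ 2 / 4 * eis7 w ^ 4 * ((H ^ 2 - 1) ^ 2 * haupt_sextic H / (H ^ 2 * (H ^ 2 + 3) ^ 4))"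
   proof -
    have gen: "(A / Q) ^ 2 * ((p / Q) * (q / Q) * (r / Q)) / (S / Q) ^ 4 = A ^ 2 * (p * q * r) / (Q * S ^ 4)"
     if "Q \<noteq> 0" "S \<noteq> 0" for A Q p q r S :: complex
     using that by (simp add: power_divide divide_simps) (simp add: power_numeral_reduce)
    show ?thesis unfolding R_def 1 haupt_sextic_def by (subst gen) (use ne in simp_all)
   qed
   also have "\<dots> = (c ^ 2 * haupt_den w ^ 4 * (H ^ 2 - 1) ^ 2 * haupt_sextic H) / (4 * H ^ 2)"
    unfolding v using ne by (simp add: power_divide mult_ac)
   also have "\<dots> = (deriv h w / H) ^ 2" unfolding ode[symmetric] using ne by (simp add: power_divide)
   finally show ?case by (simp add: H_def)
  qed
 qed
 ultimately have "((\<lambda>w. (deriv h w / h w) ^ 2) \<longlongrightarrow> c ^ 2 / 4 * eis7 z ^ 4 * ((1 - 0 ^ 2) ^ 2 * ((7 * 0 ^ 2 + 1) * (2 * 0 ^ 2 - 0 + 1) * (2 * 0 ^ 2 + 0 + 1)) / (1 + 3 * 0 ^ 2) ^ 4)) (at z)"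
  by (rule tendsto_cong[THEN iffD2, rotated])
 thus False using inf1 not_tendsto_and_filterlim_at_infinity[of "at z"] by auto
qed

lemma haupt_holomorphic: "haupt holomorphic_on {z. Im z > 0}"
proof -
 have "haupt nicely_meromorphic_on {z. Im z > 0}"
  unfolding haupt_def by (intro remove_sings_nicely_meromorphic haupt_quotient_meromorphic)
 moreover have "\<not> is_pole haupt z" if "Im z > 0" for z
 proof -
  have "(\<lambda>z. haupt_num z / haupt_den z) meromorphic_on {z}"
   using haupt_quotient_meromorphic by (rule meromorphic_on_subset) (use that in auto)
  thus ?thesis using haupt_quotient_no_pole[OF that] unfolding haupt_def meromorphic_at_iff
   by (simp add: is_pole_remove_sings_iff)
 qed
 ultimately have "haupt analytic_on {z. Im z > 0}"
  by (intro nicely_meromorphic_without_singularities) auto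
 thus ?thesis by (rule analytic_imp_holomorphic)
qed

lemma haupt_eq:
 assumes "Im z > 0" "haupt_den z \<noteq> 0"
 shows "haupt z = haupt_num z / haupt_den z"
 unfolding haupt_def using assms analytic_at_upper haupt_num_holomorphic haupt_den_holomorphic
 by (intro remove_sings_at_analytic analytic_intros) auto

section \<open>Identities for h, extended by continuity\<close>

lemma upper_eqI:
 fixes f g :: "complex \<Rightarrow> complex"
 assumes "continuous_on {z. Im z > 0} f" "continuous_on {z. Im z > 0} g"
  and ev: "\<And>z. Im z > 0 \<Longrightarrow> \<forall>\<^sub>F w in at z. f w = g w" and z: "Im z > 0"
 shows "f z = g z"
proof -
 have "isCont f z" "isCont g z" using assms(1,2) z by (auto simp: continuous_on_eq_continuous_at[OF open_upper])
 hence "(f \<longlongrightarrow> f z) (at z)" "(g \<longlongrightarrow> g z) (at z)" by (auto simp: isCont_def)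
 moreover from this(1) have "(g \<longlongrightarrow> f z) (at z)" using tendsto_cong[OF ev[OF z]] by blast
 ultimately show ?thesis using tendsto_unique[of "at z"] by auto
qed

lemma upper_eqI':
 fixes f g :: "complex \<Rightarrow> complex"
 assumes "f holomorphic_on {z. Im z > 0}" "g holomorphic_on {z. Im z > 0}"
  and eq: "\<And>z. Im z > 0 \<Longrightarrow> haupt_den z \<noteq> 0 \<Longrightarrow> f z = g z" and z: "Im z > 0"
 shows "f z = g z"
proof (rule upper_eqI[OF _ _ _ z])
 show "\<forall>\<^sub>F w in at z. f w = g w" if "Im z > 0" for z
  using eventually_haupt_den_nonzero[OF that] by eventually_elim (use eq in auto)
qed (use assms in \<open>auto intro: holomorphic_on_imp_continuous_on\<close>)

lemma haupt_times_den: "Im z > 0 \<Longrightarrow> haupt z * haupt_den z = haupt_num z"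
 by (rule upper_eqI') (auto intro!: holomorphic_intros haupt_holomorphic haupt_den_holomorphic haupt_num_holomorphic simp: haupt_eq)

lemma eis7_eq_haupt:
 assumes z: "Im z > 0"
 shows "eis7 z = haupt_den z * (haupt z ^ 2 + 3)"
proof (rule upper_eqI'[OF _ _ _ z])
 fix z assume z: "Im z > 0" "haupt_den z \<noteq> 0"
 have "haupt_den z * eis7 z = haupt_num z ^ 2 + 3 * haupt_den z ^ 2"
  using haupt_conic[OF z(1)] by (simp add: algebra_simps power2_eq_square)
 also have "\<dots> = haupt_den z * (haupt_den z * (haupt z ^ 2 + 3))"
  unfolding haupt_times_den[OF z(1), symmetric] by (simp add: algebra_simps power2_eq_square)
 finally show "eis7 z = haupt_den z * (haupt z ^ 2 + 3)" using z(2) by simp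
qed (use eis7_holomorphic in \<open>auto intro!: holomorphic_intros haupt_holomorphic haupt_den_holomorphic simp: upper_half_plane_def\<close>)

text \<open>Both h(z) and h(2 z) express E(2 z): it is b (h^2 + 1) and also b' (x^2 + 3), while the
  denominators satisfy b = b' (x + 1). Multiplied by x + 1, the right-hand side becomes x^3 + x + 2,
  the cubic of the curve.\<close>

lemma haupt_double_relation:
 assumes z: "Im z > 0"
 shows "haupt z ^ 2 * (haupt (2 * z) + 1) = haupt (2 * z) ^ 2 - haupt (2 * z) + 2"
proof (rule upper_eqI'[OF _ _ _ z])
 have "(haupt \<circ> (\<lambda>z. 2 * z)) holomorphic_on {z. Im z > 0}"
  by (rule holomorphic_on_compose_gen[OF _ haupt_holomorphic]) (auto intro!: holomorphic_intros)
 hence d: "(\<lambda>z. haupt (2 * z)) holomorphic_on {z. Im z > 0}" by (simp add: o_def)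
 show "(\<lambda>z. haupt z ^ 2 * (haupt (2 * z) + 1)) holomorphic_on {z. Im z > 0}"
  "(\<lambda>z. haupt (2 * z) ^ 2 - haupt (2 * z) + 2) holomorphic_on {z. Im z > 0}"
  by (intro holomorphic_intros haupt_holomorphic d)+
 fix z assume z: "Im z > 0" "haupt_den z \<noteq> 0"
 define h x b b' where "h = haupt z" and "x = haupt (2 * z)" and "b = haupt_den z" and "b' = haupt_den (2 * z)"
 have z2: "Im (2 * z) > 0" using z by simp
 have 1: "eis7 z = b * (h ^ 2 + 3)" "eis7 (2 * z) = b * (h ^ 2 + 1)"
  using eis7_eq_haupt[OF z(1)] by (auto simp: b_def h_def haupt_den_def algebra_simps)
 have 2: "eis7 (2 * z) = b' * (x ^ 2 + 3)"
  using eis7_eq_haupt[OF z2] by (simp add: b'_def x_def)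
 have e4: "eis7 (2 * (2 * z)) = eis7 (2 * z) - 2 * b'" by (simp add: b'_def haupt_den_def)
 have "x * b' = (eis7 z - 2 * eis7 (2 * z) + eis7 (2 * (2 * z))) / 2"
  using haupt_times_den[OF z2] by (simp add: b'_def x_def haupt_num_def)
 hence "2 * (x * b') = eis7 z - 2 * eis7 (2 * z) + eis7 (2 * (2 * z))" by (simp only:) simp
 hence "eis7 z = 2 * (x * b') + eis7 (2 * z) + 2 * b'" unfolding e4 by (simp add: algebra_simps)
 hence 3: "eis7 z = b' * (x ^ 2 + 2 * x + 5)" unfolding 2 by (simp add: algebra_simps)
 have "2 * b = eis7 z - eis7 (2 * z)" by (simp add: b_def haupt_den_def)
 also have "\<dots> = 2 * (b' * (x + 1))" unfolding 2 3 by (simp add: algebra_simps)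
 finally have b: "b = b' * (x + 1)" by simp
 have b0: "b' \<noteq> 0" using b z by (auto simp: b_def)
 have "b' * ((x + 1) * (h ^ 2 + 1)) = eis7 (2 * z)" unfolding 1(2) by (simp add: b mult.assoc)
 also have "\<dots> = b' * (x ^ 2 + 3)" by (rule 2)
 finally have "b' * ((x + 1) * (h ^ 2 + 1)) = b' * (x ^ 2 + 3)" .
 hence "(x + 1) * (h ^ 2 + 1) = x ^ 2 + 3" using b0 by simp
 thus "haupt z ^ 2 * (haupt (2 * z) + 1) = haupt (2 * z) ^ 2 - haupt (2 * z) + 2"
  unfolding h_def[symmetric] x_def[symmetric] by (simp add: algebra_simps)
qed

section \<open>The square root of the sextic\<close>

text \<open>If h^2 were constant, E would be a multiple of E(z) - E(2 z), which has no constant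
  term.\<close>

lemma haupt_not_constant: "\<exists>z. Im z > 0 \<and> haupt z ^ 2 \<noteq> k"
proof (rule ccontr)
 assume "\<not> ?thesis"
 hence h: "haupt z ^ 2 = k" if "Im z > 0" for z using that by blast
 define k' where "k' = (k + 3) / 2"
 have "q_series (\<lambda>z. k' * (eis7 z - eis7 (2 * z))) (fps_const k' * (eis7_fps 1 - eis7_fps 2))"
  by (intro q_series_mult q_series_const q_series_diff q_series_eis7 q_series_eis7_2)
 moreover have "eis7 z = k' * (eis7 z - eis7 (2 * z))" if "Im z > 0" for z
  using eis7_eq_haupt[OF that] unfolding h[OF that] haupt_den_def k'_def by (simp add: mult.commute)
 ultimately have "q_series eis7 (fps_const k' * (eis7_fps 1 - eis7_fps 2))"
  unfolding q_series_def by metis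
 from q_series_unique[OF this q_series_eis7]
 have "fps_nth (fps_const k' * (eis7_fps 1 - eis7_fps 2)) 0 = fps_nth (eis7_fps 1) 0" by simp
 thus False by (simp add: eis7_fps_def eis7_coeff_values)
qed

lemma eventually_haupt_square_neq:
 assumes "Im z > 0"
 shows "\<forall>\<^sub>F w in at z. haupt w ^ 2 \<noteq> k"
proof -
 obtain v where "Im v > 0" "haupt v ^ 2 - k \<noteq> 0" using haupt_not_constant[of k] by auto
 moreover have "(\<lambda>z. haupt z ^ 2 - k) holomorphic_on {z. Im z > 0}" by (intro holomorphic_intros haupt_holomorphic)
 ultimately have "\<forall>\<^sub>F w in at z. haupt w ^ 2 - k \<noteq> 0 \<and> w \<in> {z. Im z > 0}"
  using assms by (intro non_zero_neighbour_alt[OF _ open_upper connected_upper]) auto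
 thus ?thesis by eventually_elim auto
qed

lemma haupt_has_derivative: "Im z > 0 \<Longrightarrow> (haupt has_field_derivative deriv haupt z) (at z)"
 using analytic_at_upper[OF haupt_holomorphic] analytic_on_imp_differentiable_at DERIV_deriv_iff_field_differentiable by blast

lemma deriv_haupt_eq:
 assumes "Im z > 0" "haupt_den z \<noteq> 0"
 shows "deriv haupt z = deriv (\<lambda>z. haupt_num z / haupt_den z) z"
 unfolding haupt_def using assms analytic_at_upper haupt_num_holomorphic haupt_den_holomorphic
 by (intro deriv_remove_sings_at_analytic analytic_intros) auto

text \<open>The derivative of h has weight 2 and so has the square of \<open>haupt_den\<close>, so
  the quotient has weight 0; by the differential equation its square is the sextic. The factor -2 is
  chosen such that t is asymptotic to h^3 at infinity.\<close>

definition haupt_t_quot :: "complex \<Rightarrow> complex" where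
 "haupt_t_quot z = - (2 * deriv haupt z) / (2 * of_real pi * \<i> * haupt_den z ^ 2 * (haupt z ^ 2 - 1))"

definition haupt_t :: "complex \<Rightarrow> complex" where "haupt_t = remove_sings haupt_t_quot"

lemma haupt_t_quot_square:
 assumes z: "Im z > 0" and ne: "haupt_den z \<noteq> 0" "haupt z ^ 2 \<noteq> 0" "haupt z ^ 2 \<noteq> 1" "haupt z ^ 2 \<noteq> 9"
 shows "haupt_t_quot z ^ 2 = haupt_sextic (haupt z)"
proof -
 define c :: complex where "c = 2 * of_real pi * \<i>"
 have c0: "c \<noteq> 0" by (simp add: c_def)
 have h: "haupt z = haupt_num z / haupt_den z" by (rule haupt_eq[OF z ne(1)])
 have "4 * deriv haupt z ^ 2 = c ^ 2 * haupt_den z ^ 4 * (haupt z ^ 2 - 1) ^ 2 * haupt_sextic (haupt z)"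
  unfolding deriv_haupt_eq[OF z ne(1)] c_def unfolding h
  by (rule haupt_quotient_ode[OF z ne(1)]) (use ne h in auto)
 moreover have "haupt_t_quot z ^ 2 = 4 * deriv haupt z ^ 2 / (c ^ 2 * haupt_den z ^ 4 * (haupt z ^ 2 - 1) ^ 2)"
  by (simp add: haupt_t_quot_def c_def power_divide power_mult_distrib power_mult[symmetric])
 ultimately show ?thesis using c0 ne by simp
qed

lemma haupt_t_quot_meromorphic: "haupt_t_quot meromorphic_on {z. Im z > 0}"
proof -
 have "deriv haupt analytic_on {z. Im z > 0}" "haupt analytic_on {z. Im z > 0}" "haupt_den analytic_on {z. Im z > 0}"
  using haupt_holomorphic haupt_den_holomorphic by (auto simp: analytic_on_open open_upper intro!: holomorphic_deriv)
 thus ?thesis unfolding haupt_t_quot_def[abs_def]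
  by (intro meromorphic_intros analytic_on_imp_meromorphic_on) auto
qed

lemma haupt_t_quot_square_eventually:
 assumes "Im z > 0"
 shows "\<forall>\<^sub>F w in at z. haupt_t_quot w ^ 2 = haupt_sextic (haupt w)"
 using eventually_haupt_den_nonzero[OF assms] eventually_haupt_square_neq[OF assms, of 0]
  eventually_haupt_square_neq[OF assms, of 1] eventually_haupt_square_neq[OF assms, of 9]
 by eventually_elim (rule haupt_t_quot_square, auto)

lemma haupt_sextic_holomorphic: "(\<lambda>z. haupt_sextic (haupt z)) holomorphic_on {z. Im z > 0}"
 unfolding haupt_sextic_def by (intro holomorphic_intros haupt_holomorphic)

text \<open>A pole would make the square unbounded, but near every point the square agrees with the
  holomorphic function \<open>haupt_sextic\<close> of h.\<close>

lemma haupt_t_holomorphic: "haupt_t holomorphic_on {z. Im z > 0}"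
proof -
 have nice: "haupt_t nicely_meromorphic_on {z. Im z > 0}"
  unfolding haupt_t_def by (intro remove_sings_nicely_meromorphic haupt_t_quot_meromorphic)
 have "\<not> is_pole haupt_t z" if z: "Im z > 0" for z
 proof
  assume "is_pole haupt_t z"
  moreover have "haupt_t_quot meromorphic_on {z}"
   using z by (intro meromorphic_on_subset[OF haupt_t_quot_meromorphic]) auto
  ultimately have "is_pole haupt_t_quot z" by (simp add: haupt_t_def meromorphic_at_iff is_pole_remove_sings_iff)
  hence "filterlim (\<lambda>w. haupt_t_quot w ^ 2) at_infinity (at z)"
   unfolding is_pole_def by (intro Limits.filterlim_power_at_infinity) auto
  hence "filterlim (\<lambda>w. haupt_sextic (haupt w)) at_infinity (at z)"
   by (rule filterlim_cong[THEN iffD1, OF refl refl haupt_t_quot_square_eventually[OF z]])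
  moreover have "isCont (\<lambda>w. haupt_sextic (haupt w)) z"
   by (intro analytic_at_imp_isCont analytic_at_upper haupt_sextic_holomorphic z)
  ultimately show False using not_tendsto_and_filterlim_at_infinity[of "at z"] by (auto simp: isCont_def)
 qed
 hence "haupt_t analytic_on {z. Im z > 0}" by (intro nicely_meromorphic_without_singularities[OF nice]) auto
 thus ?thesis by (rule analytic_imp_holomorphic)
qed

lemma haupt_t_eq:
 assumes "Im z > 0" "haupt_den z \<noteq> 0" "haupt z ^ 2 \<noteq> 1"
 shows "haupt_t z = haupt_t_quot z"
proof -
 have "deriv haupt analytic_on {z}" "haupt analytic_on {z}" "haupt_den analytic_on {z}"
  using analytic_at_upper haupt_holomorphic haupt_den_holomorphic holomorphic_deriv[OF haupt_holomorphic open_upper] assms(1) by auto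
 hence "haupt_t_quot analytic_on {z}"
  unfolding haupt_t_quot_def[abs_def] using assms by (intro analytic_intros) auto
 thus ?thesis by (simp add: haupt_t_def)
qed

lemma haupt_t_eq_eventually:
 assumes "Im z > 0"
 shows "\<forall>\<^sub>F w in at z. haupt_t w = haupt_t_quot w \<and> Im w > 0 \<and> haupt_den w \<noteq> 0 \<and> haupt w ^ 2 \<noteq> 1"
 using eventually_haupt_den_nonzero[OF assms] eventually_haupt_square_neq[OF assms, of 1]
 by eventually_elim (auto intro!: haupt_t_eq)

lemma haupt_t_square:
 assumes z: "Im z > 0"
 shows "haupt_t z ^ 2 = haupt_sextic (haupt z)"
proof (rule upper_eqI[OF _ _ _ z])
 show "continuous_on {z. Im z > 0} (\<lambda>z. haupt_t z ^ 2)"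
  by (intro holomorphic_on_imp_continuous_on holomorphic_intros haupt_t_holomorphic)
 show "continuous_on {z. Im z > 0} (\<lambda>z. haupt_sextic (haupt z))"
  by (intro holomorphic_on_imp_continuous_on haupt_sextic_holomorphic)
 show "\<forall>\<^sub>F w in at z. haupt_t w ^ 2 = haupt_sextic (haupt w)" if "Im z > 0" for z
  using haupt_t_eq_eventually[OF that] haupt_t_quot_square_eventually[OF that]
  by eventually_elim auto
qed

section \<open>Transformation of h and of the square root\<close>

lemma haupt_transform:
 assumes g: "\<And>w. Im w > 0 \<Longrightarrow> Im (g w) > 0" "g holomorphic_on {z. Im z > 0}"
  and num: "\<And>w. Im w > 0 \<Longrightarrow> haupt_num (g w) = e * j w * haupt_num w"
  and den: "\<And>w. Im w > 0 \<Longrightarrow> haupt_den (g w) = j w * haupt_den w"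
  and j: "\<And>w. Im w > 0 \<Longrightarrow> j w \<noteq> 0" and z: "Im z > 0"
 shows "haupt (g z) = e * haupt z"
proof (rule upper_eqI'[OF _ _ _ z])
 have "(haupt \<circ> g) holomorphic_on {z. Im z > 0}"
  by (rule holomorphic_on_compose_gen[OF g(2) haupt_holomorphic]) (use g(1) in auto)
 thus "(\<lambda>z. haupt (g z)) holomorphic_on {z. Im z > 0}" by (simp add: o_def)
 show "(\<lambda>z. e * haupt z) holomorphic_on {z. Im z > 0}" by (intro holomorphic_intros haupt_holomorphic)
 fix z assume z: "Im z > 0" "haupt_den z \<noteq> 0"
 thus "haupt (g z) = e * haupt z"
  using haupt_eq[of z] haupt_eq[of "g z"] g(1)[OF z(1)] num[OF z(1)] den[OF z(1)] j[OF z(1)] by simp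
qed

text \<open>If h is invariant under g, its derivative is divided by g' while the square of
  \<open>haupt_den\<close> is multiplied by j^2. So t is divided by g' j^2, a sign in all
  applications.\<close>

lemma haupt_t_transform:
 assumes g: "\<And>w. Im w > 0 \<Longrightarrow> Im (g w) > 0" "\<And>w. Im w > 0 \<Longrightarrow> (g has_field_derivative g' w) (at w)"
  and h: "\<And>w. Im w > 0 \<Longrightarrow> haupt (g w) = haupt w"
  and den: "\<And>w. Im w > 0 \<Longrightarrow> haupt_den (g w) = j w * haupt_den w"
  and j: "\<And>w. Im w > 0 \<Longrightarrow> g' w * j w ^ 2 = e" and e: "e ^ 2 = 1" and z: "Im z > 0"
 shows "haupt_t (g z) = e * haupt_t z"
proof (rule upper_eqI[OF _ _ _ z])
 have "g field_differentiable (at z)" if "Im z > 0" for z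
  using g(2)[OF that] unfolding field_differentiable_def by blast
 hence "g holomorphic_on {z. Im z > 0}"
  unfolding holomorphic_on_def by (auto intro: field_differentiable_at_within)
 hence "(haupt_t \<circ> g) holomorphic_on {z. Im z > 0}"
  by (rule holomorphic_on_compose_gen[OF _ haupt_t_holomorphic]) (use g(1) in auto)
 thus "continuous_on {z. Im z > 0} (\<lambda>z. haupt_t (g z))"
  by (simp add: o_def holomorphic_on_imp_continuous_on)
 show "continuous_on {z. Im z > 0} (\<lambda>z. e * haupt_t z)"
  by (intro holomorphic_on_imp_continuous_on holomorphic_intros haupt_t_holomorphic)
 show "\<forall>\<^sub>F w in at z. haupt_t (g w) = e * haupt_t w" if z: "Im z > 0" for z
  using haupt_t_eq_eventually[OF z]
 proof eventually_elim
  case (elim w)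
  hence w: "Im w > 0" and ne: "haupt_den w \<noteq> 0" "haupt w ^ 2 \<noteq> 1" by auto
  have e0: "e \<noteq> 0" using e by auto
  hence j0: "j w \<noteq> 0" "g' w \<noteq> 0" using j[OF w] by auto
  have "((\<lambda>w. haupt (g w)) has_field_derivative deriv haupt (g w) * g' w) (at w)"
   by (rule DERIV_chain2[OF haupt_has_derivative[OF g(1)[OF w]] g(2)[OF w]])
  moreover have "((\<lambda>w. haupt (g w)) has_field_derivative deriv haupt w) (at w)"
   using has_field_derivative_transform_within_open[OF haupt_has_derivative[OF w] open_upper, of "\<lambda>w. haupt (g w)"] w h by simp
  ultimately have d: "deriv haupt (g w) * g' w = deriv haupt w" by (rule DERIV_unique)
  have "haupt_t (g w) = haupt_t_quot (g w)"
   by (rule haupt_t_eq) (use w g(1) den[OF w] h[OF w] ne j0 in auto)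
  also have "\<dots> = - (2 * deriv haupt (g w) * g' w) / (2 * of_real pi * \<i> * haupt_den w ^ 2 * (haupt w ^ 2 - 1) * (g' w * j w ^ 2))"
   unfolding haupt_t_quot_def den[OF w] h[OF w] using j0 by (simp add: power_mult_distrib divide_simps)
  also have "\<dots> = haupt_t_quot w / e"
   unfolding j[OF w] using d by (simp add: haupt_t_quot_def mult_ac)
  also have "\<dots> = e * haupt_t_quot w" using e e0 by (simp add: divide_simps power2_eq_square mult_ac)
  finally show ?case using elim by simp
 qed
qed

lemma haupt_num_eq: "haupt_num z = (eis_0 z - 2 * eis7 z + eis_inf z / 2) / 2"
 by (simp add: haupt_num_def eis_0_def eis_inf_def)

lemma haupt_den_eq: "haupt_den z = (eis7 z - eis_inf z / 2) / 2"
 by (simp add: haupt_den_def eis_inf_def)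

lemma Im_moebius_pos: "a * d - b * c = 1 \<Longrightarrow> Im z > 0 \<Longrightarrow> Im (moebius a b c d z) > 0"
 using moebius_in_upper_half_plane[of a d b c z] by (simp add: upper_half_plane_def)

lemma moebius_denom_nonzero: "a * d - b * c = 1 \<Longrightarrow> Im z > 0 \<Longrightarrow> of_int c * z + of_int d \<noteq> (0 :: complex)"
 using moebius_denominator_nonzero[of a d b c z] by (simp add: upper_half_plane_def)

section \<open>Matrices with even b and with c divisible by 14, a conjugate of Gamma0(28)\<close>

context
 fixes a b c d :: int
 assumes det: "a * d - b * c = 1" and b: "even b" and c: "14 dvd c"
begin

lemma Gamma_14_den:
 assumes "Im z > 0"
 shows "haupt_den (moebius a b c d z) = of_int (chi7 d) * (of_int c * z + of_int d) * haupt_den z"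
proof -
 have c7: "7 dvd c" "even c" using c by presburger+
 show ?thesis unfolding haupt_den_eq eis_inf_moebius[OF det c7(1) assms] eis7_Gamma0[OF det c7(1) assms]
  using c7(2) by (simp add: diff_divide_distrib right_diff_distrib)
qed

lemma Gamma_14_num:
 assumes "Im z > 0"
 shows "haupt_num (moebius a b c d z) = of_int (chi7 d) * (of_int c * z + of_int d) * haupt_num z"
proof -
 have c7: "7 dvd c" "even c" using c by presburger+
 show ?thesis unfolding haupt_num_eq eis_inf_moebius[OF det c7(1) assms] eis_0_moebius[OF det c7(1) assms] eis7_Gamma0[OF det c7(1) assms]
  using c7(2) b by (simp add: diff_divide_distrib add_divide_distrib distrib_left right_diff_distrib)
qed

lemma haupt_Gamma_14:
 assumes z: "Im z > 0"
 shows "haupt (moebius a b c d z) = haupt z"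
proof -
 have c7: "7 dvd c" using c by presburger
 have "chi7 d \<noteq> 0" using chi7_square[OF Gamma0_7_not_dvd[OF det c7]] by auto
 moreover have "moebius a b c d holomorphic_on {z. Im z > 0}"
  unfolding moebius_def[abs_def] using moebius_denom_nonzero[OF det] by (intro holomorphic_intros) auto
 ultimately have "haupt (moebius a b c d z) = 1 * haupt z"
  by (intro haupt_transform[where j = "\<lambda>w. of_int (chi7 d) * (of_int c * w + of_int d)"])
    (use z Im_moebius_pos[OF det] moebius_denom_nonzero[OF det] in \<open>auto simp: Gamma_14_num Gamma_14_den\<close>)
 thus ?thesis by simp
qed

lemma haupt_t_Gamma_14:
 assumes z: "Im z > 0"
 shows "haupt_t (moebius a b c d z) = haupt_t z"
proof -
 have c7: "7 dvd c" using c by presburger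
 have "of_int (chi7 d) ^ 2 = (1 :: complex)" using chi7_square[OF Gamma0_7_not_dvd[OF det c7]] by (metis of_int_1 of_int_power)
 hence "haupt_t (moebius a b c d z) = 1 * haupt_t z"
  by (intro haupt_t_transform[where j = "\<lambda>w. of_int (chi7 d) * (of_int c * w + of_int d)" and g' = "\<lambda>w. 1 / (of_int c * w + of_int d) ^ 2"])
    (use z Im_moebius_pos[OF det] moebius_denom_nonzero[OF det] in
     \<open>auto simp: haupt_Gamma_14 Gamma_14_den power_mult_distrib intro: has_field_derivative_moebius[of c _ d a b, unfolded det of_int_1]\<close>)
 thus ?thesis by simp
qed

end

text \<open>Up to a scalar, the matrix with rows (7, -k) and (7 l, -7) is the element of Gamma0(7)
  with rows (k, 1) and (7, l), applied after the Fricke involution.\<close>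

lemma eis7_Atkin_Lehner:
 fixes k l :: int
 assumes kl: "k * l = 8" and l: "chi7 l = 1" and v: "Im v > 0"
  and w: "w * (7 * of_int l * v - 7) = 7 * v - of_int k"
 shows "eis7 w = - (\<i> * of_real (sqrt 7)) * (of_int l * v - 1) * eis7 v"
proof -
 have v0: "v \<noteq> 0" using v by auto
 have det: "k * l - 1 * 7 = 1" using kl by simp
 have klC: "of_int k * of_int l = (8 :: complex)" using kl by (metis of_int_mult of_int_numeral)
 define u where "u = - 1 / (7 * v)"
 have u: "Im u > 0" unfolding u_def by (rule Im_Fricke_pos[OF v])
 have uv: "7 * u + of_int l = (of_int l * v - 1) / v" using v0 by (simp add: u_def field_simps)
 have lhs: "w * (of_int l * v - 1) = (7 * v - of_int k) / 7" using w by (simp add: algebra_simps)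
 have "eis7 w = of_int (chi7 l) * (of_int 7 * u + of_int l) * eis7 u"
 proof (rule eis7_moebius_eq[OF det _ u])
  have "w * (of_int 7 * u + of_int l) = (w * (of_int l * v - 1)) / v" using uv by simp
  also have "\<dots> = of_int k * u + of_int 1" unfolding lhs u_def using v0 by (simp add: field_simps)
  finally show "w * (of_int 7 * u + of_int l) = of_int k * u + of_int 1" .
 qed simp
 also have "\<dots> = (of_int l * v - 1) / v * (- (\<i> * of_real (sqrt 7)) * v * eis7 v)"
  using uv eis7_Fricke[OF v] by (simp add: l u_def)
 also have "\<dots> = - (\<i> * of_real (sqrt 7)) * (of_int l * v - 1) * eis7 v" using v0 by simp
 finally show ?thesis .
qed

section \<open>Atkin-Lehner matrices of determinant 7\<close>

context
 fixes k l :: int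
 assumes kl: "k * l = 8" and even: "even k" "even l" and l: "chi7 l = 1"
begin

lemma Atkin_Lehner_denom_nonzero:
 assumes "Im v > 0"
 shows "of_int l * v - 1 \<noteq> (0 :: complex)"
proof
 assume eq: "of_int l * v - 1 = (0 :: complex)"
 hence "Im (of_int l * v - 1) = 0" by simp
 hence "l = 0" using assms by simp
 with eq show False by simp
qed

lemma Im_Atkin_Lehner_pos:
 assumes "Im v > 0"
 shows "Im (moebius 7 (- k) (7 * l) (- 7) v) > 0"
proof -
 have "7 * (- 7) - (- k) * (7 * l) > 0" using kl by simp
 thus ?thesis using moebius_in_upper_half_plane[of 7 "- 7" "- k" "7 * l" v] assms by (simp add: upper_half_plane_def)
qed

text \<open>Doubling the argument replaces (k, l) by (2 k, l / 2), halving it by (k / 2, 2 l). Both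
  keep the product 8 and the value of \<open>chi7\<close>, so the series at w, 2 w and w / 2 acquire
  one common factor; this is why k and l are taken even.\<close>

lemma Atkin_Lehner_eis:
 fixes v :: complex
 assumes v: "Im v > 0"
 defines "w \<equiv> moebius 7 (- k) (7 * l) (- 7) v" and "J \<equiv> - (\<i> * of_real (sqrt 7)) * (of_int l * v - 1)"
 shows "eis7 w = J * eis7 v" "eis7 (2 * w) = J * eis7 (2 * v)" "eis7 (w / 2) = J * eis7 (v / 2)"
proof -
 obtain k0 l0 where kl0: "k = 2 * k0" "l = 2 * l0" using even by blast
 have "7 * of_int l * v - 7 \<noteq> 0" using Atkin_Lehner_denom_nonzero[OF v] by (simp add: algebra_simps)
 hence w: "w * (7 * of_int l * v - 7) = 7 * v - of_int k" by (simp add: w_def moebius_def)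
 show "eis7 w = J * eis7 v" unfolding J_def by (rule eis7_Atkin_Lehner[OF kl l v w])
 have "eis7 (2 * w) = - (\<i> * of_real (sqrt 7)) * (of_int l0 * (2 * v) - 1) * eis7 (2 * v)"
 proof (rule eis7_Atkin_Lehner[of "2 * k"])
  show "2 * k * l0 = 8" using kl kl0 by simp
  show "chi7 l0 = 1" using l kl0 by (simp add: chi7_half)
  have "2 * w * (7 * of_int l0 * (2 * v) - 7) = 2 * (w * (7 * of_int l * v - 7))" by (simp add: kl0)
  thus "2 * w * (7 * of_int l0 * (2 * v) - 7) = 7 * (2 * v) - of_int (2 * k)" unfolding w by simp
 qed (use v in simp)
 thus "eis7 (2 * w) = J * eis7 (2 * v)" by (simp add: J_def kl0 mult_ac)
 have "eis7 (w / 2) = - (\<i> * of_real (sqrt 7)) * (of_int (2 * l) * (v / 2) - 1) * eis7 (v / 2)"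
 proof (rule eis7_Atkin_Lehner[of k0])
  show "k0 * (2 * l) = 8" using kl kl0 by simp
  show "chi7 (2 * l) = 1" using l by (simp add: chi7_half)
  have "w / 2 * (7 * of_int (2 * l) * (v / 2) - 7) = (w * (7 * of_int l * v - 7)) / 2" by simp
  thus "w / 2 * (7 * of_int (2 * l) * (v / 2) - 7) = 7 * (v / 2) - of_int k0" unfolding w by (simp add: kl0)
 qed (use v in simp)
 thus "eis7 (w / 2) = J * eis7 (v / 2)" by (simp add: J_def)
qed

lemma Atkin_Lehner_den:
 assumes "Im v > 0"
 shows "haupt_den (moebius 7 (- k) (7 * l) (- 7) v) = - (\<i> * of_real (sqrt 7)) * (of_int l * v - 1) * haupt_den v"
 unfolding haupt_den_def Atkin_Lehner_eis[OF assms] by (simp add: diff_divide_distrib right_diff_distrib)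

lemma Atkin_Lehner_num:
 assumes "Im v > 0"
 shows "haupt_num (moebius 7 (- k) (7 * l) (- 7) v) = - (\<i> * of_real (sqrt 7)) * (of_int l * v - 1) * haupt_num v"
proof -
 have "(J * x - 2 * (J * y) + J * u) / 2 = J * ((x - 2 * y + u) / 2)" for J x y u :: complex
  by (simp add: field_simps)
 thus ?thesis unfolding haupt_num_def Atkin_Lehner_eis[OF assms] .
qed

lemma Atkin_Lehner_has_derivative:
 assumes "Im v > 0"
 shows "(moebius 7 (- k) (7 * l) (- 7) has_field_derivative 7 / (7 * (of_int l * v - 1)) ^ 2) (at v)"
proof -
 have J: "of_int (7 * l) * v + of_int (- 7) = 7 * (of_int l * v - 1)" by (simp add: algebra_simps)
 have det: "7 * - 7 - - k * (7 * l) = 7" using kl by simp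
 show ?thesis
  using has_field_derivative_moebius[of "7 * l" v "- 7" 7 "- k", unfolded J det] Atkin_Lehner_denom_nonzero[OF assms] by simp
qed

lemma haupt_Atkin_Lehner:
 assumes v: "Im v > 0"
 shows "haupt (moebius 7 (- k) (7 * l) (- 7) v) = haupt v"
proof -
 have "moebius 7 (- k) (7 * l) (- 7) field_differentiable (at w)" if "Im w > 0" for w
  using Atkin_Lehner_has_derivative[OF that] unfolding field_differentiable_def by blast
 hence "moebius 7 (- k) (7 * l) (- 7) holomorphic_on {z. Im z > 0}"
  unfolding holomorphic_on_def by (auto intro: field_differentiable_at_within)
 hence "haupt (moebius 7 (- k) (7 * l) (- 7) v) = 1 * haupt v"
  by (intro haupt_transform[where j = "\<lambda>v. - (\<i> * of_real (sqrt 7)) * (of_int l * v - 1)"])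
    (use v Im_Atkin_Lehner_pos Atkin_Lehner_denom_nonzero in \<open>auto simp: Atkin_Lehner_num Atkin_Lehner_den\<close>)
 thus ?thesis by simp
qed

lemma haupt_t_Atkin_Lehner:
 assumes v: "Im v > 0"
 shows "haupt_t (moebius 7 (- k) (7 * l) (- 7) v) = - haupt_t v"
proof -
 have "haupt_t (moebius 7 (- k) (7 * l) (- 7) v) = (- 1) * haupt_t v"
 proof (rule haupt_t_transform[where j = "\<lambda>v. - (\<i> * of_real (sqrt 7)) * (of_int l * v - 1)" and g' = "\<lambda>v. 7 / (7 * (of_int l * v - 1)) ^ 2"])
  fix w assume w: "Im w > 0"
  \<comment> \<open>The origin of the sign of t: the square of the factor -i sqrt 7 is -7, while the
    derivative contributes only 7 / 49.\<close>
  have s: "(- (\<i> * complex_of_real (sqrt 7))) ^ 2 = - 7" by (simp add: power_mult_distrib flip: of_real_power)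
  show "7 / (7 * (of_int l * w - 1)) ^ 2 * (- (\<i> * complex_of_real (sqrt 7)) * (of_int l * w - 1)) ^ 2 = - 1"
   unfolding power_mult_distrib s using Atkin_Lehner_denom_nonzero[OF w] by simp
 qed (use v Im_Atkin_Lehner_pos Atkin_Lehner_has_derivative haupt_Atkin_Lehner Atkin_Lehner_den in auto)
 thus ?thesis by simp
qed

end

lemma eis_shift: "eis7 (z + 1) = eis7 z" "eis_inf (z + 1) = eis_inf z"
 using eis7_add_of_int[of z 1] eis7_add_of_int[of "2 * z" 2] by (simp_all add: eis_inf_def distrib_left)

text \<open>The translation exchanges \<open>eis_0\<close> and \<open>eis_1\<close> and fixes E and
  \<open>eis_inf\<close>; by \<open>eis_sum\<close> this negates \<open>haupt_num\<close> and leaves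
  \<open>haupt_den\<close> unchanged. It is the source of the sign change of y.\<close>

lemma haupt_add_1:
 assumes z: "Im z > 0"
 shows "haupt (z + 1) = - haupt z"
proof -
 have num: "haupt_num (w + 1) = - 1 * 1 * haupt_num w" if "Im w > 0" for w
 proof -
  have "eis_0 (w + 1) = 4 * eis7 w - eis_inf w - eis_0 w"
   using eis_sum[OF that] by (simp add: eis_1_eq algebra_simps)
  thus ?thesis unfolding haupt_num_eq eis_shift by simp
 qed
 have "haupt (z + 1) = (- 1) * haupt z"
  by (rule haupt_transform[where j = "\<lambda>_. 1"]) (use z num in \<open>auto simp: haupt_den_eq eis_shift intro!: holomorphic_intros\<close>)
 thus ?thesis by simp
qed

lemma haupt_add_2: "Im z > 0 \<Longrightarrow> haupt (z + 2) = haupt z"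
 using haupt_add_1[of z] haupt_add_1[of "z + 1"] by (simp add: add.assoc)

lemma haupt_t_add_2:
 assumes z: "Im z > 0"
 shows "haupt_t (z + 2) = haupt_t z"
proof -
 have den: "haupt_den (w + 2) = haupt_den w" for w
  using eis_shift[of w] eis_shift[of "w + 1"] by (simp add: haupt_den_eq add.assoc)
 have "haupt_t (z + 2) = 1 * haupt_t z"
  by (rule haupt_t_transform[where j = "\<lambda>_. 1" and g' = "\<lambda>_. 1"])
    (use z in \<open>auto simp: haupt_add_2 den intro!: derivative_eq_intros\<close>)
 thus ?thesis by simp
qed

section \<open>Limits at infinity\<close>

abbreviation at_i_infinity :: "complex filter" where
 "at_i_infinity \<equiv> filtercomap Im at_top"

abbreviation near_infinity :: "(complex \<Rightarrow> bool) \<Rightarrow> bool" (binder "NEAR " 10) where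
 "near_infinity P \<equiv> eventually P at_i_infinity"

lemma eventually_at_i_infinity: "eventually P at_i_infinity \<longleftrightarrow> (\<exists>Y. \<forall>z. Im z \<ge> Y \<longrightarrow> P z)"
 unfolding eventually_filtercomap eventually_at_top_linorder
 by (metis (no_types, lifting))

lemma eventually_Im_gt: "NEAR z. Im z > y"
 unfolding eventually_at_i_infinity by (intro exI[of _ "y + 1"]) auto

lemma nome_tendsto_0: "(nome \<longlongrightarrow> 0) at_i_infinity"
proof (rule tendsto_norm_zero_cancel)
 have "((\<lambda>y. exp (- 2 * pi * y)) \<longlongrightarrow> 0) at_top" by real_asymp
 from filterlim_compose[OF this filterlim_filtercomap[of Im at_top]]
 show "((\<lambda>z. norm (nome z)) \<longlongrightarrow> 0) at_i_infinity" by (simp add: norm_nome)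
qed

lemma eis7_tendsto_1: "(eis7 \<longlongrightarrow> 1) at_i_infinity"
proof -
 have "isCont (eval_fps (eis7_fps 1)) 0"
  by (intro continuous_eval_fps)
   (use less_le_trans[of "0 :: ereal" 1, OF _ eis7_fps_conv_radius[of 1]] in \<open>simp add: zero_ereal_def\<close>)
 from isCont_tendsto_compose[OF this nome_tendsto_0] show ?thesis
  by (simp add: eis7_def[abs_def] eval_fps_at_0) (simp add: eis7_fps_def eis7_coeff_def)
qed

lemma filterlim_affine_at_i_infinity:
 assumes "A > 0"
 shows "filterlim (\<lambda>z. of_real A * z + B) at_i_infinity at_i_infinity"
proof -
 have "filterlim (\<lambda>y. A * y + Im B) at_top at_top" using assms by real_asymp
 from filterlim_compose[OF this filterlim_filtercomap[of Im at_top]]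
 have "filterlim (\<lambda>z. Im (of_real A * z + B)) at_top at_i_infinity" by simp
 thus ?thesis by (simp add: filterlim_filtercomap_iff o_def)
qed

section \<open>Expansions at infinity\<close>

lemma upper_half_plane_iff: "z \<in> upper_half_plane \<longleftrightarrow> Im z > 0"
 by (simp add: upper_half_plane_def)

lemma open_upper_half_plane: "open upper_half_plane"
 unfolding upper_half_plane_def by (rule open_upper)

lemma connected_upper_half_plane: "connected upper_half_plane"
 unfolding upper_half_plane_def by (rule connected_upper)

lemma nome_eq_iff: "nome u = nome v \<longleftrightarrow> (\<exists>n::int. u = v + of_int n)"
proof -
 have "nome u = nome v \<longleftrightarrow> nome (u - v) = 1"
  using nome_add[of "u - v" v] by (metis diff_add_cancel mult_cancel_right1 mult.commute nome_nonzero)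
 thus ?thesis unfolding nome_eq_1_iff by (simp add: algebra_simps)
qed

lemma nome_surj:
 assumes "w \<noteq> 0" "h > 0"
 obtains z where "nome (z / of_real h) = w"
proof
 show "nome ((of_real h * Ln w / (2 * of_real pi * \<i>)) / of_real h) = w"
  using assms by (simp add: nome_def)
qed

lemma Im_eq_norm_nome:
 assumes "nome (z / of_real h) = w" "h > 0"
 shows "Im z = - h * ln (norm w) / (2 * pi)"
proof -
 have "norm w = exp (- 2 * pi * (Im z / h))" using assms norm_nome[of "z / of_real h"] by simp
 thus ?thesis using assms(2) by simp
qed

text \<open>An equality of filters, not merely a limit: properties near the cusp and properties near
  0 in the local parameter can then be exchanged in both directions.\<close>

lemma filtermap_nome:
 assumes h: "h > 0"
 shows "filtermap (\<lambda>z. nome (z / of_real h)) at_i_infinity = at 0"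
proof (rule antisym)
 have "filterlim (\<lambda>z. of_real (1 / h) * z + 0) at_i_infinity at_i_infinity"
  using h by (intro filterlim_affine_at_i_infinity) simp
 from filterlim_compose[OF nome_tendsto_0 this]
 have "((\<lambda>z. nome (z / of_real h)) \<longlongrightarrow> 0) at_i_infinity" by simp
 hence "filterlim (\<lambda>z. nome (z / of_real h)) (at 0) at_i_infinity"
  by (rule filterlim_atI) simp
 thus "filtermap (\<lambda>z. nome (z / of_real h)) at_i_infinity \<le> at 0" by (simp add: filterlim_def)
next
 show "at 0 \<le> filtermap (\<lambda>z. nome (z / of_real h)) at_i_infinity"
 proof (rule filter_leI)
  fix P assume "eventually P (filtermap (\<lambda>z. nome (z / of_real h)) at_i_infinity)"
  then obtain y where y: "\<And>z. Im z \<ge> y \<Longrightarrow> P (nome (z / of_real h))"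
   by (auto simp: eventually_filtermap eventually_at_i_infinity)
  have "P w" if w: "w \<noteq> 0" "dist w 0 < exp (- 2 * pi * y / h)" for w
  proof -
   obtain z where z: "nome (z / of_real h) = w" using nome_surj[OF w(1) h] .
   have "ln (norm w) < ln (exp (- 2 * pi * y / h))" using w by (subst ln_less_cancel_iff) auto
   hence "ln (norm w) < - 2 * pi * y / h" by simp
   hence "y \<le> Im z" unfolding Im_eq_norm_nome[OF z h] using h by (simp add: field_simps)
   thus ?thesis using y z by blast
  qed
  thus "eventually P (at 0)" unfolding eventually_at by (intro exI[of _ "exp (- 2 * pi * y / h)"]) auto
 qed
qed

lemma eventually_nome_iff:
 "h > 0 \<Longrightarrow> (NEAR z. P (nome (z / of_real h))) \<longleftrightarrow> (\<forall>\<^sub>F w in at 0. P w)"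
 using eventually_filtermap[of P "\<lambda>z. nome (z / of_real h)" at_i_infinity] filtermap_nome[of h] by simp

lemma has_q_expansion_iff:
 assumes "h > 0"
 shows "has_q_expansion h f F \<longleftrightarrow>
  (\<exists>k. k has_laurent_expansion F \<and> (NEAR z. f z = k (nome (z / of_real (real h)))))"
proof
 assume "has_q_expansion h f F"
 thus "\<exists>k. k has_laurent_expansion F \<and> (NEAR z. f z = k (nome (z / of_real (real h))))"
  by (intro exI[of _ "eval_fls F"])
   (auto simp: has_q_expansion_def nome_def intro: eval_fls_has_laurent_expansion)
next
 assume "\<exists>k. k has_laurent_expansion F \<and> (NEAR z. f z = k (nome (z / of_real (real h))))"
 then obtain k where k: "fls_conv_radius F > 0" "\<forall>\<^sub>F w in at 0. eval_fls F w = k w"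
  "NEAR z. f z = k (nome (z / of_real (real h)))"
  by (auto simp: has_laurent_expansion_def)
 have "NEAR z. eval_fls F (nome (z / of_real (real h))) = k (nome (z / of_real (real h)))"
  using k(2) eventually_nome_iff[of "real h" "\<lambda>w. eval_fls F w = k w"] assms by simp
 with k(3) have "NEAR z. f z = eval_fls F (nome (z / of_real (real h)))"
  by eventually_elim simp
 thus "has_q_expansion h f F" using k(1) by (simp add: has_q_expansion_def nome_def)
qed

lemma has_q_expansion_const: "has_q_expansion 1 (\<lambda>_. c) (fls_const c)"
 by (subst has_q_expansion_iff) (auto intro!: exI[of _ "\<lambda>_. c"])

lemma has_q_expansion_combine:
 assumes "has_q_expansion h f F" "has_q_expansion h g G" and h: "h > 0"
  and "\<And>k l. k has_laurent_expansion F \<Longrightarrow> l has_laurent_expansion G \<Longrightarrow> (\<lambda>w. c (k w) (l w)) has_laurent_expansion H"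
 shows "has_q_expansion h (\<lambda>z. c (f z) (g z)) H"
proof -
 obtain k l where "k has_laurent_expansion F" "l has_laurent_expansion G"
  and ev: "NEAR z. f z = k (nome (z / of_real (real h)))" "NEAR z. g z = l (nome (z / of_real (real h)))"
  using assms(1,2) by (auto simp: has_q_expansion_iff[OF h])
 moreover from ev have "NEAR z. c (f z) (g z) = c (k (nome (z / of_real (real h)))) (l (nome (z / of_real (real h))))"
  by eventually_elim simp
 ultimately show ?thesis using assms(4) unfolding has_q_expansion_iff[OF h] by (intro exI[of _ "\<lambda>w. c (k w) (l w)"]) blast
qed

lemma has_q_expansion_add:
 "has_q_expansion h f F \<Longrightarrow> has_q_expansion h g G \<Longrightarrow> h > 0 \<Longrightarrow> has_q_expansion h (\<lambda>z. f z + g z) (F + G)"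
 by (erule (2) has_q_expansion_combine) (rule has_laurent_expansion_add)

lemma has_q_expansion_mult:
 "has_q_expansion h f F \<Longrightarrow> has_q_expansion h g G \<Longrightarrow> h > 0 \<Longrightarrow> has_q_expansion h (\<lambda>z. f z * g z) (F * G)"
 by (erule (2) has_q_expansion_combine) (rule has_laurent_expansion_mult)

lemma has_q_expansion_inverse:
 "has_q_expansion h f F \<Longrightarrow> h > 0 \<Longrightarrow> has_q_expansion h (\<lambda>z. inverse (f z)) (inverse F)"
 by (rule has_q_expansion_combine[where c = "\<lambda>x _. inverse x"]) (auto intro: has_laurent_expansion_inverse)

lemma has_q_expansion_uminus: "has_q_expansion 1 f F \<Longrightarrow> has_q_expansion 1 (\<lambda>z. - f z) (- F)"
 using has_q_expansion_mult[OF has_q_expansion_const[of "- 1"], of f F] by (simp add: fls_const_uminus)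

lemma has_q_expansion_divide:
 "has_q_expansion h f F \<Longrightarrow> has_q_expansion h g G \<Longrightarrow> h > 0 \<Longrightarrow> has_q_expansion h (\<lambda>z. f z / g z) (F / G)"
 using has_q_expansion_mult[OF _ has_q_expansion_inverse, of h f F g G] by (simp add: divide_inverse)

lemma has_q_expansion_cong:
 assumes "NEAR z. f z = g z"
 shows "has_q_expansion h f F \<longleftrightarrow> has_q_expansion h g F"
proof -
 have "(NEAR z. f z = E z) \<longleftrightarrow> (NEAR z. g z = E z)" for E
  using assms by (intro eventually_subst) (auto elim: eventually_mono)
 thus ?thesis by (simp add: has_q_expansion_def)
qed

lemma has_q_expansion_unique:
 assumes "has_q_expansion h f F" "has_q_expansion h f G" "h > 0"
 shows "F = G"
proof -
 obtain k l where k: "k has_laurent_expansion F" "l has_laurent_expansion G"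
  and ev: "NEAR z. f z = k (nome (z / of_real (real h)))" "NEAR z. f z = l (nome (z / of_real (real h)))"
  using assms by (auto simp: has_q_expansion_iff)
 from ev have "NEAR z. k (nome (z / of_real (real h))) = l (nome (z / of_real (real h)))"
  by eventually_elim simp
 hence "\<forall>\<^sub>F w in at 0. k w = l w" using eventually_nome_iff[of "real h" "\<lambda>w. k w = l w"] assms(3) by simp
 hence "k has_laurent_expansion G" using k(2) has_laurent_expansion_cong[of k l G G] by simp
 thus ?thesis using k(1) has_laurent_expansion_unique by blast
qed

lemma has_q_expansion_analytic:
 assumes "has_q_expansion h f F" "h > 0"
 shows "NEAR z. f analytic_on {z}"
proof -
 obtain k where k: "k has_laurent_expansion F"
  and "NEAR z. f z = k (nome (z / of_real (real h)))"
  using assms by (auto simp: has_q_expansion_iff)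
 then obtain y where y: "\<And>z. Im z \<ge> y \<Longrightarrow> f z = k (nome (z / of_real (real h)))"
  by (auto simp: eventually_at_i_infinity)
 have "isolated_singularity_at k 0" using has_laurent_expansion_isolated[of k 0 F] k by simp
 then obtain r where r: "r > 0" "k analytic_on ball 0 r - {0}" by (auto simp: isolated_singularity_at_def)
 have "\<forall>\<^sub>F w in at 0. w \<in> ball 0 r - {0 :: complex}" using r(1) by (intro eventually_at_in_open) auto
 hence "\<forall>\<^sub>F w in at 0. k analytic_on {w}"
  by (rule eventually_mono) (rule analytic_on_subset[OF r(2)], simp)
 hence "NEAR z. k analytic_on {nome (z / of_real (real h))}"
  using eventually_nome_iff[of "real h" "\<lambda>w. k analytic_on {w}"] assms(2) by simp
 thus ?thesis using eventually_Im_gt[of y]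
 proof eventually_elim
  case (elim z)
  have "(k \<circ> (\<lambda>z. nome (z / of_real (real h)))) analytic_on {z}"
   by (rule analytic_on_compose) (use elim assms(2) in \<open>auto intro!: analytic_intros\<close>)
  moreover have "\<forall>\<^sub>F u in nhds z. u \<in> {u. Im u > y}"
   using elim by (intro eventually_nhds_in_open) (auto simp: open_halfspace_Im_gt)
  hence "\<forall>\<^sub>F u in nhds z. f u = (k \<circ> (\<lambda>z. nome (z / of_real (real h)))) u"
   by (rule eventually_mono) (use y in auto)
  ultimately show ?case using analytic_at_cong by blast
 qed
qed

section \<open>Moderate growth\<close>

text \<open>The growth condition behind meromorphy at a cusp. Unlike an expansion it refers to no
  width of the cusp, and it is stable under sums, products, affine substitutions and square roots;
  for functions that are periodic and analytic near infinity it gives back an expansion.\<close>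

definition moderate :: "(complex \<Rightarrow> complex) \<Rightarrow> bool" where
 "moderate f \<longleftrightarrow> (\<exists>n::nat. \<exists>C. NEAR z. norm (f z) \<le> C * exp (real n * Im z))"

lemma moderateI:
 assumes "NEAR z. norm (f z) \<le> C * exp (m * Im z)"
 shows "moderate f"
proof -
 define n where "n = nat \<lceil>m\<rceil>"
 have "NEAR z. norm (f z) \<le> \<bar>C\<bar> * exp (real n * Im z)"
  using assms eventually_Im_gt[of 0]
 proof eventually_elim
  case (elim z)
  have "m \<le> real n" unfolding n_def by linarith
  hence "exp (m * Im z) \<le> exp (real n * Im z)" using elim by (simp add: mult_right_mono)
  hence "C * exp (m * Im z) \<le> \<bar>C\<bar> * exp (real n * Im z)" by (intro mult_mono) auto
  thus ?case using elim by linarith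
 qed
 thus ?thesis unfolding moderate_def by blast
qed

lemma moderate_const: "moderate (\<lambda>_. c)"
 by (rule moderateI[of _ "norm c" 0]) simp

lemma moderate_add:
 assumes "moderate f" "moderate g"
 shows "moderate (\<lambda>z. f z + g z)"
proof -
 obtain m n C D where "NEAR z. norm (f z) \<le> C * exp (real m * Im z)"
  "NEAR z. norm (g z) \<le> D * exp (real n * Im z)"
  using assms by (auto simp: moderate_def)
 hence "NEAR z. norm (f z + g z) \<le> (\<bar>C\<bar> + \<bar>D\<bar>) * exp (real (m + n) * Im z)"
  using eventually_Im_gt[of 0]
 proof eventually_elim
  case (elim z)
  have "C * exp (real m * Im z) \<le> \<bar>C\<bar> * exp (real (m + n) * Im z)"
   "D * exp (real n * Im z) \<le> \<bar>D\<bar> * exp (real (m + n) * Im z)"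
   using elim by (auto intro!: mult_mono)
  thus ?case using elim norm_triangle_ineq[of "f z" "g z"] unfolding distrib_right by linarith
 qed
 thus ?thesis by (rule moderateI)
qed

lemma moderate_mult:
 assumes "moderate f" "moderate g"
 shows "moderate (\<lambda>z. f z * g z)"
proof -
 obtain m n C D where "NEAR z. norm (f z) \<le> C * exp (real m * Im z)"
  "NEAR z. norm (g z) \<le> D * exp (real n * Im z)"
  using assms by (auto simp: moderate_def)
 hence "NEAR z. norm (f z * g z) \<le> (C * D) * exp (real (m + n) * Im z)"
 proof eventually_elim
  case (elim z)
  have "norm (f z) * norm (g z) \<le> (C * exp (real m * Im z)) * (D * exp (real n * Im z))"
   using elim by (intro mult_mono) (auto intro: order_trans[OF norm_ge_zero])
  thus ?case by (simp add: norm_mult exp_add distrib_right distrib_left mult_ac)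
 qed
 thus ?thesis by (rule moderateI)
qed

lemma moderate_power_imp:
 assumes "moderate (\<lambda>z. f z ^ 2)"
 shows "moderate f"
proof -
 obtain m C where "NEAR z. norm (f z ^ 2) \<le> C * exp (real m * Im z)"
  using assms by (auto simp: moderate_def)
 hence "NEAR z. norm (f z) \<le> (1 + C) * exp (real m * Im z)" using eventually_Im_gt[of 0]
 proof eventually_elim
  case (elim z)
  have "norm (f z) \<le> 1 + norm (f z) ^ 2"
   using sum_power2_ge_zero[of "norm (f z) - 1" "norm (f z)"] by (simp add: power2_eq_square algebra_simps)
  also have "\<dots> \<le> exp (real m * Im z) + C * exp (real m * Im z)"
   using elim by (intro add_mono) (auto simp: norm_power)
  finally show ?case by (simp add: algebra_simps)
 qed
 thus ?thesis by (rule moderateI)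
qed

lemma moderate_compose_affine:
 assumes "moderate f" "A > 0"
 shows "moderate (\<lambda>z. f (of_real A * z + B))"
proof -
 obtain m C where "NEAR z. norm (f z) \<le> C * exp (real m * Im z)"
  using assms by (auto simp: moderate_def)
 from eventually_compose_filterlim[OF this filterlim_affine_at_i_infinity[OF assms(2), of B]]
 have "NEAR z. norm (f (of_real A * z + B)) \<le> (C * exp (real m * Im B)) * exp ((real m * A) * Im z)"
  by (simp add: exp_add distrib_left mult_ac)
 thus ?thesis by (rule moderateI)
qed

lemma moderate_cong:
 assumes "NEAR z. f z = g z" "moderate f"
 shows "moderate g"
proof -
 obtain m C where "NEAR z. norm (f z) \<le> C * exp (real m * Im z)"
  using assms by (auto simp: moderate_def)
 with assms(1) have "NEAR z. norm (g z) \<le> C * exp (real m * Im z)" by eventually_elim simp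
 thus ?thesis by (rule moderateI)
qed

lemma has_q_expansion_moderate:
 assumes "has_q_expansion h f F" "h > 0"
 shows "moderate f"
proof -
 obtain k where k: "k has_laurent_expansion F"
  and ev: "NEAR z. f z = k (nome (z / of_real (real h)))"
  using assms by (auto simp: has_q_expansion_iff)
 define n where "n = nat (- fls_subdegree F)"
 have "(\<lambda>w. k w * w ^ n) has_laurent_expansion F * fls_X_intpow (int n)"
  by (intro laurent_expansion_intros k)
 moreover have "fls_subdegree (F * fls_X_intpow (int n)) \<ge> 0"
  by (cases "F = 0") (simp_all add: n_def)
 ultimately obtain c where "(\<lambda>w. k w * w ^ n) \<midarrow>0\<rightarrow> c" using has_laurent_expansion_imp_tendsto_0 by blast
 hence "((\<lambda>w. norm (k w * w ^ n)) \<longlongrightarrow> norm c) (at 0)" by (rule tendsto_norm)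
 hence "\<forall>\<^sub>F w in at 0. norm (k w * w ^ n) < norm c + 1" by (rule order_tendstoD) simp
 hence "NEAR z. norm (k (nome (z / of_real (real h))) * nome (z / of_real (real h)) ^ n) < norm c + 1"
  using eventually_nome_iff[of "real h" "\<lambda>w. norm (k w * w ^ n) < norm c + 1"] assms(2) by simp
 with ev have "NEAR z. norm (f z) \<le> (norm c + 1) * exp ((2 * pi * n / h) * Im z)"
 proof eventually_elim
  case (elim z)
  have "norm (nome (z / of_real (real h)) ^ n) = exp (- ((2 * pi * n / h) * Im z))"
   by (simp add: norm_power norm_nome exp_of_nat_mult[symmetric] field_simps)
  hence "norm (f z) * exp (- ((2 * pi * n / h) * Im z)) \<le> norm c + 1" using elim by (simp add: norm_mult)
  thus ?case by (simp add: exp_minus field_simps)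
 qed
 thus ?thesis by (rule moderateI)
qed

text \<open>The function descends to a punctured disc in the local parameter, where boundedness
  makes the puncture removable. Since everything is only assumed near infinity, the period has to be
  iterated inside a half plane, first upwards in n and then for negative n.\<close>

lemma periodic_bounded_imp_analytic:
 fixes g :: "complex \<Rightarrow> complex"
 assumes h: "h > 0" and an: "NEAR z. g analytic_on {z}"
  and per: "NEAR z. g (z + of_real h) = g z"
  and bd: "NEAR z. norm (g z) \<le> C"
 obtains k where "k analytic_on {0}" "NEAR z. g z = k (nome (z / of_real h))"
proof -
 from an per bd have "NEAR z. g analytic_on {z} \<and> g (z + of_real h) = g z \<and> norm (g z) \<le> C"
  by eventually_elim simp
 then obtain y where y: "\<And>z. Im z \<ge> y \<Longrightarrow> g analytic_on {z}" "\<And>z. Im z \<ge> y \<Longrightarrow> g (z + of_real h) = g z"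
  "\<And>z. Im z \<ge> y \<Longrightarrow> norm (g z) \<le> C" unfolding eventually_at_i_infinity by blast
 have nat_per: "g (z + of_nat n * of_real h) = g z" if "Im z \<ge> y" for z n
 proof (induction n)
  case (Suc n)
  have "g (z + of_nat (Suc n) * of_real h) = g ((z + of_nat n * of_real h) + of_real h)" by (simp add: algebra_simps)
  also have "\<dots> = g (z + of_nat n * of_real h)" using that by (intro y(2)) simp
  finally show ?case using Suc by simp
 qed simp
 have int_per: "g (z + of_int n * of_real h) = g z" if "Im z \<ge> y" for z n
 proof (cases "n \<ge> 0")
  case True
  thus ?thesis using nat_per[OF that, of "nat n"] by simp
 next
  case False
  have "g ((z + of_int n * of_real h) + of_nat (nat (- n)) * of_real h) = g (z + of_int n * of_real h)"
   using that by (intro nat_per) simp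
  thus ?thesis using False by (simp add: algebra_simps)
 qed
 define k where "k = (\<lambda>w. g (of_real h * Ln w / (2 * of_real pi * \<i>)))"
 define r where "r = exp (- 2 * pi * y / h)"
 have r: "r > 0" by (simp add: r_def)
 have Imz: "Im z \<ge> y" if "nome (z / of_real h) = w" "norm w < r" "w \<noteq> 0" for z w
 proof -
  have "ln (norm w) < ln (exp (- 2 * pi * y / h))" using that unfolding r_def by (subst ln_less_cancel_iff) auto
  hence "ln (norm w) < - 2 * pi * y / h" by simp
  thus "y \<le> Im z" unfolding Im_eq_norm_nome[OF that(1) h] using h by (simp add: field_simps)
 qed
 have k: "k w = g z" if w: "nome (z / of_real h) = w" "norm w < r" for z w
 proof -
  have w0: "w \<noteq> 0" using w by auto
  define u where "u = of_real h * Ln w / (2 * of_real pi * \<i>)"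
  have "nome (u / of_real h) = w" using h w0 by (simp add: u_def nome_def)
  hence "nome (u / of_real h) = nome (z / of_real h)" using w by simp
  then obtain n :: int where "u / of_real h = z / of_real h + of_int n" unfolding nome_eq_iff by blast
  hence "u / of_real h * of_real h = (z / of_real h + of_int n) * of_real h" by simp
  hence "u = z + of_int n * of_real h" using h by (simp add: distrib_right)
  thus ?thesis using int_per[of z n] Imz[OF w w0] by (simp add: k_def u_def)
 qed
 have "k analytic_on {w0}" if w0: "w0 \<in> ball 0 r - {0}" for w0
 proof -
  \<comment> \<open>A logarithm that is analytic at w0 even if w0 lies on the cut of the principal
    branch. Periodicity makes the result independent of the branch.\<close>
  define L where "L = (\<lambda>w. of_real h * (Ln (w / w0) + Ln w0) / (2 * of_real pi * \<i>))"
  have L: "nome (L w / of_real h) = w" if "w \<noteq> 0" for w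
   using h that w0 by (simp add: L_def nome_def exp_add)
  have "L analytic_on {w0}" unfolding L_def using w0 by (auto intro!: analytic_intros)
  moreover have "g analytic_on {L w0}" using w0 by (intro y(1) Imz[OF L]) auto
  ultimately have "(g \<circ> L) analytic_on {w0}" by (intro analytic_on_compose) auto
  moreover have "\<forall>\<^sub>F w in nhds w0. w \<in> ball 0 r - {0}"
   using w0 by (intro eventually_nhds_in_open) auto
  hence "\<forall>\<^sub>F w in nhds w0. k w = (g \<circ> L) w"
  proof (rule eventually_mono)
   fix w :: complex assume "w \<in> ball 0 r - {0}"
   thus "k w = (g \<circ> L) w" using k[OF L, of w] by simp
  qed
  ultimately show ?thesis using analytic_at_cong by blast
 qed
 hence "k holomorphic_on ball 0 r - {0}"
  using analytic_on_analytic_at analytic_imp_holomorphic by blast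
 moreover have "k \<in> O[at 0](\<lambda>_. 1)"
 proof (rule bigoI)
  have "\<forall>\<^sub>F w in at 0. w \<in> ball 0 r - {0 :: complex}" using r by (intro eventually_at_in_open) auto
  thus "\<forall>\<^sub>F w in at 0. norm (k w) \<le> C * norm (1 :: complex)"
  proof (rule eventually_mono)
   fix w :: complex assume w: "w \<in> ball 0 r - {0}"
   then obtain z where z: "nome (z / of_real h) = w" using nome_surj[OF _ h] by blast
   show "norm (k w) \<le> C * norm (1 :: complex)" using k[OF z] Imz[OF z] y(3) w by simp
  qed
 qed
 ultimately have "\<exists>g. g holomorphic_on ball 0 r \<and> (\<forall>z\<in>ball 0 r - {0}. g z = k z)"
  using r by (intro removable_singularities) auto
 then obtain K where K: "K holomorphic_on ball 0 r" "\<And>z. z \<in> ball 0 r - {0} \<Longrightarrow> K z = k z" by blast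
 show thesis
 proof (rule that)
  show "K analytic_on {0}" unfolding analytic_at by (rule exI[of _ "ball 0 r"]) (use K(1) r in simp)
  have "\<forall>\<^sub>F w in at 0. w \<in> ball 0 r - {0 :: complex}" using r by (intro eventually_at_in_open) auto
  hence "NEAR z. nome (z / of_real h) \<in> ball 0 r - {0}"
   using eventually_nome_iff[OF h, of "\<lambda>w. w \<in> ball 0 r - {0}"] by blast
  thus "NEAR z. g z = K (nome (z / of_real h))"
  proof (rule eventually_mono)
   fix z assume "nome (z / of_real h) \<in> ball 0 r - {0}"
   thus "g z = K (nome (z / of_real h))" using k[OF refl, of z] K(2) by simp
  qed
 qed
qed

lemma norm_mult_nome_power_le:
 assumes "norm w \<le> C * exp (real m * Im z)" "Im z > 0" "h > 0" "real m * h \<le> real n"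
 shows "norm (w * nome (z / of_real h) ^ n) \<le> \<bar>C\<bar>"
proof -
 have "real m \<le> real n / h" using assms(3,4) by (simp add: field_simps)
 also have "\<dots> \<le> 2 * pi * (real n / h)" using pi_gt3 mult_right_mono[of 1 "2 * pi" "real n / h"] assms(3) by simp
 finally have "real m * Im z \<le> 2 * pi * (real n / h) * Im z" using assms(2) by (intro mult_right_mono) simp_all
 hence le: "exp (real m * Im z) * exp (- (2 * pi * (real n / h) * Im z)) \<le> 1" by (simp flip: exp_add)
 have "norm (w * nome (z / of_real h) ^ n) = norm w * exp (- (2 * pi * (real n / h) * Im z))"
  using assms(3) by (simp add: norm_mult norm_power norm_nome exp_of_nat_mult[symmetric] mult_ac)
 also have "\<dots> \<le> (\<bar>C\<bar> * exp (real m * Im z)) * exp (- (2 * pi * (real n / h) * Im z))"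
  by (intro mult_right_mono order_trans[OF assms(1)]) auto
 also have "\<dots> \<le> \<bar>C\<bar>" using mult_left_mono[OF le, of "\<bar>C\<bar>"] by (simp add: mult.assoc)
 finally show ?thesis .
qed

text \<open>The power m h of the local parameter has norm exp(-2 pi m Im z), which outweighs the
  growth exp(m Im z). The product is bounded, hence analytic in the parameter, and dividing by the
  power gives a Laurent series.\<close>

lemma moderate_imp_has_q_expansion:
 assumes h: "h > 0" and an: "NEAR z. g analytic_on {z}"
  and per: "NEAR z. g (z + of_nat h) = g z" and "moderate g"
 shows "\<exists>F. has_q_expansion h g F"
proof -
 obtain m C where mC: "NEAR z. norm (g z) \<le> C * exp (real m * Im z)"
  using assms by (auto simp: moderate_def)
 define n where "n = m * h"
 define e where "e = (\<lambda>z. nome (z / of_real (real h)) ^ n)"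
 have e_an: "e analytic_on {z}" for z unfolding e_def using h by (auto intro!: analytic_intros)
 have e_per: "e (z + of_real (real h)) = e z" for z
  using h by (simp add: e_def add_divide_distrib nome_add)
 have bd: "NEAR z. norm (g z * e z) \<le> \<bar>C\<bar>"
  using mC eventually_Im_gt[of 0] unfolding e_def
  by eventually_elim (rule norm_mult_nome_power_le[where m = m], use h in \<open>simp_all add: n_def\<close>)
 have an': "NEAR z. (\<lambda>z. g z * e z) analytic_on {z}"
  using an by eventually_elim (intro analytic_intros e_an)
 have per': "NEAR z. g (z + of_real (real h)) * e (z + of_real (real h)) = g z * e z"
  using per by eventually_elim (simp add: e_per[simplified])
 obtain k where k: "k analytic_on {0}" "NEAR z. g z * e z = k (nome (z / of_real (real h)))"
  by (rule periodic_bounded_imp_analytic[OF _ an' per' bd]) (use h in simp_all)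
 obtain F where "k has_fps_expansion F" using analytic_at_imp_has_fps_expansion_0[OF k(1)] by blast
 hence "(\<lambda>w. k w / w ^ n) has_laurent_expansion fps_to_fls F / fls_X_intpow (int n)"
  by (intro laurent_expansion_intros has_laurent_expansion_fps)
 moreover have "NEAR z. g z = k (nome (z / of_real (real h))) / nome (z / of_real (real h)) ^ n"
  using k(2) by eventually_elim (simp add: e_def eq_divide_eq)
 ultimately show ?thesis unfolding has_q_expansion_iff[OF h] by blast
qed

section \<open>Moebius transformations and removable singularities\<close>

lemma Im_moebius_det_pos: "a * d - b * c > 0 \<Longrightarrow> Im z > 0 \<Longrightarrow> Im (moebius a b c d z) > 0"
 using moebius_in_upper_half_plane[of a d b c z] by (simp add: upper_half_plane_def)

lemma moebius_det_nonzero: "a * d - b * c > 0 \<Longrightarrow> Im z > 0 \<Longrightarrow> of_int c * z + of_int d \<noteq> (0 :: complex)"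
 using moebius_denominator_nonzero[of a d b c z] by (simp add: upper_half_plane_def)

lemma moebius_scalar: "n \<noteq> 0 \<Longrightarrow> moebius n 0 0 n z = z"
 by (simp add: moebius_def)

lemma moebius_inverse:
 assumes "a * d - b * c > 0" "Im z > 0"
 shows "moebius d (- b) (- c) a (moebius a b c d z) = z"
proof -
 have "moebius d (- b) (- c) a (moebius a b c d z) = moebius (a * d - b * c) 0 0 (a * d - b * c) z"
  by (subst moebius_compose[OF moebius_det_nonzero[OF assms]]) (simp add: algebra_simps)
 thus ?thesis using assms(1) by (subst (asm) moebius_scalar) auto
qed

lemma moebius_analytic:
 assumes "a * d - b * c > 0"
 shows "moebius a b c d analytic_on upper_half_plane"
proof -
 have "(\<lambda>z. (of_int a * z + of_int b) / (of_int c * z + of_int d)) analytic_on upper_half_plane"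
  using moebius_det_nonzero[OF assms] by (intro analytic_intros) (auto simp: upper_half_plane_iff)
 thus ?thesis by (simp add: moebius_def[abs_def])
qed

lemma filterlim_moebius:
 assumes det: "a * d - b * c > 0" and z: "Im z > 0"
 shows "filterlim (moebius a b c d) (at (moebius a b c d z)) (at z)"
proof (rule filterlim_atI)
 have "moebius a b c d analytic_on {z}"
  by (rule analytic_on_subset[OF moebius_analytic[OF det]]) (use z in \<open>simp add: upper_half_plane_iff\<close>)
 thus "moebius a b c d \<midarrow>z\<rightarrow> moebius a b c d z" using analytic_at_imp_isCont isContD by blast
 have "\<forall>\<^sub>F w in at z. w \<in> {w. Im w > 0} - {z}" using z by (intro eventually_at_in_open open_upper) simp
 thus "\<forall>\<^sub>F w in at z. moebius a b c d w \<noteq> moebius a b c d z"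
  by (rule eventually_mono) (use moebius_inverse[OF det] z in \<open>metis Diff_iff insertI1 mem_Collect_eq\<close>)
qed

text \<open>The inverse transformation supplies the reverse inclusion of filters. Equality is what
  lets \<open>remove_sings\<close> commute with the transformation.\<close>

lemma filtermap_moebius:
 assumes det: "a * d - b * c > 0" and z: "Im z > 0"
 shows "filtermap (moebius a b c d) (at z) = at (moebius a b c d z)"
proof (rule antisym)
 show "filtermap (moebius a b c d) (at z) \<le> at (moebius a b c d z)"
  using filterlim_moebius[OF assms] by (simp add: filterlim_def)
 define z' where "z' = moebius a b c d z"
 have z': "Im z' > 0" unfolding z'_def by (rule Im_moebius_det_pos[OF assms])
 have det': "d * a - (- b) * (- c) > 0" using det by (simp add: mult.commute)
 have inv: "moebius a b c d (moebius d (- b) (- c) a w) = w" if "Im w > 0" for w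
  using moebius_inverse[OF det' that] by simp
 have "filterlim (moebius d (- b) (- c) a) (at z) (at z')"
  using filterlim_moebius[OF det' z'] moebius_inverse[OF det z] by (simp add: z'_def)
 hence "filtermap (moebius a b c d) (filtermap (moebius d (- b) (- c) a) (at z')) \<le> filtermap (moebius a b c d) (at z)"
  unfolding filterlim_def by (rule filtermap_mono)
 moreover have "filtermap (moebius a b c d) (filtermap (moebius d (- b) (- c) a) (at z')) = at z'"
 proof -
  have "\<forall>\<^sub>F w in at z'. w \<in> {w. Im w > 0} - {z'}" using z' by (intro eventually_at_in_open open_upper) simp
  hence "\<forall>\<^sub>F w in at z'. moebius a b c d (moebius d (- b) (- c) a w) = w" by (rule eventually_mono) (use inv in auto)
  hence "eventually (\<lambda>w. Q (moebius a b c d (moebius d (- b) (- c) a w))) (at z') \<longleftrightarrow> eventually Q (at z')" for Q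
   by (intro eventually_subst) (auto elim: eventually_mono)
  thus ?thesis by (simp add: filtermap_filtermap filter_eq_iff eventually_filtermap)
 qed
 ultimately show "at (moebius a b c d z) \<le> filtermap (moebius a b c d) (at z)" by (simp add: z'_def)
qed

lemma meromorphic_on_moebius:
 assumes "f meromorphic_on upper_half_plane" "a * d - b * c > 0"
 shows "(\<lambda>z. f (moebius a b c d z)) meromorphic_on upper_half_plane"
 using assms by (intro meromorphic_on_compose[OF _ moebius_analytic]) (auto simp: upper_half_plane_iff Im_moebius_det_pos)

lemma canonical_rep_moebius:
 assumes "a * d - b * c > 0" "Im z > 0"
 shows "canonical_rep f (moebius a b c d z) = remove_sings (\<lambda>z. f (moebius a b c d z)) z"
 using remove_sings_compose[OF filtermap_moebius[OF assms], of f] Im_moebius_det_pos[OF assms]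
 by (simp add: canonical_rep_def upper_half_plane_iff o_def)

definition locally_bounded_at :: "(complex \<Rightarrow> complex) \<Rightarrow> complex \<Rightarrow> bool" where
 "locally_bounded_at f z \<longleftrightarrow> (\<exists>C. \<forall>\<^sub>F w in at z. norm (f w) \<le> C)"

lemma locally_bounded_at_limit:
 assumes "locally_bounded_at f z" "f meromorphic_on {z}"
 obtains c where "f \<midarrow>z\<rightarrow> c"
proof -
 have "\<not> is_pole f z"
 proof
  assume p: "is_pole f z"
  obtain C where C: "\<forall>\<^sub>F w in at z. norm (f w) \<le> C" using assms(1) by (auto simp: locally_bounded_at_def)
  have "\<forall>\<^sub>F w in at z. norm (f w) > C"
   using p unfolding is_pole_def filterlim_at_infinity_imp_norm_at_top[THEN filterlim_at_top_dense[THEN iffD1]]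
   by (metis filterlim_at_infinity_imp_norm_at_top filterlim_at_top_dense)
  with C have "\<forall>\<^sub>F w in at z. False" by eventually_elim simp
  thus False by simp
 qed
 moreover have "not_essential f z" using assms(2) by (rule meromorphic_on_not_essential)
 ultimately show thesis using that by (auto simp: not_essential_def)
qed

lemma locally_bounded_remove_sings_analytic:
 assumes "locally_bounded_at f z" "f meromorphic_on {z}"
 shows "remove_sings f analytic_on {z}"
 using locally_bounded_at_limit[OF assms] remove_sings_analytic_at meromorphic_on_isolated_singularity[OF assms(2)] by metis

lemma norm_remove_sings_le:
 assumes "\<forall>\<^sub>F w in at z. norm (f w) \<le> B w" "B \<midarrow>z\<rightarrow> B z" "B z \<ge> 0"
 shows "norm (remove_sings f z) \<le> B z"
proof (cases "\<exists>c. f \<midarrow>z\<rightarrow> c")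
 case True
 then obtain c where c: "f \<midarrow>z\<rightarrow> c" by blast
 have "norm c \<le> B z" by (rule tendsto_le[OF _ assms(2) tendsto_norm[OF c] assms(1)]) simp
 thus ?thesis using remove_sings_eqI[OF c] by simp
next
 case False
 thus ?thesis using assms(3) by (simp add: remove_sings_def)
qed

lemma locally_bounded_at_mult:
 assumes "locally_bounded_at f z" "locally_bounded_at g z"
 shows "locally_bounded_at (\<lambda>w. f w * g w) z"
proof -
 obtain C D where "\<forall>\<^sub>F w in at z. norm (f w) \<le> C" "\<forall>\<^sub>F w in at z. norm (g w) \<le> D"
  using assms by (auto simp: locally_bounded_at_def)
 hence "\<forall>\<^sub>F w in at z. norm (f w * g w) \<le> C * D"
  by eventually_elim (auto simp: norm_mult intro!: mult_mono intro: order_trans[OF norm_ge_zero])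
 thus ?thesis by (auto simp: locally_bounded_at_def)
qed

lemma tendsto_imp_locally_bounded_at:
 assumes "f \<midarrow>z\<rightarrow> c"
 shows "locally_bounded_at f z"
proof -
 have "\<forall>\<^sub>F w in at z. norm (f w) < norm c + 1"
  using tendsto_norm[OF assms] by (rule order_tendstoD) simp
 hence "\<forall>\<^sub>F w in at z. norm (f w) \<le> norm c + 1" by (rule eventually_mono) simp
 thus ?thesis unfolding locally_bounded_at_def by blast
qed

lemma moderate_eventually_locally_bounded:
 assumes "moderate f"
 shows "NEAR z. locally_bounded_at f z"
proof -
 obtain m C where "NEAR z. norm (f z) \<le> C * exp (real m * Im z)"
  using assms by (auto simp: moderate_def)
 then obtain y where y: "\<And>z. Im z \<ge> y \<Longrightarrow> norm (f z) \<le> C * exp (real m * Im z)"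
  by (auto simp: eventually_at_i_infinity)
 have "locally_bounded_at f z" if z: "Im z > y" for z
 proof -
  have "\<forall>\<^sub>F w in at z. w \<in> ({w. Im w > y} \<inter> {w. Im w < Im z + 1}) - {z}"
   using z by (intro eventually_at_in_open open_Int open_halfspace_Im_gt open_halfspace_Im_lt) simp
  hence "\<forall>\<^sub>F w in at z. norm (f w) \<le> \<bar>C\<bar> * exp (real m * (Im z + 1))"
  proof eventually_elim
   case (elim w)
   have "norm (f w) \<le> C * exp (real m * Im w)" using elim y by simp
   also have "\<dots> \<le> \<bar>C\<bar> * exp (real m * (Im z + 1))" using elim by (intro mult_mono) (auto intro: mult_left_mono)
   finally show ?case .
  qed
  thus ?thesis unfolding locally_bounded_at_def by blast
 qed
 thus ?thesis using eventually_Im_gt[of y] by (auto elim: eventually_mono)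
qed

lemma eventually_norm_remove_sings_le:
 assumes "NEAR z. norm (f z) \<le> C * exp (m * Im z)"
 shows "NEAR z. norm (remove_sings f z) \<le> C * exp (m * Im z)"
proof -
 obtain y where y: "\<And>z. Im z \<ge> y \<Longrightarrow> norm (f z) \<le> C * exp (m * Im z)"
  using assms by (auto simp: eventually_at_i_infinity)
 have "norm (remove_sings f z) \<le> C * exp (m * Im z)" if z: "Im z > y" for z
 proof (rule norm_remove_sings_le[where B = "\<lambda>z. C * exp (m * Im z)"])
  have "\<forall>\<^sub>F w in at z. w \<in> {w. Im w > y} - {z}" using z by (intro eventually_at_in_open open_halfspace_Im_gt) simp
  thus "\<forall>\<^sub>F w in at z. norm (f w) \<le> C * exp (m * Im w)" by (rule eventually_mono) (use y in auto)
  show "(\<lambda>w. C * exp (m * Im w)) \<midarrow>z\<rightarrow> C * exp (m * Im z)" by (intro tendsto_intros)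
  show "0 \<le> C * exp (m * Im z)" using y[of z] z norm_ge_zero[of "f z"] by linarith
 qed
 thus ?thesis using eventually_Im_gt[of y] by (auto elim: eventually_mono)
qed

lemma canonical_rep_analytic:
 assumes "locally_bounded_at f z" "f meromorphic_on {z}" "Im z > 0"
 shows "canonical_rep f analytic_on {z}"
proof -
 have "\<forall>\<^sub>F w in nhds z. w \<in> {w. Im w > 0}" using assms(3) by (intro eventually_nhds_in_open open_upper) simp
 hence "\<forall>\<^sub>F w in nhds z. remove_sings f w = canonical_rep f w"
  by (rule eventually_mono) (simp add: canonical_rep_def upper_half_plane_iff)
 thus ?thesis using locally_bounded_remove_sings_analytic[OF assms(1,2)] analytic_at_cong by blast
qed

section \<open>Automorphic functions and the function field\<close>

text \<open>A version of \<open>modular_function\<close> without normalised values at singularities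
  and with growth in place of expansions. It is closed under pointwise operations, and
  \<open>canonical_rep\<close> leads back to modular functions.\<close>

definition automorphic :: "nat \<Rightarrow> (complex \<Rightarrow> complex) \<Rightarrow> bool" where
 "automorphic N f \<longleftrightarrow> f meromorphic_on upper_half_plane \<and> Gamma0_invariant N f \<and>
   (\<forall>a b c d. a * d - b * c = 1 \<longrightarrow> moderate (\<lambda>z. f (moebius a b c d z)))"

lemma Gamma0_invariantD:
 "Gamma0_invariant N f \<Longrightarrow> a * d - b * c = 1 \<Longrightarrow> int N dvd c \<Longrightarrow> Im z > 0 \<Longrightarrow> f (moebius a b c d z) = f z"
 by (simp add: Gamma0_invariant_def upper_half_plane_iff)

lemma automorphicD:
 assumes "automorphic N f"
 shows "f meromorphic_on upper_half_plane" "Gamma0_invariant N f"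
  "\<And>a b c d. a * d - b * c = 1 \<Longrightarrow> moderate (\<lambda>z. f (moebius a b c d z))"
 using assms by (auto simp: automorphic_def)

lemma automorphic_const: "automorphic N (\<lambda>_. c)"
 by (simp add: automorphic_def Gamma0_invariant_def moderate_const meromorphic_on_const)

lemma automorphic_add: "automorphic N f \<Longrightarrow> automorphic N g \<Longrightarrow> automorphic N (\<lambda>z. f z + g z)"
 unfolding automorphic_def Gamma0_invariant_def by (auto intro: moderate_add meromorphic_on_add)

lemma automorphic_mult: "automorphic N f \<Longrightarrow> automorphic N g \<Longrightarrow> automorphic N (\<lambda>z. f z * g z)"
 unfolding automorphic_def Gamma0_invariant_def by (auto intro: moderate_mult meromorphic_on_mult)

lemma automorphic_poly: "automorphic N f \<Longrightarrow> automorphic N (\<lambda>z. poly p (f z))"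
 by (induction p) (auto intro: automorphic_const automorphic_add automorphic_mult)

text \<open>The translation by N, conjugated by the given matrix, has rows (1 - a c N, a^2 N) and
  (-c^2 N, 1 + a c N) and lies in Gamma0(N).\<close>

lemma Gamma0_invariant_periodic:
 assumes f: "Gamma0_invariant N f" and det: "a * d - b * c = 1" and z: "Im z > 0"
 shows "f (moebius a b c d (z + of_nat N)) = f (moebius a b c d z)"
proof -
 define n where "n = int N"
 have det': "(1 - a * c * n) * (1 + a * c * n) - (a ^ 2 * n) * (- (c ^ 2) * n) = 1"
  by (simp add: power2_eq_square algebra_simps)
 have e: "(1 - a * c * n) * a + a ^ 2 * n * c = a" "(- (c ^ 2) * n) * a + (1 + a * c * n) * c = c"
  by (simp_all add: power2_eq_square algebra_simps)
 have "(1 - a * c * n) * b + a ^ 2 * n * d = b + a * n * (a * d - b * c)"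
  "(- (c ^ 2) * n) * b + (1 + a * c * n) * d = d + c * n * (a * d - b * c)"
  by (simp_all add: power2_eq_square algebra_simps)
 note e' = this[unfolded det mult_1_right]
 have "moebius a b c d (z + of_nat N) = moebius a (b + a * n) c (d + c * n) z"
  by (simp add: moebius_def n_def algebra_simps)
 also have "\<dots> = moebius (1 - a * c * n) (a ^ 2 * n) (- (c ^ 2) * n) (1 + a * c * n) (moebius a b c d z)"
  by (subst moebius_compose[OF moebius_denom_nonzero[OF det z]]) (simp only: e e')
 finally show ?thesis
  using Gamma0_invariantD[OF f det' _ Im_moebius_pos[OF det z]] by (simp add: n_def)
qed

lemma modular_function_automorphic:
 assumes "modular_function N f" "N > 0"
 shows "automorphic N f"
 using assms unfolding modular_function_def automorphic_def nicely_meromorphic_on_def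
 by (blast intro: has_q_expansion_moderate)

lemma automorphic_inverse:
 assumes "modular_function N f" "N > 0"
 shows "automorphic N (\<lambda>z. inverse (f z))"
proof -
 have "moderate (\<lambda>z. inverse (f (moebius a b c d z)))" if det: "a * d - b * c = 1" for a b c d
 proof -
  obtain F where "has_q_expansion N (\<lambda>z. f (moebius a b c d z)) F"
   using assms(1) det unfolding modular_function_def by blast
  from has_q_expansion_moderate[OF has_q_expansion_inverse[OF this assms(2)] assms(2)] show ?thesis .
 qed
 thus ?thesis using assms(1)
  by (auto simp: automorphic_def modular_function_def nicely_meromorphic_on_def Gamma0_invariant_def intro: meromorphic_on_inverse)
qed

lemma canonical_rep_upper: "Im z > 0 \<Longrightarrow> canonical_rep f z = remove_sings f z"
 by (simp add: canonical_rep_def upper_half_plane_iff)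

lemma eventually_at_upper: "Im z > 0 \<Longrightarrow> \<forall>\<^sub>F w in at z. Im w > 0"
 using eventually_at_in_open'[OF open_upper, of z] by simp

lemma canonical_rep_cong:
 assumes "\<And>z. Im z > 0 \<Longrightarrow> \<forall>\<^sub>F w in at z. f w = g w"
 shows "canonical_rep f = canonical_rep g"
 using assms by (auto simp: canonical_rep_def upper_half_plane_iff intro!: ext remove_sings_cong)

lemma eventually_canonical_rep:
 assumes "f meromorphic_on upper_half_plane" "Im z > 0"
 shows "\<forall>\<^sub>F w in at z. canonical_rep f w = f w"
proof -
 have "isolated_singularity_at f z"
  by (rule meromorphic_on_isolated_singularity[OF meromorphic_on_subset[OF assms(1)]])
   (use assms(2) in \<open>simp add: upper_half_plane_iff\<close>)
 from eventually_remove_sings_eq_at[OF this] eventually_at_upper[OF assms(2)]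
 show ?thesis by eventually_elim (simp add: canonical_rep_upper)
qed

lemma canonical_rep_nicely_meromorphic:
 assumes "f meromorphic_on upper_half_plane"
 shows "canonical_rep f nicely_meromorphic_on upper_half_plane"
proof -
 have n: "remove_sings f nicely_meromorphic_on upper_half_plane"
  by (rule remove_sings_nicely_meromorphic[OF assms])
 have ev: "\<forall>\<^sub>F w in at z. canonical_rep f w = remove_sings f w" if "Im z > 0" for z
  using eventually_at_upper[OF that] by eventually_elim (simp add: canonical_rep_upper)
 have "canonical_rep f meromorphic_on upper_half_plane \<longleftrightarrow> remove_sings f meromorphic_on upper_half_plane"
  by (rule meromorphic_on_cong) (use ev in \<open>auto simp: upper_half_plane_iff\<close>)
 moreover have "is_pole (canonical_rep f) z \<longleftrightarrow> is_pole (remove_sings f) z"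
  "canonical_rep f \<midarrow>z\<rightarrow> c \<longleftrightarrow> remove_sings f \<midarrow>z\<rightarrow> c" if "Im z > 0" for z c
  using is_pole_cong[OF ev[OF that] refl] tendsto_cong[OF ev[OF that]] by blast+
 ultimately show ?thesis
  using n by (auto simp: nicely_meromorphic_on_def upper_half_plane_iff canonical_rep_upper)
qed

text \<open>Near a cusp moderate growth excludes poles, so the representative is analytic there;
  invariance supplies the period N. Both together give the expansion.\<close>

lemma modular_function_canonical_rep:
 assumes f: "automorphic N f" and N: "N > 0"
 shows "modular_function N (canonical_rep f)"
proof -
 have mero: "f meromorphic_on upper_half_plane" by (rule automorphicD[OF f])
 have "Gamma0_invariant N (canonical_rep f)"
  unfolding Gamma0_invariant_def
 proof (intro allI impI ballI)
  fix a b c d :: int and z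
  assume det: "a * d - b * c = 1" and c: "int N dvd c" and z: "z \<in> upper_half_plane"
  hence z: "Im z > 0" by (simp add: upper_half_plane_iff)
  have "\<forall>\<^sub>F w in at z. f (moebius a b c d w) = f w"
   using eventually_at_upper[OF z] by eventually_elim (rule Gamma0_invariantD[OF automorphicD(2)[OF f] det c])
  hence "remove_sings (\<lambda>z. f (moebius a b c d z)) z = remove_sings f z" by (rule remove_sings_cong) simp
  thus "canonical_rep f (moebius a b c d z) = canonical_rep f z"
   using canonical_rep_moebius[of a d b c z f] det z by (simp add: canonical_rep_upper)
 qed
 moreover have "\<exists>F. has_q_expansion N (\<lambda>z. canonical_rep f (moebius a b c d z)) F" if det: "a * d - b * c = 1" for a b c d
 proof (rule moderate_imp_has_q_expansion[OF N])
  define g where "g = (\<lambda>z. f (moebius a b c d z))"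
  have det0: "a * d - b * c > 0" using det by simp
  have eq: "canonical_rep f (moebius a b c d z) = canonical_rep g z" if "Im z > 0" for z
   unfolding canonical_rep_moebius[OF det0 that] canonical_rep_upper[OF that] g_def ..
  have mod: "moderate g" unfolding g_def by (rule automorphicD(3)[OF f det])
  then obtain m C where "NEAR z. norm (g z) \<le> C * exp (real m * Im z)" by (auto simp: moderate_def)
  from eventually_norm_remove_sings_le[OF this] eventually_Im_gt[of 0]
  have "NEAR z. norm (canonical_rep f (moebius a b c d z)) \<le> C * exp (real m * Im z)"
   by eventually_elim (simp add: eq canonical_rep_upper)
  thus "moderate (\<lambda>z. canonical_rep f (moebius a b c d z))" by (rule moderateI)
  show "NEAR z. canonical_rep f (moebius a b c d (z + of_nat N)) = canonical_rep f (moebius a b c d z)"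
   using eventually_Im_gt[of 0]
   by eventually_elim (rule Gamma0_invariant_periodic[OF \<open>Gamma0_invariant N (canonical_rep f)\<close> det])
  show "NEAR z. (\<lambda>z. canonical_rep f (moebius a b c d z)) analytic_on {z}"
   using moderate_eventually_locally_bounded[OF mod] eventually_Im_gt[of 0]
  proof eventually_elim
   case (elim z)
   have "canonical_rep g analytic_on {z}"
    by (rule canonical_rep_analytic[OF elim(1) meromorphic_on_subset[OF meromorphic_on_moebius[OF mero det0], folded g_def] elim(2)])
     (use elim(2) in \<open>simp add: upper_half_plane_iff\<close>)
   moreover have "\<forall>\<^sub>F w in nhds z. w \<in> {w. Im w > 0}" using elim(2) by (intro eventually_nhds_in_open open_upper) simp
   hence "\<forall>\<^sub>F w in nhds z. canonical_rep g w = canonical_rep f (moebius a b c d w)"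
    by (rule eventually_mono) (simp add: eq)
   ultimately show ?case by (subst (asm) analytic_at_cong) auto
  qed
 qed
 ultimately show ?thesis
  using canonical_rep_nicely_meromorphic[OF mero] by (simp add: modular_function_def canonical_rep_def)
qed

lemma has_q_expansion_canonical_rep:
 assumes "has_q_expansion h f F" "h > 0"
 shows "has_q_expansion h (canonical_rep f) F"
proof -
 have "NEAR z. canonical_rep f z = f z"
  using has_q_expansion_analytic[OF assms] eventually_Im_gt[of 0]
  by eventually_elim (simp add: canonical_rep_upper)
 thus ?thesis using assms(1) has_q_expansion_cong by blast
qed

lemma canonical_rep_eq:
 assumes "modular_function N f"
 shows "canonical_rep f = f"
proof
 fix z
 show "canonical_rep f z = f z"
 proof (cases "Im z > 0")
  case True
  hence "is_pole f z \<and> f z = 0 \<or> f \<midarrow>z\<rightarrow> f z"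
   using assms by (auto simp: modular_function_def nicely_meromorphic_on_def upper_half_plane_iff)
  thus ?thesis using True by (auto simp: canonical_rep_upper)
 next
  case False
  thus ?thesis using assms by (auto simp: modular_function_def canonical_rep_def upper_half_plane_iff)
 qed
qed

lemma modular_function_meromorphic: "modular_function N f \<Longrightarrow> f meromorphic_on upper_half_plane"
 by (simp add: modular_function_def nicely_meromorphic_on_def)

text \<open>The identity theorem on the connected half plane. It is applied to the normalised
  difference, which takes honest values at removable singularities.\<close>

lemma meromorphic_eq_near_infinity:
 assumes f: "f meromorphic_on upper_half_plane" and g: "g meromorphic_on upper_half_plane"
  and ev: "NEAR z. f z = g z" and z: "Im z > 0"
 shows "\<forall>\<^sub>F w in at z. f w = g w"
proof -
 define h where "h = (\<lambda>z. f z - g z)"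
 have h: "h meromorphic_on upper_half_plane" unfolding h_def by (intro meromorphic_intros f g)
 obtain y where y: "\<And>z. Im z \<ge> y \<Longrightarrow> f z = g z" using ev by (auto simp: eventually_at_i_infinity)
 define z0 where "z0 = Complex 0 (max 1 (y + 1))"
 have "\<forall>\<^sub>F w in at z0. w \<in> {w. Im w > y}"
  by (intro eventually_at_in_open' open_halfspace_Im_gt) (simp add: z0_def)
 hence "\<forall>\<^sub>F w in at z0. h w = 0" by (rule eventually_mono) (simp add: h_def y)
 moreover have "\<forall>\<^sub>F w in at z0. canonical_rep h w = h w"
  by (rule eventually_canonical_rep[OF h]) (simp add: z0_def)
 ultimately have "\<forall>\<^sub>F w in at z0. canonical_rep h w = 0" by eventually_elim simp
 hence "\<exists>\<^sub>F w in at z0. canonical_rep h w = 0" by (rule eventually_frequently[rotated]) simp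
 moreover have "z0 \<in> upper_half_plane" by (simp add: z0_def upper_half_plane_iff)
 ultimately have h0: "canonical_rep h w = 0" if "w \<in> upper_half_plane" for w
  using frequently_eq_meromorphic_imp_constant[OF _ canonical_rep_nicely_meromorphic[OF h] open_upper_half_plane connected_upper_half_plane] that
  by blast
 from eventually_canonical_rep[OF h z] eventually_at_upper[OF z]
 have "\<forall>\<^sub>F w in at z. h w = 0" by eventually_elim (use h0 in \<open>simp add: upper_half_plane_iff\<close>)
 thus ?thesis by eventually_elim (simp add: h_def)
qed

lemma modular_function_eqI:
 assumes "modular_function N f" "modular_function N g" "NEAR z. f z = g z"
 shows "f = g"
 using canonical_rep_cong[OF meromorphic_eq_near_infinity[OF modular_function_meromorphic modular_function_meromorphic], OF assms]
  canonical_rep_eq assms by metis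

section \<open>Expansions determine functions\<close>

definition q_expansion :: "(complex \<Rightarrow> complex) \<Rightarrow> complex fls" where
 "q_expansion f = (THE F. has_q_expansion 1 f F)"

lemma q_expansion_eq: "has_q_expansion 1 f F \<Longrightarrow> q_expansion f = F"
 unfolding q_expansion_def by (rule the_equality) (auto intro: has_q_expansion_unique[of 1 f])

lemma modular_function_eqI':
 assumes "modular_function N f" "modular_function N g" "has_q_expansion 1 f F" "has_q_expansion 1 g F"
 shows "f = g"
proof (rule modular_function_eqI[OF assms(1,2)])
 let ?e = "\<lambda>z. eval_fls F (exp (2 * of_real pi * \<i> * z / of_nat 1))"
 have "NEAR z. f z = ?e z" "NEAR z. g z = ?e z"
  using assms(3,4) unfolding has_q_expansion_def by blast+
 thus "NEAR z. f z = g z" by eventually_elim simp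
qed

section \<open>Rational coefficients\<close>

definition rational_coeffs :: "complex fls \<Rightarrow> bool" where
 "rational_coeffs F \<longleftrightarrow> (\<forall>n. fls_nth F n \<in> \<rat>)"

lemma fls_times_nth_wide:
 fixes F G :: "'a :: comm_ring_1 fls"
 assumes "m \<le> fls_subdegree F" "l \<le> fls_subdegree G"
 shows "fls_nth (F * G) n = (\<Sum>i=m..n-l. fls_nth F i * fls_nth G (n - i))"
proof -
 have "(\<Sum>i=fls_subdegree F..n - fls_subdegree G. fls_nth F i * fls_nth G (n - i)) =
   (\<Sum>i=m..n-l. fls_nth F i * fls_nth G (n - i))"
  by (rule sum.mono_neutral_left) (use assms in \<open>auto simp: not_le\<close>)
 thus ?thesis by (simp add: fls_times_nth(2))
qed

lemma rational_coeffs_add: "rational_coeffs F \<Longrightarrow> rational_coeffs G \<Longrightarrow> rational_coeffs (F + G)"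
 by (simp add: rational_coeffs_def)

lemma rational_coeffs_uminus: "rational_coeffs F \<Longrightarrow> rational_coeffs (- F)"
 by (simp add: rational_coeffs_def)

lemma rational_coeffs_mult: "rational_coeffs F \<Longrightarrow> rational_coeffs G \<Longrightarrow> rational_coeffs (F * G)"
 by (simp add: rational_coeffs_def fls_times_nth(2) Rats_sum)

lemma rational_coeffs_const: "c \<in> \<rat> \<Longrightarrow> rational_coeffs (fls_const c)"
 by (simp add: rational_coeffs_def)

lemma rational_coeffs_1: "rational_coeffs 1"
 by (simp add: rational_coeffs_def)

text \<open>Applied to all coefficients, such a functional is linear over Laurent series with
  rational coefficients. It serves twice: inverses of rational series are rational, and complex
  relations yield rational ones.\<close>

locale rational_functional =
 fixes \<phi> :: "complex \<Rightarrow> rat"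
 assumes add: "\<phi> (u + v) = \<phi> u + \<phi> v" and scale: "\<phi> (of_rat r * u) = r * \<phi> u"
begin

lemma zero [simp]: "\<phi> 0 = 0"
 using scale[of 0 0] by simp

lemma sum: "\<phi> (sum f A) = (\<Sum>x\<in>A. \<phi> (f x))"
 by (induction A rule: infinite_finite_induct) (simp_all add: add)

definition apply_fls :: "complex fls \<Rightarrow> complex fls" where
 "apply_fls F = Abs_fls (\<lambda>n. of_rat (\<phi> (fls_nth F n)))"

lemma apply_fls_nth: "fls_nth (apply_fls F) n = of_rat (\<phi> (fls_nth F n))"
proof -
 obtain m where "\<forall>n<m. fls_nth F n = 0" by (rule fls_nth_vanishes_belowE)
 hence "\<forall>n<m. of_rat (\<phi> (fls_nth F n)) = (0 :: complex)" by simp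
 thus ?thesis unfolding apply_fls_def by (rule nth_Abs_fls_lower_bound)
qed

lemma apply_fls_add: "apply_fls (F + G) = apply_fls F + apply_fls G"
 by (rule fls_eqI) (simp add: apply_fls_nth add of_rat_add)

lemma apply_fls_mult:
 assumes "rational_coeffs F"
 shows "apply_fls (F * G) = F * apply_fls G"
proof (rule fls_eqI)
 fix n
 \<comment> \<open>A common lower bound for both orders: the functional may kill leading
   coefficients, so the two products are compared over one wider range.\<close>
 define l where "l = min (fls_subdegree G) (fls_subdegree (apply_fls G))"
 have "of_rat (\<phi> (fls_nth F i * fls_nth G j)) = fls_nth F i * of_rat (\<phi> (fls_nth G j))" for i j
 proof -
  obtain r where "fls_nth F i = of_rat r" using assms by (auto simp: rational_coeffs_def Rats_def)
  thus ?thesis by (simp add: scale of_rat_mult)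
 qed
 thus "fls_nth (apply_fls (F * G)) n = fls_nth (F * apply_fls G) n"
  using fls_times_nth_wide[of "fls_subdegree F" F l G n] fls_times_nth_wide[of "fls_subdegree F" F l "apply_fls G" n]
  by (simp add: apply_fls_nth l_def sum of_rat_sum)
qed

lemma apply_fls_const: "apply_fls (fls_const c) = fls_const (of_rat (\<phi> c))"
 by (rule fls_eqI) (simp add: apply_fls_nth)

end

lemma rational_functional_exists:
 assumes "p \<noteq> 0"
 obtains v where "rational_functional v" "v p = 1"
proof -
 interpret rational: vector_space_pair "\<lambda>r (u :: complex). of_rat r * u" "\<lambda>r (u :: rat). r * u"
  by unfold_locales (simp_all add: algebra_simps of_rat_add of_rat_mult)
 have indep: "rational.vs1.independent {p}" using assms by (simp add: rational.vs1.dependent_single)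
 define v where "v = rational.construct {p} (\<lambda>_. 1)"
 have lin: "Vector_Spaces.linear (\<lambda>r (u :: complex). of_rat r * u) (\<lambda>r (u :: rat). r * u) v"
  unfolding v_def by (rule rational.linear_construct[OF indep])
 show thesis
 proof
  show "rational_functional v"
   using lin by unfold_locales (simp_all add: rational.linear_add rational.linear_scale)
  show "v p = 1" unfolding v_def by (rule rational.construct_basis[OF indep]) simp
 qed
qed

text \<open>A functional with value 1 at 1, applied to F times its inverse, shows that the
  rationalised inverse is an inverse too; inverses are unique.\<close>

lemma rational_coeffs_inverse:
 assumes "rational_coeffs F"
 shows "rational_coeffs (inverse F)"
proof (cases "F = 0")
 case False
 obtain v where v: "rational_functional v" "v 1 = 1" using rational_functional_exists[of 1] by auto
 interpret rational_functional v by fact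
 have "F * apply_fls (inverse F) = 1"
  using apply_fls_mult[OF assms, of "inverse F"] apply_fls_const[of 1] False v(2) by simp
 hence "apply_fls (inverse F) = inverse F" using False by (simp add: field_simps)
 thus ?thesis unfolding rational_coeffs_def by (metis apply_fls_nth Rats_of_rat)
qed (simp add: rational_coeffs_def)

lemma rational_coeffs_divide: "rational_coeffs F \<Longrightarrow> rational_coeffs G \<Longrightarrow> rational_coeffs (F / G)"
 unfolding divide_inverse by (intro rational_coeffs_mult rational_coeffs_inverse)

section \<open>The function field embeds into the Laurent series\<close>

text \<open>The laws are pulled back along the injective map. Negatives and inverses enter only
  through their images, so the operations of K need not be unfolded for them.\<close>

lemma field_of_embedding:
 fixes K (structure) and w :: "'a \<Rightarrow> 'b :: field"
 assumes inj: "inj_on w (carrier K)" and unit: "\<one> \<in> carrier K" "w \<one> = 1" and null: "\<zero> \<in> carrier K" "w \<zero> = 0"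
  and add: "\<And>u v. u \<in> carrier K \<Longrightarrow> v \<in> carrier K \<Longrightarrow> u \<oplus> v \<in> carrier K \<and> w (u \<oplus> v) = w u + w v"
  and mult: "\<And>u v. u \<in> carrier K \<Longrightarrow> v \<in> carrier K \<Longrightarrow> u \<otimes> v \<in> carrier K \<and> w (u \<otimes> v) = w u * w v"
  and minus: "\<And>u. u \<in> carrier K \<Longrightarrow> \<exists>v\<in>carrier K. w v = - w u"
  and inverse: "\<And>u. u \<in> carrier K \<Longrightarrow> \<exists>v\<in>carrier K. w v = inverse (w u)"
 shows "field K"
proof -
 have eq: "u = v \<longleftrightarrow> w u = w v" if "u \<in> carrier K" "v \<in> carrier K" for u v
  using inj that by (auto simp: inj_on_def)
 have "abelian_group K"
 proof (rule abelian_groupI)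
  fix u assume u: "u \<in> carrier K"
  obtain v where "v \<in> carrier K" "w v = - w u" using minus[OF u] by blast
  thus "\<exists>v\<in>carrier K. v \<oplus> u = \<zero>" using u by (intro bexI[of _ v]) (simp_all add: eq add null)
 qed (simp_all add: eq add null add_ac)
 moreover have "comm_monoid K"
  by (rule comm_monoidI) (simp_all add: eq mult unit mult_ac)
 ultimately interpret cring K
  by (rule cringI) (simp add: eq mult add distrib_right)
 show ?thesis
 proof (rule cring_fieldI2)
  show "\<zero> \<noteq> \<one>" using null unit by (metis zero_neq_one)
  fix u assume u: "u \<in> carrier K" "u \<noteq> \<zero>"
  obtain v where "v \<in> carrier K" "w v = inverse (w u)" using inverse[OF u(1)] by blast
  moreover have "w u \<noteq> 0" using u null eq[of u \<zero>] by simp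
  ultimately show "\<exists>v\<in>carrier K. u \<otimes> v = \<one>" using u by (intro bexI[of _ v]) (simp_all add: eq mult unit null)
 qed
qed

context
 fixes N :: nat and K (structure)
 assumes N: "N > 0"
 defines "K \<equiv> X0_function_field N"
begin

lemma function_field_simps:
 "u \<otimes> v = canonical_rep (\<lambda>z. u z * v z)" "u \<oplus> v = canonical_rep (\<lambda>z. u z + v z)"
 "\<one> = canonical_rep (\<lambda>_. 1)" "\<zero> = (\<lambda>_. 0)"
 by (simp_all add: K_def X0_function_field_def)

lemma function_field_carrier:
 "u \<in> carrier K \<longleftrightarrow> modular_function N u \<and> (\<exists>F. has_q_expansion 1 u F \<and> rational_coeffs F)"
 by (simp add: K_def X0_function_field_def rational_coeffs_def)

lemma function_field_q_expansion:
 assumes "u \<in> carrier K"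
 shows "has_q_expansion 1 u (q_expansion u)" "rational_coeffs (q_expansion u)"
 using assms q_expansion_eq by (auto simp: function_field_carrier)

lemma canonical_rep_in_function_field:
 assumes "automorphic N f" "has_q_expansion 1 f F" "rational_coeffs F"
 shows "canonical_rep f \<in> carrier K \<and> q_expansion (canonical_rep f) = F"
 using modular_function_canonical_rep[OF assms(1) N] has_q_expansion_canonical_rep[OF assms(2)] assms(3) q_expansion_eq
 by (auto simp: function_field_carrier)

lemma function_field_automorphic: "u \<in> carrier K \<Longrightarrow> automorphic N u"
 using modular_function_automorphic N by (simp add: function_field_carrier)

lemma q_expansion_inj: "inj_on q_expansion (carrier K)"
 by (rule inj_onI) (metis function_field_carrier function_field_q_expansion(1) modular_function_eqI')

lemma function_field_add:
 "u \<in> carrier K \<Longrightarrow> v \<in> carrier K \<Longrightarrow> u \<oplus> v \<in> carrier K \<and> q_expansion (u \<oplus> v) = q_expansion u + q_expansion v"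
 unfolding function_field_simps
 by (intro canonical_rep_in_function_field automorphic_add function_field_automorphic has_q_expansion_add
  function_field_q_expansion rational_coeffs_add) auto

lemma function_field_mult:
 "u \<in> carrier K \<Longrightarrow> v \<in> carrier K \<Longrightarrow> u \<otimes> v \<in> carrier K \<and> q_expansion (u \<otimes> v) = q_expansion u * q_expansion v"
 unfolding function_field_simps
 by (intro canonical_rep_in_function_field automorphic_mult function_field_automorphic has_q_expansion_mult
  function_field_q_expansion rational_coeffs_mult) auto

lemma function_field_const:
 assumes "c \<in> \<rat>"
 shows "canonical_rep (\<lambda>_. c) \<in> carrier K \<and> q_expansion (canonical_rep (\<lambda>_. c)) = fls_const c"
 using assms by (intro canonical_rep_in_function_field automorphic_const has_q_expansion_const rational_coeffs_const)

lemma function_field_one: "\<one> \<in> carrier K" "q_expansion \<one> = 1"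
 using function_field_const[of 1] by (simp_all add: function_field_simps)

lemma function_field_zero: "\<zero> \<in> carrier K" "q_expansion \<zero> = 0"
proof -
 have "canonical_rep (\<lambda>_. 0) = (\<lambda>_. 0)" by (auto simp: canonical_rep_def intro!: ext)
 thus "\<zero> \<in> carrier K" "q_expansion \<zero> = 0"
  using function_field_const[of 0] by (simp_all add: function_field_simps)
qed

lemma function_field_uminus:
 assumes "u \<in> carrier K"
 shows "canonical_rep (\<lambda>z. - 1 * u z) \<in> carrier K \<and> q_expansion (canonical_rep (\<lambda>z. - 1 * u z)) = - q_expansion u"
proof -
 have "has_q_expansion 1 (\<lambda>z. - 1 * u z) (- q_expansion u)"
  using has_q_expansion_uminus[OF function_field_q_expansion(1)[OF assms]] by simp
 moreover have "automorphic N (\<lambda>z. - 1 * u z)"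
  by (intro automorphic_mult automorphic_const function_field_automorphic assms)
 ultimately show ?thesis
  by (intro canonical_rep_in_function_field rational_coeffs_uminus function_field_q_expansion assms)
qed

lemma function_field_inverse:
 assumes "u \<in> carrier K"
 shows "canonical_rep (\<lambda>z. inverse (u z)) \<in> carrier K \<and> q_expansion (canonical_rep (\<lambda>z. inverse (u z))) = inverse (q_expansion u)"
 using assms N by (intro canonical_rep_in_function_field automorphic_inverse has_q_expansion_inverse
  rational_coeffs_inverse function_field_q_expansion) (auto simp: function_field_carrier)

lemma function_field_field: "field K"
proof (rule field_of_embedding[of q_expansion])
 fix u assume "u \<in> carrier K"
 thus "\<exists>v\<in>carrier K. q_expansion v = - q_expansion u" "\<exists>v\<in>carrier K. q_expansion v = inverse (q_expansion u)"
  using function_field_uminus function_field_inverse by blast+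
qed (use q_expansion_inj function_field_one function_field_zero function_field_add function_field_mult in auto)

end

section \<open>The normalizer of level 56\<close>

lemma moebius_denom_pos:
 assumes "Im z > 0" "c \<noteq> 0 \<or> d \<noteq> 0"
 shows "of_int c * z + of_int d \<noteq> (0 :: complex)"
proof
 assume eq: "of_int c * z + of_int d = (0 :: complex)"
 hence "Im (of_int c * z + of_int d) = 0" by simp
 hence "c = 0" using assms(1) by simp
 with eq assms(2) show False by simp
qed

definition half_shift :: "complex \<Rightarrow> complex" where "half_shift = moebius 2 1 0 2"

definition fricke7 :: "complex \<Rightarrow> complex" where "fricke7 = moebius 7 (- 1) 56 (- 7)"

lemma half_shift_eq: "half_shift z = z + 1 / 2"
 by (simp add: half_shift_def moebius_def add_divide_distrib)

lemma Im_half_shift: "Im z > 0 \<Longrightarrow> Im (half_shift z) > 0"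
 by (simp add: half_shift_eq)

lemma Im_fricke7: "Im z > 0 \<Longrightarrow> Im (fricke7 z) > 0"
 unfolding fricke7_def by (rule Im_moebius_det_pos) simp_all

lemma fricke7_fricke7: "Im z > 0 \<Longrightarrow> fricke7 (fricke7 z) = z"
 unfolding fricke7_def by (subst moebius_compose[OF moebius_denom_pos]) (simp_all add: moebius_scalar)

text \<open>Every integer matrix of positive determinant is a unimodular one times an upper
  triangular one, with the gcd of the first column in the corner. Growth at the cusps thus passes to
  arbitrary rational matrices.\<close>

lemma moebius_reduce:
 fixes a b c d :: int
 assumes det: "a * d - b * c > 0"
 obtains a' b' c' d' g B D :: int where "a' * d' - b' * c' = 1" "g > 0" "D > 0" "a = a' * g" "c = c' * g"
  "\<And>z. moebius a b c d z = moebius a' b' c' d' (of_real (g / D) * z + of_int B / of_int D)"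
proof -
 define g where "g = gcd a c"
 have "g \<noteq> 0" using det by (auto simp: g_def)
 hence g: "g > 0" using gcd_ge_0_int[of a c] by (simp add: g_def)
 obtain a' c' where ac: "a = a' * g" "c = c' * g" and cop: "coprime a' c'"
  using gcd_coprime_exists[of a c] \<open>g \<noteq> 0\<close> unfolding g_def by metis
 obtain u v where uv: "u * a' + v * c' = 1" using cop by (metis coprime_iff_gcd_eq_1 bezout_int)
 define B D where "B = u * b + v * d" and "D = a' * d - c' * b"
 have "g * D = a * d - b * c" by (simp add: D_def ac algebra_simps)
 hence D: "D > 0" using det g by (metis zero_less_mult_pos)
 have e: "a' * B + (- v) * D = b" "c' * B + u * D = d"
 proof -
  have "a' * B + (- v) * D = b * (u * a' + v * c')" "c' * B + u * D = d * (u * a' + v * c')"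
   by (simp_all add: B_def D_def algebra_simps)
  thus "a' * B + (- v) * D = b" "c' * B + u * D = d" by (simp_all add: uv)
 qed
 show thesis
 proof (rule that[of a' u "- v" c' g D B])
  fix z
  have "moebius a' (- v) c' u (moebius g B 0 D z) = moebius (a' * g + (- v) * 0) (a' * B + (- v) * D) (c' * g + u * 0) (c' * B + u * D) z"
   by (rule moebius_compose) (use D in simp)
  thus "moebius a b c d z = moebius a' (- v) c' u (of_real (g / D) * z + of_int B / of_int D)"
   using D unfolding e by (simp add: ac moebius_def[of g B 0 D] add_divide_distrib)
 qed (use uv ac g D in \<open>simp_all add: algebra_simps\<close>)
qed

lemma automorphic_moderate:
 assumes f: "automorphic N f" and det: "a * d - b * c > 0"
 shows "moderate (\<lambda>z. f (moebius a b c d z))"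
proof -
 obtain a' b' c' d' g B D :: int where 1: "a' * d' - b' * c' = 1" "g > 0" "D > 0" "a = a' * g" "c = c' * g"
  "\<And>z. moebius a b c d z = moebius a' b' c' d' (of_real (g / D) * z + of_int B / of_int D)"
  by (rule moebius_reduce[OF det]) (rule that)
 thus ?thesis using moderate_compose_affine[OF automorphicD(3)[OF f 1(1)], of "g / D"] by simp
qed

text \<open>Conjugation by z + 1/2 changes b by (d - a) / 2 - c / 4 and the diagonal by c / 2. These
  are integers because a and d are odd and 56 divides c.\<close>

lemma half_shift_Gamma0:
 assumes f: "Gamma0_invariant 56 f"
 shows "Gamma0_invariant 56 (\<lambda>z. f (half_shift z))"
 unfolding Gamma0_invariant_def
proof (intro allI impI ballI)
 fix a b c d :: int and z assume det: "a * d - b * c = 1" and c: "int 56 dvd c" and "z \<in> upper_half_plane"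
 hence z: "Im z > 0" by (simp add: upper_half_plane_iff)
 have "odd (a * d)" using det c by (metis even_add even_diff dvd_mult dvd_trans odd_one even_numeral of_nat_numeral mult.commute add_diff_cancel_right' diff_add_cancel)
 hence "even (d - a)" by simp
 then obtain e where e: "d = a + 2 * e" by (metis dvdE diff_eq_eq add.commute)
 obtain c0 where c0: "c = 56 * c0" using c by auto
 define p q r s where "p = a + 28 * c0" and "q = b + e - 14 * c0" and "r = c" and "s = d - 28 * c0"
 have "p * s - q * r = a * d - b * c" by (simp add: p_def q_def r_def s_def c0 e algebra_simps)
 hence det': "p * s - q * r = 1" by (simp add: det)
 have "half_shift (moebius a b c d z) = moebius p q r s (half_shift z)"
  unfolding half_shift_def moebius_compose[OF moebius_denom_nonzero[OF det z]]
  by (subst moebius_compose[OF moebius_denom_pos[OF z]]) (simp_all add: p_def q_def r_def s_def c0 e algebra_simps)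
 thus "f (half_shift (moebius a b c d z)) = f (half_shift z)"
  using Gamma0_invariantD[OF f det' _ Im_half_shift[OF z]] c by (simp add: r_def)
qed

lemma fricke7_Gamma0:
 assumes f: "Gamma0_invariant 56 f"
 shows "Gamma0_invariant 56 (\<lambda>z. f (fricke7 z))"
 unfolding Gamma0_invariant_def
proof (intro allI impI ballI)
 fix a b c d :: int and z assume det: "a * d - b * c = 1" and c: "int 56 dvd c" and "z \<in> upper_half_plane"
 hence z: "Im z > 0" by (simp add: upper_half_plane_iff)
 obtain c0 where c0: "c = 56 * c0" using c by auto
 \<comment> \<open>The matrix W of \<open>fricke7\<close> has square -7, so the conjugate of M is
   -(W M W) / 7; its entries are integral because 7 divides c.\<close>
 define p q r s where "p = 56 * c0 - 7 * a - 56 * b + 8 * d" and "q = a - 8 * c0 + 7 * b - d"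
  and "r = 56 * (7 * c0 - a - 8 * b + d)" and "s = 8 * a - 56 * c0 + 56 * b - 7 * d"
 have "p * s - q * r = a * d - b * c" by (simp add: p_def q_def r_def s_def c0 algebra_simps)
 hence det': "p * s - q * r = 1" by (simp add: det)
 have "fricke7 (moebius a b c d z) = moebius p q r s (fricke7 z)"
  unfolding fricke7_def moebius_compose[OF moebius_denom_nonzero[OF det z]]
  by (subst moebius_compose[OF moebius_denom_pos[OF z]]) (simp_all add: p_def q_def r_def s_def c0 algebra_simps)
 thus "f (fricke7 (moebius a b c d z)) = f (fricke7 z)"
  using Gamma0_invariantD[OF f det' _ Im_fricke7[OF z]] by (simp add: r_def)
qed

lemma automorphic_half_shift:
 assumes f: "automorphic 56 f"
 shows "automorphic 56 (\<lambda>z. f (half_shift z))"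
 unfolding automorphic_def
proof (intro conjI allI impI half_shift_Gamma0 automorphicD(2)[OF f])
 show "(\<lambda>z. f (half_shift z)) meromorphic_on upper_half_plane"
  unfolding half_shift_def by (rule meromorphic_on_moebius[OF automorphicD(1)[OF f]]) simp
 fix a b c d :: int assume det: "a * d - b * c = 1"
 have "2 * a * (2 * d) - (2 * b + d) * (2 * c) + c * (2 * d) = 4 * (a * d - b * c)" by (simp add: algebra_simps)
 hence "(2 * a + c) * (2 * d) - (2 * b + d) * (2 * c) > 0" using det by (simp add: algebra_simps)
 from automorphic_moderate[OF f this]
 have "moderate (\<lambda>z. f (moebius (2 * a + c) (2 * b + d) (2 * c) (2 * d) z))" .
 moreover have "NEAR z. f (moebius (2 * a + c) (2 * b + d) (2 * c) (2 * d) z) = f (half_shift (moebius a b c d z))"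
  using eventually_Im_gt[of 0]
  by eventually_elim (simp add: half_shift_def moebius_compose[OF moebius_denom_nonzero[OF det]])
 ultimately show "moderate (\<lambda>z. f (half_shift (moebius a b c d z)))" by (rule moderate_cong[rotated])
qed

lemma automorphic_fricke7:
 assumes f: "automorphic 56 f"
 shows "automorphic 56 (\<lambda>z. f (fricke7 z))"
 unfolding automorphic_def
proof (intro conjI allI impI fricke7_Gamma0 automorphicD(2)[OF f])
 show "(\<lambda>z. f (fricke7 z)) meromorphic_on upper_half_plane"
  unfolding fricke7_def by (rule meromorphic_on_moebius[OF automorphicD(1)[OF f]]) simp
 fix a b c d :: int assume det: "a * d - b * c = 1"
 have "(7 * a - c) * (56 * b - 7 * d) - (7 * b - d) * (56 * a - 7 * c) = 7 * (a * d - b * c)" by (simp add: algebra_simps)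
 hence "(7 * a - c) * (56 * b - 7 * d) - (7 * b - d) * (56 * a - 7 * c) > 0" using det by simp
 from automorphic_moderate[OF f this]
 have "moderate (\<lambda>z. f (moebius (7 * a - c) (7 * b - d) (56 * a - 7 * c) (56 * b - 7 * d) z))" .
 moreover have "NEAR z. f (moebius (7 * a - c) (7 * b - d) (56 * a - 7 * c) (56 * b - 7 * d) z) = f (fricke7 (moebius a b c d z))"
  using eventually_Im_gt[of 0]
  by eventually_elim (simp add: fricke7_def moebius_compose[OF moebius_denom_nonzero[OF det]])
 ultimately show "moderate (\<lambda>z. f (fricke7 (moebius a b c d z)))" by (rule moderate_cong[rotated])
qed

lemma half_shift_half_shift:
 assumes "Gamma0_invariant 56 f" "Im z > 0"
 shows "f (half_shift (half_shift z)) = f z"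
 using Gamma0_invariantD[OF assms(1), of 1 1 1 0 z] assms(2) by (simp add: half_shift_eq moebius_def add.assoc)

text \<open>The two transformations commute up to the element of Gamma0(56) with rows (141, -17) and
  (224, -27), where 224 = 4 * 56. On invariant functions they therefore generate a
  four-group.\<close>

lemma half_shift_fricke7:
 assumes "Gamma0_invariant 56 f" "Im z > 0"
 shows "f (half_shift (fricke7 z)) = f (fricke7 (half_shift z))"
proof -
 have "half_shift (fricke7 z) = moebius 70 (- 9) 112 (- 14) z"
  unfolding half_shift_def fricke7_def by (subst moebius_compose[OF moebius_denom_pos[OF assms(2)]]) simp_all
 moreover have ws: "fricke7 (half_shift z) = moebius 14 5 112 42 z"
  unfolding half_shift_def fricke7_def by (subst moebius_compose[OF moebius_denom_pos[OF assms(2)]]) simp_all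
 moreover have "moebius 141 (- 17) 224 (- 27) (moebius 14 5 112 42 z) = moebius 70 (- 9) 112 (- 14) z"
  by (subst moebius_compose[OF moebius_denom_pos[OF assms(2)]]) simp_all
 ultimately show ?thesis
  using Gamma0_invariantD[OF assms(1), of 141 "- 27" "- 17" 224 "fricke7 (half_shift z)"] Im_fricke7[OF Im_half_shift[OF assms(2)]]
  by simp
qed

text \<open>The two cusps with denominator divisible by 8 are exchanged by the involution.\<close>
lemma cusp_8:
 fixes a b c d :: int
 assumes det: "a * d - b * c = 1" and c8: "8 dvd c"
 obtains A B where "A > 0" "\<And>f z. Gamma0_invariant 56 f \<Longrightarrow> (\<And>z. Im z > 0 \<Longrightarrow> f (fricke7 z) = f z) \<Longrightarrow> Im z > 0 \<Longrightarrow>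
  f (moebius a b c d z) = f (of_real A * z + B)"
proof (cases "7 dvd c")
 case True
 hence "56 dvd c" using c8 by presburger
 thus thesis using that[of 1 0] Gamma0_invariantD[of 56 _ a d b c] det by simp
next
 case False
 \<comment> \<open>Composed with \<open>fricke7\<close>, the matrix factors as an element of
   Gamma0(56) times z -> (z + B) / 7. Here B is chosen so that 7 divides p B + d, which is possible
   because p is prime to 7.\<close>
 define p where "p = 7 * a - c"
 have "\<not> 7 dvd p" using False by (simp add: p_def dvd_diff_right_iff)
 hence "coprime p 7" using prime_imp_coprime[of "7 :: int" p] by (simp add: coprime_commute)
 then obtain u v where uv: "u * p + v * 7 = 1" by (metis coprime_iff_gcd_eq_1 bezout_int)
 define B where "B = - (u * d)"
 have "p * B + d = d * (1 - u * p)" by (simp add: B_def algebra_simps)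
 also have "1 - u * p = 7 * v" using uv by simp
 finally have pB: "p * B = 7 * (d * v) - d" by simp
 obtain c0 where c0: "c = 8 * c0" using c8 by auto
 define q r s where "q = b - d * v" and "r = 56 * (a - c0)" and "s = 8 * b - d - 8 * (a - c0) * B"
 have "p * s - q * r = 8 * p * b - p * d - 8 * (a - c0) * (p * B) - 56 * (b - d * v) * (a - c0)"
  by (simp add: q_def r_def s_def algebra_simps)
 also have "\<dots> = a * d - b * c" unfolding pB by (simp add: p_def c0 algebra_simps)
 finally have det': "p * s - q * r = 1" by (simp add: det)
 have e: "p * 1 + q * 0 = 7 * a - c" "p * B + q * 7 = 7 * b - d" "r * 1 + s * 0 = 56 * a - 7 * c" "r * B + s * 7 = 56 * b - 7 * d"
  unfolding pB by (simp_all add: p_def q_def r_def s_def c0 algebra_simps)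
 show thesis
 proof (rule that[of "1 / 7" "of_int B / 7"])
  fix f z assume f: "Gamma0_invariant 56 f" "\<And>z. Im z > 0 \<Longrightarrow> f (fricke7 z) = f z" and z: "Im z > 0"
  have m: "moebius 1 B 0 7 z = of_real (1 / 7) * z + of_int B / 7" by (simp add: moebius_def add_divide_distrib)
  have "fricke7 (moebius a b c d z) = moebius p q r s (moebius 1 B 0 7 z)"
   unfolding fricke7_def moebius_compose[OF moebius_denom_nonzero[OF det z]]
   by (subst moebius_compose[OF moebius_denom_pos[OF z]]) (simp_all only: e, simp_all)
  moreover have "Im (moebius 1 B 0 7 z) > 0" using z by (simp add: m)
  ultimately show "f (moebius a b c d z) = f (of_real (1 / 7) * z + of_int B / 7)"
   using Gamma0_invariantD[OF f(1) det', of "moebius 1 B 0 7 z"] f(2)[OF Im_moebius_pos[OF det z]] unfolding m by (simp add: r_def)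
 qed simp
qed

section \<open>The coordinate functions\<close>

definition coord_x :: "complex \<Rightarrow> complex" where
 "coord_x z = (if Im z > 0 then haupt (4 * z) else 0)"

definition coord_y :: "complex \<Rightarrow> complex" where
 "coord_y z = (if Im z > 0 then haupt (2 * z) * (haupt (4 * z) + 1) else 0)"

definition coord_t :: "complex \<Rightarrow> complex" where
 "coord_t z = (if Im z > 0 then haupt_t (4 * z) else 0)"

lemma coord_y_square:
 assumes "Im z > 0"
 shows "coord_y z ^ 2 = coord_x z ^ 3 + coord_x z + 2"
proof -
 have A: "(v * (h + 1)) ^ 2 = h ^ 3 + h + 2" if "v ^ 2 * (h + 1) = h ^ 2 - h + 2" for v h :: complex
 proof -
  have "(v * (h + 1)) ^ 2 = (v ^ 2 * (h + 1)) * (h + 1)" by (simp add: power2_eq_square algebra_simps)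
  also have "\<dots> = h ^ 3 + h + 2" unfolding that by (simp add: power2_eq_square power3_eq_cube algebra_simps)
  finally show ?thesis .
 qed
 show ?thesis using A[OF haupt_double_relation[of "2 * z"]] assms by (simp add: coord_x_def coord_y_def)
qed

lemma coord_t_square:
 assumes "Im z > 0"
 shows "coord_t z ^ 2 = (7 + coord_x z ^ 2) * (2 - coord_x z + coord_x z ^ 2) * (2 + coord_x z + coord_x z ^ 2)"
 using haupt_t_square[of "4 * z"] assms by (simp add: coord_x_def coord_t_def haupt_sextic_def)

lemma coord_holomorphic:
 "coord_x holomorphic_on upper_half_plane" "coord_y holomorphic_on upper_half_plane" "coord_t holomorphic_on upper_half_plane"
proof -
 have c: "(\<lambda>z. f (of_real k * z)) holomorphic_on {z. Im z > 0}" if "f holomorphic_on {z. Im z > 0}" "k > 0" for f k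
 proof -
  have "(f \<circ> (\<lambda>z. of_real k * z)) holomorphic_on {z. Im z > 0}"
   by (rule holomorphic_on_compose_gen[OF _ that(1)]) (use that(2) in \<open>auto intro!: holomorphic_intros\<close>)
  thus ?thesis by (simp add: o_def)
 qed
 have "(\<lambda>z. haupt (4 * z)) holomorphic_on {z. Im z > 0}" "(\<lambda>z. haupt (2 * z)) holomorphic_on {z. Im z > 0}"
  "(\<lambda>z. haupt_t (4 * z)) holomorphic_on {z. Im z > 0}"
  using c[OF haupt_holomorphic, of 4] c[OF haupt_holomorphic, of 2] c[OF haupt_t_holomorphic, of 4] by simp_all
 thus "coord_x holomorphic_on upper_half_plane" "coord_y holomorphic_on upper_half_plane" "coord_t holomorphic_on upper_half_plane"
  unfolding upper_half_plane_def
  by - (rule holomorphic_transform[of "\<lambda>z. haupt (4 * z)"], assumption, simp add: coord_x_def,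
   rule holomorphic_transform[of "\<lambda>z. haupt (2 * z) * (haupt (4 * z) + 1)"], intro holomorphic_intros, assumption+,
   simp add: coord_y_def, rule holomorphic_transform[of "\<lambda>z. haupt_t (4 * z)"], assumption, simp add: coord_t_def)
qed

section \<open>Symmetries of the coordinate functions\<close>

lemma moebius_scale:
 assumes "m > 0"
 shows "of_int m * moebius a b (m * c) d z = moebius a (m * b) c d (of_int m * z)"
 using assms by (simp add: moebius_def algebra_simps)

lemma coord_Gamma0:
 "Gamma0_invariant 56 coord_x" "Gamma0_invariant 56 coord_y" "Gamma0_invariant 56 coord_t"
proof -
 have "coord_x (moebius a b c d z) = coord_x z \<and> coord_y (moebius a b c d z) = coord_y z \<and> coord_t (moebius a b c d z) = coord_t z"
  if det: "a * d - b * c = 1" and c: "56 dvd c" and z: "Im z > 0" for a b c d z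
 proof -
  obtain c0 where c0: "c = 56 * c0" using c by auto
  have "4 * moebius a b c d z = moebius a (4 * b) (14 * c0) d (4 * z)"
   "2 * moebius a b c d z = moebius a (2 * b) (28 * c0) d (2 * z)"
   using moebius_scale[of 4 a b "14 * c0" d z] moebius_scale[of 2 a b "28 * c0" d z] by (simp_all add: c0)
  moreover have "a * d - (4 * b) * (14 * c0) = 1" "a * d - (2 * b) * (28 * c0) = 1" using det by (simp_all add: c0)
  moreover have "Im (4 * z) > 0" "Im (2 * z) > 0" using z by simp_all
  ultimately show ?thesis
   using z Im_moebius_pos[OF det z] haupt_Gamma_14[of a d "4 * b" "14 * c0" "4 * z"]
    haupt_Gamma_14[of a d "2 * b" "28 * c0" "2 * z"] haupt_t_Gamma_14[of a d "4 * b" "14 * c0" "4 * z"]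
   by (simp add: coord_x_def coord_y_def coord_t_def)
 qed
 thus "Gamma0_invariant 56 coord_x" "Gamma0_invariant 56 coord_y" "Gamma0_invariant 56 coord_t"
  by (simp_all add: Gamma0_invariant_def upper_half_plane_iff)
qed

lemma coord_fricke7:
 assumes z: "Im z > 0"
 shows "coord_x (fricke7 z) = coord_x z" "coord_y (fricke7 z) = coord_y z" "coord_t (fricke7 z) = - coord_t z"
proof -
 have w4: "4 * fricke7 z = moebius 7 (- 4) (7 * 2) (- 7) (4 * z)"
  using moebius_scale[of 4 7 "- 1" 14 "- 7" z] by (simp add: fricke7_def)
 have w2: "2 * fricke7 z = moebius 7 (- 2) (7 * 4) (- 7) (2 * z)"
  using moebius_scale[of 2 7 "- 1" 28 "- 7" z] by (simp add: fricke7_def)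
 have chi: "chi7 2 = 1" "chi7 4 = 1" by (simp_all add: chi7_def)
 have h: "haupt (4 * fricke7 z) = haupt (4 * z)" unfolding w4 by (rule haupt_Atkin_Lehner) (use z chi in simp_all)
 have h2: "haupt (2 * fricke7 z) = haupt (2 * z)" unfolding w2 by (rule haupt_Atkin_Lehner) (use z chi in simp_all)
 have t: "haupt_t (4 * fricke7 z) = - haupt_t (4 * z)" unfolding w4 by (rule haupt_t_Atkin_Lehner) (use z chi in simp_all)
 show "coord_x (fricke7 z) = coord_x z" "coord_y (fricke7 z) = coord_y z" "coord_t (fricke7 z) = - coord_t z"
  using z Im_fricke7[OF z] by (simp_all add: coord_x_def coord_y_def coord_t_def h h2 t)
qed

lemma coord_half_shift:
 assumes z: "Im z > 0"
 shows "coord_x (half_shift z) = coord_x z" "coord_y (half_shift z) = - coord_y z" "coord_t (half_shift z) = coord_t z"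
 using z haupt_add_2[of "4 * z"] haupt_add_1[of "2 * z"] haupt_t_add_2[of "4 * z"]
 by (simp_all add: coord_x_def coord_y_def coord_t_def half_shift_eq distrib_left)

text \<open>For odd c the form \<open>eis_inf\<close> is moved to \<open>eis_0\<close> or
  \<open>eis_1\<close>, whose limit is 1 instead of 2. After removal of the automorphy factor the
  denominator of h then tends to 1 - 1/2 and not to 0.\<close>

lemma haupt_bounded_odd_denominator:
 fixes a b c d :: int
 assumes det: "a * d - b * c = 1" and c: "7 dvd c" "odd c"
 shows "\<exists>C. NEAR z. norm (haupt (moebius a b c d z)) \<le> C"
proof -
 define f where "f = (if even d then eis_0 else eis_1)"
 define g where "g = (if even b then eis_0 else if even a then eis_inf else eis_1)"
 have e: "((\<lambda>z. eis7 (of_real A * z + B)) \<longlongrightarrow> 1) at_i_infinity" if "A > 0" for A B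
  by (rule filterlim_compose[OF eis7_tendsto_1 filterlim_affine_at_i_infinity[OF that]])
 have lim: "(eis_0 \<longlongrightarrow> 1) at_i_infinity" "(eis_1 \<longlongrightarrow> 1) at_i_infinity" "(eis_inf \<longlongrightarrow> 2 * 1) at_i_infinity"
  using e[of "1 / 2" 0] e[of "1 / 2" "1 / 2"] tendsto_mult[OF tendsto_const e[of 2 0], of 2]
  by (simp_all add: eis_0_def[abs_def] eis_1_def[abs_def] eis_inf_def[abs_def] add_divide_distrib)
 have f: "(f \<longlongrightarrow> 1) at_i_infinity" using lim by (simp add: f_def)
 obtain l where "(g \<longlongrightarrow> l) at_i_infinity" by (cases "even b"; cases "even a") (use lim g_def in auto)
 hence "((\<lambda>z. (g z - 2 * eis7 z + f z / 2) / (eis7 z - f z / 2)) \<longlongrightarrow> (l - 2 * 1 + 1 / 2) / (1 - 1 / 2)) at_i_infinity"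
  by (intro tendsto_intros f eis7_tendsto_1) auto
 from order_tendstoD(2)[OF tendsto_norm[OF this] less_add_one]
 have b: "NEAR z. norm ((g z - 2 * eis7 z + f z / 2) / (eis7 z - f z / 2)) < norm ((l - 2 * 1 + 1 / 2) / (1 - 1 / 2)) + 1" .
 have "((\<lambda>z. eis7 z - f z / 2) \<longlongrightarrow> 1 - 1 / 2) at_i_infinity" by (intro tendsto_intros f eis7_tendsto_1) auto
 hence "NEAR z. eis7 z - f z / 2 \<noteq> 0" by (rule tendsto_imp_eventually_ne) simp
 with b eventually_Im_gt[of 0]
 have "NEAR z. norm (haupt (moebius a b c d z)) \<le> norm ((l - 2 * 1 + 1 / 2) / (1 - 1 / 2)) + 1"
 proof eventually_elim
  case (elim z)
  define j where "j = of_int (chi7 d) * (of_int c * z + of_int d) / 2"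
  have j: "j \<noteq> 0" using norm_chi7[OF det c(1)] moebius_denom_nonzero[OF det elim(2)] by (auto simp: j_def)
  have "eis7 (moebius a b c d z) = 2 * j * eis7 z" "eis_inf (moebius a b c d z) = 2 * j * f z" "eis_0 (moebius a b c d z) = 2 * j * g z"
   using eis7_Gamma0[OF det c(1) elim(2)] eis_inf_moebius[OF det c(1) elim(2)] eis_0_moebius[OF det c(1) elim(2)] c(2)
   by (simp_all add: j_def f_def g_def)
  hence "haupt_den (moebius a b c d z) = j * (eis7 z - f z / 2)"
   "haupt_num (moebius a b c d z) = j * (g z - 2 * eis7 z + f z / 2)"
   by (simp_all add: haupt_den_eq haupt_num_eq right_diff_distrib distrib_left diff_divide_distrib add_divide_distrib)
  hence "haupt (moebius a b c d z) = (g z - 2 * eis7 z + f z / 2) / (eis7 z - f z / 2)"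
   using haupt_eq[OF Im_moebius_pos[OF det elim(2)]] elim(3) j by (simp only: mult_eq_0_iff mult_divide_mult_cancel_left simp_thms)
  thus ?case using elim(1) by simp
 qed
 thus ?thesis by blast
qed

text \<open>Since x = h(4 z), the cusp a / c turns into 4 a / c, whose reduced denominator is odd
  unless 8 divides c. The bound for h also wants that denominator divisible by 7; if it is not,
  \<open>fricke7\<close>, under which x is invariant, is applied first.\<close>

lemma coord_x_bounded_at_cusp:
 fixes a b c d :: int
 assumes det: "a * d - b * c = 1" and c: "\<not> 8 dvd c"
 shows "\<exists>C. NEAR z. norm (coord_x (moebius a b c d z)) \<le> C"
proof -
 have *: "\<exists>C. NEAR z. norm (haupt (moebius p q r s z)) \<le> C"
  if pr: "p * s - q * r > 0" "4 dvd p" "\<not> 7 dvd p" "7 dvd r" "\<not> 8 dvd r" for p q r s :: int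
 proof -
  obtain p' q' r' s' g B D :: int where 1: "p' * s' - q' * r' = 1" "g > 0" "D > 0" "p = p' * g" "r = r' * g"
   "\<And>z. moebius p q r s z = moebius p' q' r' s' (of_real (g / D) * z + of_int B / of_int D)"
   by (rule moebius_reduce[OF pr(1)]) (rule that)
  have "\<not> 7 dvd g" using pr(3) 1(4) by auto
  hence 7: "7 dvd r'" using pr(4) 1(5) by (simp add: prime_dvd_mult_iff)
  have "odd r'"
  proof
   assume "even r'"
   moreover have "odd (p' * s' - q' * r')" by (simp add: 1(1))
   ultimately have "odd p'" by auto
   hence "coprime 4 p'" by (metis coprime_commute coprime_power_right_iff coprime_right_2_iff_odd power2_eq_square mult_2_right numeral_Bit0)
   hence "4 dvd g" using pr(2) unfolding 1(4) by (simp add: coprime_dvd_mult_right_iff)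
   with \<open>even r'\<close> have "2 * 4 dvd r" unfolding 1(5) by (rule mult_dvd_mono)
   thus False using pr(5) by simp
  qed
  from haupt_bounded_odd_denominator[OF 1(1) 7 this] obtain C where
   "NEAR z. norm (haupt (moebius p' q' r' s' z)) \<le> C" by blast
  from eventually_compose_filterlim[OF this filterlim_affine_at_i_infinity[of "g / D" "of_int B / of_int D"]] 1(2,3)
  show ?thesis unfolding 1(6) by auto
 qed
 show ?thesis
 proof (cases "7 dvd c")
  case True
  have "\<not> 7 dvd a" using Gamma0_7_not_dvd[of d a b c] det True by (simp add: mult.commute)
  obtain C where C: "NEAR z. norm (haupt (moebius (4 * a) (4 * b) c d z)) \<le> C"
   using *[of "4 * a" d "4 * b" c] det True c \<open>\<not> 7 dvd a\<close> by (auto simp: prime_dvd_mult_iff)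
  have "NEAR z. norm (coord_x (moebius a b c d z)) \<le> C"
   using C eventually_Im_gt[of 0]
  proof eventually_elim
   case (elim z)
   have "moebius (4 * a) (4 * b) c d z = 4 * moebius a b c d z" by (simp add: moebius_def algebra_simps)
   thus ?case using elim by (simp add: coord_x_def Im_moebius_pos[OF det])
  qed
  thus ?thesis by blast
 next
  case False
  have "(28 * a - 4 * c) * (56 * b - 7 * d) - (28 * b - 4 * d) * (56 * a - 7 * c) = 28 * (a * d - b * c)" by (simp add: algebra_simps)
  moreover have "\<not> 7 dvd 28 * a - 4 * c" "4 dvd 28 * a - 4 * c" "7 dvd 56 * a - 7 * c" "\<not> 8 dvd 56 * a - 7 * c" using False c by presburger+
  ultimately obtain C where C: "NEAR z. norm (haupt (moebius (28 * a - 4 * c) (28 * b - 4 * d) (56 * a - 7 * c) (56 * b - 7 * d) z)) \<le> C"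
   using *[of "28 * a - 4 * c" "56 * b - 7 * d" "28 * b - 4 * d" "56 * a - 7 * c"] det by auto
  have "NEAR z. norm (coord_x (moebius a b c d z)) \<le> C"
   using C eventually_Im_gt[of 0]
  proof eventually_elim
   case (elim z)
   have "4 * fricke7 (moebius a b c d z) = moebius (28 * a - 4 * c) (28 * b - 4 * d) (56 * a - 7 * c) (56 * b - 7 * d) z"
    unfolding fricke7_def moebius_compose[OF moebius_denom_nonzero[OF det elim(2)]] by (simp add: moebius_def algebra_simps)
   hence "coord_x (fricke7 (moebius a b c d z)) = haupt (moebius (28 * a - 4 * c) (28 * b - 4 * d) (56 * a - 7 * c) (56 * b - 7 * d) z)"
    using Im_fricke7[OF Im_moebius_pos[OF det elim(2)]] by (simp add: coord_x_def)
   thus ?case using elim(1) coord_fricke7(1)[OF Im_moebius_pos[OF det elim(2)]] by simp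
  qed
  thus ?thesis by blast
 qed
qed

section \<open>Expansions of the coordinate functions\<close>

definition rational_fps :: "complex fps \<Rightarrow> bool" where
 "rational_fps F \<longleftrightarrow> (\<forall>n. fps_nth F n \<in> \<rat>)"

lemma rational_fps_diff: "rational_fps F \<Longrightarrow> rational_fps G \<Longrightarrow> rational_fps (F - G)"
 by (simp add: rational_fps_def)

lemma rational_fps_add: "rational_fps F \<Longrightarrow> rational_fps G \<Longrightarrow> rational_fps (F + G)"
 by (simp add: rational_fps_def)

lemma rational_fps_mult: "rational_fps F \<Longrightarrow> rational_fps G \<Longrightarrow> rational_fps (F * G)"
 by (simp add: rational_fps_def fps_mult_nth Rats_sum)

lemma rational_fps_const: "c \<in> \<rat> \<Longrightarrow> rational_fps (fps_const c)"
 by (simp add: rational_fps_def)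

lemma rational_fps_numeral: "rational_fps (numeral k)"
 unfolding numeral_fps_const by (rule rational_fps_const) simp

lemma rational_fps_eis7: "rational_fps (eis7_fps k)"
 by (simp add: rational_fps_def eis7_fps_def)

lemma rational_fps_dilate: "rational_fps F \<Longrightarrow> rational_fps (F oo fps_X ^ k)"
 by (auto simp: rational_fps_def fps_compose_nth simp flip: power_mult intro!: Rats_sum)

lemma rational_fps_to_fls: "rational_fps F \<Longrightarrow> rational_coeffs (fps_to_fls F)"
 by (auto simp: rational_fps_def rational_coeffs_def)

lemma q_series_dilate:
 assumes F: "q_series f F" and k: "k > 0"
 shows "has_q_expansion 1 (\<lambda>z. f (of_nat k * z)) (fps_to_fls (F oo fps_X ^ k))"
proof -
 have "fps_conv_radius F \<ge> 1" using F by (simp add: q_series_def)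
 hence "fps_conv_radius F > 0" using less_le_trans[of "0 :: ereal" 1] by (simp add: zero_ereal_def)
 hence "eval_fps F has_fps_expansion F" by (simp add: has_fps_expansion_def)
 moreover have "(\<lambda>w :: complex. w ^ k) has_fps_expansion fps_X ^ k" by (intro fps_expansion_intros)
 ultimately have "(eval_fps F \<circ> (\<lambda>w. w ^ k)) has_fps_expansion (F oo fps_X ^ k)"
  using k by (intro fps_expansion_intros) auto
 hence "(eval_fps F \<circ> (\<lambda>w. w ^ k)) has_laurent_expansion fps_to_fls (F oo fps_X ^ k)" by (rule has_laurent_expansion_fps)
 moreover have "NEAR z. f (of_nat k * z) = (eval_fps F \<circ> (\<lambda>w. w ^ k)) (nome (z / of_real (real 1)))"
  using eventually_Im_gt[of 0]
  by eventually_elim (use k in \<open>simp add: q_series_eq[OF F] nome_of_nat_mult\<close>)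
 ultimately show ?thesis unfolding has_q_expansion_iff[OF zero_less_one] by blast
qed

lemma has_q_expansion_eventually_nonzero:
 assumes "has_q_expansion 1 f F" "F \<noteq> 0"
 shows "NEAR z. f z \<noteq> 0"
proof -
 obtain k where k: "k has_laurent_expansion F" "NEAR z. f z = k (nome (z / of_real (real 1)))"
  using assms by (auto simp: has_q_expansion_iff)
 have "\<forall>\<^sub>F w in at 0. k w \<noteq> 0" by (rule has_laurent_expansion_nonzero_imp_eventually_nonzero[OF k(1) assms(2)])
 hence "NEAR z. k (nome (z / of_real (real 1))) \<noteq> 0"
  using eventually_nome_iff[of 1 "\<lambda>w. k w \<noteq> 0"] by simp
 with k(2) show ?thesis by eventually_elim simp
qed

lemma has_q_expansion_quotient:
 assumes "has_q_expansion 1 g G" "has_q_expansion 1 h H" "G \<noteq> 0" "\<And>z. Im z > 0 \<Longrightarrow> f z * g z = h z"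
 shows "has_q_expansion 1 f (H / G)"
proof -
 have "NEAR z. h z / g z = f z"
  using has_q_expansion_eventually_nonzero[OF assms(1,3)] eventually_Im_gt[of 0]
  by eventually_elim (simp add: assms(4)[symmetric])
 thus ?thesis using has_q_expansion_divide[OF assms(2,1)] has_q_expansion_cong by simp
qed

lemma q_series_haupt_den: "q_series haupt_den (fps_const (1 / 2) * (eis7_fps 1 - eis7_fps 2))"
proof -
 have "q_series (\<lambda>z. 1 / 2 * (eis7 z - eis7 (2 * z))) (fps_const (1 / 2) * (eis7_fps 1 - eis7_fps 2))"
  by (intro q_series_mult q_series_const q_series_diff q_series_eis7 q_series_eis7_2)
 thus ?thesis by (simp add: haupt_den_def[abs_def])
qed

lemma q_series_haupt_num: "q_series (\<lambda>z. haupt_num (2 * z)) (fps_const (1 / 2) * (eis7_fps 1 - 2 * eis7_fps 2 + eis7_fps 4))"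
proof -
 have "q_series (\<lambda>z. eis7 (4 * z)) (eis7_fps 4)"
  using eis7_fps_conv_radius[of 4] eis7_multiple[of _ 4] by (simp add: q_series_def)
 hence "q_series (\<lambda>z. 1 / 2 * (eis7 z - 2 * eis7 (2 * z) + eis7 (4 * z))) (fps_const (1 / 2) * (eis7_fps 1 - 2 * eis7_fps 2 + eis7_fps 4))"
  by (intro q_series_mult q_series_const q_series_diff q_series_add q_series_numeral q_series_eis7 q_series_eis7_2)
 thus ?thesis by (simp add: haupt_num_def[abs_def])
qed

lemma subdegree_dilate:
 fixes F :: "complex fps"
 assumes k: "k > 0" and "fps_nth F 0 = 0" "fps_nth F 1 \<noteq> 0"
 shows "subdegree (F oo fps_X ^ k) = k"
proof (rule subdegreeI)
 have nth: "fps_nth (F oo fps_X ^ k) n = (\<Sum>i=0..n. if n = k * i then fps_nth F i else 0)" for n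
  unfolding fps_compose_nth by (rule sum.cong) (simp_all flip: power_mult)
 have "fps_nth (F oo fps_X ^ k) k = (\<Sum>i=0..k. if i = 1 then fps_nth F 1 else 0)"
  unfolding nth by (rule sum.cong) (use k in auto)
 thus "fps_nth (F oo fps_X ^ k) k \<noteq> 0" using k assms(3) by simp
 fix n assume "n < k"
 thus "fps_nth (F oo fps_X ^ k) n = 0" unfolding nth
  by (intro sum.neutral ballI) (use assms(2) in \<open>auto simp: gr0_conv_Suc dest: dvd_imp_le\<close>)
qed

text \<open>The numerator involves E(z/2), so only even multiples of z give integral powers of q. In
  the parameter of 2 k z the numerator vanishes to half the order of the denominator, which leaves a
  pole of order k in q.\<close>

lemma haupt_dilate_expansion:
 assumes k: "k > 0"
 obtains H where "has_q_expansion 1 (\<lambda>z. haupt (of_nat (2 * k) * z)) H" "rational_coeffs H" "fls_subdegree H = - int k"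
proof -
 define D0 N0 where "D0 = fps_const (1 / 2) * (eis7_fps 1 - eis7_fps 2)"
  and "N0 = fps_const (1 / 2) * (eis7_fps 1 - 2 * eis7_fps 2 + eis7_fps 4)"
 define D1 N1 where "D1 = D0 oo fps_X ^ (2 * k)" and "N1 = N0 oo fps_X ^ k"
 have D: "has_q_expansion 1 (\<lambda>z. haupt_den (of_nat (2 * k) * z)) (fps_to_fls D1)"
  unfolding D1_def D0_def by (rule q_series_dilate[OF q_series_haupt_den]) (use k in simp)
 have "has_q_expansion 1 (\<lambda>z. haupt_num (2 * (of_nat k * z))) (fps_to_fls N1)"
  unfolding N1_def N0_def by (rule q_series_dilate[OF q_series_haupt_num k])
 hence N: "has_q_expansion 1 (\<lambda>z. haupt_num (of_nat (2 * k) * z)) (fps_to_fls N1)" by (simp add: mult_ac)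
 have sub: "subdegree D1 = 2 * k" "subdegree N1 = k"
  unfolding D1_def N1_def
  by (rule subdegree_dilate;
   use k in \<open>simp add: D0_def N0_def eis7_fps_def eis7_coeff_values[unfolded One_nat_def] numeral_fps_const\<close>)+
 hence D1: "fps_to_fls D1 \<noteq> 0" and N1: "fps_to_fls N1 \<noteq> 0" using k by auto
 have rat: "rational_coeffs (fps_to_fls D1)" "rational_coeffs (fps_to_fls N1)"
  unfolding D1_def N1_def D0_def N0_def
  by (intro rational_fps_to_fls rational_fps_dilate rational_fps_mult rational_fps_const rational_fps_diff rational_fps_add
   rational_fps_numeral rational_fps_eis7; simp)+
 show thesis
 proof (rule that)
  show "has_q_expansion 1 (\<lambda>z. haupt (of_nat (2 * k) * z)) (fps_to_fls N1 / fps_to_fls D1)"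
   by (rule has_q_expansion_quotient[OF D N D1]) (use k in \<open>simp add: haupt_times_den\<close>)
  show "rational_coeffs (fps_to_fls N1 / fps_to_fls D1)" by (intro rational_coeffs_divide rat)
  show "fls_subdegree (fps_to_fls N1 / fps_to_fls D1) = - int k"
   using D1 N1 sub by (simp add: fls_divide_subdegree fls_subdegree_fls_to_fps)
 qed
qed

lemma coord_x_expansion:
 obtains F where "has_q_expansion 1 coord_x F" "rational_coeffs F" "fls_subdegree F = - 2"
proof -
 obtain H where H: "has_q_expansion 1 (\<lambda>z. haupt (4 * z)) H" "rational_coeffs H" "fls_subdegree H = - 2"
  using haupt_dilate_expansion[of 2] by auto
 have "NEAR z. haupt (4 * z) = coord_x z"
  using eventually_Im_gt[of 0] by eventually_elim (simp add: coord_x_def)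
 from that[OF has_q_expansion_cong[OF this, THEN iffD1, OF H(1)] H(2,3)] show thesis .
qed

lemma coord_y_expansion:
 obtains F where "has_q_expansion 1 coord_y F" "rational_coeffs F"
proof -
 obtain H where H: "has_q_expansion 1 (\<lambda>z. haupt (4 * z)) H" "rational_coeffs H"
  using haupt_dilate_expansion[of 2] by auto
 obtain G where G: "has_q_expansion 1 (\<lambda>z. haupt (2 * z)) G" "rational_coeffs G"
  using haupt_dilate_expansion[of 1] by auto
 have "has_q_expansion 1 (\<lambda>z. haupt (2 * z) * (haupt (4 * z) + 1)) (G * (H + fls_const 1))"
  by (intro has_q_expansion_mult has_q_expansion_add has_q_expansion_const G H) simp_all
 moreover have "NEAR z. haupt (2 * z) * (haupt (4 * z) + 1) = coord_y z"
  using eventually_Im_gt[of 0] by eventually_elim (simp add: coord_y_def)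
 note has_q_expansion_cong[OF this]
 moreover have "rational_coeffs (G * (H + fls_const 1))"
  by (intro rational_coeffs_mult rational_coeffs_add rational_coeffs_const G H) simp
 ultimately show thesis using that[of "G * (H + fls_const 1)"] by simp
qed

section \<open>Growth of the coordinates at all cusps\<close>

lemma coord_x_automorphic: "automorphic 56 coord_x"
 unfolding automorphic_def
proof (intro conjI allI impI coord_Gamma0)
 show "coord_x meromorphic_on upper_half_plane"
  by (intro analytic_on_imp_meromorphic_on) (simp add: analytic_on_open open_upper_half_plane coord_holomorphic)
 fix a b c d :: int assume det: "a * d - b * c = 1"
 obtain F where "has_q_expansion 1 coord_x F" using coord_x_expansion by blast
 hence mod: "moderate coord_x" by (rule has_q_expansion_moderate) simp
 show "moderate (\<lambda>z. coord_x (moebius a b c d z))"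
 proof (cases "8 dvd c")
  case False
  then obtain C where "NEAR z. norm (coord_x (moebius a b c d z)) \<le> C * exp (0 * Im z)"
   using coord_x_bounded_at_cusp[OF det] by auto
  thus ?thesis by (rule moderateI)
 next
  case True
  from cusp_8[OF det True] obtain A B where A: "A > 0" "\<And>z. Im z > 0 \<Longrightarrow> coord_x (moebius a b c d z) = coord_x (of_real A * z + B)"
   by (metis coord_Gamma0(1) coord_fricke7(1))
  have "NEAR z. coord_x (of_real A * z + B) = coord_x (moebius a b c d z)"
   using eventually_Im_gt[of 0] by eventually_elim (simp add: A(2))
  thus ?thesis using moderate_compose_affine[OF mod A(1)] by (rule moderate_cong)
 qed
qed

text \<open>Growth at the cusps is inherited from x: the square is a polynomial in x, and a square
  root grows moderately if its square does.\<close>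

lemma automorphic_square_root:
 assumes "f holomorphic_on upper_half_plane" "Gamma0_invariant 56 f" "\<And>z. Im z > 0 \<Longrightarrow> f z ^ 2 = poly p (coord_x z)"
 shows "automorphic 56 f"
 unfolding automorphic_def
proof (intro conjI allI impI)
 show "f meromorphic_on upper_half_plane"
  by (intro analytic_on_imp_meromorphic_on) (simp add: analytic_on_open open_upper_half_plane assms)
 fix a b c d :: int assume det: "a * d - b * c = 1"
 have "moderate (\<lambda>z. poly p (coord_x (moebius a b c d z)))"
  by (rule automorphicD(3)[OF automorphic_poly[OF coord_x_automorphic] det])
 moreover have "NEAR z. poly p (coord_x (moebius a b c d z)) = f (moebius a b c d z) ^ 2"
  using eventually_Im_gt[of 0] by eventually_elim (simp add: assms(3) Im_moebius_pos[OF det])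
 ultimately have "moderate (\<lambda>z. f (moebius a b c d z) ^ 2)" by (rule moderate_cong[rotated])
 thus "moderate (\<lambda>z. f (moebius a b c d z))" by (rule moderate_power_imp)
qed (rule assms(2))

lemma coord_y_automorphic: "automorphic 56 coord_y"
 by (rule automorphic_square_root[OF coord_holomorphic(2) coord_Gamma0(2), of "[:2, 1, 0, 1:]"])
  (simp add: coord_y_square power3_eq_cube algebra_simps)

lemma coord_t_automorphic: "automorphic 56 coord_t"
 by (rule automorphic_square_root[OF coord_holomorphic(3) coord_Gamma0(3), of "[:7, 0, 1:] * [:2, - 1, 1:] * [:2, 1, 1:]"],
  subst coord_t_square) (simp_all add: power2_eq_square algebra_simps)

text \<open>In the square, the coefficient of index n contains the new unknown only with the factor
  twice the constant term, which is 2 or -2; all other contributions are known to be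
  rational.\<close>

lemma rational_fps_sqrt:
 fixes R :: "complex fps"
 assumes R: "rational_fps (R * R)" "fps_nth (R * R) 0 = 1"
 shows "rational_fps R"
proof -
 have r0: "fps_nth R 0 = 1 \<or> fps_nth R 0 = - 1" using R(2) by (simp add: square_eq_1_iff)
 have "fps_nth R n \<in> \<rat>" for n
 proof (induction n rule: less_induct)
  case (less n)
  show ?case
  proof (cases n)
   case 0
   thus ?thesis using r0 by auto
  next
   case (Suc m)
   have "fps_nth (R * R) n = 2 * (fps_nth R 0 * fps_nth R n) + (\<Sum>i=1..m. fps_nth R i * fps_nth R (n - i))"
    unfolding fps_mult_nth Suc by (simp add: sum.atLeast_Suc_atMost[of 0] Suc_diff_le)
   moreover have "(\<Sum>i=1..m. fps_nth R i * fps_nth R (n - i)) \<in> \<rat>"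
    using less Suc by (intro Rats_sum Rats_mult) auto
   moreover have "fps_nth (R * R) n \<in> \<rat>" using R(1) by (simp add: rational_fps_def)
   ultimately have "2 * (fps_nth R 0 * fps_nth R n) \<in> \<rat>" by (metis Rats_diff add_diff_cancel_right')
   hence "2 * (fps_nth R 0 * fps_nth R n) / 2 \<in> \<rat>" by (rule Rats_divide) simp
   thus ?thesis using r0 by auto
  qed
 qed
 thus ?thesis by (simp add: rational_fps_def)
qed

text \<open>Dividing \<open>t\<close> by \<open>x\<^sup>3\<close> turns the sextic into a power series with constant term 1.\<close>
lemma coord_t_expansion:
 obtains F where "has_q_expansion 1 coord_t F" "rational_coeffs F"
proof -
 obtain F where F: "has_q_expansion 1 coord_x F" "rational_coeffs F" "fls_subdegree F = - 2" using coord_x_expansion .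
 have "NEAR z. coord_t analytic_on {z}"
  using eventually_Im_gt[of 0] by eventually_elim (rule analytic_at_upper[OF coord_holomorphic(3)[unfolded upper_half_plane_def]])
 moreover have "NEAR z. coord_t (z + of_nat 1) = coord_t z"
  using eventually_Im_gt[of 0] Gamma0_invariantD[OF coord_Gamma0(3), of 1 1 1 0]
  by (auto elim!: eventually_mono simp: moebius_def)
 moreover have "moderate coord_t"
  using automorphicD(3)[OF coord_t_automorphic, of 1 1 0 0] by (simp add: moebius_scalar)
 ultimately obtain T where T: "has_q_expansion 1 coord_t T" using moderate_imp_has_q_expansion[of 1 coord_t] by auto
 have "has_q_expansion 1 (\<lambda>z. coord_t z * coord_t z)
  ((fls_const 7 + F * F) * (fls_const 2 + (- F) + F * F) * (fls_const 2 + F + F * F))"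
 proof (rule iffD1[OF has_q_expansion_cong])
  show "has_q_expansion 1 (\<lambda>z. (7 + coord_x z * coord_x z) * (2 + (- coord_x z) + coord_x z * coord_x z) * (2 + coord_x z + coord_x z * coord_x z))
   ((fls_const 7 + F * F) * (fls_const 2 + (- F) + F * F) * (fls_const 2 + F + F * F))"
   by (intro has_q_expansion_mult has_q_expansion_add has_q_expansion_const has_q_expansion_uminus F(1) zero_less_one)
  show "NEAR z. (7 + coord_x z * coord_x z) * (2 + (- coord_x z) + coord_x z * coord_x z) * (2 + coord_x z + coord_x z * coord_x z) = coord_t z * coord_t z"
   using eventually_Im_gt[of 0] by eventually_elim (simp add: coord_t_square[unfolded power2_eq_square])
 qed
 from has_q_expansion_unique[OF has_q_expansion_mult[OF T T zero_less_one] this zero_less_one]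
 have TT: "T * T = (fls_const 7 + F * F) * (fls_const 2 + (- F) + F * F) * (fls_const 2 + F + F * F)" .
 have F0: "F \<noteq> 0" using F(3) by auto
 define K where "K = inverse F"
 define k where "k = fls_regpart K"
 have K: "rational_coeffs K" "fls_subdegree K = 2" "F * K = 1"
  using F F0 by (simp_all add: K_def rational_coeffs_inverse fls_inverse_subdegree)
 have kK: "fps_to_fls k = K" "fps_nth k 0 = 0" using K(2) by (simp_all add: k_def)
 define R where "R = T * (K * K * K)"
 define s where "s = (fps_const 7 * (k * k) + 1) * (fps_const 2 * (k * k) - k + 1) * (fps_const 2 * (k * k) + k + 1)"
 have "R * R = (fls_const 7 * (K * K) + (F * K) ^ 2) * (fls_const 2 * (K * K) - (F * K) * K + (F * K) ^ 2) * (fls_const 2 * (K * K) + (F * K) * K + (F * K) ^ 2)"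
 proof -
  have "R * R = T * T * (K * K * K * (K * K * K))" by (simp add: R_def mult_ac)
  thus ?thesis unfolding TT by (simp add: algebra_simps power2_eq_square)
 qed
 also have "\<dots> = fps_to_fls s"
  unfolding K(3) s_def by (simp add: kK fls_times_fps_to_fls fps_to_fls_plus fps_to_fls_minus)
 finally have RR: "R * R = fps_to_fls s" .
 have s0: "fps_nth s 0 = 1" by (simp add: s_def kK)
 hence "subdegree s = 0" "s \<noteq> 0" by (auto intro: subdegreeI)
 hence "R \<noteq> 0" using RR by auto
 hence "fls_subdegree R = 0" using arg_cong[OF RR, of fls_subdegree] \<open>subdegree s = 0\<close> by (simp add: fls_subdegree_fls_to_fps)
 hence R: "fps_to_fls (fls_regpart R) = R" by simp
 hence "fps_to_fls (fls_regpart R * fls_regpart R) = fps_to_fls s" using RR by (simp add: fls_times_fps_to_fls)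
 hence Rs: "fls_regpart R * fls_regpart R = s" by simp
 have "rational_fps k" "rational_fps 1" using K(1) by (simp_all add: k_def rational_fps_def rational_coeffs_def)
 hence "rational_fps s" unfolding s_def
  by (intro rational_fps_mult rational_fps_add rational_fps_diff rational_fps_const; (assumption | simp))
 hence "rational_fps (fls_regpart R)" by (rule rational_fps_sqrt[of "fls_regpart R", unfolded Rs, OF _ s0])
 from rational_fps_to_fls[OF this] have "rational_coeffs R" unfolding R .
 hence "rational_coeffs (R * (F * F * F))" by (intro rational_coeffs_mult F(2))
 moreover have "R * (F * F * F) = T * ((F * K) * (F * K) * (F * K))" by (simp only: R_def mult_ac)
 ultimately have "rational_coeffs T" by (simp only: K(3) mult_1_right)
 thus thesis by (rule that[OF T])
qed

lemma canonical_rep_holomorphic: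
 assumes "f holomorphic_on upper_half_plane" "\<And>z. \<not> Im z > 0 \<Longrightarrow> f z = 0"
 shows "canonical_rep f = f"
proof
 fix z
 show "canonical_rep f z = f z"
  using assms(2)[of z] analytic_at_upper[of f z] assms(1)
  by (cases "Im z > 0") (simp_all add: canonical_rep_def upper_half_plane_def)
qed

lemma canonical_rep_coord:
 "canonical_rep coord_x = coord_x" "canonical_rep coord_y = coord_y" "canonical_rep coord_t = coord_t"
 using coord_holomorphic by (auto intro!: canonical_rep_holomorphic simp: coord_x_def coord_y_def coord_t_def)

lemma coord_in_function_field:
 "coord_x \<in> carrier (X0_function_field 56)" "coord_y \<in> carrier (X0_function_field 56)" "coord_t \<in> carrier (X0_function_field 56)"
 using coord_x_expansion coord_y_expansion coord_t_expansion
  canonical_rep_in_function_field[OF _ coord_x_automorphic] canonical_rep_in_function_field[OF _ coord_y_automorphic]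
  canonical_rep_in_function_field[OF _ coord_t_automorphic]
 unfolding canonical_rep_coord by (metis zero_less_numeral)+

section \<open>Cosets and the vanishing theorem\<close>

text \<open>Representatives are kept as maps of the half plane. The congruence between c and c' is
  recorded because the condition that 8 divides c has to pass to the representative.\<close>

definition coset_representatives :: "nat \<Rightarrow> (complex \<Rightarrow> complex) set \<Rightarrow> bool" where
 "coset_representatives N R \<longleftrightarrow> finite R \<and> (\<forall>v\<in>R. \<exists>a b c d. a * d - b * c = 1 \<and> v = moebius a b c d) \<and>
  (\<forall>a b c d. a * d - b * c = 1 \<longrightarrow> (\<exists>a' b' c' d'. a' * d' - b' * c' = 1 \<and> int N dvd c - c' \<and> moebius a' b' c' d' \<in> R \<and>
   (\<forall>f z. Gamma0_invariant N f \<longrightarrow> Im z > 0 \<longrightarrow> f (moebius a b c d z) = f (moebius a' b' c' d' z))))"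

text \<open>One matrix is chosen in each residue class modulo N. Two matrices in the same class
  differ by a left factor in Gamma0(N), and there are finitely many classes.\<close>

lemma coset_representatives_exist:
 assumes N: "N > 0"
 shows "\<exists>R. coset_representatives N R"
proof -
 define S :: "(int \<times> int \<times> int \<times> int) set" where "S = {(a, b, c, d). a * d - b * c = 1}"
 define red where "red = (\<lambda>(a, b, c, d). (a mod int N, b mod int N, c mod int N, d mod int N))"
 define R where "R = (\<lambda>(a, b, c, d). moebius a b c d) ` (inv_into S red ` red ` S)"
 have "red ` S \<subseteq> {0..<int N} \<times> {0..<int N} \<times> {0..<int N} \<times> {0..<int N}"
  using N by (auto simp: red_def)
 hence "finite (red ` S)" by (rule finite_subset) simp
 hence fin: "finite R" unfolding R_def by (rule finite_imageI[OF finite_imageI])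
 have det1: "\<exists>a b c d. a * d - b * c = 1 \<and> v = moebius a b c d" if v: "v \<in> R" for v
 proof -
  obtain r where r: "r \<in> red ` S" "v = (\<lambda>(a, b, c, d). moebius a b c d) (inv_into S red r)"
   using v unfolding R_def by blast
  obtain a b c d where "inv_into S red r = (a, b, c, d)" by (metis prod_cases4)
  thus ?thesis using inv_into_into[OF r(1)] r(2) by (auto simp: S_def)
 qed
 have reps: "\<exists>a' b' c' d'. a' * d' - b' * c' = 1 \<and> int N dvd c - c' \<and> moebius a' b' c' d' \<in> R \<and>
   (\<forall>f z. Gamma0_invariant N f \<longrightarrow> Im z > 0 \<longrightarrow> f (moebius a b c d z) = f (moebius a' b' c' d' z))"
  if det: "a * d - b * c = 1" for a b c d
 proof -
  define m where "m = (a, b, c, d)"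
  have m: "m \<in> S" using det by (simp add: m_def S_def)
  obtain a' b' c' d' where m': "inv_into S red (red m) = (a', b', c', d')" by (metis prod_cases4)
  have "(a', b', c', d') \<in> S" "red (a', b', c', d') = red m"
   unfolding m'[symmetric] using m by (auto intro: inv_into_into f_inv_into_f)
  hence det': "a' * d' - b' * c' = 1" and "c' mod int N = c mod int N" "d' mod int N = d mod int N"
   unfolding S_def red_def m_def by simp_all
  hence N_dvd: "int N dvd c - c'" "int N dvd d - d'" by (metis mod_eq_dvd_iff)+
  have R: "moebius a' b' c' d' \<in> R" unfolding R_def using m m' by (metis (mono_tags, lifting) case_prod_conv imageI)
  have "c * d' - d * c' = (c - c') * d' - (d - d') * c'" by (simp add: algebra_simps)
  hence dvd: "int N dvd c * d' - d * c'" using N_dvd by simp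
  have "(a * d' - b * c') * (d * a' - c * b') - (b * a' - a * b') * (c * d' - d * c') = (a * d - b * c) * (a' * d' - b' * c')"
   by (simp add: algebra_simps)
  hence det2: "(a * d' - b * c') * (d * a' - c * b') - (b * a' - a * b') * (c * d' - d * c') = 1" using det det' by simp
  have "f (moebius a b c d z) = f (moebius a' b' c' d' z)" if f: "Gamma0_invariant N f" and z: "Im z > 0" for f z
  proof -
   have e: "(a * d' - b * c') * a' + (b * a' - a * b') * c' = a * (a' * d' - b' * c')"
    "(a * d' - b * c') * b' + (b * a' - a * b') * d' = b * (a' * d' - b' * c')"
    "(c * d' - d * c') * a' + (d * a' - c * b') * c' = c * (a' * d' - b' * c')"
    "(c * d' - d * c') * b' + (d * a' - c * b') * d' = d * (a' * d' - b' * c')"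
    by (simp_all add: algebra_simps)
   have "moebius (a * d' - b * c') (b * a' - a * b') (c * d' - d * c') (d * a' - c * b') (moebius a' b' c' d' z) = moebius a b c d z"
    unfolding moebius_compose[OF moebius_denom_nonzero[OF det' z]] e det' by simp
   thus ?thesis using Gamma0_invariantD[OF f det2 dvd Im_moebius_pos[OF det' z]] by simp
  qed
  thus ?thesis using R det' N_dvd by blast
 qed
 have "coset_representatives N R" unfolding coset_representatives_def
  by (intro conjI ballI allI impI fin det1 reps)
 thus ?thesis by blast
qed

lemmas coset_representativesD =
 coset_representatives_def[THEN iffD1, THEN conjunct1]
 coset_representatives_def[THEN iffD1, THEN conjunct2, THEN conjunct1, THEN bspec]
 coset_representatives_def[THEN iffD1, THEN conjunct2, THEN conjunct2, rule_format]

lemma moebius_surj: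
 assumes "a * d - b * c = 1" "Im z > 0"
 shows "moebius a b c d (moebius d (- b) (- c) a z) = z" "Im (moebius d (- b) (- c) a z) > 0"
 using moebius_inverse[of d a "- b" "- c" z] Im_moebius_pos[of d a "- b" "- c" z] assms by (simp_all add: mult.commute)

lemma strip_Im_pos: "sqrt 3 / 2 \<le> Im z \<Longrightarrow> Im z > 0"
 using real_sqrt_gt_zero[of 3] by linarith

lemma analytic_on_poly: "f analytic_on A \<Longrightarrow> (\<lambda>w. poly p (f w)) analytic_on A"
 by (induction p) (auto intro: analytic_intros)

lemma holomorphic_moebius_compose:
 assumes f: "f holomorphic_on upper_half_plane" and det: "a * d - b * c = 1"
 shows "(\<lambda>z. f (moebius a b c d z)) holomorphic_on upper_half_plane"
proof -
 have "moebius a b c d holomorphic_on upper_half_plane"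
  using det by (intro analytic_imp_holomorphic moebius_analytic) simp
 hence "(f \<circ> moebius a b c d) holomorphic_on upper_half_plane"
  by (rule holomorphic_on_compose_gen[OF _ f]) (auto simp: upper_half_plane_iff Im_moebius_pos[OF det])
 thus ?thesis by (simp add: o_def)
qed

text \<open>Near infinity f is smaller than at \<open>z0\<close>, so its norm attains a maximum in
  the compact part of the fundamental domain. It is then constant, which contradicts the limit
  0.\<close>

lemma SL2Z_invariant_vanishing:
 assumes f: "f holomorphic_on upper_half_plane"
  and inv: "\<And>a b c d z. a * d - b * c = 1 \<Longrightarrow> Im z > 0 \<Longrightarrow> f (moebius a b c d z) = f z"
  and lim: "(f \<longlongrightarrow> 0) at_i_infinity" and z0: "Im z0 > 0"
 shows "f z0 = 0"
proof (rule ccontr)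
 assume nz: "f z0 \<noteq> 0"
 have "NEAR z. norm (f z) < norm (f z0)"
  using tendsto_norm[OF lim] by (rule order_tendstoD) (use nz in simp)
 then obtain y where y: "\<And>z. Im z \<ge> y \<Longrightarrow> norm (f z) < norm (f z0)" by (auto simp: eventually_at_i_infinity)
 define D where "D = {z. \<bar>Re z\<bar> \<le> 1 / 2 \<and> sqrt 3 / 2 \<le> Im z \<and> Im z \<le> y}"
 have "D = cbox (Complex (- 1 / 2) (sqrt 3 / 2)) (Complex (1 / 2) y)"
  by (auto simp: D_def cbox_def Basis_complex_def)
 hence "compact D" by simp
 have up: "D \<subseteq> upper_half_plane" by (auto simp: D_def upper_half_plane_iff intro!: strip_Im_pos)
 have red: "\<exists>w. norm (f w) = norm (f z) \<and> (w \<in> D \<or> norm (f w) < norm (f z0))" if z: "Im z > 0" for z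
 proof -
  obtain a b c d where m: "a * d - b * c = 1" "Im (moebius a b c d z) \<ge> sqrt 3 / 2" "\<bar>Re (moebius a b c d z)\<bar> \<le> 1 / 2"
   using SL2Z_reduction[OF z] .
  show ?thesis
   using m(2,3) inv[OF m(1) z] y[of "moebius a b c d z"]
   by (intro exI[of _ "moebius a b c d z"]) (auto simp: D_def intro: le_cases)
 qed
 have "D \<noteq> {}" using red[OF z0] by auto
 moreover have "continuous_on D (\<lambda>z. norm (f z))"
  using holomorphic_on_imp_continuous_on[OF f] up by (intro continuous_intros) (rule continuous_on_subset)
 ultimately obtain p where p: "p \<in> D" "\<And>w. w \<in> D \<Longrightarrow> norm (f w) \<le> norm (f p)"
  using continuous_attains_sup[OF \<open>compact D\<close>] by metis
 have z0p: "norm (f z0) \<le> norm (f p)" using red[OF z0] p(2) by fastforce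
 hence "norm (f z) \<le> norm (f p)" if "z \<in> upper_half_plane" for z
  using red[of z] that p(2) unfolding upper_half_plane_iff by fastforce
 hence "f constant_on upper_half_plane"
  using maximum_modulus_principle[OF f open_upper_half_plane connected_upper_half_plane open_upper_half_plane] p(1) up by blast
 then obtain c where c: "\<And>z. Im z > 0 \<Longrightarrow> f z = c" by (auto simp: constant_on_def upper_half_plane_iff)
 have "f z0 = f (Complex 0 (max 1 y))" using c[of z0] c[of "Complex 0 (max 1 y)"] z0 by simp
 thus False using y[of "Complex 0 (max 1 y)"] by simp
qed

text \<open>The product over the finite orbit of \<open>f\<close> under the modular group is invariant and vanishes at infinity.\<close>
theorem Gamma0_vanishing:
 assumes f: "f holomorphic_on upper_half_plane" "Gamma0_invariant N f" and N: "N > 0"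
  and bd: "\<And>a b c d. a * d - b * c = 1 \<Longrightarrow> \<exists>C. NEAR z. norm (f (moebius a b c d z)) \<le> C"
  and lim: "(f \<longlongrightarrow> 0) at_i_infinity" and z0: "Im z0 > 0"
 shows "f z0 = 0"
proof -
 define tr where "tr = (\<lambda>(v :: complex \<Rightarrow> complex) h z. if Im z > 0 then v (h z) else 0 :: complex)"
 \<comment> \<open>Translates are collected as functions, cut off outside the half plane, so that
   representatives of one coset give literally the same element of the finite set.\<close>
 define m where "m = {tr f (moebius a b c d) |a b c d. a * d - b * c = 1}"
 obtain R where "coset_representatives N R" using coset_representatives_exist[OF N] by blast
 note R = coset_representativesD[OF this]
 have "m \<subseteq> tr f ` R"
 proof
  fix v assume "v \<in> m"
  then obtain a b c d where v: "v = tr f (moebius a b c d)" and det: "a * d - b * c = 1" by (auto simp: m_def)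
  obtain h where "h \<in> R" "\<And>z. Im z > 0 \<Longrightarrow> f (moebius a b c d z) = f (h z)" using R(3)[OF det] f(2) by metis
  thus "v \<in> tr f ` R" unfolding v by (intro image_eqI[of _ _ h]) (auto simp: tr_def)
 qed
 hence fin: "finite m" using R(1) finite_surj by blast
 define G where "G = (\<lambda>z. \<Prod>v\<in>m. v z)"
 have G_inv: "G (moebius a b c d z) = G z" if det: "a * d - b * c = 1" and z: "Im z > 0" for a b c d z
 proof -
  define T where "T = (\<lambda>v. tr v (moebius a b c d))"
  \<comment> \<open>Composition with a modular transformation maps the finite set of translates
    injectively to itself, hence permutes it, and the product is invariant.\<close>
  have sub: "T ` m \<subseteq> m"
  proof safe
   fix v assume "v \<in> m"
   then obtain a' b' c' d' where v: "v = tr f (moebius a' b' c' d')" and det': "a' * d' - b' * c' = 1" by (auto simp: m_def)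
   have "T v = tr f (moebius (a' * a + b' * c) (a' * b + b' * d) (c' * a + d' * c) (c' * b + d' * d))"
    by (auto simp: T_def v tr_def Im_moebius_pos[OF det] moebius_compose[OF moebius_denom_nonzero[OF det]])
   moreover have "(a' * a + b' * c) * (c' * b + d' * d) - (a' * b + b' * d) * (c' * a + d' * c) = (a' * d' - b' * c') * (a * d - b * c)"
    by (simp add: algebra_simps)
   ultimately show "T v \<in> m" unfolding m_def using det det' by auto
  qed
  have out: "v w = 0" if "v \<in> m" "\<not> Im w > 0" for v w using that by (auto simp: m_def tr_def)
  have inj: "inj_on T m"
  proof (rule inj_onI, rule ext)
   fix v k w assume v: "v \<in> m" "k \<in> m" "T v = T k"
   show "v w = k w"
   proof (cases "Im w > 0")
    case True
    from v(3) have "T v (moebius d (- b) (- c) a w) = T k (moebius d (- b) (- c) a w)" by simp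
    thus ?thesis using moebius_surj[OF det True] by (simp add: T_def tr_def)
   qed (simp add: out v)
  qed
  have "T ` m = m" by (rule endo_inj_surj[OF fin sub inj])
  hence "G z = (\<Prod>v\<in>T ` m. v z)" by (simp add: G_def)
  also have "\<dots> = (\<Prod>v\<in>m. T v z)" by (rule prod.reindex[OF inj, unfolded o_def])
  also have "\<dots> = G (moebius a b c d z)" using z by (simp add: T_def tr_def G_def)
  finally show ?thesis ..
 qed
 have hol: "v holomorphic_on upper_half_plane" if m: "v \<in> m" for v
 proof -
  obtain a b c d where v: "v = tr f (moebius a b c d)" and det: "a * d - b * c = 1" using m by (auto simp: m_def)
  from holomorphic_moebius_compose[OF f(1) det] show ?thesis
   by (rule holomorphic_transform) (simp add: v tr_def upper_half_plane_iff)
 qed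
 define f0 where "f0 = tr f (moebius 1 0 0 1)"
 have "1 * 1 - 0 * 0 = (1 :: int)" by simp
 hence "f0 \<in> m" unfolding m_def f0_def by blast
 moreover have "f0 z = f z" if "Im z > 0" for z using that by (simp add: f0_def tr_def moebius_scalar)
 ultimately have f0: "f0 \<in> m" "\<And>z. Im z > 0 \<Longrightarrow> f0 z = f z" by blast+
 have "\<forall>v\<in>m. \<exists>C. NEAR z. norm (v z) \<le> C"
 proof
  fix v assume "v \<in> m"
  then obtain a b c d where v: "v = tr f (moebius a b c d)" and det: "a * d - b * c = 1" by (auto simp: m_def)
  obtain C where "NEAR z. norm (f (moebius a b c d z)) \<le> C" using bd[OF det] by blast
  with eventually_Im_gt[of 0] have "NEAR z. norm (v z) \<le> C"
   by eventually_elim (simp add: v tr_def)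
  thus "\<exists>C. NEAR z. norm (v z) \<le> C" by blast
 qed
 then obtain C where C: "\<And>v. v \<in> m \<Longrightarrow> NEAR z. norm (v z) \<le> C v" by metis
 have G0: "G z = 0" if z: "Im z > 0" for z
 proof (rule SL2Z_invariant_vanishing[OF _ G_inv _ z])
  show "G holomorphic_on upper_half_plane" unfolding G_def by (intro holomorphic_intros hol)
  have "NEAR z. \<forall>v\<in>m - {f0}. norm (v z) \<le> C v"
   using fin C by (intro eventually_ball_finite) auto
  hence "NEAR z. norm (G z) \<le> norm (f z) * (\<Prod>v\<in>m - {f0}. C v)"
   using eventually_Im_gt[of 0]
  proof eventually_elim
   case (elim z)
   have "G z = f z * (\<Prod>v\<in>m - {f0}. v z)"
    unfolding G_def using f0(2)[OF elim(2)] by (subst prod.remove[OF fin f0(1)]) simp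
   moreover have "norm (\<Prod>v\<in>m - {f0}. v z) \<le> (\<Prod>v\<in>m - {f0}. C v)"
    unfolding prod_norm[symmetric] using elim by (intro prod_mono) auto
   ultimately show ?case by (simp add: norm_mult mult_left_mono)
  qed
  moreover have "((\<lambda>z. norm (f z) * (\<Prod>v\<in>m - {f0}. C v)) \<longlongrightarrow> 0) at_i_infinity"
   by (rule tendsto_mult_left_zero[OF tendsto_norm_zero[OF lim]])
  ultimately show "(G \<longlongrightarrow> 0) at_i_infinity" by (rule Lim_null_comparison)
 qed
 \<comment> \<open>A finite product of holomorphic functions vanishes identically only if one factor
   does; then so do all other translates, including \<open>f\<close>.\<close>
 have "\<exists>v\<in>m. \<forall>z. Im z > 0 \<longrightarrow> v z = 0"
 proof (rule ccontr)
  assume no: "\<not> (\<exists>v\<in>m. \<forall>z. Im z > 0 \<longrightarrow> v z = 0)"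
  have "\<forall>\<^sub>F w in at z0. v w \<noteq> 0" if v: "v \<in> m" for v
  proof -
   obtain g where "Im g > 0" "v g \<noteq> 0" using no v by blast
   hence "\<forall>\<^sub>F w in at z0. v w \<noteq> 0 \<and> w \<in> upper_half_plane" using z0
    by (intro non_zero_neighbour_alt[OF hol[OF v] open_upper_half_plane connected_upper_half_plane, of _ g]) (auto simp: upper_half_plane_iff)
   thus ?thesis by eventually_elim simp
  qed
  hence "\<forall>\<^sub>F w in at z0. \<forall>v\<in>m. v w \<noteq> 0" using fin by (intro eventually_ball_finite) auto
  with eventually_at_upper[OF z0] have "\<forall>\<^sub>F w in at z0. False"
  proof eventually_elim
   case (elim w)
   thus ?case using G0[of w] fin by (simp add: G_def)
  qed
  thus False by simp
 qed
 then obtain a b c d where det: "a * d - b * c = 1" and zero: "\<And>z. Im z > 0 \<Longrightarrow> f (moebius a b c d z) = 0"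
  by (auto simp: m_def tr_def)
 show ?thesis using zero[OF moebius_surj(2)[OF det z0]] moebius_surj(1)[OF det z0] by simp
qed

section \<open>Removing poles by polynomials\<close>

lemma locally_bounded_at_poly_dvd:
 assumes "locally_bounded_at (\<lambda>w. poly p (h w) * v w) z" "isCont h z" "p dvd q"
 shows "locally_bounded_at (\<lambda>w. poly q (h w) * v w) z"
proof -
 obtain r where q: "q = p * r" using assms(3) by blast
 have "(\<lambda>w. poly r (h w)) \<midarrow>z\<rightarrow> poly r (h z)" using assms(2) by (intro tendsto_intros) (simp add: isCont_def)
 from locally_bounded_at_mult[OF tendsto_imp_locally_bounded_at[OF this] assms(1)]
 show ?thesis by (simp add: q mult_ac)
qed

text \<open>The function h - h(p) vanishes at p, so its n-th power compensates a pole of order n,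
  even where h is ramified.\<close>

lemma clear_pole_at:
 assumes v: "v meromorphic_on {p}" and h: "h analytic_on {p}"
 shows "\<exists>q :: complex poly. q \<noteq> 0 \<and> locally_bounded_at (\<lambda>w. poly q (h w) * v w) p"
proof -
 obtain F where F: "(\<lambda>w. v (p + w)) has_laurent_expansion F" using v by (auto simp: meromorphic_on_def)
 define n where "n = nat (- fls_subdegree F)"
 have "(\<lambda>w. v (p + w) * w ^ n) has_laurent_expansion F * fls_X_intpow (int n)"
  by (intro laurent_expansion_intros F)
 moreover have "fls_subdegree (F * fls_X_intpow (int n)) \<ge> 0" by (cases "F = 0") (simp_all add: n_def)
 ultimately obtain c where "(\<lambda>w. v (p + w) * w ^ n) \<midarrow>0\<rightarrow> c" using has_laurent_expansion_imp_tendsto_0 by blast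
 hence lim: "(\<lambda>w. v w * (w - p) ^ n) \<midarrow>p\<rightarrow> c" by (subst LIM_offset_zero_iff[of p]) (simp_all add: add.commute)
 have "(h has_field_derivative deriv h p) (at p)"
  using h analytic_on_imp_differentiable_at DERIV_deriv_iff_field_differentiable by blast
 hence "(\<lambda>w. (h w - h p) / (w - p)) \<midarrow>p\<rightarrow> deriv h p" by (simp add: has_field_derivative_iff)
 hence "(\<lambda>w. ((h w - h p) / (w - p)) ^ n * (v w * (w - p) ^ n)) \<midarrow>p\<rightarrow> deriv h p ^ n * c"
  by (intro tendsto_intros lim)
 moreover have "\<forall>\<^sub>F w in at p. ((h w - h p) / (w - p)) ^ n * (v w * (w - p) ^ n) = poly ([:- h p, 1:] ^ n) (h w) * v w"
  by (auto simp: eventually_at_filter power_divide poly_power)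
 ultimately have "(\<lambda>w. poly ([:- h p, 1:] ^ n) (h w) * v w) \<midarrow>p\<rightarrow> deriv h p ^ n * c" by (rule Lim_transform_eventually)
 thus ?thesis by (intro exI[of _ "[:- h p, 1:] ^ n"]) (auto intro: tendsto_imp_locally_bounded_at)
qed

lemma clear_poles_compact:
 assumes "compact D" "D \<subseteq> upper_half_plane" and v: "v meromorphic_on upper_half_plane" and h: "h holomorphic_on upper_half_plane"
 shows "\<exists>q :: complex poly. q \<noteq> 0 \<and> (\<forall>p\<in>D. locally_bounded_at (\<lambda>w. poly q (h w) * v w) p)"
proof -
 have an: "h analytic_on {p}" if "p \<in> upper_half_plane" for p
  using h that open_upper_half_plane by (auto simp: analytic_at)
 have "\<exists>q U. q \<noteq> 0 \<and> open U \<and> p \<in> U \<and> (\<forall>w\<in>U. locally_bounded_at (\<lambda>w. poly q (h w) * v w) w)" if p: "p \<in> D" for p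
 proof -
  have mp: "v meromorphic_on {p}" by (rule meromorphic_on_subset[OF v]) (use p assms(2) in auto)
  have ap: "h analytic_on {p}" using an p assms(2) by blast
  obtain q :: "complex poly" where q: "q \<noteq> 0" "locally_bounded_at (\<lambda>w. poly q (h w) * v w) p"
   using clear_pole_at[OF mp ap] by blast
  have "(\<lambda>w. poly q (h w) * v w) meromorphic_on {p}"
   by (intro meromorphic_on_mult mp analytic_on_imp_meromorphic_on analytic_on_poly ap)
  hence "isolated_singularity_at (\<lambda>w. poly q (h w) * v w) p" by (rule meromorphic_on_isolated_singularity)
  then obtain r where r: "r > 0" "(\<lambda>w. poly q (h w) * v w) analytic_on ball p r - {p}"
   by (auto simp: isolated_singularity_at_def)
  have "locally_bounded_at (\<lambda>w. poly q (h w) * v w) w" if "w \<in> ball p r" for w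
  proof (cases "w = p")
   case False
   hence "(\<lambda>w. poly q (h w) * v w) analytic_on {w}" using that by (intro analytic_on_subset[OF r(2)]) auto
   thus ?thesis using analytic_at_imp_isCont isContD tendsto_imp_locally_bounded_at by blast
  qed (use q in simp)
  thus ?thesis using q(1) r(1) by (intro exI[of _ q] exI[of _ "ball p r"]) auto
 qed
 then obtain q U where qU: "\<And>p. p \<in> D \<Longrightarrow> q p \<noteq> 0" "\<And>p. p \<in> D \<Longrightarrow> open (U p)" "\<And>p. p \<in> D \<Longrightarrow> p \<in> U p"
  "\<And>p w. p \<in> D \<Longrightarrow> w \<in> U p \<Longrightarrow> locally_bounded_at (\<lambda>w. poly (q p) (h w) * v w) w" by metis
 have "D \<subseteq> (\<Union>p\<in>D. U p)" using qU(3) by blast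
 then obtain D' where D': "D' \<subseteq> D" "finite D'" "D \<subseteq> (\<Union>p\<in>D'. U p)"
  using compactE_image[OF assms(1), of D U] qU(2) by blast
 have "(\<Prod>p\<in>D'. q p) \<noteq> 0" using D' qU(1) by auto
 moreover have "locally_bounded_at (\<lambda>w. poly (\<Prod>p\<in>D'. q p) (h w) * v w) w" if w: "w \<in> D" for w
 proof -
  obtain p where p: "p \<in> D'" "w \<in> U p" using D'(3) w by blast
  show ?thesis
   by (rule locally_bounded_at_poly_dvd[OF qU(4)[OF _ p(2)]])
    (use p D' w assms(2) in \<open>auto intro!: analytic_at_imp_isCont an\<close>)
 qed
 ultimately show ?thesis by blast
qed

lemma locally_bounded_at_moebius:
 assumes det: "a * d - b * c = 1" and z: "Im z > 0" and "locally_bounded_at (\<lambda>w. F (moebius d (- b) (- c) a w)) (moebius a b c d z)"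
 shows "locally_bounded_at F z"
proof -
 obtain C where C: "\<forall>\<^sub>F w in at (moebius a b c d z). norm (F (moebius d (- b) (- c) a w)) \<le> C"
  using assms(3) by (auto simp: locally_bounded_at_def)
 have fl: "filterlim (moebius a b c d) (at (moebius a b c d z)) (at z)" using det z by (intro filterlim_moebius) auto
 from eventually_compose_filterlim[OF C fl] eventually_at_upper[OF z]
 have "\<forall>\<^sub>F w in at z. norm (F w) \<le> C"
  by eventually_elim (use moebius_inverse[of a d b c] det in simp)
 thus ?thesis by (auto simp: locally_bounded_at_def)
qed

text \<open>A reduced region together with finitely many representatives covers all orbits. For each
  representative, growth excludes poles above some height, compactness handles the part below, and
  invariance under Gamma0(N) spreads the bound over the half plane.\<close>

lemma clear_poles:
 assumes g: "automorphic N g" and x: "automorphic N x" "x holomorphic_on upper_half_plane" and N: "N > 0"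
 obtains q :: "complex poly" where "q \<noteq> 0" "\<And>z. Im z > 0 \<Longrightarrow> locally_bounded_at (\<lambda>w. poly q (x w) * g w) z"
proof -
 obtain R where "coset_representatives N R" using coset_representatives_exist[OF N] by blast
 note R = coset_representativesD[OF this]
 define D where "D = {z. \<bar>Re z\<bar> \<le> 1 / 2 \<and> sqrt 3 / 2 \<le> Im z}"
 have xh: "(\<lambda>z. x (v z)) holomorphic_on upper_half_plane" if "v \<in> R" for v
  using R(2)[OF that] holomorphic_moebius_compose[OF x(2)] by auto
 hence xc: "isCont (\<lambda>z. x (v z)) p" if "v \<in> R" "Im p > 0" for v p
  using that open_upper_half_plane by (intro analytic_at_imp_isCont) (auto simp: analytic_at upper_half_plane_iff)
 have "\<exists>q. q \<noteq> 0 \<and> (\<forall>p\<in>D. locally_bounded_at (\<lambda>w. poly q (x (v w)) * g (v w)) p)" if v: "v \<in> R" for v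
 proof -
  obtain a b c d where v': "v = moebius a b c d" and det: "a * d - b * c = 1" using R(2)[OF v] by metis
  obtain y where y: "\<And>z. Im z \<ge> y \<Longrightarrow> locally_bounded_at (\<lambda>w. g (v w)) z"
   using moderate_eventually_locally_bounded[OF automorphicD(3)[OF g det]] by (auto simp: eventually_at_i_infinity v')
  define D0 where "D0 = {z. \<bar>Re z\<bar> \<le> 1 / 2 \<and> sqrt 3 / 2 \<le> Im z \<and> Im z \<le> y}"
  have "D0 = cbox (Complex (- 1 / 2) (sqrt 3 / 2)) (Complex (1 / 2) y)"
   by (auto simp: D0_def cbox_def Basis_complex_def)
  hence "compact D0" by simp
  moreover have D_up: "D \<subseteq> upper_half_plane"
   by (auto simp: D_def upper_half_plane_iff intro!: strip_Im_pos)
  have "D0 \<subseteq> upper_half_plane" using D_up by (auto simp: D_def D0_def)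
  moreover have "(\<lambda>w. g (v w)) meromorphic_on upper_half_plane"
   unfolding v' by (rule meromorphic_on_moebius[OF automorphicD(1)[OF g]]) (simp add: det)
  ultimately obtain q where q: "q \<noteq> 0" "\<forall>p\<in>D0. locally_bounded_at (\<lambda>w. poly q (x (v w)) * g (v w)) p"
   using clear_poles_compact[OF _ _ _ xh[OF v]] by blast
  have "locally_bounded_at (\<lambda>w. poly q (x (v w)) * g (v w)) p" if p: "p \<in> D" for p
  proof (cases "Im p \<le> y")
   case False
   have "locally_bounded_at (\<lambda>w. poly 1 (x (v w)) * g (v w)) p" using y[of p] False by simp
   thus ?thesis by (rule locally_bounded_at_poly_dvd) (use xc[OF v] p D_up in \<open>auto simp: upper_half_plane_iff\<close>)
  qed (use q p in \<open>auto simp: D_def D0_def\<close>)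
  thus ?thesis using q(1) by blast
 qed
 then obtain q where q: "\<And>v. v \<in> R \<Longrightarrow> q v \<noteq> 0"
  "\<And>v p. v \<in> R \<Longrightarrow> p \<in> D \<Longrightarrow> locally_bounded_at (\<lambda>w. poly (q v) (x (v w)) * g (v w)) p" by metis
 define Q where "Q = (\<Prod>v\<in>R. q v)"
 show thesis
 proof (rule that)
  show "Q \<noteq> 0" unfolding Q_def using R(1) q(1) by simp
  fix z :: complex assume z: "Im z > 0"
  obtain a b c d where det: "a * d - b * c = 1" and red: "Im (moebius a b c d z) \<ge> sqrt 3 / 2" "\<bar>Re (moebius a b c d z)\<bar> \<le> 1 / 2"
   using SL2Z_reduction[OF z] .
  define p where "p = moebius a b c d z"
  have p: "p \<in> D" "Im p > 0" using red Im_moebius_pos[OF det z] by (simp_all add: D_def p_def)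
  have det': "d * a - (- b) * (- c) = 1" using det by (simp add: mult.commute)
  obtain v where v: "v \<in> R"
   "\<And>f z. Gamma0_invariant N f \<Longrightarrow> Im z > 0 \<Longrightarrow> f (moebius d (- b) (- c) a z) = f (v z)"
   using R(3)[OF det'] by metis
  have "locally_bounded_at (\<lambda>w. poly Q (x (v w)) * g (v w)) p"
   by (rule locally_bounded_at_poly_dvd[OF q(2)[OF v(1) p(1)] xc[OF v(1) p(2)]]) (use R(1) v(1) in \<open>simp add: Q_def dvd_prodI\<close>)
  then obtain C where "\<forall>\<^sub>F w in at p. norm (poly Q (x (v w)) * g (v w)) \<le> C" by (auto simp: locally_bounded_at_def)
  with eventually_at_upper[OF p(2)]
  have "\<forall>\<^sub>F w in at p. norm (poly Q (x (moebius d (- b) (- c) a w)) * g (moebius d (- b) (- c) a w)) \<le> C"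
   by eventually_elim (simp add: v(2)[OF automorphicD(2)[OF x(1)]] v(2)[OF automorphicD(2)[OF g]])
  thus "locally_bounded_at (\<lambda>w. poly Q (x w) * g w) z"
   by (intro locally_bounded_at_moebius[OF det z]) (auto simp: locally_bounded_at_def p_def)
 qed
qed

section \<open>Functions invariant under the normalizer\<close>

lemma bounded_mult:
 fixes f g :: "'a \<Rightarrow> complex"
 assumes "\<exists>C. \<forall>\<^sub>F z in F. norm (f z) \<le> C" "\<exists>C. \<forall>\<^sub>F z in F. norm (g z) \<le> C"
 shows "\<exists>C. \<forall>\<^sub>F z in F. norm (f z * g z) \<le> C"
proof -
 obtain B C where "\<forall>\<^sub>F z in F. norm (f z) \<le> B" "\<forall>\<^sub>F z in F. norm (g z) \<le> C" using assms by blast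
 hence "\<forall>\<^sub>F z in F. norm (f z * g z) \<le> B * C"
  by eventually_elim (auto simp: norm_mult intro!: mult_mono intro: order_trans[OF norm_ge_zero])
 thus ?thesis by blast
qed

lemma bounded_poly:
 assumes "\<exists>C. \<forall>\<^sub>F z in F. norm (f z) \<le> C"
 shows "\<exists>C. \<forall>\<^sub>F z in F. norm (poly p (f z) :: complex) \<le> C"
proof (induction p)
 case (pCons k p)
 obtain C where "\<forall>\<^sub>F z in F. norm (f z * poly p (f z)) \<le> C" using bounded_mult[OF assms pCons.IH] by blast
 hence "\<forall>\<^sub>F z in F. norm (poly (pCons k p) (f z)) \<le> norm k + C"
  by eventually_elim (auto intro: norm_triangle_mono)
 thus ?case by blast
qed (auto intro: exI[of _ 0])

lemma upper_half_plane_analytic_at: "f holomorphic_on upper_half_plane \<Longrightarrow> Im z > 0 \<Longrightarrow> f analytic_on {z}"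
 using open_upper_half_plane by (auto simp: analytic_at upper_half_plane_iff)

text \<open>At such a cusp x is bounded, hence analytic in the local parameter with a finite value
  k(0). Powers of x - k(0) decay there and can be used to kill the growth of g.\<close>

lemma clear_cusp:
 assumes g: "automorphic 56 g" and det: "a * d - b * c = 1" and c: "\<not> 8 dvd c"
 shows "\<exists>q :: complex poly. q \<noteq> 0 \<and> (\<exists>C. NEAR z. norm (poly q (coord_x (moebius a b c d z)) * g (moebius a b c d z)) \<le> C)"
proof -
 define v where "v = (\<lambda>z. coord_x (moebius a b c d z))"
 define e where "e = (\<lambda>z. nome (z / of_real 56))"
 obtain C where C: "NEAR z. norm (v z) \<le> C" unfolding v_def using coord_x_bounded_at_cusp[OF det c] by blast
 have an: "NEAR z. v analytic_on {z}"
  using eventually_Im_gt[of 0] unfolding v_def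
  by eventually_elim (rule upper_half_plane_analytic_at[OF holomorphic_moebius_compose[OF coord_holomorphic(1) det]])
 have per: "NEAR z. v (z + of_real 56) = v z"
  using eventually_Im_gt[of 0] unfolding v_def
  by eventually_elim (use Gamma0_invariant_periodic[OF coord_Gamma0(1) det] in simp)
 obtain k where k: "k analytic_on {0}" "NEAR z. v z = k (e z)"
  unfolding e_def by (rule periodic_bounded_imp_analytic[OF _ an per C]) simp_all
 obtain n B where n: "NEAR z. norm (g (moebius a b c d z)) \<le> B * exp (real n * Im z)"
  using automorphicD(3)[OF g det] by (auto simp: moderate_def)
 have "(k has_field_derivative deriv k 0) (at 0)"
  using k(1) analytic_on_imp_differentiable_at DERIV_deriv_iff_field_differentiable by blast
 hence "(\<lambda>w. norm ((k w - k 0) / w)) \<midarrow>0\<rightarrow> norm (deriv k 0)" by (intro tendsto_norm) (simp add: has_field_derivative_iff)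
 hence "\<forall>\<^sub>F w in at 0. norm ((k w - k 0) / w) < norm (deriv k 0) + 1" by (rule order_tendstoD) simp
 hence kb: "NEAR z. norm ((k (e z) - k 0) / e z) < norm (deriv k 0) + 1"
  unfolding e_def using eventually_nome_iff[of 56 "\<lambda>w. norm ((k w - k 0) / w) < norm (deriv k 0) + 1"] by simp
 define L where "L = norm (deriv k 0) + 1"
 \<comment> \<open>The norm of the parameter to the power 56 n is exp(-2 pi n Im z), which dominates
   the growth exp(n Im z) of \<open>g\<close>.\<close>
 have "NEAR z. norm (poly ([:- k 0, 1:] ^ (56 * n)) (v z) * g (moebius a b c d z)) \<le> L ^ (56 * n) * \<bar>B\<bar>"
  using k(2) n kb eventually_Im_gt[of 0]
 proof eventually_elim
  case (elim z)
  have e0: "e z \<noteq> 0" by (simp add: e_def)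
  have "norm (v z - k 0) \<le> L * norm (e z)"
   using elim(1,3) e0 by (simp add: L_def norm_divide divide_less_eq)
  hence "norm (v z - k 0) ^ (56 * n) \<le> (L * norm (e z)) ^ (56 * n)" by (intro power_mono) auto
  also have "\<dots> = L ^ (56 * n) * exp (- (2 * pi * n * Im z))"
   by (simp add: power_mult_distrib e_def norm_nome exp_of_nat_mult[symmetric])
  finally have "norm (v z - k 0) ^ (56 * n) * norm (g (moebius a b c d z)) \<le>
    (L ^ (56 * n) * exp (- (2 * pi * n * Im z))) * (\<bar>B\<bar> * exp (real n * Im z))"
   by (intro mult_mono) (auto intro: order_trans[OF elim(2)] mult_right_mono simp: L_def)
  also have "\<dots> = L ^ (56 * n) * \<bar>B\<bar> * exp (real n * Im z * (1 - 2 * pi))" by (simp add: algebra_simps flip: exp_add)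
  also have "\<dots> \<le> L ^ (56 * n) * \<bar>B\<bar> * 1"
   using elim pi_gt3 by (intro mult_left_mono) (auto simp: mult_nonneg_nonpos L_def)
  finally show ?case by (simp add: norm_mult norm_power poly_power)
 qed
 thus ?thesis unfolding v_def by (intro exI[of _ "[:- k 0, 1:] ^ (56 * n)"]) auto
qed

lemma clear_cusps:
 assumes g: "automorphic 56 g"
 shows "\<exists>q :: complex poly. q \<noteq> 0 \<and> (\<forall>a b c d. a * d - b * c = 1 \<longrightarrow> \<not> 8 dvd c \<longrightarrow>
  (\<exists>C. NEAR z. norm (poly q (coord_x (moebius a b c d z)) * g (moebius a b c d z)) \<le> C))"
proof -
 obtain R where "coset_representatives 56 R" using coset_representatives_exist[of 56] by auto
 note R = coset_representativesD[OF this]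
 define Bd where "Bd = (\<lambda>v q. \<exists>C. NEAR z. norm (poly q (coord_x (v z)) * g (v z)) \<le> C)"
 have "\<exists>q. q \<noteq> 0 \<and> ((\<exists>a b c d. a * d - b * c = 1 \<and> \<not> 8 dvd c \<and> v = moebius a b c d) \<longrightarrow> Bd v q)" for v
 proof (cases "\<exists>a b c d. a * d - b * c = 1 \<and> \<not> 8 dvd c \<and> v = moebius a b c d")
  case True
  then obtain a b c d where det: "a * d - b * c = 1" "\<not> 8 dvd c" and v: "v = moebius a b c d" by (elim exE conjE)
  show ?thesis using clear_cusp[OF g det] unfolding Bd_def v by (elim exE conjE) (intro exI conjI impI)
 next
  case False
  show ?thesis by (intro exI[of _ 1] conjI impI) (use False in simp_all)
 qed
 then obtain q where q: "\<And>v. q v \<noteq> 0" "\<And>v a b c d. a * d - b * c = 1 \<Longrightarrow> \<not> 8 dvd c \<Longrightarrow> v = moebius a b c d \<Longrightarrow> Bd v (q v)"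
  by metis
 define Q where "Q = (\<Prod>v\<in>R. q v)"
 show ?thesis
 proof (intro exI[of _ Q] conjI allI impI)
  show "Q \<noteq> 0" unfolding Q_def using R(1) q(1) by simp
  fix a b c d :: int assume det: "a * d - b * c = 1" and c: "\<not> 8 dvd c"
  obtain a' b' c' d' where det': "a' * d' - b' * c' = 1" and cc: "int 56 dvd c - c'" and v: "moebius a' b' c' d' \<in> R"
   and eq: "\<And>f z. Gamma0_invariant 56 f \<Longrightarrow> Im z > 0 \<Longrightarrow> f (moebius a b c d z) = f (moebius a' b' c' d' z)"
   using R(3)[OF det] by metis
  \<comment> \<open>Here the recorded congruence modulo 56 is used: it preserves divisibility by
    8.\<close>
  have c': "\<not> 8 dvd c'" using c cc by presburger
  define v' where "v' = moebius a' b' c' d'"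
  obtain r where Qr: "Q = q v' * r" unfolding Q_def using dvd_prodI[OF R(1) v] by (auto simp: v'_def elim: dvdE)
  have "\<exists>C. NEAR z. norm (poly r (coord_x (v' z)) * (poly (q v') (coord_x (v' z)) * g (v' z))) \<le> C"
   unfolding v'_def by (rule bounded_mult[OF bounded_poly[OF coord_x_bounded_at_cusp[OF det' c']] q(2)[OF det' c' refl, unfolded Bd_def]])
  then obtain C where "NEAR z. norm (poly r (coord_x (v' z)) * (poly (q v') (coord_x (v' z)) * g (v' z))) \<le> C" by blast
  with eventually_Im_gt[of 0]
  have "NEAR z. norm (poly Q (coord_x (moebius a b c d z)) * g (moebius a b c d z)) \<le> C"
   by eventually_elim (simp add: eq[OF coord_Gamma0(1)] eq[OF automorphicD(2)[OF g]] v'_def Qr mult_ac)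
  thus "\<exists>C. NEAR z. norm (poly Q (coord_x (moebius a b c d z)) * g (moebius a b c d z)) \<le> C" by blast
 qed
qed

lemma coord_x_leading:
 obtains c where "c \<noteq> 0" "((\<lambda>z. coord_x z * nome (z / of_real (1 / 2))) \<longlongrightarrow> c) at_i_infinity"
proof -
 obtain F where F: "has_q_expansion 1 coord_x F" "fls_subdegree F = - 2" using coord_x_expansion by metis
 obtain k where k: "k has_laurent_expansion F" "NEAR z. coord_x z = k (nome (z / of_real (real 1)))"
  using F(1) by (auto simp: has_q_expansion_iff)
 have "(\<lambda>w. k w * w ^ 2) has_laurent_expansion F * fls_X_intpow (int 2)" by (intro laurent_expansion_intros k)
 from has_laurent_expansion_imp_tendsto_0[OF this] have "(\<lambda>w. k w * w ^ 2) \<midarrow>0\<rightarrow> fls_nth F (- 2)"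
  using F(2) by (cases "F = 0") (simp_all add: fls_X_intpow_times_conv_shift)
 moreover have "filterlim (\<lambda>z. nome (z / of_real 1)) (at 0) at_i_infinity"
  using filtermap_nome[of 1] by (simp add: filterlim_def)
 ultimately have "((\<lambda>z. k (nome (z / of_real 1)) * nome (z / of_real 1) ^ 2) \<longlongrightarrow> fls_nth F (- 2)) at_i_infinity"
  by (rule filterlim_compose)
 moreover have "NEAR z. k (nome (z / of_real 1)) * nome (z / of_real 1) ^ 2 = coord_x z * nome (z / of_real (1 / 2))"
  using k(2) by eventually_elim (simp add: nome_of_nat_mult[of 2, symmetric] mult.commute)
 ultimately have "((\<lambda>z. coord_x z * nome (z / of_real (1 / 2))) \<longlongrightarrow> fls_nth F (- 2)) at_i_infinity"
  by (rule Lim_transform_eventually)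
 moreover have "fls_nth F (- 2) \<noteq> 0" using F(2) nth_fls_subdegree_nonzero[of F] by (cases "F = 0") auto
 ultimately show thesis using that by blast
qed

text \<open>
 The function \<open>coord_x\<close> has a simple pole in the local parameter \<open>nome (2 * z)\<close>, so subtracting multiples of
 its powers removes the principal part.
\<close>
lemma polynomial_part:
 assumes "NEAR z. h analytic_on {z}" "NEAR z. h (z + of_real (1 / 2)) = h z"
  and "NEAR z. norm (h z * nome (z / of_real (1 / 2)) ^ n) \<le> C"
 shows "\<exists>q. ((\<lambda>z. h z - poly q (coord_x z)) \<longlongrightarrow> 0) at_i_infinity"
 using assms
proof (induction n arbitrary: h C)
 case 0
 have bd: "NEAR z. norm (h z) \<le> C" using 0(3) by simp
 obtain k where k: "k analytic_on {0}" "NEAR z. h z = k (nome (z / of_real (1 / 2)))"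
  by (rule periodic_bounded_imp_analytic[OF _ 0(1,2) bd]) simp_all
 have "filterlim (\<lambda>z. nome (z / of_real (1 / 2))) (nhds 0) at_i_infinity"
  using filtermap_nome[of "1 / 2"] by (simp add: filterlim_def at_within_def)
 from isCont_tendsto_compose[OF analytic_at_imp_isCont[OF k(1)] this]
 have "((\<lambda>z. k (nome (z / of_real (1 / 2)))) \<longlongrightarrow> k 0) at_i_infinity" .
 moreover have "NEAR z. k (nome (z / of_real (1 / 2))) = h z" using k(2) by eventually_elim simp
 ultimately have "(h \<longlongrightarrow> k 0) at_i_infinity" by (rule Lim_transform_eventually)
 hence "((\<lambda>z. h z - poly [:k 0:] (coord_x z)) \<longlongrightarrow> 0) at_i_infinity" by (simp add: LIM_zero_iff)
 thus ?case by blast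
next
 case (Suc n)
 define e where "e = (\<lambda>z. nome (z / of_real (1 / 2)))"
 have e_an: "e analytic_on {z}" for z unfolding e_def by (auto intro!: analytic_intros)
 have e_per: "e (z + of_real (1 / 2)) = e z" for z by (simp add: e_def distrib_left nome_add add_divide_distrib)
 have e_lim: "filterlim e (at 0) at_i_infinity" unfolding e_def using filtermap_nome[of "1 / 2"] by (simp add: filterlim_def)
 hence e_nhds: "filterlim e (nhds 0) at_i_infinity" by (simp add: filterlim_at)
 have x_an: "NEAR z. coord_x analytic_on {z}"
  using eventually_Im_gt[of 0] by eventually_elim (rule upper_half_plane_analytic_at[OF coord_holomorphic(1)])
 have x_per: "NEAR z. coord_x (z + of_real (1 / 2)) = coord_x z"
  using eventually_Im_gt[of 0] by eventually_elim (use coord_half_shift(1) in \<open>simp add: half_shift_eq\<close>)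
 obtain c where c: "c \<noteq> 0" "((\<lambda>z. coord_x z * e z) \<longlongrightarrow> c) at_i_infinity" unfolding e_def by (rule coord_x_leading)
 have limit: "\<exists>k. k analytic_on {0} \<and> (NEAR z. f z * e z ^ Suc n = k (e z))"
  if f: "NEAR z. f analytic_on {z}" "NEAR z. f (z + of_real (1 / 2)) = f z"
   "NEAR z. norm (f z * e z ^ Suc n) \<le> D" for f D
 proof -
  have an: "NEAR z. (\<lambda>z. f z * e z ^ Suc n) analytic_on {z}"
   using f(1) by eventually_elim (intro analytic_intros e_an)
  have per: "NEAR z. f (z + of_real (1 / 2)) * e (z + of_real (1 / 2)) ^ Suc n = f z * e z ^ Suc n"
   using f(2) by eventually_elim (simp only: e_per)
  show ?thesis
   by (rule periodic_bounded_imp_analytic[OF _ an per f(3)]) (auto simp: e_def)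
 qed
 obtain k where k: "k analytic_on {0}" "NEAR z. h z * e z ^ Suc n = k (e z)"
  using limit[OF Suc.prems(1,2)] Suc.prems(3) unfolding e_def by blast
 \<comment> \<open>The coefficient for which subtracting a multiple of the power
   \<open>Suc n\<close> of x cancels the leading term, so that the pole order drops by one.\<close>
 define v where "v = k 0 / c ^ Suc n"
 define h' where "h' = (\<lambda>z. h z - v * coord_x z ^ Suc n)"
 have h'_an: "NEAR z. h' analytic_on {z}"
  using Suc.prems(1) x_an unfolding h'_def by eventually_elim (intro analytic_intros)
 have h'_per: "NEAR z. h' (z + of_real (1 / 2)) = h' z"
  using Suc.prems(2) x_per unfolding h'_def by eventually_elim (simp only:)
 have "((\<lambda>z. k (e z) - v * (coord_x z * e z) ^ Suc n) \<longlongrightarrow> k 0 - v * c ^ Suc n) at_i_infinity"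
  by (intro tendsto_intros isCont_tendsto_compose[OF analytic_at_imp_isCont[OF k(1)] e_nhds] c(2))
 moreover have "NEAR z. k (e z) - v * (coord_x z * e z) ^ Suc n = h' z * e z ^ Suc n"
  using k(2) by eventually_elim (simp only: h'_def left_diff_distrib power_mult_distrib mult.assoc)
 ultimately have "((\<lambda>z. h' z * e z ^ Suc n) \<longlongrightarrow> k 0 - v * c ^ Suc n) at_i_infinity" by (rule Lim_transform_eventually)
 hence h'_lim: "((\<lambda>z. h' z * e z ^ Suc n) \<longlongrightarrow> 0) at_i_infinity" using c(1) by (simp add: v_def)
 hence "NEAR z. norm (h' z * e z ^ Suc n) < 1" using order_tendstoD(2)[OF tendsto_norm_zero[OF h'_lim], of 1] by simp
 hence "NEAR z. norm (h' z * e z ^ Suc n) \<le> 1" by eventually_elim simp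
 from limit[OF h'_an h'_per this] obtain l where l: "l analytic_on {0}" "NEAR z. h' z * e z ^ Suc n = l (e z)" by blast
 have "((\<lambda>z. l (e z)) \<longlongrightarrow> l 0) at_i_infinity" by (rule isCont_tendsto_compose[OF analytic_at_imp_isCont[OF l(1)] e_nhds])
 moreover have "((\<lambda>z. l (e z)) \<longlongrightarrow> 0) at_i_infinity" by (rule Lim_transform_eventually[OF h'_lim l(2)])
 moreover have "at_i_infinity \<noteq> bot" using e_lim by (metis filtermap_bot filtermap_nome at_neq_bot zero_less_one)
 ultimately have l0: "l 0 = 0" using tendsto_unique by blast
 have "(l has_field_derivative deriv l 0) (at 0)"
  using l(1) analytic_on_imp_differentiable_at DERIV_deriv_iff_field_differentiable by blast
 hence "(\<lambda>w. l w / w) \<midarrow>0\<rightarrow> deriv l 0" using l0 by (simp add: has_field_derivative_iff)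
 from filterlim_compose[OF this e_lim] have "((\<lambda>z. norm (l (e z) / e z)) \<longlongrightarrow> norm (deriv l 0)) at_i_infinity" by (rule tendsto_norm)
 hence "NEAR z. norm (l (e z) / e z) < norm (deriv l 0) + 1" by (rule order_tendstoD) simp
 with l(2) have "NEAR z. norm (h' z * e z ^ n) \<le> norm (deriv l 0) + 1"
 proof eventually_elim
  case (elim z)
  have "h' z * e z ^ n = l (e z) / e z" using elim(1)[symmetric] by (simp add: e_def)
  thus ?case using elim(2) by simp
 qed
 from Suc.IH[OF h'_an h'_per this[unfolded e_def]] obtain q
  where "((\<lambda>z. h' z - poly q (coord_x z)) \<longlongrightarrow> 0) at_i_infinity" by blast
 hence "((\<lambda>z. h z - poly (Polynomial.monom v (Suc n) + q) (coord_x z)) \<longlongrightarrow> 0) at_i_infinity"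
  by (simp add: h'_def poly_monom diff_diff_eq)
 thus ?case by blast
qed

text \<open>A polynomial in x clears the poles in the half plane and the growth at all cusps where 8
  does not divide c. The two remaining cusps are interchanged by the involution, so removing the
  principal part at infinity, again by a polynomial in x, bounds the remainder at both. It tends to
  0 at infinity and therefore vanishes identically.\<close>

theorem normalizer_invariant_rational:
 assumes g: "automorphic 56 g" and s: "\<And>z. Im z > 0 \<Longrightarrow> g (half_shift z) = g z" and w: "\<And>z. Im z > 0 \<Longrightarrow> g (fricke7 z) = g z"
 shows "\<exists>p q. p \<noteq> 0 \<and> (\<forall>z. Im z > 0 \<longrightarrow> (\<forall>\<^sub>F u in at z. poly p (coord_x u) * g u = poly q (coord_x u)))"
proof -
 obtain p1 :: "complex poly" where p1: "p1 \<noteq> 0" "\<And>z. Im z > 0 \<Longrightarrow> locally_bounded_at (\<lambda>w. poly p1 (coord_x w) * g w) z"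
  by (rule clear_poles[OF g coord_x_automorphic coord_holomorphic(1)]) auto
 obtain p2 :: "complex poly" where p2: "p2 \<noteq> 0" "\<forall>a b c d. a * d - b * c = 1 \<longrightarrow> \<not> 8 dvd c \<longrightarrow>
  (\<exists>C. NEAR z. norm (poly p2 (coord_x (moebius a b c d z)) * g (moebius a b c d z)) \<le> C)"
  using clear_cusps[OF g] by (elim exE conjE)
 define p where "p = p1 * p2"
 define f where "f = (\<lambda>z. poly p (coord_x z) * g z)"
 have f: "automorphic 56 f" unfolding f_def by (intro automorphic_mult automorphic_poly coord_x_automorphic g)
 define h where "h = canonical_rep f"
 have h: "automorphic 56 h" unfolding h_def by (intro modular_function_automorphic modular_function_canonical_rep f) simp_all
 have f_mero: "f meromorphic_on {z}" if "Im z > 0" for z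
  by (rule meromorphic_on_subset[OF automorphicD(1)[OF f]]) (use that in \<open>simp add: upper_half_plane_iff\<close>)
 have "h analytic_on {z}" if z: "Im z > 0" for z
  unfolding h_def
 proof (rule canonical_rep_analytic[OF _ f_mero[OF z] z])
  show "locally_bounded_at f z" unfolding f_def
   by (rule locally_bounded_at_poly_dvd[OF p1(2)[OF z] analytic_at_imp_isCont[OF upper_half_plane_analytic_at[OF coord_holomorphic(1) z]]])
    (simp add: p_def)
 qed
 hence h_an: "h analytic_on upper_half_plane" by (subst analytic_on_analytic_at) (simp add: upper_half_plane_iff)
 hence h_hol: "h holomorphic_on upper_half_plane" by (rule analytic_imp_holomorphic)
 have h_eq: "h (moebius a b c d z) = h z" if det: "a * d - b * c > 0" and z: "Im z > 0"
  and inv: "\<And>z. Im z > 0 \<Longrightarrow> f (moebius a b c d z) = f z" for a b c d z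
 proof -
  have "h (moebius a b c d z) = remove_sings (\<lambda>z. f (moebius a b c d z)) z"
   unfolding h_def by (rule canonical_rep_moebius[OF det z])
  also have "\<dots> = remove_sings f z"
   by (rule remove_sings_cong) (use eventually_at_upper[OF z] in \<open>auto elim: eventually_mono simp: inv\<close>)
  finally show ?thesis using z by (simp add: h_def canonical_rep_upper)
 qed
 have h_s: "h (half_shift z) = h z" if "Im z > 0" for z
  unfolding half_shift_def
  by (rule h_eq[OF _ that]) (simp_all flip: half_shift_def add: f_def coord_half_shift s)
 have h_w: "h (fricke7 z) = h z" if "Im z > 0" for z
  unfolding fricke7_def
  by (rule h_eq[OF _ that]) (simp_all flip: fricke7_def add: f_def coord_fricke7 w)
 have h_bd: "\<exists>C. NEAR z. norm (h (moebius a b c d z)) \<le> C" if det: "a * d - b * c = 1" and c: "\<not> 8 dvd c" for a b c d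
 proof -
  have "f (moebius a b c d z) = poly p1 (coord_x (moebius a b c d z)) * (poly p2 (coord_x (moebius a b c d z)) * g (moebius a b c d z))" for z
   by (simp add: f_def p_def mult_ac)
  moreover have "\<exists>C. NEAR z. norm (poly p1 (coord_x (moebius a b c d z)) * (poly p2 (coord_x (moebius a b c d z)) * g (moebius a b c d z))) \<le> C"
   by (rule bounded_mult[OF bounded_poly[OF coord_x_bounded_at_cusp[OF det c]] p2(2)[rule_format, OF det c]])
  ultimately obtain C where "NEAR z. norm (f (moebius a b c d z)) \<le> C * exp (0 * Im z)" by auto
  from eventually_norm_remove_sings_le[OF this] eventually_Im_gt[of 0]
  have "NEAR z. norm (h (moebius a b c d z)) \<le> C"
   by eventually_elim (simp add: h_def canonical_rep_moebius det)
  thus ?thesis by blast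
 qed
 obtain n C where "NEAR z. norm (h (moebius 1 0 0 1 z)) \<le> C * exp (real n * Im z)"
  using automorphicD(3)[OF h, of 1 1 0 0] by (auto simp: moderate_def)
 hence "NEAR z. norm (h z * nome (z / of_real (1 / 2)) ^ n) \<le> \<bar>C\<bar>"
  using eventually_Im_gt[of 0]
  by eventually_elim (rule norm_mult_nome_power_le[where m = n], simp_all add: moebius_scalar)
 moreover have "NEAR z. h analytic_on {z}"
  using eventually_Im_gt[of 0] by eventually_elim (rule upper_half_plane_analytic_at[OF h_hol])
 moreover have "NEAR z. h (z + of_real (1 / 2)) = h z"
  using eventually_Im_gt[of 0] by eventually_elim (use h_s in \<open>simp add: half_shift_eq\<close>)
 ultimately obtain q where q: "((\<lambda>z. h z - poly q (coord_x z)) \<longlongrightarrow> 0) at_i_infinity" using polynomial_part by blast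
 define r where "r = (\<lambda>z. h z - poly q (coord_x z))"
 have r_inv: "Gamma0_invariant 56 r"
  using automorphicD(2)[OF h] coord_Gamma0(1) by (simp add: r_def Gamma0_invariant_def)

 have r_bd: "NEAR z. norm (r z) \<le> 1"
  using order_tendstoD(2)[OF tendsto_norm_zero[OF q], of 1] unfolding r_def by (auto elim: eventually_mono)
 have r0: "r z = 0" if z: "Im z > 0" for z
 proof (rule Gamma0_vanishing[OF _ r_inv _ _ _ z])
  show "r holomorphic_on upper_half_plane" unfolding r_def by (intro holomorphic_intros h_hol coord_holomorphic)
  show "(r \<longlongrightarrow> 0) at_i_infinity" unfolding r_def by (rule q)
  fix a b c d :: int assume det: "a * d - b * c = 1"
  show "\<exists>C. NEAR z. norm (r (moebius a b c d z)) \<le> C"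
  proof (cases "8 dvd c")
   case False
   obtain B C where "NEAR z. norm (h (moebius a b c d z)) \<le> B"
    "NEAR z. norm (poly q (coord_x (moebius a b c d z))) \<le> C"
    using h_bd[OF det False] bounded_poly[OF coord_x_bounded_at_cusp[OF det False]] by blast
   hence "NEAR z. norm (r (moebius a b c d z)) \<le> B + C"
    unfolding r_def by eventually_elim (rule norm_triangle_le_diff, linarith)
   thus ?thesis by blast
  next
   case True
   have rw: "r (fricke7 z) = r z" if "Im z > 0" for z using that by (simp add: r_def h_w coord_fricke7)
   from cusp_8[OF det True] obtain A B where A: "A > 0" "\<And>z. Im z > 0 \<Longrightarrow> r (moebius a b c d z) = r (of_real A * z + B)"
    using r_inv rw by metis
   from eventually_compose_filterlim[OF r_bd filterlim_affine_at_i_infinity[OF A(1)]] eventually_Im_gt[of 0]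
   have "NEAR z. norm (r (moebius a b c d z)) \<le> 1" by eventually_elim (simp add: A(2))
   thus ?thesis by blast
  qed
 qed simp
 have "\<forall>\<^sub>F u in at z. poly p (coord_x u) * g u = poly q (coord_x u)" if z: "Im z > 0" for z
  using eventually_canonical_rep[OF automorphicD(1)[OF f] z] eventually_at_upper[OF z]
 proof eventually_elim
  case (elim u)
  thus ?case using r0[of u] by (simp add: r_def h_def f_def)
 qed
 moreover have "p \<noteq> 0" using p1 p2 by (simp add: p_def)
 ultimately show ?thesis by blast
qed

section \<open>Decomposition under the normalizer\<close>

text \<open>\<open>v\<close> is the projection of f, up to the factor 4, to the character of the
  four-group with value e at \<open>half_shift\<close> and d at \<open>fricke7\<close>. If u has the
  same character, u v is invariant and so rational in x; since u^2 is a polynomial in x, v is a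
  rational multiple of u.\<close>

lemma character_component:
 fixes e d :: complex
 assumes f: "automorphic 56 f" and u: "automorphic 56 u"
  and e: "e ^ 2 = 1" and d: "d ^ 2 = 1"
  and us: "\<And>z. Im z > 0 \<Longrightarrow> u (half_shift z) = e * u z" and uw: "\<And>z. Im z > 0 \<Longrightarrow> u (fricke7 z) = d * u z"
  and r: "r \<noteq> 0" "\<And>z. Im z > 0 \<Longrightarrow> u z ^ 2 = poly r (coord_x z)"
 defines "v \<equiv> \<lambda>z. f z + e * f (half_shift z) + d * f (fricke7 z) + e * d * f (half_shift (fricke7 z))"
 shows "\<exists>p q. p \<noteq> 0 \<and> (\<forall>z. Im z > 0 \<longrightarrow> (\<forall>\<^sub>F w in at z. poly p (coord_x w) * v w = poly q (coord_x w) * u w))"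
proof -
 have fs: "automorphic 56 (\<lambda>z. f (half_shift z))" and fw: "automorphic 56 (\<lambda>z. f (fricke7 z))"
  by (intro automorphic_half_shift automorphic_fricke7 f)+
 note inv = automorphicD(2)[OF f] automorphicD(2)[OF fs] automorphicD(2)[OF fw]
 have v: "automorphic 56 v" unfolding v_def
  by (intro automorphic_add automorphic_mult automorphic_const f fs fw automorphic_fricke7[OF fs])
 have ee: "e * (e * t) = t" "d * (d * t) = t" for t using e d by (simp_all add: power2_eq_square flip: mult.assoc)
 have vs: "v (half_shift z) = e * v z" if z: "Im z > 0" for z
 proof -
  have "f (half_shift (half_shift z)) = f z" by (rule half_shift_half_shift[OF inv(1) z])
  moreover have "f (fricke7 (half_shift z)) = f (half_shift (fricke7 z))" by (rule half_shift_fricke7[OF inv(1) z, symmetric])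
  moreover have "f (half_shift (fricke7 (half_shift z))) = f (fricke7 z)"
   using half_shift_fricke7[OF inv(1) Im_half_shift[OF z]] half_shift_half_shift[OF inv(3) z] by simp
  ultimately show ?thesis by (simp add: v_def distrib_left mult.left_commute[of e d] ee)
 qed
 have vw: "v (fricke7 z) = d * v z" if z: "Im z > 0" for z
  by (simp add: v_def fricke7_fricke7[OF z] distrib_left mult.left_commute[of d e] mult.assoc ee)
 have "automorphic 56 (\<lambda>z. v z * u z)" by (intro automorphic_mult v u)
 moreover have "v (half_shift z) * u (half_shift z) = v z * u z" "v (fricke7 z) * u (fricke7 z) = v z * u z" if "Im z > 0" for z
  using ee[of "v z * u z"] by (simp_all add: vs vw us uw that mult_ac)
 ultimately obtain p q where pq: "p \<noteq> 0" "\<And>z. Im z > 0 \<Longrightarrow> \<forall>\<^sub>F w in at z. poly p (coord_x w) * (v w * u w) = poly q (coord_x w)"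
  using normalizer_invariant_rational[of "\<lambda>z. v z * u z"] by blast
 have "\<forall>\<^sub>F w in at z. poly (p * r) (coord_x w) * v w = poly q (coord_x w) * u w" if z: "Im z > 0" for z
  using pq(2)[OF z] eventually_at_upper[OF z]
 proof eventually_elim
  case (elim w)
  have "poly (p * r) (coord_x w) * v w = (poly p (coord_x w) * (v w * u w)) * u w"
   by (simp add: r(2)[OF elim(2), symmetric] power2_eq_square mult_ac)
  thus ?case using elim(1) by simp
 qed
 thus ?thesis using pq(1) r(1) by (intro exI[of _ "p * r"] exI[of _ q]) simp
qed

definition curve_cubic :: "complex poly" where "curve_cubic = [:2, 1, 0, 1:]"

definition curve_sextic :: "complex poly" where "curve_sextic = [:7, 0, 1:] * ([:2, - 1, 1:] * [:2, 1, 1:])"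

lemma poly_curve: "poly curve_cubic h = h ^ 3 + h + 2"
 "poly curve_sextic h = (7 + h ^ 2) * (2 - h + h ^ 2) * (2 + h + h ^ 2)"
 by (simp_all add: curve_cubic_def curve_sextic_def power2_eq_square power3_eq_cube algebra_simps)

lemma curve_nonzero: "curve_cubic \<noteq> 0" "curve_sextic \<noteq> 0"
 by (simp_all add: curve_cubic_def curve_sextic_def)

theorem automorphic_decomposition:
 assumes f: "automorphic 56 f"
 shows "\<exists>p q1 q2 q3 q4. p \<noteq> 0 \<and> (\<forall>z. Im z > 0 \<longrightarrow> (\<forall>\<^sub>F w in at z. poly p (coord_x w) * f w =
  poly q1 (coord_x w) + poly q2 (coord_x w) * coord_y w + poly q3 (coord_x w) * coord_t w
   + poly q4 (coord_x w) * (coord_y w * coord_t w)))"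
proof -
 define v where "v = (\<lambda>e d z. f z + e * f (half_shift z) + d * f (fricke7 z) + e * d * f (half_shift (fricke7 z)))"
 have c1: "\<exists>p q. p \<noteq> 0 \<and> (\<forall>z. Im z > 0 \<longrightarrow> (\<forall>\<^sub>F w in at z. poly p (coord_x w) * v 1 1 w = poly q (coord_x w) * 1))"
  unfolding v_def by (rule character_component[OF f automorphic_const, where r = 1]) simp_all
 have c2: "\<exists>p q. p \<noteq> 0 \<and> (\<forall>z. Im z > 0 \<longrightarrow> (\<forall>\<^sub>F w in at z. poly p (coord_x w) * v (- 1) 1 w = poly q (coord_x w) * coord_y w))"
  unfolding v_def by (rule character_component[OF f coord_y_automorphic, where r = curve_cubic])
   (simp_all add: curve_nonzero poly_curve coord_half_shift coord_fricke7 coord_y_square)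
 have c3: "\<exists>p q. p \<noteq> 0 \<and> (\<forall>z. Im z > 0 \<longrightarrow> (\<forall>\<^sub>F w in at z. poly p (coord_x w) * v 1 (- 1) w = poly q (coord_x w) * coord_t w))"
  unfolding v_def by (rule character_component[OF f coord_t_automorphic, where r = curve_sextic])
   (simp_all add: curve_nonzero poly_curve coord_half_shift coord_fricke7 coord_t_square)
 have c4: "\<exists>p q. p \<noteq> 0 \<and> (\<forall>z. Im z > 0 \<longrightarrow> (\<forall>\<^sub>F w in at z. poly p (coord_x w) * v (- 1) (- 1) w = poly q (coord_x w) * (coord_y w * coord_t w)))"
  unfolding v_def by (rule character_component[OF f automorphic_mult[OF coord_y_automorphic coord_t_automorphic], where r = "curve_cubic * curve_sextic"])
   (simp_all add: curve_nonzero poly_curve coord_half_shift coord_fricke7 coord_t_square coord_y_square power_mult_distrib)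
 obtain p1 q1 where 1: "p1 \<noteq> 0" "\<And>z. Im z > 0 \<Longrightarrow> \<forall>\<^sub>F w in at z. poly p1 (coord_x w) * v 1 1 w = poly q1 (coord_x w) * 1" using c1 by blast
 obtain p2 q2 where 2: "p2 \<noteq> 0" "\<And>z. Im z > 0 \<Longrightarrow> \<forall>\<^sub>F w in at z. poly p2 (coord_x w) * v (- 1) 1 w = poly q2 (coord_x w) * coord_y w" using c2 by blast
 obtain p3 q3 where 3: "p3 \<noteq> 0" "\<And>z. Im z > 0 \<Longrightarrow> \<forall>\<^sub>F w in at z. poly p3 (coord_x w) * v 1 (- 1) w = poly q3 (coord_x w) * coord_t w" using c3 by blast
 obtain p4 q4 where 4: "p4 \<noteq> 0" "\<And>z. Im z > 0 \<Longrightarrow> \<forall>\<^sub>F w in at z. poly p4 (coord_x w) * v (- 1) (- 1) w = poly q4 (coord_x w) * (coord_y w * coord_t w)" using c4 by blast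
 have A: "4 * (a1 * a2 * a3 * a4) * f0 = (a2 * a3 * a4) * b1 + (a1 * a3 * a4) * b2 * y + (a1 * a2 * a4) * b3 * t + (a1 * a2 * a3) * b4 * (y * t)"
  if "a1 * v1 = b1 * 1" "a2 * v2 = b2 * y" "a3 * v3 = b3 * t" "a4 * v4 = b4 * (y * t)" "4 * f0 = v1 + v2 + v3 + v4"
  for a1 a2 a3 a4 b1 b2 b3 b4 v1 v2 v3 v4 f0 y t :: complex
 proof -
  have "4 * (a1 * a2 * a3 * a4) * f0 = a1 * a2 * a3 * a4 * (4 * f0)" by simp
  also have "\<dots> = a2 * a3 * a4 * (a1 * v1) + a1 * a3 * a4 * (a2 * v2) + a1 * a2 * a4 * (a3 * v3) + a1 * a2 * a3 * (a4 * v4)"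
   unfolding that(5) by (simp add: algebra_simps)
  finally show ?thesis unfolding that by (simp add: mult_ac)
 qed
 show ?thesis
 proof (intro exI conjI allI impI)
  \<comment> \<open>The factor 4 enters because the four projections of \<open>f\<close> add up to 4
    f.\<close>
  show "p1 * p2 * p3 * p4 * [:4:] \<noteq> 0" using 1 2 3 4 by simp
  fix z :: complex assume z: "Im z > 0"
  from 1(2)[OF z] 2(2)[OF z] 3(2)[OF z] 4(2)[OF z]
  show "\<forall>\<^sub>F w in at z. poly (p1 * p2 * p3 * p4 * [:4:]) (coord_x w) * f w =
   poly (p2 * p3 * p4 * q1) (coord_x w) + poly (p1 * p3 * p4 * q2) (coord_x w) * coord_y w
    + poly (p1 * p2 * p4 * q3) (coord_x w) * coord_t w + poly (p1 * p2 * p3 * q4) (coord_x w) * (coord_y w * coord_t w)"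
  proof eventually_elim
   case (elim w)
   have "4 * f w = v 1 1 w + v (- 1) 1 w + v 1 (- 1) w + v (- 1) (- 1) w" by (simp add: v_def)
   from A[OF elim this] show ?case by simp
  qed
 qed
qed

text \<open>The involution fixes x and y and negates t. Comparing the decomposition at a point and
  at its image cancels both terms containing t.\<close>

lemma automorphic_decomposition_invariant:
 assumes f: "automorphic 56 f" and w: "\<And>z. Im z > 0 \<Longrightarrow> f (fricke7 z) = f z"
 shows "\<exists>p q1 q2. p \<noteq> 0 \<and> (\<forall>z. Im z > 0 \<longrightarrow> (\<forall>\<^sub>F w in at z. poly p (coord_x w) * f w =
  poly q1 (coord_x w) + poly q2 (coord_x w) * coord_y w))"
proof -
 obtain p q1 q2 q3 q4 where p: "p \<noteq> 0" and rel: "\<And>z. Im z > 0 \<Longrightarrow> \<forall>\<^sub>F w in at z. poly p (coord_x w) * f w =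
  poly q1 (coord_x w) + poly q2 (coord_x w) * coord_y w + poly q3 (coord_x w) * coord_t w + poly q4 (coord_x w) * (coord_y w * coord_t w)"
  using automorphic_decomposition[OF f] by blast
 have "\<forall>\<^sub>F u in at z. poly p (coord_x u) * f u = poly q1 (coord_x u) + poly q2 (coord_x u) * coord_y u" if z: "Im z > 0" for z
 proof -
  have fl: "filterlim fricke7 (at (fricke7 z)) (at z)" unfolding fricke7_def by (rule filterlim_moebius[OF _ z]) simp
  from rel[OF z] eventually_compose_filterlim[OF rel[OF Im_fricke7[OF z]] fl] eventually_at_upper[OF z]
  show ?thesis
  proof eventually_elim
   case (elim u)
   have A: "l = a" if "l = a + b + c" "l = a + (- b) + (- c)" for l a b c :: complex
   proof -
    have "2 * l = 2 * a" using that by (metis (no_types, lifting) add_uminus_conv_diff diff_add_cancel add.assoc add.commute mult_2 ab_semigroup_add_class.add_ac(1) add_diff_cancel_right')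
    thus ?thesis by simp
   qed
   show ?case
    by (rule A[OF elim(1)]) (use elim(2) in \<open>simp add: coord_fricke7[OF elim(3)] w[OF elim(3)]\<close>)
  qed
 qed
 thus ?thesis using p by blast
qed

lemma coord_x_infinite:
 fixes p :: "complex poly"
 assumes "p \<noteq> 0" "Im z > 0"
 shows "\<forall>\<^sub>F w in at z. poly p (coord_x w) \<noteq> 0"
proof -
 have "\<not> (\<forall>z. Im z > 0 \<longrightarrow> poly p (coord_x z) = 0)"
 proof
  assume zero: "\<forall>z. Im z > 0 \<longrightarrow> poly p (coord_x z) = 0"
  have fin: "finite (coord_x ` upper_half_plane)"
   by (rule finite_subset[OF _ poly_roots_finite[OF assms(1)]]) (use zero in \<open>auto simp: upper_half_plane_iff\<close>)
  have "coord_x constant_on upper_half_plane"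
   by (rule continuous_finite_range_constant[OF connected_upper_half_plane holomorphic_on_imp_continuous_on[OF coord_holomorphic(1)] fin])
  then obtain c where "\<forall>z\<in>upper_half_plane. coord_x z = c" by (auto simp: constant_on_def)
  hence c: "\<And>z. Im z > 0 \<Longrightarrow> coord_x z = c" by (simp add: upper_half_plane_iff)
  obtain z where z: "Im z > 0" "haupt z ^ 2 \<noteq> c ^ 2" using haupt_not_constant by blast
  thus False using c[of "z / 4"] by (simp add: coord_x_def)
 qed
 then obtain v where "Im v > 0" "poly p (coord_x v) \<noteq> 0" by blast
 moreover have "(\<lambda>z. poly p (coord_x z)) holomorphic_on upper_half_plane" by (intro holomorphic_intros coord_holomorphic)
 ultimately have "\<forall>\<^sub>F w in at z. poly p (coord_x w) \<noteq> 0 \<and> w \<in> upper_half_plane"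
  using assms(2) by (intro non_zero_neighbour_alt[OF _ open_upper_half_plane connected_upper_half_plane]) (auto simp: upper_half_plane_iff)
 thus ?thesis by eventually_elim simp
qed

text \<open>The two symmetries change the signs of y and t independently, so the relation holds with
  all four choices of signs and each summand vanishes separately. Multiplication by y, t or y t
  turns it into a polynomial in x, which takes infinitely many values.\<close>

lemma coord_independent:
 assumes "\<And>z. Im z > 0 \<Longrightarrow> poly q1 (coord_x z) + poly q2 (coord_x z) * coord_y z + poly q3 (coord_x z) * coord_t z
   + poly q4 (coord_x z) * (coord_y z * coord_t z) = 0"
 shows "q1 = 0" "q2 = 0" "q3 = 0" "q4 = 0"
proof -
 have A: "a = 0 \<and> b * y = 0 \<and> c * t = 0 \<and> d * (y * t) = 0"
  if "a + b * y + c * t + d * (y * t) = 0" "a + b * (- y) + c * t + d * (- y * t) = 0"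
   "a + b * y + c * (- t) + d * (y * - t) = 0" "a + b * (- y) + c * (- t) + d * (- y * - t) = 0" for a b c d y t :: complex
 proof -
  have "4 * a = (a + b * y + c * t + d * (y * t)) + (a + b * (- y) + c * t + d * (- y * t)) + (a + b * y + c * (- t) + d * (y * - t)) + (a + b * (- y) + c * (- t) + d * (- y * - t))"
   "4 * (b * y) = (a + b * y + c * t + d * (y * t)) - (a + b * (- y) + c * t + d * (- y * t)) + (a + b * y + c * (- t) + d * (y * - t)) - (a + b * (- y) + c * (- t) + d * (- y * - t))"
   "4 * (c * t) = (a + b * y + c * t + d * (y * t)) + (a + b * (- y) + c * t + d * (- y * t)) - (a + b * y + c * (- t) + d * (y * - t)) - (a + b * (- y) + c * (- t) + d * (- y * - t))"
   "4 * (d * (y * t)) = (a + b * y + c * t + d * (y * t)) - (a + b * (- y) + c * t + d * (- y * t)) - (a + b * y + c * (- t) + d * (y * - t)) + (a + b * (- y) + c * (- t) + d * (- y * - t))"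
   by (simp_all add: algebra_simps)
  thus ?thesis unfolding that by simp
 qed
 have vanish: "poly q1 (coord_x z) = 0 \<and> poly q2 (coord_x z) * coord_y z = 0 \<and> poly q3 (coord_x z) * coord_t z = 0 \<and>
   poly q4 (coord_x z) * (coord_y z * coord_t z) = 0" if z: "Im z > 0" for z
  using assms[OF z] assms[OF Im_half_shift[OF z]] assms[OF Im_fricke7[OF z]] assms[OF Im_half_shift[OF Im_fricke7[OF z]]]
  by (intro A) (simp_all add: coord_half_shift coord_fricke7 z Im_fricke7 Im_half_shift)
 have zero: "q = 0" if "\<And>z. Im z > 0 \<Longrightarrow> poly (q * r) (coord_x z) = 0" "r \<noteq> 0" for q r :: "complex poly"
 proof (rule ccontr)
  assume "q \<noteq> 0"
  hence "q * r \<noteq> 0" using that(2) by simp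
  hence "\<forall>\<^sub>F w in at \<i>. poly (q * r) (coord_x w) \<noteq> 0" by (rule coord_x_infinite) simp
  moreover have "\<forall>\<^sub>F w in at \<i>. Im w > 0" by (rule eventually_at_upper) simp
  ultimately have "\<forall>\<^sub>F w in at \<i>. False" by eventually_elim (use that(1) in blast)
  thus False by simp
 qed
 have squares: "poly curve_cubic (coord_x z) = coord_y z * coord_y z" "poly curve_sextic (coord_x z) = coord_t z * coord_t z"
  if "Im z > 0" for z using coord_y_square[OF that] coord_t_square[OF that] unfolding poly_curve power2_eq_square by simp_all
 show "q1 = 0" by (rule zero[of _ 1]) (use vanish in simp_all)
 show "q2 = 0"
 proof (rule zero[of _ curve_cubic])
  fix z :: complex assume z: "Im z > 0"
  have "poly (q2 * curve_cubic) (coord_x z) = (poly q2 (coord_x z) * coord_y z) * coord_y z"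
   by (simp add: squares[OF z])
  thus "poly (q2 * curve_cubic) (coord_x z) = 0" using vanish[OF z] by simp
 qed (rule curve_nonzero)
 show "q3 = 0"
 proof (rule zero[of _ curve_sextic])
  fix z :: complex assume z: "Im z > 0"
  have "poly (q3 * curve_sextic) (coord_x z) = (poly q3 (coord_x z) * coord_t z) * coord_t z"
   by (simp add: squares[OF z])
  thus "poly (q3 * curve_sextic) (coord_x z) = 0" using vanish[OF z] by simp
 qed (rule curve_nonzero)
 show "q4 = 0"
 proof (rule zero[of _ "curve_cubic * curve_sextic"])
  fix z :: complex assume z: "Im z > 0"
  have "poly (q4 * (curve_cubic * curve_sextic)) (coord_x z) = (poly q4 (coord_x z) * (coord_y z * coord_t z)) * (coord_y z * coord_t z)"
   by (simp add: squares[OF z])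
  thus "poly (q4 * (curve_cubic * curve_sextic)) (coord_x z) = 0" using vanish[OF z] by simp
 qed (simp add: curve_nonzero)
qed

section \<open>Polynomial evaluation along ring homomorphisms\<close>

text \<open>Homomorphisms between types, so that evaluation of the iterated polynomials can be built
  one variable at a time: \<open>hom_eval\<close> turns one such map into another.\<close>

definition type_hom :: "('a :: comm_ring_1 \<Rightarrow> 'b :: comm_ring_1) \<Rightarrow> bool" where
 "type_hom h \<longleftrightarrow> h 0 = 0 \<and> h 1 = 1 \<and> (\<forall>a b. h (a + b) = h a + h b) \<and> (\<forall>a b. h (a * b) = h a * h b)"

lemma type_homD:
 assumes "type_hom h"
 shows "h 0 = 0" "h 1 = 1" "h (a + b) = h a + h b" "h (a * b) = h a * h b" "h (- a) = - h a" "h (a - b) = h a - h b"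
proof -
 show *: "h 0 = 0" "h 1 = 1" "h (a + b) = h a + h b" "h (a * b) = h a * h b" for a b
  using assms by (auto simp: type_hom_def)
 show "h (- a) = - h a" using *(1) *(3)[of "- a" a] by (simp add: eq_neg_iff_add_eq_0)
 show "h (a - b) = h a - h b" using *(3)[of "a - b" b] by (simp add: eq_diff_eq)
qed

definition hom_eval :: "('a :: comm_ring_1 \<Rightarrow> 'b :: comm_ring_1) \<Rightarrow> 'b \<Rightarrow> 'a poly \<Rightarrow> 'b" where
 "hom_eval h x p = poly (map_poly h p) x"

lemma hom_eval_0 [simp]: "hom_eval h x 0 = 0"
 by (simp add: hom_eval_def)

lemma hom_eval_pCons: "type_hom h \<Longrightarrow> hom_eval h x (pCons a p) = h a + x * hom_eval h x p"
 by (simp add: hom_eval_def map_poly_pCons type_homD)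

lemma type_hom_hom_eval:
 assumes h: "type_hom h"
 shows "type_hom (hom_eval h x)"
proof -
 note s = hom_eval_pCons[OF h] type_homD[OF h]
 have add: "hom_eval h x (p + q) = hom_eval h x p + hom_eval h x q" for p q
  by (induction p q rule: poly_induct2) (simp_all add: s algebra_simps)
 have smult: "hom_eval h x (Polynomial.smult a q) = h a * hom_eval h x q" for a q
  by (induction q) (simp_all add: s algebra_simps)
 have mult: "hom_eval h x (p * q) = hom_eval h x p * hom_eval h x q" for p q
  by (induction p) (simp_all add: s add smult algebra_simps)
 have "hom_eval h x 1 = 1" unfolding one_pCons by (simp add: s)
 thus ?thesis unfolding type_hom_def using add mult by simp
qed

definition rat_fls :: "rat \<Rightarrow> complex fls" where "rat_fls r = fls_const (of_rat r)"

lemma type_hom_fls_const: "type_hom (fls_const :: complex \<Rightarrow> complex fls)"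
 by (simp add: type_hom_def fls_plus_const)

lemma type_hom_rat_fls: "type_hom rat_fls"
 by (simp add: type_hom_def rat_fls_def fls_plus_const of_rat_add of_rat_mult)

lemma hom_eval_of_rat: "hom_eval fls_const F (map_poly of_rat p) = hom_eval rat_fls F p"
 by (induction p) (simp_all add: map_poly_pCons hom_eval_pCons type_hom_fls_const type_hom_rat_fls flip: rat_fls_def)

lemma has_q_expansion_poly:
 assumes "has_q_expansion 1 f F"
 shows "has_q_expansion 1 (\<lambda>z. poly p (f z)) (hom_eval fls_const F p)"
proof (induction p)
 case 0
 show ?case using has_q_expansion_const[of 0] by simp
next
 case (pCons a p)
 have "has_q_expansion 1 (\<lambda>z. a + f z * poly p (f z)) (fls_const a + F * hom_eval fls_const F p)"
  by (intro has_q_expansion_add has_q_expansion_mult has_q_expansion_const assms pCons zero_less_one)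
 thus ?case by (simp add: hom_eval_pCons type_hom_fls_const)
qed

lemma has_q_expansion_eqI:
 assumes "has_q_expansion 1 u U" "has_q_expansion 1 v V" "\<And>z. Im z > 0 \<Longrightarrow> \<forall>\<^sub>F w in at z. u w = v w"
 shows "U = V"
proof -
 have "NEAR z. u z = v z"
  using has_q_expansion_analytic[OF assms(1) zero_less_one] has_q_expansion_analytic[OF assms(2) zero_less_one] eventually_Im_gt[of 0]
 proof eventually_elim
  case (elim z)
  have "u \<midarrow>z\<rightarrow> u z" "v \<midarrow>z\<rightarrow> v z"
   using elim by (auto intro: isContD analytic_at_imp_isCont)
  moreover from this(2) have "u \<midarrow>z\<rightarrow> v z" using tendsto_cong[OF assms(3)[OF elim(3)]] by blast
  ultimately show ?case using tendsto_unique[OF at_neq_bot] by blast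
 qed
 hence "has_q_expansion 1 v U" using has_q_expansion_cong assms(1) by blast
 thus ?thesis using has_q_expansion_unique[OF _ assms(2)] by simp
qed

section \<open>Relations over the rational numbers\<close>

definition series_x :: "complex fls" where "series_x = q_expansion coord_x"
definition series_y :: "complex fls" where "series_y = q_expansion coord_y"
definition series_t :: "complex fls" where "series_t = q_expansion coord_t"

lemma series_expansion:
 "has_q_expansion 1 coord_x series_x" "has_q_expansion 1 coord_y series_y" "has_q_expansion 1 coord_t series_t"
 "rational_coeffs series_x" "rational_coeffs series_y" "rational_coeffs series_t"
 using coord_in_function_field function_field_q_expansion[of 56] by (simp_all add: series_x_def series_y_def series_t_def)

lemma has_q_expansion_combination:
 "has_q_expansion 1 (\<lambda>z. poly q1 (coord_x z) + poly q2 (coord_x z) * coord_y z + poly q3 (coord_x z) * coord_t z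
   + poly q4 (coord_x z) * (coord_y z * coord_t z))
  (hom_eval fls_const series_x q1 + hom_eval fls_const series_x q2 * series_y + hom_eval fls_const series_x q3 * series_t
   + hom_eval fls_const series_x q4 * (series_y * series_t))"
 by (intro has_q_expansion_add has_q_expansion_mult has_q_expansion_poly series_expansion zero_less_one)

definition eval_x :: "rat poly \<Rightarrow> complex fls" where "eval_x = hom_eval rat_fls series_x"
definition eval_xy :: "rat poly poly \<Rightarrow> complex fls" where "eval_xy = hom_eval eval_x series_y"
definition eval_xyt :: "rat poly poly poly \<Rightarrow> complex fls" where "eval_xyt = hom_eval eval_xy series_t"

lemma type_hom_eval: "type_hom eval_x" "type_hom eval_xy" "type_hom eval_xyt"
 unfolding eval_x_def eval_xy_def eval_xyt_def by (intro type_hom_hom_eval type_hom_rat_fls)+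

lemma eval_xyt_reduced:
 "eval_xyt [:[:q1, q2:], [:q3, q4:]:] = eval_x q1 + eval_x q2 * series_y + eval_x q3 * series_t + eval_x q4 * (series_y * series_t)"
proof -
 have "eval_xyt [:[:q1, q2:], [:q3, q4:]:] = eval_xy [:q1, q2:] + series_t * eval_xy [:q3, q4:]"
  unfolding eval_xyt_def by (simp add: hom_eval_pCons type_hom_eval)
 thus ?thesis by (simp add: eval_xy_def hom_eval_pCons type_hom_eval algebra_simps)
qed

text \<open>A combination whose expansion vanishes is zero near infinity, hence on the half plane,
  and independence over the complex numbers applies.\<close>

lemma eval_xyt_reduced_eq_0:
 assumes "eval_xyt [:[:q1, q2:], [:q3, q4:]:] = 0"
 shows "q1 = 0" "q2 = 0" "q3 = 0" "q4 = 0"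
proof -
 define r :: "rat poly \<Rightarrow> complex poly" where "r = map_poly of_rat"
 define f where "f = (\<lambda>z. poly (r q1) (coord_x z) + poly (r q2) (coord_x z) * coord_y z + poly (r q3) (coord_x z) * coord_t z
   + poly (r q4) (coord_x z) * (coord_y z * coord_t z))"
 have "has_q_expansion 1 f 0"
  using has_q_expansion_combination[of "r q1" "r q2" "r q3" "r q4"] assms
  unfolding eval_xyt_reduced eval_x_def r_def hom_eval_of_rat f_def by simp
 hence "NEAR z. f z = 0" by (simp add: has_q_expansion_def)
 moreover have hol: "f holomorphic_on upper_half_plane" unfolding f_def by (intro holomorphic_intros coord_holomorphic)
 ultimately have ev: "\<forall>\<^sub>F w in at z. f w = 0" if "Im z > 0" for z
  using that open_upper_half_plane
  by (intro meromorphic_eq_near_infinity[of f "\<lambda>_. 0"] analytic_on_imp_meromorphic_on meromorphic_on_const) (simp_all add: analytic_on_open)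
 have "f z = 0" if z: "Im z > 0" for z
 proof -
  have "f \<midarrow>z\<rightarrow> f z" by (intro isContD analytic_at_imp_isCont upper_half_plane_analytic_at[OF hol z])
  moreover have "f \<midarrow>z\<rightarrow> 0" using tendsto_cong[OF ev[OF z]] by simp
  ultimately show ?thesis using tendsto_unique[OF at_neq_bot] by blast
 qed
 hence "r q1 = 0 \<and> r q2 = 0 \<and> r q3 = 0 \<and> r q4 = 0" unfolding f_def using coord_independent[of "r q1" "r q2" "r q3" "r q4"] by blast
 thus "q1 = 0" "q2 = 0" "q3 = 0" "q4 = 0" by (simp_all add: r_def map_poly_eq_0_iff)
qed

lemma eval_x_eq_0: "eval_x p = 0 \<Longrightarrow> p = 0"
 using eval_xyt_reduced_eq_0[of p 0 0 0] unfolding eval_xyt_reduced by (simp add: type_homD(1)[OF type_hom_eval(1)])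

lemma (in rational_functional) apply_fls_eval:
 assumes "rational_coeffs F" "rational_coeffs G"
 shows "apply_fls (hom_eval fls_const F p * G) = hom_eval rat_fls F (map_poly \<phi> p) * G"
proof (induction p)
 case 0
 show ?case using apply_fls_const[of 0] by simp
next
 case (pCons a p)
 have "apply_fls (hom_eval fls_const F (pCons a p) * G) = apply_fls (G * fls_const a) + apply_fls (F * (hom_eval fls_const F p * G))"
  by (simp add: hom_eval_pCons type_hom_fls_const apply_fls_add[symmetric] algebra_simps)
 also have "\<dots> = G * rat_fls (\<phi> a) + F * (hom_eval rat_fls F (map_poly \<phi> p) * G)"
  unfolding apply_fls_mult[OF assms(1)] apply_fls_mult[OF assms(2)] pCons apply_fls_const rat_fls_def ..
 also have "\<dots> = hom_eval rat_fls F (map_poly \<phi> (pCons a p)) * G"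
  by (simp add: map_poly_pCons hom_eval_pCons type_hom_rat_fls algebra_simps)
 finally show ?case .
qed

text \<open>
 A linear functional of the complex numbers over the rational numbers, applied to all coefficients,
 turns a relation with complex coefficients into one with rational coefficients.
\<close>
lemma descent:
 assumes F: "rational_coeffs F" and p: "p \<noteq> 0"
  and rel: "hom_eval fls_const series_x p * F = hom_eval fls_const series_x q1 + hom_eval fls_const series_x q2 * series_y
   + hom_eval fls_const series_x q3 * series_t + hom_eval fls_const series_x q4 * (series_y * series_t)"
 obtains v where "v 0 = 0" "map_poly v p \<noteq> 0"
  "eval_x (map_poly v p) * F = eval_xyt [:[:map_poly v q1, map_poly v q2:], [:map_poly v q3, map_poly v q4:]:]"
proof -
 \<comment> \<open>Value 1 at the leading coefficient of \<open>p\<close> keeps the new denominator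
   nonzero.\<close>
 obtain v where v: "rational_functional v" "v (Polynomial.lead_coeff p) = 1"
  using rational_functional_exists[of "Polynomial.lead_coeff p"] p by auto
 interpret rational_functional v by fact
 note R = series_expansion(4-6)
 have "hom_eval rat_fls series_x (map_poly v q1) = apply_fls (hom_eval fls_const series_x q1)"
  using apply_fls_eval[OF R(1) rational_coeffs_1, of q1] by simp
 hence "apply_fls (hom_eval fls_const series_x p * F) = eval_xyt [:[:map_poly v q1, map_poly v q2:], [:map_poly v q3, map_poly v q4:]:]"
  unfolding rel apply_fls_add eval_xyt_reduced eval_x_def
  by (simp add: apply_fls_eval R rational_coeffs_mult)
 moreover have "Polynomial.coeff (map_poly v p) (Polynomial.degree p) \<noteq> 0" using v(2) by (simp add: coeff_map_poly)
 hence "map_poly v p \<noteq> 0" by auto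
 ultimately show thesis using that[of v] apply_fls_eval[OF R(1) F, of p] by (simp add: eval_x_def)
qed

lemma function_field_relation:
 assumes "f \<in> carrier (X0_function_field 56)"
 obtains p q1 q2 q3 q4 where "eval_x p \<noteq> 0" "eval_x p * q_expansion f = eval_xyt [:[:q1, q2:], [:q3, q4:]:]"
proof -
 have f: "automorphic 56 f" "has_q_expansion 1 f (q_expansion f)" "rational_coeffs (q_expansion f)"
  using function_field_automorphic[OF _ assms] function_field_q_expansion[OF _ assms] by auto
 obtain p q1 q2 q3 q4 where p: "p \<noteq> 0" and rel: "\<And>z. Im z > 0 \<Longrightarrow> \<forall>\<^sub>F w in at z. poly p (coord_x w) * f w =
  poly q1 (coord_x w) + poly q2 (coord_x w) * coord_y w + poly q3 (coord_x w) * coord_t w + poly q4 (coord_x w) * (coord_y w * coord_t w)"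
  using automorphic_decomposition[OF f(1)] by blast
 have "hom_eval fls_const series_x p * q_expansion f = hom_eval fls_const series_x q1 + hom_eval fls_const series_x q2 * series_y
   + hom_eval fls_const series_x q3 * series_t + hom_eval fls_const series_x q4 * (series_y * series_t)"
  by (rule has_q_expansion_eqI[OF has_q_expansion_mult[OF has_q_expansion_poly[OF series_expansion(1)] f(2) zero_less_one]
   has_q_expansion_combination rel])
 from descent[OF f(3) p this] obtain v where "map_poly v p \<noteq> 0"
  "eval_x (map_poly v p) * q_expansion f = eval_xyt [:[:map_poly v q1, map_poly v q2:], [:map_poly v q3, map_poly v q4:]:]" by metis
 thus thesis using that eval_x_eq_0 by blast
qed

lemma function_field_relation_invariant:
 assumes "f \<in> carrier (X0_function_field 56)" and w: "\<And>z. Im z > 0 \<Longrightarrow> f (fricke7 z) = f z"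
 obtains p q1 q2 where "eval_x p \<noteq> 0" "eval_x p * q_expansion f = eval_xy [:q1, q2:]"
proof -
 have f: "automorphic 56 f" "has_q_expansion 1 f (q_expansion f)" "rational_coeffs (q_expansion f)"
  using function_field_automorphic[OF _ assms(1)] function_field_q_expansion[OF _ assms(1)] by auto
 obtain p q1 q2 where p: "p \<noteq> 0" and rel: "\<And>z. Im z > 0 \<Longrightarrow> \<forall>\<^sub>F w in at z. poly p (coord_x w) * f w =
  poly q1 (coord_x w) + poly q2 (coord_x w) * coord_y w"
  using automorphic_decomposition_invariant[OF f(1) w] by blast
 have "hom_eval fls_const series_x p * q_expansion f = hom_eval fls_const series_x q1 + hom_eval fls_const series_x q2 * series_y
   + hom_eval fls_const series_x 0 * series_t + hom_eval fls_const series_x 0 * (series_y * series_t)"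
  by (rule has_q_expansion_eqI[OF has_q_expansion_mult[OF has_q_expansion_poly[OF series_expansion(1)] f(2) zero_less_one]
   has_q_expansion_combination]) (use rel in simp)
 from descent[OF f(3) p this] obtain v where v: "v 0 = 0" "map_poly v p \<noteq> 0"
  "eval_x (map_poly v p) * q_expansion f = eval_xyt [:[:map_poly v q1, map_poly v q2:], [:map_poly v 0, map_poly v 0:]:]" by metis
 have "eval_xyt [:[:map_poly v q1, map_poly v q2:], [:map_poly v 0, map_poly v 0:]:] = eval_xy [:map_poly v q1, map_poly v q2:]"
  by (simp add: eval_xyt_def hom_eval_pCons type_hom_eval)
 thus thesis using that[of "map_poly v p" "map_poly v q1" "map_poly v q2"] v(2,3) eval_x_eq_0[of "map_poly v p"] by auto
qed

lemma series_equations: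
 "series_y ^ 2 = series_x ^ 3 + series_x + 2"
 "series_t ^ 2 = (7 + series_x ^ 2) * (2 - series_x + series_x ^ 2) * (2 + series_x + series_x ^ 2)"
proof -
 have c: "hom_eval fls_const series_x curve_cubic = series_x ^ 3 + series_x + 2"
  "hom_eval fls_const series_x curve_sextic = (7 + series_x ^ 2) * (2 - series_x + series_x ^ 2) * (2 + series_x + series_x ^ 2)"
  by (simp_all add: curve_cubic_def curve_sextic_def type_homD(4)[OF type_hom_hom_eval[OF type_hom_fls_const]] hom_eval_pCons type_hom_fls_const
   power2_eq_square power3_eq_cube algebra_simps fls_const_numeral)
 have sq: "has_q_expansion 1 (\<lambda>z. f z * f z) (F * F)" if "has_q_expansion 1 f F" for f F
  using that by (intro has_q_expansion_mult zero_less_one)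
 have "series_y * series_y = hom_eval fls_const series_x curve_cubic"
  by (rule has_q_expansion_eqI[OF sq[OF series_expansion(2)] has_q_expansion_poly[OF series_expansion(1)]])
   (rule eventually_mono[OF eventually_at_upper], assumption, simp add: poly_curve coord_y_square[symmetric] power2_eq_square)
 thus "series_y ^ 2 = series_x ^ 3 + series_x + 2" unfolding c by (simp add: power2_eq_square)
 have "series_t * series_t = hom_eval fls_const series_x curve_sextic"
 proof (rule has_q_expansion_eqI[OF sq[OF series_expansion(3)] has_q_expansion_poly[OF series_expansion(1)]])
  fix z assume "Im z > 0"
  from eventually_at_upper[OF this] show "\<forall>\<^sub>F w in at z. coord_t w * coord_t w = poly curve_sextic (coord_x w)"
   by eventually_elim (simp only: poly_curve coord_t_square[symmetric] power2_eq_square[of "coord_t _"])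
 qed
 thus "series_t ^ 2 = (7 + series_x ^ 2) * (2 - series_x + series_x ^ 2) * (2 + series_x + series_x ^ 2)"
  unfolding c by (simp add: power2_eq_square)
qed

section \<open>Embedded fields and fields of fractions\<close>

text \<open>Identities between elements of the abstract field are checked on their images, where the
  arithmetic of the type class of fields is available.\<close>

locale field_embedding = field K for K (structure) +
 fixes \<Phi> :: "'a \<Rightarrow> 'f :: Fields.field"
 assumes inj: "inj_on \<Phi> (carrier K)"
  and hom: "\<Phi> \<one> = 1" "\<Phi> \<zero> = 0"
   "\<And>u v. u \<in> carrier K \<Longrightarrow> v \<in> carrier K \<Longrightarrow> \<Phi> (u \<oplus> v) = \<Phi> u + \<Phi> v"
   "\<And>u v. u \<in> carrier K \<Longrightarrow> v \<in> carrier K \<Longrightarrow> \<Phi> (u \<otimes> v) = \<Phi> u * \<Phi> v"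
begin

lemma hom_minus:
 assumes "u \<in> carrier K"
 shows "\<Phi> (\<ominus> u) = - \<Phi> u"
 using hom(3)[of u "\<ominus> u"] assms hom(2) by (simp add: r_neg eq_neg_iff_add_eq_0 add.commute)

lemma hom_diff: "u \<in> carrier K \<Longrightarrow> v \<in> carrier K \<Longrightarrow> \<Phi> (u \<ominus> v) = \<Phi> u - \<Phi> v"
 by (simp add: a_minus_def hom hom_minus)

lemma hom_inverse:
 assumes "u \<in> carrier K" "u \<noteq> \<zero>"
 shows "\<Phi> (inv u) = inverse (\<Phi> u)"
proof -
 have u: "u \<in> Units K" using assms by (simp add: field_Units)
 have "\<Phi> u * \<Phi> (inv u) = 1" using hom(4)[of u "inv u"] u assms hom(1) by simp
 thus ?thesis by (rule inverse_unique[symmetric])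
qed

lemma hom_power: "u \<in> carrier K \<Longrightarrow> \<Phi> (u [^] (n :: nat)) = \<Phi> u ^ n"
 by (induction n) (simp_all add: hom mult.commute)

lemma hom_of_nat: "\<Phi> ([(n :: nat)] \<cdot> \<one>) = of_nat n"
 by (induction n) (simp_all add: hom add.commute)

lemma hom_eq_iff: "u \<in> carrier K \<Longrightarrow> v \<in> carrier K \<Longrightarrow> u = v \<longleftrightarrow> \<Phi> u = \<Phi> v"
 using inj by (auto simp: inj_on_def)

end

definition subfield_closed :: "'b :: Fields.field set \<Rightarrow> bool" where
 "subfield_closed S \<longleftrightarrow> 1 \<in> S \<and> (\<forall>u\<in>S. - u \<in> S \<and> inverse u \<in> S) \<and> (\<forall>u\<in>S. \<forall>v\<in>S. u + v \<in> S \<and> u * v \<in> S)"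

lemma (in field_embedding) subfield_closed_generate_field:
 assumes "A \<subseteq> carrier K"
 shows "subfield_closed (\<Phi> ` generate_field K A)"
proof -
 have sub: "generate_field K A \<subseteq> carrier K" using generate_field_in_carrier[OF assms] by blast
 have "inverse (\<Phi> u) \<in> \<Phi> ` generate_field K A" if "u \<in> generate_field K A" for u
 proof (cases "u = \<zero>")
  case True
  thus ?thesis using that hom(2) by (auto intro: image_eqI[of _ _ u])
 next
  case False
  thus ?thesis using generate_field.m_inv[OF that] hom_inverse[of u] sub that by (metis image_eqI subsetD)
 qed
 moreover have "- \<Phi> u \<in> \<Phi> ` generate_field K A" if "u \<in> generate_field K A" for u
  using generate_field.a_inv[OF that] hom_minus[of u] sub that by (metis image_eqI subsetD)
 moreover have "\<Phi> u + \<Phi> v \<in> \<Phi> ` generate_field K A" "\<Phi> u * \<Phi> v \<in> \<Phi> ` generate_field K A"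
  if "u \<in> generate_field K A" "v \<in> generate_field K A" for u v
  using generate_field.eng_add[OF that] generate_field.eng_mult[OF that] hom(3,4)[of u v] sub that by (metis image_eqI subsetD)+
 moreover have "1 \<in> \<Phi> ` generate_field K A" using generate_field.one hom(1) by (metis image_eqI)
 ultimately show ?thesis unfolding subfield_closed_def by blast
qed

lemma (in field_embedding) generate_field_memI:
 assumes "A \<subseteq> carrier K" "f \<in> carrier K" "\<Phi> f \<in> \<Phi> ` generate_field K A"
 shows "f \<in> generate_field K A"
 using assms hom_eq_iff[OF assms(2)] generate_field_in_carrier[OF assms(1)] by auto

lemma subfield_closedD:
 assumes "subfield_closed S"
 shows "1 \<in> S" "0 \<in> S" "\<And>u. u \<in> S \<Longrightarrow> - u \<in> S" "\<And>u. u \<in> S \<Longrightarrow> inverse u \<in> S"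
  "\<And>u v. u \<in> S \<Longrightarrow> v \<in> S \<Longrightarrow> u + v \<in> S" "\<And>u v. u \<in> S \<Longrightarrow> v \<in> S \<Longrightarrow> u * v \<in> S"
proof -
 show *: "1 \<in> S" "\<And>u. u \<in> S \<Longrightarrow> - u \<in> S" "\<And>u. u \<in> S \<Longrightarrow> inverse u \<in> S"
  "\<And>u v. u \<in> S \<Longrightarrow> v \<in> S \<Longrightarrow> u + v \<in> S" "\<And>u v. u \<in> S \<Longrightarrow> v \<in> S \<Longrightarrow> u * v \<in> S"
  using assms unfolding subfield_closed_def by blast+
 show "0 \<in> S" using *(4)[OF *(1) *(2)[OF *(1)]] by simp
qed

lemma subfield_closed_rat_fls:
 assumes S: "subfield_closed S"
 shows "rat_fls r \<in> S"
proof -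
 have nat: "of_nat n \<in> S" for n by (induction n) (auto intro: subfield_closedD[OF S])
 have int: "of_int i \<in> S" for i using nat[of "nat i"] subfield_closedD(3)[OF S nat[of "nat (- i)"]] by (cases "i \<ge> 0") auto
 obtain a b where r: "r = Rat.Fract a b" "b > 0" by (cases r)
 have "rat_fls r * of_int b = fls_const (of_rat r * of_int b)" by (simp add: rat_fls_def fls_of_int)
 also have "of_rat r * of_int b = (of_int a :: complex)" using r by (simp add: of_rat_rat)
 also have "fls_const (of_int a) = (of_int a :: complex fls)" by (simp add: fls_of_int)
 finally have "rat_fls r = of_int a * inverse (of_int b)" using r(2) by (simp add: field_simps)
 thus ?thesis using subfield_closedD(4,6)[OF S] int by simp
qed

lemma subfield_closed_hom_eval:
 assumes S: "subfield_closed S" and h: "type_hom h" "\<And>a. h a \<in> S" "x \<in> S"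
 shows "hom_eval h x p \<in> S"
 by (induction p) (auto simp: hom_eval_pCons h intro: subfield_closedD[OF S] h)

lemma subfield_closed_eval:
 assumes S: "subfield_closed S" and "series_x \<in> S" "series_y \<in> S"
 shows "eval_x p \<in> S" "eval_xy q \<in> S" "series_t \<in> S \<Longrightarrow> eval_xyt r \<in> S"
proof -
 show x: "eval_x p \<in> S" for p
  unfolding eval_x_def by (intro subfield_closed_hom_eval[OF S] type_hom_rat_fls subfield_closed_rat_fls[OF S] assms)
 show xy: "eval_xy q \<in> S" for q
  unfolding eval_xy_def by (intro subfield_closed_hom_eval[OF S] type_hom_eval x assms)
 show "series_t \<in> S \<Longrightarrow> eval_xyt r \<in> S"
  unfolding eval_xyt_def by (intro subfield_closed_hom_eval[OF S] type_hom_eval xy)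
qed

text \<open>Under an embedding of A into a field, the classes of fractions are exactly the nonempty
  fibres of (a, b) -> theta(a) / theta(b). The fraction field is thereby identified with the set of
  these quotients, which by assumption is the image of K.\<close>

lemma fraction_field_iso:
 fixes A :: "('c, 'm) ring_scheme" (structure) and \<theta> :: "'c \<Rightarrow> 'b :: Fields.field"
 assumes K: "field_embedding K \<Phi>" and inj: "inj_on \<theta> (carrier A)"
  and one: "\<one> \<in> carrier A" "\<theta> \<one> = 1" and zero: "\<zero> \<in> carrier A" "\<theta> \<zero> = 0"
  and add: "\<And>u v. u \<in> carrier A \<Longrightarrow> v \<in> carrier A \<Longrightarrow> u \<oplus> v \<in> carrier A \<and> \<theta> (u \<oplus> v) = \<theta> u + \<theta> v"
  and mult: "\<And>u v. u \<in> carrier A \<Longrightarrow> v \<in> carrier A \<Longrightarrow> u \<otimes> v \<in> carrier A \<and> \<theta> (u \<otimes> v) = \<theta> u * \<theta> v"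
  and image: "\<Phi> ` carrier K = {\<theta> a / \<theta> b |a b. a \<in> carrier A \<and> b \<in> carrier A \<and> \<theta> b \<noteq> 0}"
 shows "fraction_field A \<simeq> K"
proof -
 interpret K: field_embedding K \<Phi> by fact
 define B where "B = carrier A \<times> (carrier A - {\<zero>})"
 define ratio where "ratio = (\<lambda>(a, b). \<theta> a / \<theta> b)"
 define cls where "cls = (\<lambda>r. {p \<in> B. ratio p = r})"
 have nz: "\<theta> b \<noteq> 0 \<longleftrightarrow> b \<noteq> \<zero>" if "b \<in> carrier A" for b
  using inj that zero by (metis inj_onD)
 have B_image: "ratio ` B = \<Phi> ` carrier K"
  unfolding image by (auto simp: B_def ratio_def nz image_iff Bex_def) (metis nz)
 have eqv: "\<theta> a / \<theta> b = \<theta> c / \<theta> d \<longleftrightarrow> a \<otimes> d = c \<otimes> b"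
  if "a \<in> carrier A" "c \<in> carrier A" "b \<in> carrier A" "d \<in> carrier A" "b \<noteq> \<zero>" "d \<noteq> \<zero>" for a b c d
 proof -
  have "a \<otimes> d = c \<otimes> b \<longleftrightarrow> \<theta> a * \<theta> d = \<theta> c * \<theta> b"
   using inj mult[of a d] mult[of c b] that by (metis inj_onD)
  thus ?thesis using that nz by (simp add: frac_eq_eq)
 qed
 have rel: "fraction_rel A `` {p} = cls (ratio p)" if "p \<in> B" for p
  using that eqv unfolding fraction_rel_def cls_def B_def ratio_def by (auto simp: Image_def)
 have carrier: "carrier (fraction_field A) = cls ` \<Phi> ` carrier K"
  unfolding fraction_field_def quotient_def B_image[symmetric] by (auto simp: rel B_def[symmetric])
 have ratio_mult: "(a \<otimes> c, b \<otimes> d) \<in> B \<and> ratio (a \<otimes> c, b \<otimes> d) = ratio (a, b) * ratio (c, d)"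
  if "(a, b) \<in> B" "(c, d) \<in> B" for a b c d
  using that mult nz by (auto simp: B_def ratio_def) (metis mult_eq_0_iff nz)
 have ratio_add: "(a \<otimes> d \<oplus> c \<otimes> b, b \<otimes> d) \<in> B \<and> ratio (a \<otimes> d \<oplus> c \<otimes> b, b \<otimes> d) = ratio (a, b) + ratio (c, d)"
  if "(a, b) \<in> B" "(c, d) \<in> B" for a b c d
 proof
  have *: "a \<in> carrier A" "b \<in> carrier A" "c \<in> carrier A" "d \<in> carrier A" "\<theta> b \<noteq> 0" "\<theta> d \<noteq> 0"
   using that nz by (auto simp: B_def)
  show "(a \<otimes> d \<oplus> c \<otimes> b, b \<otimes> d) \<in> B" using ratio_mult[OF that] * by (simp add: B_def add mult)
  show "ratio (a \<otimes> d \<oplus> c \<otimes> b, b \<otimes> d) = ratio (a, b) + ratio (c, d)"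
   using * add mult by (simp add: ratio_def add_frac_eq)
 qed
 have ex: "\<exists>p. p \<in> cls (\<Phi> u)" if "u \<in> carrier K" for u
 proof -
  have "\<Phi> u \<in> ratio ` B" unfolding B_image using that by simp
  then obtain p where "p \<in> B" "ratio p = \<Phi> u" by (metis imageE)
  hence "p \<in> cls (\<Phi> u)" by (simp add: cls_def)
  thus ?thesis by blast
 qed
 have UN: "(\<Union>(a, b)\<in>cls (\<Phi> u). \<Union>(c, d)\<in>cls (\<Phi> v). fraction_rel A `` {F a b c d}) = cls r"
  if uv: "u \<in> carrier K" "v \<in> carrier K"
   and F: "\<And>a b c d. (a, b) \<in> cls (\<Phi> u) \<Longrightarrow> (c, d) \<in> cls (\<Phi> v) \<Longrightarrow> F a b c d \<in> B \<and> ratio (F a b c d) = r" for u v F r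
 proof -
  have "(\<Union>(a, b)\<in>cls (\<Phi> u). \<Union>(c, d)\<in>cls (\<Phi> v). fraction_rel A `` {F a b c d}) = (\<Union>p\<in>cls (\<Phi> u). \<Union>p'\<in>cls (\<Phi> v). cls r)"
   by (intro SUP_cong refl, unfold case_prod_beta, intro SUP_cong refl) (use F rel in \<open>metis prod.collapse\<close>)
  also have "\<dots> = cls r" using ex[OF uv(1)] ex[OF uv(2)] by auto
  finally show ?thesis .
 qed
 have cmult: "cls (\<Phi> u) \<otimes>\<^bsub>fraction_field A\<^esub> cls (\<Phi> v) = cls (\<Phi> u * \<Phi> v)" if "u \<in> carrier K" "v \<in> carrier K" for u v
  unfolding fraction_field_def monoid.select_convs by (rule UN[OF that]) (use ratio_mult in \<open>auto simp: cls_def\<close>)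
 have cadd: "cls (\<Phi> u) \<oplus>\<^bsub>fraction_field A\<^esub> cls (\<Phi> v) = cls (\<Phi> u + \<Phi> v)" if "u \<in> carrier K" "v \<in> carrier K" for u v
  unfolding fraction_field_def ring.select_convs by (rule UN[OF that]) (use ratio_add in \<open>auto simp: cls_def\<close>)
 have one_B: "(\<one>, \<one>) \<in> B" using one nz[OF one(1)] by (simp add: B_def)
 have cone: "\<one>\<^bsub>fraction_field A\<^esub> = cls 1"
  using rel[OF one_B] one by (simp add: fraction_field_def ratio_def)
 define \<Psi> where "\<Psi> = (\<lambda>P. inv_into (carrier K) \<Phi> (THE r. P = cls r \<and> P \<noteq> {}))"
 have \<Psi>: "\<Psi> (cls (\<Phi> u)) = u" if u: "u \<in> carrier K" for u
 proof -
  have "(THE r. cls (\<Phi> u) = cls r \<and> cls (\<Phi> u) \<noteq> {}) = \<Phi> u"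
   by (rule the_equality) (use ex[OF u] in \<open>auto simp: cls_def\<close>)
  thus ?thesis using K.inj u by (simp add: \<Psi>_def)
 qed
 have "\<Psi> \<in> ring_iso (fraction_field A) K"
 proof (rule ring_iso_memI)
  show "bij_betw \<Psi> (carrier (fraction_field A)) (carrier K)"
   unfolding carrier by (rule bij_betw_byWitness[where f' = "\<lambda>u. cls (\<Phi> u)"]) (auto simp: \<Psi>)
  show "\<Psi> \<one>\<^bsub>fraction_field A\<^esub> = \<one>\<^bsub>K\<^esub>" unfolding cone using \<Psi>[OF K.one_closed] by (simp add: K.hom)
 next
  fix P assume "P \<in> carrier (fraction_field A)"
  thus "\<Psi> P \<in> carrier K" unfolding carrier by (auto simp: \<Psi>)
 next
  fix P Q assume "P \<in> carrier (fraction_field A)" "Q \<in> carrier (fraction_field A)"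
  then obtain u v where uv: "u \<in> carrier K" "v \<in> carrier K" "P = cls (\<Phi> u)" "Q = cls (\<Phi> v)" unfolding carrier by auto
  show "\<Psi> (P \<otimes>\<^bsub>fraction_field A\<^esub> Q) = \<Psi> P \<otimes>\<^bsub>K\<^esub> \<Psi> Q"
   using \<Psi>[of "u \<otimes>\<^bsub>K\<^esub> v"] uv by (simp add: cmult \<Psi> K.hom)
  show "\<Psi> (P \<oplus>\<^bsub>fraction_field A\<^esub> Q) = \<Psi> P \<oplus>\<^bsub>K\<^esub> \<Psi> Q"
   using \<Psi>[of "u \<oplus>\<^bsub>K\<^esub> v"] uv by (simp add: cadd \<Psi> K.hom)
 qed
 thus ?thesis unfolding is_ring_iso_def by blast
qed

section \<open>The coordinate ring\<close>

lemma monic_quadratic_division: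
 fixes p :: "'a :: comm_ring_1 poly"
 shows "\<exists>l m u. p = [:l, m:] + u * [:- s, 0, 1:]"
proof (induction p)
 case 0
 show ?case by (rule exI[of _ 0], rule exI[of _ 0], rule exI[of _ 0]) simp
next
 case (pCons a p)
 then obtain l m u where p: "p = [:l, m:] + u * [:- s, 0, 1:]" by blast
 have "pCons a p = [:a:] + [:0, 1:] * p" by simp
 also have "\<dots> = [:a + m * s, l:] + ([:m:] + [:0, 1:] * u) * [:- s, 0, 1:]" unfolding p by (simp add: algebra_simps)
 finally show ?case by blast
qed

definition curve_y :: "rat poly poly poly" where "curve_y = var_Y ^ 2 - (var_X ^ 3 + var_X + 2)"

definition curve_t :: "rat poly poly poly" where
 "curve_t = var_T ^ 2 - (7 + var_X ^ 2) * (2 - var_X + var_X ^ 2) * (2 + var_X + var_X ^ 2)"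

lemma curve_eqs:
 "curve_y = [:[:- [:2, 1, 0, 1:], 0, 1:]:]"
 "curve_t = [:- [:[:7, 0, 1:] * [:2, - 1, 1:] * [:2, 1, 1:]:], 0, 1:]"
 by (simp_all add: curve_y_def curve_t_def var_X_def var_Y_def var_T_def power2_eq_square power3_eq_cube numeral_poly one_pCons)

text \<open>Both equations are monic quadratic, one in T and the other in Y, so two rounds of
  division leave at most first powers of T and Y.\<close>

lemma curve_reduction:
 obtains u v q1 q2 q3 q4 where "p = [:[:q1, q2:], [:q3, q4:]:] + u * curve_y + v * curve_t"
proof -
 obtain l m v where p: "p = [:l, m:] + v * curve_t"
  using monic_quadratic_division[of p "[:[:7, 0, 1:] * [:2, - 1, 1:] * [:2, 1, 1:]:]"] unfolding curve_eqs by auto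
 obtain q1 q2 u1 where l: "l = [:q1, q2:] + u1 * [:- [:2, 1, 0, 1:], 0, 1:]"
  using monic_quadratic_division[of l "[:2, 1, 0, 1:]"] by blast
 obtain q3 q4 u2 where m: "m = [:q3, q4:] + u2 * [:- [:2, 1, 0, 1:], 0, 1:]"
  using monic_quadratic_division[of m "[:2, 1, 0, 1:]"] by blast
 have "[:l, m:] = [:[:q1, q2:], [:q3, q4:]:] + [:u1, u2:] * curve_y"
  unfolding l m curve_eqs by (simp add: algebra_simps)
 thus thesis using that[of q1 q2 q3 q4 "[:u1, u2:]" v] p by simp
qed

lemma eval_xyt_vars: "eval_xyt var_X = series_x" "eval_xyt var_Y = series_y" "eval_xyt var_T = series_t"
proof -
 note h = type_homD(1,2)[OF type_hom_eval(1)] type_homD(1,2)[OF type_hom_eval(2)] type_homD(1,2)[OF type_hom_rat_fls]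
 have "eval_x [:0, 1:] = series_x" by (simp add: eval_x_def hom_eval_pCons type_hom_rat_fls h)
 moreover have "eval_xy [:q:] = eval_x q" "eval_xy [:0, 1:] = series_y" for q
  by (simp_all add: eval_xy_def hom_eval_pCons type_hom_eval h)
 ultimately show "eval_xyt var_X = series_x" "eval_xyt var_Y = series_y" "eval_xyt var_T = series_t"
  by (simp_all add: eval_xyt_def var_X_def var_Y_def var_T_def hom_eval_pCons type_hom_eval h)
qed

lemma type_hom_numeral:
 assumes "type_hom h"
 shows "h (numeral k) = numeral k"
proof -
 have "h (of_nat n) = of_nat n" for n by (induction n) (simp_all add: type_homD[OF assms])
 from this[of "numeral k"] show ?thesis by simp
qed

lemma type_hom_power: "type_hom h \<Longrightarrow> h (a ^ n) = h a ^ n"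
 by (induction n) (simp_all add: type_homD)

lemma eval_xyt_curve: "eval_xyt curve_y = 0" "eval_xyt curve_t = 0"
 unfolding curve_y_def curve_t_def
 by (simp_all add: type_homD[OF type_hom_eval(3)] type_hom_numeral[OF type_hom_eval(3)] type_hom_power[OF type_hom_eval(3)]
  eval_xyt_vars series_equations)

section \<open>The coordinate ring as a quotient of the polynomial ring\<close>

lemma ring_of_type_simps:
 "carrier (ring_of_type_algebra :: 'a :: comm_ring_1 ring) = UNIV"
 "u \<oplus>\<^bsub>(ring_of_type_algebra :: 'a ring)\<^esub> v = u + v" "u \<otimes>\<^bsub>(ring_of_type_algebra :: 'a ring)\<^esub> v = u * v"
 "\<one>\<^bsub>(ring_of_type_algebra :: 'a ring)\<^esub> = 1" "\<zero>\<^bsub>(ring_of_type_algebra :: 'a ring)\<^esub> = 0"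
 by (simp_all add: ring_of_type_algebra_def)

lemma ring_of_type_minus: "u \<ominus>\<^bsub>(ring_of_type_algebra :: 'a :: comm_ring_1 ring)\<^esub> v = u - v"
proof -
 interpret cring "ring_of_type_algebra :: 'a ring" by (rule cring_from_type_algebra)
 have "\<ominus>\<^bsub>(ring_of_type_algebra :: 'a ring)\<^esub> v = - v"
  by (rule minus_equality) (simp_all add: ring_of_type_simps)
 thus ?thesis by (simp add: a_minus_def ring_of_type_simps)
qed

abbreviation poly_ring :: "rat poly poly poly ring" where "poly_ring \<equiv> ring_of_type_algebra"

definition curve_ideal :: "rat poly poly poly set" where "curve_ideal = Idl\<^bsub>poly_ring\<^esub> {curve_y, curve_t}"

lemma curve_ideal_ideal: "ideal curve_ideal poly_ring"
proof -
 interpret cring poly_ring by (rule cring_from_type_algebra)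
 show ?thesis unfolding curve_ideal_def by (rule genideal_ideal) (simp add: ring_of_type_simps)
qed

text \<open>The generators lie in the kernel of evaluation. Conversely, modulo the ideal every
  polynomial has a reduced form, and a reduced form in the kernel is zero because 1, y, t, y t are
  independent over x.\<close>

lemma curve_ideal_iff: "p \<in> curve_ideal \<longleftrightarrow> eval_xyt p = 0"
proof
 interpret cring poly_ring by (rule cring_from_type_algebra)
 have "eval_xyt \<in> ring_hom poly_ring (ring_of_type_algebra :: complex fls ring)"
  unfolding ring_hom_def ring_of_type_simps using type_homD(2-4)[OF type_hom_eval(3)] by simp
 then interpret h: ring_hom_ring poly_ring "ring_of_type_algebra :: complex fls ring" eval_xyt
  by (rule ring_hom_ringI2[OF ring_from_type_algebra ring_from_type_algebra])
 have "a_kernel poly_ring (ring_of_type_algebra :: complex fls ring) eval_xyt = {p. eval_xyt p = 0}"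
  unfolding a_kernel_def' ring_of_type_simps by simp
 hence "ideal {p. eval_xyt p = 0} poly_ring" using h.kernel_is_ideal by simp
 hence "curve_ideal \<subseteq> {p. eval_xyt p = 0}"
  unfolding curve_ideal_def by (rule genideal_minimal) (simp add: eval_xyt_curve)
 thus "p \<in> curve_ideal \<Longrightarrow> eval_xyt p = 0" by blast
 interpret I: ideal curve_ideal poly_ring by (rule curve_ideal_ideal)
 assume zero: "eval_xyt p = 0"
 obtain u v q1 q2 q3 q4 where p: "p = [:[:q1, q2:], [:q3, q4:]:] + u * curve_y + v * curve_t" by (rule curve_reduction)
 have "eval_xyt [:[:q1, q2:], [:q3, q4:]:] = 0"
  using zero unfolding p by (simp add: type_homD(3,4)[OF type_hom_eval(3)] eval_xyt_curve)
 from eval_xyt_reduced_eq_0[OF this] have p: "p = u * curve_y + v * curve_t" unfolding p by simp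
 have "curve_y \<in> curve_ideal" "curve_t \<in> curve_ideal"
  using genideal_self[of "{curve_y, curve_t}"] by (simp_all add: curve_ideal_def ring_of_type_simps)
 thus "p \<in> curve_ideal"
  unfolding p using I.I_l_closed[of curve_y u] I.I_l_closed[of curve_t v] I.a_closed[of "u * curve_y" "v * curve_t"]
  by (simp add: ring_of_type_simps)
qed

definition coset :: "rat poly poly poly \<Rightarrow> rat poly poly poly set" where
 "coset p = curve_ideal +>\<^bsub>poly_ring\<^esub> p"

lemma coset_eq_iff: "coset p = coset q \<longleftrightarrow> eval_xyt p = eval_xyt q"
proof -
 interpret cring poly_ring by (rule cring_from_type_algebra)
 have "coset p = coset q \<longleftrightarrow> p - q \<in> curve_ideal"
  using quotient_eq_iff_same_a_r_cos[OF curve_ideal_ideal, of p q] by (simp add: coset_def ring_of_type_simps ring_of_type_minus)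
 thus ?thesis by (simp add: curve_ideal_iff type_homD(6)[OF type_hom_eval(3)])
qed

abbreviation curve_ring :: "rat poly poly poly set ring" where
 "curve_ring \<equiv> coordinate_ring {curve_y, curve_t}"

lemma curve_ring_eq: "curve_ring = poly_ring Quot curve_ideal"
 by (simp add: coordinate_ring_def curve_ideal_def)

lemma curve_ring_simps:
 "carrier curve_ring = range coset" "\<one>\<^bsub>curve_ring\<^esub> = coset 1" "\<zero>\<^bsub>curve_ring\<^esub> = coset 0"
 "coset p \<oplus>\<^bsub>curve_ring\<^esub> coset q = coset (p + q)" "coset p \<otimes>\<^bsub>curve_ring\<^esub> coset q = coset (p * q)"
proof -
 interpret cring poly_ring by (rule cring_from_type_algebra)
 interpret I: ideal curve_ideal poly_ring by (rule curve_ideal_ideal)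
 show "carrier curve_ring = range coset"
  unfolding curve_ring_eq FactRing_def by (auto simp: A_RCOSETS_def' ring_of_type_simps coset_def)
 show "\<one>\<^bsub>curve_ring\<^esub> = coset 1" by (simp add: curve_ring_eq FactRing_def coset_def ring_of_type_simps)
 have "curve_ideal +>\<^bsub>poly_ring\<^esub> \<zero>\<^bsub>poly_ring\<^esub> = curve_ideal" by (rule a_coset_add_zero) (simp add: ring_of_type_simps)
 thus "\<zero>\<^bsub>curve_ring\<^esub> = coset 0" by (simp add: curve_ring_eq FactRing_def coset_def ring_of_type_simps)
 show "coset p \<oplus>\<^bsub>curve_ring\<^esub> coset q = coset (p + q)"
  using I.a_rcos_sum[of p q] by (simp add: curve_ring_eq FactRing_def coset_def ring_of_type_simps)
 show "coset p \<otimes>\<^bsub>curve_ring\<^esub> coset q = coset (p * q)"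
  using I.rcoset_mult_add[of p q] by (simp add: curve_ring_eq FactRing_def coset_def ring_of_type_simps)
qed

text \<open>The chosen representative does not matter: by \<open>coset_eq_iff\<close> all members of
  a coset have the same value.\<close>

definition eval_coset :: "rat poly poly poly set \<Rightarrow> complex fls" where
 "eval_coset P = eval_xyt (SOME p. P = coset p)"

lemma eval_coset: "eval_coset (coset p) = eval_xyt p"
proof -
 have "coset p = coset (SOME q. coset p = coset q)" by (rule someI[of _ p]) simp
 thus ?thesis unfolding eval_coset_def coset_eq_iff by simp
qed

lemma curve_ring_domain: "domain curve_ring"
proof -
 interpret cring poly_ring by (rule cring_from_type_algebra)
 interpret I: ideal curve_ideal poly_ring by (rule curve_ideal_ideal)
 interpret Q: cring curve_ring unfolding curve_ring_eq by (rule I.quotient_is_cring) (rule cring_from_type_algebra)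
 show ?thesis
 proof (unfold_locales)
  show "\<one>\<^bsub>curve_ring\<^esub> \<noteq> \<zero>\<^bsub>curve_ring\<^esub>"
   by (simp add: curve_ring_simps coset_eq_iff type_homD[OF type_hom_eval(3)])
  fix a b assume ab: "a \<otimes>\<^bsub>curve_ring\<^esub> b = \<zero>\<^bsub>curve_ring\<^esub>" "a \<in> carrier curve_ring" "b \<in> carrier curve_ring"
  then obtain p q where "a = coset p" "b = coset q" by (auto simp: curve_ring_simps(1))
  thus "a = \<zero>\<^bsub>curve_ring\<^esub> \<or> b = \<zero>\<^bsub>curve_ring\<^esub>"
   using ab(1) by (simp add: curve_ring_simps(2-) coset_eq_iff type_homD[OF type_hom_eval(3)])
 qed
qed

lemma function_field_embedding: "field_embedding (X0_function_field 56) q_expansion"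
proof -
 interpret field "X0_function_field 56" by (rule function_field_field) simp
 show ?thesis
 proof
  show "inj_on q_expansion (carrier (X0_function_field 56))" by (rule q_expansion_inj) simp
  show "q_expansion \<one>\<^bsub>X0_function_field 56\<^esub> = 1" by (rule function_field_one) simp
  show "q_expansion \<zero>\<^bsub>X0_function_field 56\<^esub> = 0" by (rule function_field_zero) simp
  fix u v assume "u \<in> carrier (X0_function_field 56)" "v \<in> carrier (X0_function_field 56)"
  thus "q_expansion (u \<oplus>\<^bsub>X0_function_field 56\<^esub> v) = q_expansion u + q_expansion v"
   "q_expansion (u \<otimes>\<^bsub>X0_function_field 56\<^esub> v) = q_expansion u * q_expansion v"
   using function_field_add[of 56 u v] function_field_mult[of 56 u v] by simp_all
 qed
qed

lemma subfield_closed_function_field: "subfield_closed (q_expansion ` carrier (X0_function_field 56))"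
proof -
 interpret field_embedding "X0_function_field 56" q_expansion by (rule function_field_embedding)
 have "generate_field (X0_function_field 56) (carrier (X0_function_field 56)) = carrier (X0_function_field 56)"
  by (auto intro: generate_field_in_carrier[OF subset_refl] generate_field.incl)
 thus ?thesis using subfield_closed_generate_field[of "carrier (X0_function_field 56)"] by simp
qed

lemma curve_function_field: "fraction_field curve_ring \<simeq> X0_function_field 56"
proof (rule fraction_field_iso[where \<theta> = eval_coset and \<Phi> = q_expansion])
 show "field_embedding (X0_function_field 56) q_expansion" by (rule function_field_embedding)
 show "inj_on eval_coset (carrier curve_ring)"
 proof (rule inj_onI)
  fix P Q assume "P \<in> carrier curve_ring" "Q \<in> carrier curve_ring" and eq: "eval_coset P = eval_coset Q"
  then obtain p q where "P = coset p" "Q = coset q" by (auto simp: curve_ring_simps(1))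
  thus "P = Q" using eq by (simp add: eval_coset coset_eq_iff)
 qed
 show "q_expansion ` carrier (X0_function_field 56) =
   {eval_coset a / eval_coset b |a b. a \<in> carrier curve_ring \<and> b \<in> carrier curve_ring \<and> eval_coset b \<noteq> 0}"
 proof (intro equalityI subsetI)
  fix F assume "F \<in> q_expansion ` carrier (X0_function_field 56)"
  then obtain f where f: "f \<in> carrier (X0_function_field 56)" "F = q_expansion f" by blast
  obtain p q1 q2 q3 q4 where p: "eval_x p \<noteq> 0" "eval_x p * q_expansion f = eval_xyt [:[:q1, q2:], [:q3, q4:]:]"
   by (rule function_field_relation[OF f(1)])
  have "eval_xyt [:[:p:]:] = eval_x p"
   using eval_xyt_reduced[of p 0 0 0] by (simp add: type_homD(1)[OF type_hom_eval(1)])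
  hence "F = eval_coset (coset [:[:q1, q2:], [:q3, q4:]:]) / eval_coset (coset [:[:p:]:])" "eval_coset (coset [:[:p:]:]) \<noteq> 0"
   using p f(2) by (simp_all add: eval_coset eq_divide_eq mult.commute)
  thus "F \<in> {eval_coset a / eval_coset b |a b. a \<in> carrier curve_ring \<and> b \<in> carrier curve_ring \<and> eval_coset b \<noteq> 0}"
   unfolding curve_ring_simps(1) by blast
 next
  fix F assume "F \<in> {eval_coset a / eval_coset b |a b. a \<in> carrier curve_ring \<and> b \<in> carrier curve_ring \<and> eval_coset b \<noteq> 0}"
  then obtain p q where F: "F = eval_xyt p / eval_xyt q" by (auto simp: curve_ring_simps(1) eval_coset)
  have "series_x \<in> q_expansion ` carrier (X0_function_field 56)" "series_y \<in> q_expansion ` carrier (X0_function_field 56)"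
   "series_t \<in> q_expansion ` carrier (X0_function_field 56)"
   using coord_in_function_field by (auto simp: series_x_def series_y_def series_t_def)
  from subfield_closed_eval(3)[OF subfield_closed_function_field this]
  show "F \<in> q_expansion ` carrier (X0_function_field 56)"
   unfolding F divide_inverse by (intro subfield_closedD(4,6)[OF subfield_closed_function_field])
 qed
qed (auto simp: curve_ring_simps eval_coset type_homD[OF type_hom_eval(3)])

section \<open>The Atkin-Lehner involution on the function field\<close>

lemma atkin_lehner_fricke7:
 assumes "f \<in> carrier (X0_function_field 56)"
 shows "atkin_lehner_pullback 56 7 f = (\<lambda>z. if Im z > 0 then f (fricke7 z) else 0)"
proof
 fix z
 show "atkin_lehner_pullback 56 7 f z = (if Im z > 0 then f (fricke7 z) else 0)"
 proof (cases "Im z > 0")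
  case True
  have "Gamma0_invariant 56 f" using function_field_automorphic[OF _ assms] by (simp add: automorphic_def)
  moreover have "atkin_lehner_entries 56 7 1 (- 1) 1 (- 1)" by (simp add: atkin_lehner_entries_def)
  ultimately show ?thesis
   using atkin_lehner_pullback_eq[of 56 f 7 1 "- 1" 1 "- 1" z] True by (simp add: upper_half_plane_iff fricke7_def)
 qed (simp add: atkin_lehner_pullback_def upper_half_plane_iff)
qed

lemma function_field_outside: "f \<in> carrier (X0_function_field 56) \<Longrightarrow> \<not> Im z > 0 \<Longrightarrow> f z = 0"
 using function_field_carrier[of 56 f] by (simp add: modular_function_def upper_half_plane_iff)

lemma atkin_lehner_fixed_iff:
 assumes "f \<in> carrier (X0_function_field 56)"
 shows "atkin_lehner_pullback 56 7 f = f \<longleftrightarrow> (\<forall>z. Im z > 0 \<longrightarrow> f (fricke7 z) = f z)"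
 unfolding atkin_lehner_fricke7[OF assms] fun_eq_iff using function_field_outside[OF assms] by auto

lemma canonical_rep_fricke7:
 assumes "\<And>z. Im z > 0 \<Longrightarrow> f (fricke7 z) = f z" and z: "Im z > 0"
 shows "canonical_rep f (fricke7 z) = canonical_rep f z"
proof -
 have "canonical_rep f (fricke7 z) = remove_sings (\<lambda>z. f (fricke7 z)) z"
  unfolding fricke7_def by (rule canonical_rep_moebius) (use z in simp_all)
 also have "\<dots> = remove_sings f z"
  by (rule remove_sings_cong) (use eventually_at_upper[OF z] in \<open>auto elim: eventually_mono simp: assms\<close>)
 finally show ?thesis using z by (simp add: canonical_rep_upper)
qed

text \<open>Each field operation is a pointwise operation followed by \<open>canonical_rep\<close>,
  also for negatives and inverses, and \<open>canonical_rep\<close> respects invariance under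
  \<open>fricke7\<close>.\<close>

lemma generate_field_fricke7:
 fixes K (structure)
 defines "K \<equiv> X0_function_field 56"
 assumes A: "A \<subseteq> carrier K" "\<And>f z. f \<in> A \<Longrightarrow> Im z > 0 \<Longrightarrow> f (fricke7 z) = f z" and f: "f \<in> generate_field K A"
 shows "\<forall>z. Im z > 0 \<longrightarrow> f (fricke7 z) = f z"
proof -
 interpret field_embedding K q_expansion unfolding K_def by (rule function_field_embedding)
 note s = function_field_simps[of 56, folded K_def]
 have neg: "\<ominus> u = canonical_rep (\<lambda>z. - 1 * u z)" if "u \<in> carrier K" for u
  using function_field_uminus[of 56 u] that hom_minus[OF that] hom_eq_iff[of "\<ominus> u" "canonical_rep (\<lambda>z. - 1 * u z)"]
  by (simp add: K_def[symmetric])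
 have inv: "inv u = canonical_rep (\<lambda>z. inverse (u z))" if "u \<in> carrier K" "u \<noteq> \<zero>" for u
  using function_field_inverse[of 56 u] that hom_inverse[OF that] hom_eq_iff[of "inv u" "canonical_rep (\<lambda>z. inverse (u z))"] field_Units
  by (simp add: K_def[symmetric])
 from f have "f \<in> carrier K \<and> (\<forall>z. Im z > 0 \<longrightarrow> f (fricke7 z) = f z)"
 proof (induction rule: generate_field.induct)
  case one
  have "canonical_rep (\<lambda>_. 1) (fricke7 z) = canonical_rep (\<lambda>_. 1) z" if "Im z > 0" for z
   by (rule canonical_rep_fricke7[OF refl that])
  thus ?case using one_closed by (simp add: s)
 next
  case (incl h)
  thus ?case using A by auto
 next
  case (a_inv h)
  hence "canonical_rep (\<lambda>z. - 1 * h z) (fricke7 z) = canonical_rep (\<lambda>z. - 1 * h z) z" if "Im z > 0" for z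
   by (intro canonical_rep_fricke7[OF _ that]) simp
  moreover have h: "h \<in> carrier K" using a_inv by blast
  ultimately show ?case unfolding neg[OF h, symmetric] using a_inv_closed[OF h] by blast
 next
  case (m_inv h)
  hence "canonical_rep (\<lambda>z. inverse (h z)) (fricke7 z) = canonical_rep (\<lambda>z. inverse (h z)) z" if "Im z > 0" for z
   by (intro canonical_rep_fricke7[OF _ that]) simp
  moreover have "inv h \<in> carrier K" using m_inv field_Units by auto
  ultimately show ?case using m_inv by (simp add: inv[symmetric])
 next
  case (eng_add h1 h2)
  hence "canonical_rep (\<lambda>z. h1 z + h2 z) (fricke7 z) = canonical_rep (\<lambda>z. h1 z + h2 z) z" if "Im z > 0" for z
   by (intro canonical_rep_fricke7[OF _ that]) simp
  thus ?case using eng_add a_closed by (simp add: s(2)[symmetric])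
 next
  case (eng_mult h1 h2)
  hence "canonical_rep (\<lambda>z. h1 z * h2 z) (fricke7 z) = canonical_rep (\<lambda>z. h1 z * h2 z) z" if "Im z > 0" for z
   by (intro canonical_rep_fricke7[OF _ that]) simp
  thus ?case using eng_mult m_closed by (simp add: s(1)[symmetric])
 qed
 thus ?thesis by blast
qed

section \<open>The main theorem\<close>

theorem mainTheorem9:
  fixes K (structure) and w :: "(complex \<Rightarrow> complex) \<Rightarrow> complex \<Rightarrow> complex"
  defines "K \<equiv> X0_function_field 56" and "w \<equiv> atkin_lehner_pullback 56 7"
  shows "(\<exists>x\<in>carrier K. \<exists>y\<in>carrier K. \<exists>t\<in>carrier K.
            carrier K = generate_field K {x, y, t} \<and>
            {f \<in> carrier K. w f = f} = generate_field K {x, y} \<and>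
            w t = \<ominus> t \<and>
            y [^] (2::nat) = x [^] (3::nat) \<oplus> x \<oplus> [(2::nat)] \<cdot> \<one> \<and>
            t [^] (2::nat) = ([(7::nat)] \<cdot> \<one> \<oplus> x [^] (2::nat)) \<otimes>
                             ([(2::nat)] \<cdot> \<one> \<ominus> x \<oplus> x [^] (2::nat)) \<otimes>
                             ([(2::nat)] \<cdot> \<one> \<oplus> x \<oplus> x [^] (2::nat))) \<and>
         equations_up_to_birational
           {var_Y ^ 2 - (var_X ^ 3 + var_X + 2),
            var_T ^ 2 - (7 + var_X ^ 2) * (2 - var_X + var_X ^ 2) * (2 + var_X + var_X ^ 2)} K"
proof
 interpret field_embedding K q_expansion unfolding K_def by (rule function_field_embedding)
 have c [simp]: "coord_x \<in> carrier K" "coord_y \<in> carrier K" "coord_t \<in> carrier K"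
  unfolding K_def by (rule coord_in_function_field)+
 have series: "q_expansion coord_x = series_x" "q_expansion coord_y = series_y" "q_expansion coord_t = series_t"
  by (simp_all add: series_x_def series_y_def series_t_def)
 have gen: "carrier K = generate_field K {coord_x, coord_y, coord_t}"
 proof
  show "generate_field K {coord_x, coord_y, coord_t} \<subseteq> carrier K"
   using generate_field_in_carrier[of "{coord_x, coord_y, coord_t}"] by auto
  define S where "S = q_expansion ` generate_field K {coord_x, coord_y, coord_t}"
  \<comment> \<open>The generated field is compared with K inside the Laurent series:
    \<open>q_expansion\<close> is injective, and its image of a subfield is closed under the
    evaluation of polynomials.\<close>
  have S: "subfield_closed S" unfolding S_def by (rule subfield_closed_generate_field) simp
  have "series_x \<in> S" "series_y \<in> S" "series_t \<in> S"
   unfolding S_def series[symmetric] by (auto intro: generate_field.incl)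
  note ev = subfield_closed_eval[OF S this(1,2)] this(3)
  show "carrier K \<subseteq> generate_field K {coord_x, coord_y, coord_t}"
  proof
   fix f assume f: "f \<in> carrier K"
   obtain p q1 q2 q3 q4 where "eval_x p \<noteq> 0" "eval_x p * q_expansion f = eval_xyt [:[:q1, q2:], [:q3, q4:]:]"
    by (rule function_field_relation[OF f[unfolded K_def]])
   hence "q_expansion f = eval_xyt [:[:q1, q2:], [:q3, q4:]:] * inverse (eval_x p)" by (simp add: field_simps)
   thus "f \<in> generate_field K {coord_x, coord_y, coord_t}"
    using ev subfield_closedD(4,6)[OF S] f by (intro generate_field_memI) (simp_all flip: S_def)
  qed
 qed
 have fixed: "{f \<in> carrier K. w f = f} = generate_field K {coord_x, coord_y}"
 proof
  define S where "S = q_expansion ` generate_field K {coord_x, coord_y}"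
  have S: "subfield_closed S" unfolding S_def by (rule subfield_closed_generate_field) simp
  have "series_x \<in> S" "series_y \<in> S" unfolding S_def series[symmetric] by (auto intro: generate_field.incl)
  note ev = subfield_closed_eval(1,2)[OF S this]
  show "{f \<in> carrier K. w f = f} \<subseteq> generate_field K {coord_x, coord_y}"
  proof safe
   fix f assume f: "f \<in> carrier K" "w f = f"
   have "\<And>z. Im z > 0 \<Longrightarrow> f (fricke7 z) = f z"
    using f(2) atkin_lehner_fixed_iff[OF f(1)[unfolded K_def]] by (simp add: w_def)
   then obtain p q1 q2 where "eval_x p \<noteq> 0" "eval_x p * q_expansion f = eval_xy [:q1, q2:]"
    by (rule function_field_relation_invariant[OF f(1)[unfolded K_def]])
   hence "q_expansion f = eval_xy [:q1, q2:] * inverse (eval_x p)" by (simp add: field_simps)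
   thus "f \<in> generate_field K {coord_x, coord_y}"
    using ev subfield_closedD(4,6)[OF S] f(1) by (intro generate_field_memI) (simp_all flip: S_def)
  qed
  show "generate_field K {coord_x, coord_y} \<subseteq> {f \<in> carrier K. w f = f}"
  proof
   fix f assume f: "f \<in> generate_field K {coord_x, coord_y}"
   have "f \<in> carrier K" using generate_field_in_carrier[of "{coord_x, coord_y}" f] f by simp
   moreover have "\<forall>z. Im z > 0 \<longrightarrow> f (fricke7 z) = f z"
    by (rule generate_field_fricke7[of "{coord_x, coord_y}", folded K_def]) (use f coord_fricke7 in auto)
   ultimately show "f \<in> {f \<in> carrier K. w f = f}"
    using atkin_lehner_fixed_iff[of f] by (simp add: K_def w_def)
  qed
 qed
 have wt: "w coord_t = \<ominus> coord_t"
 proof -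
  have hol: "(\<lambda>z. - 1 * coord_t z) holomorphic_on upper_half_plane" by (intro holomorphic_intros coord_holomorphic)
  have "w coord_t = (\<lambda>z. - 1 * coord_t z)"
  proof
   fix z
   show "w coord_t z = - 1 * coord_t z"
    unfolding w_def atkin_lehner_fricke7[OF coord_in_function_field(3)]
    using coord_fricke7(3)[of z] by (cases "Im z > 0") (simp_all add: coord_t_def)
  qed
  \<comment> \<open>The pointwise negative is already in canonical form; this connects it with the
    additive inverse in K, whose expansion is the negative one.\<close>
  also have "\<dots> = canonical_rep (\<lambda>z. - 1 * coord_t z)"
   by (rule canonical_rep_holomorphic[OF hol, symmetric]) (simp add: coord_t_def)
  finally have "w coord_t \<in> carrier K" "q_expansion (w coord_t) = - q_expansion coord_t"
   using function_field_uminus[of 56 coord_t] c(3) by (simp_all add: K_def)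
  thus ?thesis using hom_eq_iff[of "w coord_t" "\<ominus> coord_t"] hom_minus by simp
 qed
 have ey: "coord_y [^] (2::nat) = coord_x [^] (3::nat) \<oplus> coord_x \<oplus> [(2::nat)] \<cdot> \<one>"
  by (subst hom_eq_iff) (simp_all add: hom hom_power hom_of_nat series series_equations)
 have et: "coord_t [^] (2::nat) = ([(7::nat)] \<cdot> \<one> \<oplus> coord_x [^] (2::nat)) \<otimes>
   ([(2::nat)] \<cdot> \<one> \<ominus> coord_x \<oplus> coord_x [^] (2::nat)) \<otimes> ([(2::nat)] \<cdot> \<one> \<oplus> coord_x \<oplus> coord_x [^] (2::nat))"
  by (subst hom_eq_iff) (simp_all add: hom hom_power hom_of_nat hom_diff series series_equations)
 show "\<exists>x\<in>carrier K. \<exists>y\<in>carrier K. \<exists>t\<in>carrier K.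
      carrier K = generate_field K {x, y, t} \<and>
      {f \<in> carrier K. w f = f} = generate_field K {x, y} \<and>
      w t = \<ominus> t \<and>
      y [^] (2::nat) = x [^] (3::nat) \<oplus> x \<oplus> [(2::nat)] \<cdot> \<one> \<and>
      t [^] (2::nat) = ([(7::nat)] \<cdot> \<one> \<oplus> x [^] (2::nat)) \<otimes>
               ([(2::nat)] \<cdot> \<one> \<ominus> x \<oplus> x [^] (2::nat)) \<otimes>
               ([(2::nat)] \<cdot> \<one> \<oplus> x \<oplus> x [^] (2::nat))"
  by (rule bexI[of _ coord_x], rule bexI[of _ coord_y], rule bexI[of _ coord_t])
   (intro conjI gen fixed wt ey et, (rule c)+)
 show "equations_up_to_birational
      {var_Y ^ 2 - (var_X ^ 3 + var_X + 2),
      var_T ^ 2 - (7 + var_X ^ 2) * (2 - var_X + var_X ^ 2) * (2 + var_X + var_X ^ 2)} K"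
  unfolding equations_up_to_birational_def K_def
  using curve_ring_domain curve_function_field by (simp only: curve_y_def curve_t_def)
qed
end
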